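(* Let $\lambda \in X(T)_+$ satisfy the following properties: (a) $L(\lambda)=H^{0}(\lambda)$; (b) there exists $\sigma\in X(T)_{+}$ such that for all $\mu\in X(T)_+$ with $\mu \neq \sigma$, $\mathrm{Ext}^{2}_{G}(k,H^{0}(\mu)\otimes H^{0}(\mu^{*})^{(r)}\otimes L(\lambda)) = 0$; (c) $\mathrm{Ext}^{3}_{G}(k,S_{<\sigma}\otimes L(\lambda))=0$; and (d) $\mathrm{Ext}^{1}_{G}(k,Q_{\nleq \sigma}\otimes L(\lambda))=0$. Then $\mathrm{H}^{2}(G(\mathbb{F}_q),L(\lambda))\cong \mathrm{Ext}_G^2(k,H^{0}(\sigma)\otimes H^{0}(\sigma^{*})^{(r)}\otimes L(\lambda))$.
   Context: $k$ is an algebraically closed field of characteristic $p>0$; $G$ is a simple, simply-connected algebraic group over $k$, defined and split over $\mathbb{F}_p$, with Frobenius morphism $F$; $r\ge 1$, $q=p^r$, and $G(\mathbb{F}_q)$ is the finite group of $\mathbb{F}_q$-rational points. $T$ is a maximal split torus, $W$ the Weyl group with longest element $w_0$, $B\supset T$ the Borel subgroup corresponding to the negative roots. $X(T)_+$ is the set of dominant weights, ordered by $\mu\le\lambda$ iff $\lambda-\mu$ is a nonnegative integral combination of simple roots; $\mu^*=-w_0\mu$. $H^0(\mu)=\mathrm{ind}_B^G\mu$, and $L(\mu)$ is its simple socle. $M^{(r)}$ is the twist of the $G$-module $M$ by $F^r$. Weights are linked if they lie in the same orbit of $W_p=W\ltimes p\mathbb{Z}\Phi$ under the dot action $w\cdot\lambda=w(\lambda+\rho)-\rho$,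 $\rho$ the half-sum of positive roots. $\mathcal{G}_r(k)=\mathrm{ind}_{G(\mathbb{F}_q)}^G(k)$ is a rational $G$-module having a filtration by $G$-submodules with sections $H^0(\mu)\otimes H^0(\mu^* )^{(r)}$, $\mu\in X(T)_+$, each occurring exactly once. For $\sigma\in X(T)_+$ there exist (by work of Bendel, Nakano and Pillen) $G$-submodules $S_{<\sigma}$, $S_{\le\sigma}$ and quotients $Q_{\nless\sigma}$, $Q_{\nleq\sigma}$ of $\mathcal{G}_r(k)$, which are the ones used in the theorem, with the following properties: (i) $S_{<\sigma}$ (resp. $S_{\le\sigma}$) has a filtration with factors $H^0(\nu)\otimes H^0(\nu^* )^{(r)}$ where $\nu<\sigma$ (resp. $\nu\le\sigma$) and $\nu$ is linked to $\sigma$; (ii) $Q_{\nless\sigma}$ (resp. $Q_{\nleq\sigma}$) has a filtration with factors $H^0(\nu)\otimes H^0(\nu^* )^{(r)}$ where $\nu\nless\sigma$ (resp. $\nu\nleq\sigma$) or $\nu$ is not linked to $\sigma$; (iii) each such factor occurs in these filtrations with multiplicity one; (iv)–(vi) there are short exact sequences of $G$-modules $0\to H^0(\sigma)\otimes H^0(\sigma^* )^{(r)}\to Q_{\nless\sigma}\to Q_{\nleq\sigma}\to 0$, $\ 0\to S_{<\sigma}\to\mathcal{G}_r(k)\to Q_{\nless\sigma}\to0$, $\ 0\to S_{\le\sigma}\to\mathcal{G}_r(k)\to Q_{\nleq\sigma}\to0$. In (c), (d) and the conclusion, $\sigma$ is the weight from (b). *)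

theory Defs
  imports
    "HOL-Library.Function_Algebras"
    "HOL-Computational_Algebra.Polynomial"
    "HOL-Computational_Algebra.Primes"
    "HOL-Algebra.Module"
    "HOL-Algebra.Generated_Groups"
    "HOL-Algebra.Solvable_Groups"
    "HOL-Algebra.Group_Action"
begin

section \<open>Affine algebraic groups over an algebraically closed field\<close>

text \<open>
  A (reduced) affine algebraic group over \<open>k\<close> is given by its group of \<open>k\<close>-points together with
  its coordinate ring, a finitely generated algebra of \<open>k\<close>-valued functions on the points.
  All functions on (subsets of) the group are normalised to vanish outside their domain.
\<close>

record ('g, 'k) alg_group = "'g monoid" +
  coord :: "('g \<Rightarrow> 'k) set"

definition restr :: "'g set \<Rightarrow> ('g \<Rightarrow> 'k::zero) \<Rightarrow> 'g \<Rightarrow> 'k" where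
  "restr X f = (\<lambda>x. if x \<in> X then f x else 0)"

definition fun_algebra :: "'g set \<Rightarrow> 'k::field set \<Rightarrow> ('g \<Rightarrow> 'k) set \<Rightarrow> bool" where
  "fun_algebra X R A \<longleftrightarrow>
     (\<forall>f\<in>A. \<forall>x. x \<notin> X \<longrightarrow> f x = 0) \<and>
     restr X (\<lambda>_. 1) \<in> A \<and>
     (\<forall>f\<in>A. \<forall>g\<in>A. (\<lambda>x. f x + g x) \<in> A \<and> (\<lambda>x. f x * g x) \<in> A) \<and>
     (\<forall>c\<in>R. \<forall>f\<in>A. (\<lambda>x. c * f x) \<in> A)"

definition algebra_hom :: "('g, 'k::field) alg_group \<Rightarrow> (('g \<Rightarrow> 'k) \<Rightarrow> 'k) \<Rightarrow> bool" where
  "algebra_hom G \<phi> \<longleftrightarrow>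
     \<phi> (restr (carrier G) (\<lambda>_. 1)) = 1 \<and>
     (\<forall>f\<in>coord G. \<forall>g\<in>coord G.
        \<phi> (\<lambda>x. f x + g x) = \<phi> f + \<phi> g \<and> \<phi> (\<lambda>x. f x * g x) = \<phi> f * \<phi> g) \<and>
     (\<forall>c. \<forall>f\<in>coord G. \<phi> (\<lambda>x. c * f x) = c * \<phi> f)"

definition hopf_closed :: "('g, 'k::field) alg_group \<Rightarrow> ('g \<Rightarrow> 'k) set \<Rightarrow> bool" where
  "hopf_closed G A \<longleftrightarrow>
     (\<forall>f\<in>A. restr (carrier G) (\<lambda>x. f (inv\<^bsub>G\<^esub> x)) \<in> A) \<and>
     (\<forall>f\<in>A. \<exists>n. \<exists>u v. (\<forall>i<n::nat. u i \<in> A \<and> v i \<in> A) \<and>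
        (\<forall>x\<in>carrier G. \<forall>y\<in>carrier G. f (x \<otimes>\<^bsub>G\<^esub> y) = (\<Sum>i<n. u i x * v i y)))"

text \<open>The last condition below says that the points of the group are exactly the \<open>k\<close>-algebra
  homomorphisms from the coordinate ring to \<open>k\<close>.\<close>

definition affine_alg_group :: "('g, 'k::alg_closed_field) alg_group \<Rightarrow> bool" where
  "affine_alg_group G \<longleftrightarrow>
     group G \<and> fun_algebra (carrier G) UNIV (coord G) \<and> hopf_closed G (coord G) \<and>
     (\<exists>S. finite S \<and> S \<subseteq> coord G \<and>
        (\<forall>A. fun_algebra (carrier G) UNIV A \<and> S \<subseteq> A \<longrightarrow> coord G \<subseteq> A)) \<and>
     (\<forall>\<phi>. algebra_hom G \<phi> \<longrightarrow> (\<exists>!x. x \<in> carrier G \<and> (\<forall>f\<in>coord G. \<phi> f = f x)))"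

definition zariski_closed :: "('g, 'k::field) alg_group \<Rightarrow> 'g set \<Rightarrow> bool" where
  "zariski_closed G X \<longleftrightarrow>
     (\<exists>S. S \<subseteq> coord G \<and> X = {x \<in> carrier G. \<forall>f\<in>S. f x = 0})"

definition zariski_connected :: "('g, 'k::field) alg_group \<Rightarrow> 'g set \<Rightarrow> bool" where
  "zariski_connected G X \<longleftrightarrow>
     \<not> (\<exists>Y Z. zariski_closed G Y \<and> zariski_closed G Z \<and> X \<subseteq> Y \<union> Z \<and>
          Y \<inter> Z \<inter> X = {} \<and> Y \<inter> X \<noteq> {} \<and> Z \<inter> X \<noteq> {})"

definition closed_subgroup :: "('g, 'k::field) alg_group \<Rightarrow> 'g set \<Rightarrow> bool" where
  "closed_subgroup G H \<longleftrightarrow> subgroup H G \<and> zariski_closed G H"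

definition simple_alg_group :: "('g, 'k::alg_closed_field) alg_group \<Rightarrow> bool" where
  "simple_alg_group G \<longleftrightarrow>
     affine_alg_group G \<and> zariski_connected G (carrier G) \<and> \<not> comm_group G \<and>
     (\<forall>N. normal N G \<and> zariski_closed G N \<and> zariski_connected G N \<longrightarrow>
          N = {\<one>\<^bsub>G\<^esub>} \<or> N = carrier G)"

definition borel_subgroup :: "('g, 'k::field) alg_group \<Rightarrow> 'g set \<Rightarrow> bool" where
  "borel_subgroup G B \<longleftrightarrow>
     (let P = (\<lambda>H. closed_subgroup G H \<and> zariski_connected G H \<and> solvable (G\<lparr>carrier := H\<rparr>))
      in P B \<and> (\<forall>H. P H \<and> B \<subseteq> H \<longrightarrow> H = B))"


section \<open>Characters and tori\<close>

text \<open>Characters are morphisms into the multiplicative group of \<open>k\<close>; the group law on characters,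
  written additively in the literature, is pointwise multiplication.\<close>

definition char_group :: "('g, 'k::field) alg_group \<Rightarrow> 'g set \<Rightarrow> ('g \<Rightarrow> 'k) monoid" where
  "char_group G H =
     \<lparr>carrier = {\<chi> \<in> restr H ` coord G.
        (\<forall>x\<in>H. \<chi> x \<noteq> 0) \<and> (\<forall>x\<in>H. \<forall>y\<in>H. \<chi> (x \<otimes>\<^bsub>G\<^esub> y) = \<chi> x * \<chi> y)},
      monoid.mult = (\<lambda>\<chi> \<psi> x. \<chi> x * \<psi> x),
      one = restr H (\<lambda>_. 1)\<rparr>"

text \<open>Pointwise scalar multiplication of functions.\<close>

definition fscale :: "('k \<Rightarrow> 'v \<Rightarrow> 'v) \<Rightarrow> 'k \<Rightarrow> ('x \<Rightarrow> 'v) \<Rightarrow> 'x \<Rightarrow> 'v" where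
  "fscale s c f = (\<lambda>x. s c (f x))"

definition torus :: "('g, 'k::field) alg_group \<Rightarrow> 'g set \<Rightarrow> bool" where
  "torus G T \<longleftrightarrow> closed_subgroup G T \<and> zariski_connected G T \<and>
     restr T ` coord G \<subseteq> module.span (fscale (*)) (carrier (char_group G T))"

definition maximal_torus :: "('g, 'k::field) alg_group \<Rightarrow> 'g set \<Rightarrow> bool" where
  "maximal_torus G T \<longleftrightarrow> torus G T \<and> (\<forall>T'. torus G T' \<and> T \<subseteq> T' \<longrightarrow> T' = T)"

text \<open>Cocharacters are morphisms from the multiplicative group; the value at \<open>0\<close> is a dummy.\<close>

definition cochar_group :: "('g, 'k::field) alg_group \<Rightarrow> 'g set \<Rightarrow> ('k \<Rightarrow> 'g) monoid" where
  "cochar_group G T =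
     \<lparr>carrier = {\<gamma>. \<gamma> 0 = \<one>\<^bsub>G\<^esub> \<and> (\<forall>c. c \<noteq> 0 \<longrightarrow> \<gamma> c \<in> T) \<and>
        (\<forall>c d. c \<noteq> 0 \<and> d \<noteq> 0 \<longrightarrow> \<gamma> (c * d) = \<gamma> c \<otimes>\<^bsub>G\<^esub> \<gamma> d) \<and>
        (\<forall>f\<in>coord G. \<exists>P n. \<forall>c. c \<noteq> 0 \<longrightarrow> f (\<gamma> c) = poly P c / c ^ n)},
      monoid.mult = (\<lambda>\<gamma> \<delta> c. \<gamma> c \<otimes>\<^bsub>G\<^esub> \<delta> c),
      one = (\<lambda>_. \<one>\<^bsub>G\<^esub>)\<rparr>"

definition pairing :: "('g \<Rightarrow> 'k::field) \<Rightarrow> ('k \<Rightarrow> 'g) \<Rightarrow> int" where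
  "pairing \<chi> \<gamma> = (THE n. \<forall>c. c \<noteq> 0 \<longrightarrow> \<chi> (\<gamma> c) = c powi n)"


section \<open>Rational structures over finite fields\<close>

text \<open>An \<open>\<bbbF>\<^sub>p\<close>-structure is an \<open>\<bbbF>\<^sub>p\<close>-Hopf algebra \<open>A\<close> inside the coordinate ring such that
  \<open>k \<otimes> A\<close> maps isomorphically onto the coordinate ring. The set of all \<open>x\<close> with \<open>x ^ q = x\<close> is
  the subfield of \<open>k\<close> with \<open>q\<close> elements when \<open>q\<close> is a power of the characteristic.\<close>

definition subfield_of_order :: "nat \<Rightarrow> 'k::field set" where
  "subfield_of_order q = {x. x ^ q = x}"

definition Fp_structure :: "nat \<Rightarrow> ('g, 'k::field) alg_group \<Rightarrow> ('g \<Rightarrow> 'k) set \<Rightarrow> bool" where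
  "Fp_structure p G A \<longleftrightarrow>
     A \<subseteq> coord G \<and> fun_algebra (carrier G) (subfield_of_order p) A \<and> hopf_closed G A \<and>
     (\<forall>f\<in>A. f \<one>\<^bsub>G\<^esub> \<in> subfield_of_order p) \<and>
     coord G \<subseteq> module.span (fscale (*)) A \<and>
     (\<forall>S. finite S \<and> S \<subseteq> A \<and>
        (\<forall>c. c ` S \<subseteq> subfield_of_order p \<and> (\<Sum>f\<in>S. fscale (*) (c f) f) = 0 \<longrightarrow> (\<forall>f\<in>S. c f = 0)) \<longrightarrow>
        \<not> module.dependent (fscale (*)) S)"

definition frobenius :: "nat \<Rightarrow> ('g, 'k::field) alg_group \<Rightarrow> ('g \<Rightarrow> 'k) set \<Rightarrow> 'g \<Rightarrow> 'g" where
  "frobenius p G A x = (THE y. y \<in> carrier G \<and> (\<forall>f\<in>A. f y = f x ^ p))"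

definition rational_points :: "nat \<Rightarrow> ('g, 'k::field) alg_group \<Rightarrow> ('g \<Rightarrow> 'k) set \<Rightarrow> 'g set" where
  "rational_points q G A = {x \<in> carrier G. \<forall>f\<in>A. f x \<in> subfield_of_order q}"

text \<open>A torus is split over \<open>\<bbbF>\<^sub>p\<close> if it and all of its characters are defined over \<open>\<bbbF>\<^sub>p\<close>.\<close>

definition Fp_split :: "('g, 'k::field) alg_group \<Rightarrow> ('g \<Rightarrow> 'k) set \<Rightarrow> 'g set \<Rightarrow> bool" where
  "Fp_split G A T \<longleftrightarrow>
     (\<exists>S. S \<subseteq> A \<and> T = {x \<in> carrier G. \<forall>f\<in>S. f x = 0}) \<and>
     carrier (char_group G T) \<subseteq> restr T ` A"


section \<open>Roots, Weyl group and weights\<close>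

text \<open>The Lie algebra of a closed subgroup \<open>H\<close>: point derivations at \<open>1\<close> of the coordinate ring
  of \<open>G\<close> that kill the ideal of \<open>H\<close>.\<close>

definition lie_algebra :: "('g, 'k::field) alg_group \<Rightarrow> 'g set \<Rightarrow> (('g \<Rightarrow> 'k) \<Rightarrow> 'k) set" where
  "lie_algebra G H = {\<delta>.
     (\<forall>f. f \<notin> coord G \<longrightarrow> \<delta> f = 0) \<and>
     (\<forall>f\<in>coord G. \<forall>g\<in>coord G.
        \<delta> (\<lambda>x. f x + g x) = \<delta> f + \<delta> g \<and>
        \<delta> (\<lambda>x. f x * g x) = f \<one>\<^bsub>G\<^esub> * \<delta> g + \<delta> f * g \<one>\<^bsub>G\<^esub>) \<and>
     (\<forall>c. \<forall>f\<in>coord G. \<delta> (\<lambda>x. c * f x) = c * \<delta> f) \<and>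
     (\<forall>f\<in>coord G. (\<forall>x\<in>H. f x = 0) \<longrightarrow> \<delta> f = 0)}"

text \<open>The roots of \<open>H\<close> with respect to \<open>T\<close>: the nonzero weights of \<open>T\<close> for the adjoint action
  \<open>Ad(t)(\<delta>) = \<delta> \<circ> Int(t)\<^sup>*\<close> on the Lie algebra of \<open>H\<close>.\<close>

definition roots_of :: "('g, 'k::field) alg_group \<Rightarrow> 'g set \<Rightarrow> 'g set \<Rightarrow> ('g \<Rightarrow> 'k) set" where
  "roots_of G T H = {\<alpha> \<in> carrier (char_group G T). \<alpha> \<noteq> \<one>\<^bsub>char_group G T\<^esub> \<and>
     (\<exists>\<delta>\<in>lie_algebra G H. \<delta> \<noteq> (\<lambda>_. 0) \<and>
        (\<forall>t\<in>T. \<forall>f\<in>coord G.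
           \<delta> (restr (carrier G) (\<lambda>x. f (t \<otimes>\<^bsub>G\<^esub> x \<otimes>\<^bsub>G\<^esub> inv\<^bsub>G\<^esub> t))) = \<alpha> t * \<delta> f))}"

abbreviation roots :: "('g, 'k::field) alg_group \<Rightarrow> 'g set \<Rightarrow> ('g \<Rightarrow> 'k) set" where
  "roots G T \<equiv> roots_of G T (carrier G)"

text \<open>The Borel subgroup \<open>B\<close> corresponds to the negative roots.\<close>

definition pos_roots :: "('g, 'k::field) alg_group \<Rightarrow> 'g set \<Rightarrow> 'g set \<Rightarrow> ('g \<Rightarrow> 'k) set" where
  "pos_roots G T B = (\<lambda>\<alpha>. inv\<^bsub>char_group G T\<^esub> \<alpha>) ` roots_of G T B"

definition simple_roots :: "('g, 'k::field) alg_group \<Rightarrow> 'g set \<Rightarrow> 'g set \<Rightarrow> ('g \<Rightarrow> 'k) set" where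
  "simple_roots G T B = {\<alpha> \<in> pos_roots G T B.
     \<not> (\<exists>\<beta>\<in>pos_roots G T B. \<exists>\<gamma>\<in>pos_roots G T B. \<alpha> = \<beta> \<otimes>\<^bsub>char_group G T\<^esub> \<gamma>)}"

text \<open>The Weyl group \<open>N(T)/Z(T)\<close>, represented by its faithful action on functions on \<open>T\<close>.\<close>

definition weyl_group ::
    "('g, 'k::field) alg_group \<Rightarrow> 'g set \<Rightarrow> (('g \<Rightarrow> 'k) \<Rightarrow> 'g \<Rightarrow> 'k) set" where
  "weyl_group G T =
     (\<lambda>n \<chi>. restr T (\<lambda>t. \<chi> (inv\<^bsub>G\<^esub> n \<otimes>\<^bsub>G\<^esub> t \<otimes>\<^bsub>G\<^esub> n))) ` normalizer G T"

definition reflection ::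
    "('g, 'k::field) alg_group \<Rightarrow> 'g set \<Rightarrow> ('g \<Rightarrow> 'k) \<Rightarrow> ('k \<Rightarrow> 'g) \<Rightarrow> ('g \<Rightarrow> 'k) \<Rightarrow> 'g \<Rightarrow> 'k" where
  "reflection G T \<alpha> \<gamma> \<chi> =
     \<chi> \<otimes>\<^bsub>char_group G T\<^esub> inv\<^bsub>char_group G T\<^esub> (\<alpha> [^]\<^bsub>char_group G T\<^esub> pairing \<chi> \<gamma>)"

text \<open>The coroot of \<open>\<alpha>\<close> is the unique cocharacter \<open>\<gamma>\<close> with \<open>\<langle>\<alpha>, \<gamma>\<rangle> = 2\<close> for which
  \<open>\<chi> \<mapsto> \<chi> - \<langle>\<chi>, \<gamma>\<rangle>\<alpha>\<close> is the action of an element of the Weyl group.\<close>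

definition coroot ::
    "('g, 'k::field) alg_group \<Rightarrow> 'g set \<Rightarrow> ('g \<Rightarrow> 'k) \<Rightarrow> 'k \<Rightarrow> 'g" where
  "coroot G T \<alpha> = (THE \<gamma>. \<gamma> \<in> carrier (cochar_group G T) \<and> pairing \<alpha> \<gamma> = 2 \<and>
     (\<exists>w\<in>weyl_group G T. \<forall>\<chi>\<in>carrier (char_group G T). w \<chi> = reflection G T \<alpha> \<gamma> \<chi>))"

definition simply_connected :: "('g, 'k::field) alg_group \<Rightarrow> 'g set \<Rightarrow> bool" where
  "simply_connected G T \<longleftrightarrow>
     generate (cochar_group G T) (coroot G T ` roots G T) = carrier (cochar_group G T)"

definition weyl_length ::
    "('g, 'k::field) alg_group \<Rightarrow> 'g set \<Rightarrow> 'g set \<Rightarrow> (('g \<Rightarrow> 'k) \<Rightarrow> 'g \<Rightarrow> 'k) \<Rightarrow> nat" where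
  "weyl_length G T B w = (LEAST n. \<exists>as. length as = n \<and> set as \<subseteq> simple_roots G T B \<and>
     (\<forall>\<chi>\<in>carrier (char_group G T). w \<chi> = foldr (\<lambda>\<alpha>. reflection G T \<alpha> (coroot G T \<alpha>)) as \<chi>))"

definition longest_element ::
    "('g, 'k::field) alg_group \<Rightarrow> 'g set \<Rightarrow> 'g set \<Rightarrow> ('g \<Rightarrow> 'k) \<Rightarrow> 'g \<Rightarrow> 'k" where
  "longest_element G T B = (THE w. w \<in> weyl_group G T \<and>
     (\<forall>w'\<in>weyl_group G T. weyl_length G T B w' \<le> weyl_length G T B w))"

definition dual_weight ::
    "('g, 'k::field) alg_group \<Rightarrow> 'g set \<Rightarrow> 'g set \<Rightarrow> ('g \<Rightarrow> 'k) \<Rightarrow> 'g \<Rightarrow> 'k" where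
  "dual_weight G T B \<mu> = inv\<^bsub>char_group G T\<^esub> (longest_element G T B \<mu>)"

definition dominant_weights ::
    "('g, 'k::field) alg_group \<Rightarrow> 'g set \<Rightarrow> 'g set \<Rightarrow> ('g \<Rightarrow> 'k) set" where
  "dominant_weights G T B = {\<mu> \<in> carrier (char_group G T).
     \<forall>\<alpha>\<in>simple_roots G T B. 0 \<le> pairing \<mu> (coroot G T \<alpha>)}"

definition weight_le ::
    "('g, 'k::field) alg_group \<Rightarrow> 'g set \<Rightarrow> 'g set \<Rightarrow> ('g \<Rightarrow> 'k) \<Rightarrow> ('g \<Rightarrow> 'k) \<Rightarrow> bool" where
  "weight_le G T B \<mu> lam \<longleftrightarrow> (\<exists>n :: ('g \<Rightarrow> 'k) \<Rightarrow> nat. lam = \<mu> \<otimes>\<^bsub>char_group G T\<^esub>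
     finprod (char_group G T) (\<lambda>\<alpha>. \<alpha> [^]\<^bsub>char_group G T\<^esub> n \<alpha>) (simple_roots G T B))"

definition weight_less ::
    "('g, 'k::field) alg_group \<Rightarrow> 'g set \<Rightarrow> 'g set \<Rightarrow> ('g \<Rightarrow> 'k) \<Rightarrow> ('g \<Rightarrow> 'k) \<Rightarrow> bool" where
  "weight_less G T B \<mu> lam \<longleftrightarrow> weight_le G T B \<mu> lam \<and> \<mu> \<noteq> lam"

text \<open>For simply connected \<open>G\<close> the half-sum of the positive roots is a character.\<close>

definition half_sum :: "('g, 'k::field) alg_group \<Rightarrow> 'g set \<Rightarrow> 'g set \<Rightarrow> 'g \<Rightarrow> 'k" where
  "half_sum G T B = (THE \<rho>. \<rho> \<in> carrier (char_group G T) \<and>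
     \<rho> \<otimes>\<^bsub>char_group G T\<^esub> \<rho> = finprod (char_group G T) (\<lambda>\<alpha>. \<alpha>) (pos_roots G T B))"

definition dot_action ::
    "('g, 'k::field) alg_group \<Rightarrow> 'g set \<Rightarrow> 'g set \<Rightarrow> (('g \<Rightarrow> 'k) \<Rightarrow> 'g \<Rightarrow> 'k) \<Rightarrow> ('g \<Rightarrow> 'k) \<Rightarrow> 'g \<Rightarrow> 'k" where
  "dot_action G T B w lam =
     w (lam \<otimes>\<^bsub>char_group G T\<^esub> half_sum G T B) \<otimes>\<^bsub>char_group G T\<^esub> inv\<^bsub>char_group G T\<^esub> half_sum G T B"

definition linked ::
    "nat \<Rightarrow> ('g, 'k::field) alg_group \<Rightarrow> 'g set \<Rightarrow> 'g set \<Rightarrow> ('g \<Rightarrow> 'k) \<Rightarrow> ('g \<Rightarrow> 'k) \<Rightarrow> bool" where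
  "linked p G T B \<mu> lam \<longleftrightarrow>
     (\<exists>w\<in>weyl_group G T. \<exists>\<nu>\<in>generate (char_group G T) (roots G T).
        \<mu> = dot_action G T B w lam \<otimes>\<^bsub>char_group G T\<^esub> (\<nu> [^]\<^bsub>char_group G T\<^esub> p))"


section \<open>Rational modules\<close>

text \<open>A \<open>G\<close>-module lives on a subspace of an ambient vector space, whose addition is that of the
  type and whose scalar multiplication is \<open>scale\<close>.\<close>

record ('g, 'k, 'v) gmodule =
  space :: "'v set"
  scale :: "'k \<Rightarrow> 'v \<Rightarrow> 'v"
  act :: "'g \<Rightarrow> 'v \<Rightarrow> 'v"

text \<open>Morphisms of varieties from \<open>G\<close> to the vector space \<open>V\<close>, that is, elements of \<open>k[G] \<otimes> V\<close>.\<close>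

definition regular_maps ::
    "('g, 'k::field) alg_group \<Rightarrow> ('k \<Rightarrow> 'v \<Rightarrow> 'v) \<Rightarrow> 'v::ab_group_add set \<Rightarrow> ('g \<Rightarrow> 'v) set" where
  "regular_maps G s V = module.span (fscale s) {(\<lambda>x. s (a x) v) | a v. a \<in> coord G \<and> v \<in> V}"

definition rational_module ::
    "('g, 'k::field) alg_group \<Rightarrow> ('g, 'k, 'v::ab_group_add) gmodule \<Rightarrow> bool" where
  "rational_module G M \<longleftrightarrow>
     vector_space (scale M) \<and> module.subspace (scale M) (space M) \<and>
     (\<forall>x\<in>carrier G. \<forall>v\<in>space M. act M x v \<in> space M) \<and>
     (\<forall>x\<in>carrier G. \<forall>v\<in>space M. \<forall>w\<in>space M. act M x (v + w) = act M x v + act M x w) \<and>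
     (\<forall>x\<in>carrier G. \<forall>c. \<forall>v\<in>space M. act M x (scale M c v) = scale M c (act M x v)) \<and>
     (\<forall>v\<in>space M. act M \<one>\<^bsub>G\<^esub> v = v) \<and>
     (\<forall>x\<in>carrier G. \<forall>y\<in>carrier G. \<forall>v\<in>space M. act M (x \<otimes>\<^bsub>G\<^esub> y) v = act M x (act M y v)) \<and>
     (\<forall>v\<in>space M. (\<lambda>x. if x \<in> carrier G then act M x v else 0) \<in> regular_maps G (scale M) (space M))"

definition gsubmodule ::
    "('g, 'k::field) alg_group \<Rightarrow> ('g, 'k, 'v::ab_group_add) gmodule \<Rightarrow> 'v set \<Rightarrow> bool" where
  "gsubmodule G M N \<longleftrightarrow> N \<subseteq> space M \<and> module.subspace (scale M) N \<and>
     (\<forall>x\<in>carrier G. \<forall>v\<in>N. act M x v \<in> N)"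

definition ghom ::
    "('g, 'k::field) alg_group \<Rightarrow> ('g, 'k, 'v::ab_group_add) gmodule \<Rightarrow>
     ('g, 'k, 'w::ab_group_add) gmodule \<Rightarrow> ('v \<Rightarrow> 'w) \<Rightarrow> bool" where
  "ghom G M N f \<longleftrightarrow>
     (\<forall>v\<in>space M. f v \<in> space N) \<and>
     (\<forall>v\<in>space M. \<forall>w\<in>space M. f (v + w) = f v + f w) \<and>
     (\<forall>c. \<forall>v\<in>space M. f (scale M c v) = scale N c (f v)) \<and>
     (\<forall>x\<in>carrier G. \<forall>v\<in>space M. f (act M x v) = act N x (f v))"

text \<open>Exactness of \<open>0 \<rightarrow> L \<rightarrow> M \<rightarrow> N \<rightarrow> 0\<close> with maps \<open>f\<close> and \<open>g\<close>.\<close>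

definition short_exact ::
    "('g, 'k::field) alg_group \<Rightarrow> ('g, 'k, 'u::ab_group_add) gmodule \<Rightarrow> ('u \<Rightarrow> 'v) \<Rightarrow>
     ('g, 'k, 'v::ab_group_add) gmodule \<Rightarrow> ('v \<Rightarrow> 'w) \<Rightarrow>
     ('g, 'k, 'w::ab_group_add) gmodule \<Rightarrow> bool" where
  "short_exact G L f M g N \<longleftrightarrow>
     ghom G L M f \<and> ghom G M N g \<and> inj_on f (space L) \<and>
     f ` space L = {v \<in> space M. g v = 0} \<and> g ` space M = space N"

text \<open>A filtration in the sense of the theory of good filtrations: an exhaustive ascending chain,
  finite or of type \<open>\<omega>\<close>, whose nonzero sections are the modules \<open>N i\<close> for \<open>i \<in> I\<close>, each occurring
  exactly once. At the steps not in \<open>J\<close> the chain does not grow.\<close>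

definition filtered_by ::
    "('g, 'k::field) alg_group \<Rightarrow> ('g, 'k, 'v::ab_group_add) gmodule \<Rightarrow> 'i set \<Rightarrow>
     ('i \<Rightarrow> ('g, 'k, 'w::ab_group_add) gmodule) \<Rightarrow> bool" where
  "filtered_by G M I N \<longleftrightarrow>
     (\<exists>(F :: nat \<Rightarrow> 'v set) J \<theta>.
        (\<forall>n. gsubmodule G M (F n) \<and> F n \<subseteq> F (Suc n)) \<and> F 0 = {0} \<and> (\<Union>n. F n) = space M \<and>
        bij_betw \<theta> J I \<and>
        (\<forall>n. n \<notin> J \<longrightarrow> F (Suc n) = F n) \<and>
        (\<forall>n\<in>J. \<exists>\<pi>. short_exact G (M\<lparr>space := F n\<rparr>) (\<lambda>v. v) (M\<lparr>space := F (Suc n)\<rparr>) \<pi> (N (\<theta> n))))"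

definition trivial_module :: "('g, 'k, 'k::field) gmodule" where
  "trivial_module = \<lparr>space = UNIV, scale = (*), act = (\<lambda>_ c. c)\<rparr>"

definition char_module :: "('g \<Rightarrow> 'k::field) \<Rightarrow> ('g, 'k, 'k) gmodule" where
  "char_module \<chi> = \<lparr>space = UNIV, scale = (*), act = (\<lambda>x c. \<chi> x * c)\<rparr>"

text \<open>The induced module of all \<open>f \<in> k[G] \<otimes> M\<close> with \<open>f(xh) = h\<inverse>f(x)\<close>, with left translation.\<close>

definition induced_module ::
    "('g, 'k::field) alg_group \<Rightarrow> 'g set \<Rightarrow> ('g, 'k, 'v::ab_group_add) gmodule \<Rightarrow>
     ('g, 'k, 'g \<Rightarrow> 'v) gmodule" where
  "induced_module G H M =
     \<lparr>space = {f \<in> regular_maps G (scale M) (space M).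
        \<forall>x\<in>carrier G. \<forall>h\<in>H. f (x \<otimes>\<^bsub>G\<^esub> h) = act M (inv\<^bsub>G\<^esub> h) (f x)},
      scale = fscale (scale M),
      act = (\<lambda>y f x. if x \<in> carrier G then f (inv\<^bsub>G\<^esub> y \<otimes>\<^bsub>G\<^esub> x) else 0)\<rparr>"

definition frobenius_twist ::
    "('g \<Rightarrow> 'g) \<Rightarrow> nat \<Rightarrow> ('g, 'k, 'v) gmodule \<Rightarrow> ('g, 'k, 'v) gmodule" where
  "frobenius_twist F r M = M\<lparr>act := (\<lambda>x. act M ((F ^^ r) x))\<rparr>"

definition simple_submodule ::
    "('g, 'k::field) alg_group \<Rightarrow> ('g, 'k, 'v::ab_group_add) gmodule \<Rightarrow> 'v set \<Rightarrow> bool" where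
  "simple_submodule G M N \<longleftrightarrow> gsubmodule G M N \<and> N \<noteq> {0} \<and>
     (\<forall>N'. gsubmodule G M N' \<and> N' \<subseteq> N \<longrightarrow> N' = {0} \<or> N' = N)"

definition socle ::
    "('g, 'k::field) alg_group \<Rightarrow> ('g, 'k, 'v::ab_group_add) gmodule \<Rightarrow> ('g, 'k, 'v) gmodule" where
  "socle G M = M\<lparr>space := module.span (scale M) (\<Union>{N. simple_submodule G M N})\<rparr>"

text \<open>\<open>H\<^sup>0(\<mu>)\<close> is induced from the unique extension of \<open>\<mu>\<close> to a character of \<open>B\<close>.\<close>

definition H0 ::
    "('g, 'k::field) alg_group \<Rightarrow> 'g set \<Rightarrow> 'g set \<Rightarrow> ('g \<Rightarrow> 'k) \<Rightarrow> ('g, 'k, 'g \<Rightarrow> 'k) gmodule" where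
  "H0 G T B \<mu> = induced_module G B
     (char_module (THE \<chi>. \<chi> \<in> carrier (char_group G B) \<and> restr T \<chi> = \<mu>))"

definition simple_module ::
    "('g, 'k::field) alg_group \<Rightarrow> 'g set \<Rightarrow> 'g set \<Rightarrow> ('g \<Rightarrow> 'k) \<Rightarrow> ('g, 'k, 'g \<Rightarrow> 'k) gmodule" where
  "simple_module G T B lam = socle G (H0 G T B lam)"


section \<open>Tensor products\<close>

text \<open>\<open>M \<otimes> N\<close> is realised inside the dual of the space of bilinear forms on \<open>M \<times> N\<close>, as the span of
  the evaluations at pairs \<open>(v, w)\<close>; over a field this is the usual tensor product.\<close>

definition bilinear_form ::
    "('g, 'k::field, 'v::ab_group_add) gmodule \<Rightarrow> ('g, 'k, 'w::ab_group_add) gmodule \<Rightarrow>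
     ('v \<Rightarrow> 'w \<Rightarrow> 'k) \<Rightarrow> bool" where
  "bilinear_form M N \<beta> \<longleftrightarrow>
     (\<forall>v\<in>space M. \<forall>v'\<in>space M. \<forall>w\<in>space N. \<beta> (v + v') w = \<beta> v w + \<beta> v' w) \<and>
     (\<forall>v\<in>space M. \<forall>w\<in>space N. \<forall>w'\<in>space N. \<beta> v (w + w') = \<beta> v w + \<beta> v w') \<and>
     (\<forall>c. \<forall>v\<in>space M. \<forall>w\<in>space N.
        \<beta> (scale M c v) w = c * \<beta> v w \<and> \<beta> v (scale N c w) = c * \<beta> v w)"

definition pure_tensor ::
    "('g, 'k::field, 'v::ab_group_add) gmodule \<Rightarrow> ('g, 'k, 'w::ab_group_add) gmodule \<Rightarrow>
     'v \<Rightarrow> 'w \<Rightarrow> ('v \<Rightarrow> 'w \<Rightarrow> 'k) \<Rightarrow> 'k" where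
  "pure_tensor M N v w = (\<lambda>\<beta>. if bilinear_form M N \<beta> then \<beta> v w else 0)"

text \<open>The action below is the diagonal one: it sends \<open>v \<otimes> w\<close> to \<open>xv \<otimes> xw\<close>.\<close>

definition tensor ::
    "('g, 'k::field, 'v::ab_group_add) gmodule \<Rightarrow> ('g, 'k, 'w::ab_group_add) gmodule \<Rightarrow>
     ('g, 'k, ('v \<Rightarrow> 'w \<Rightarrow> 'k) \<Rightarrow> 'k) gmodule" (infixl \<open>\<otimes>\<^sub>k\<close> 70) where
  "M \<otimes>\<^sub>k N =
     \<lparr>space = module.span (fscale (*)) {pure_tensor M N v w | v w. v \<in> space M \<and> w \<in> space N},
      scale = fscale (*),
      act = (\<lambda>x \<Theta> \<beta>. if bilinear_form M N \<beta> then \<Theta> (\<lambda>v w. \<beta> (act M x v) (act N x w)) else 0)\<rparr>"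


section \<open>Ext groups\<close>

text \<open>
  \<open>Ext\<^sub>G\<^sup>n(M, -)\<close> is the \<open>n\<close>-th right derived functor of \<open>Hom\<^sub>G(M, -)\<close> on rational modules, computed
  from the standard injective resolution of \<open>N\<close>: its \<open>n\<close>-th term consists of the regular maps
  \<open>G\<^sup>n\<^sup>+\<^sup>1 \<rightarrow> N\<close>, with \<open>(yf)(x\<^sub>0, \<dots>, x\<^sub>n) = y f(y\<inverse>x\<^sub>0, \<dots>, y\<inverse>x\<^sub>n)\<close>. Tuples are lists; the maps vanish on
  lists of the wrong length or with entries outside \<open>G\<close>. That these terms are injective and form a
  resolution is proved at the end of this theory.
\<close>

primrec regular_maps_pow ::
    "('g, 'k::field) alg_group \<Rightarrow> ('k \<Rightarrow> 'v \<Rightarrow> 'v) \<Rightarrow> 'v::ab_group_add set \<Rightarrow> nat \<Rightarrow>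
     ('g list \<Rightarrow> 'v) set" where
  "regular_maps_pow G s V 0 = (\<lambda>v xs. if xs = [] then v else 0) ` V"
| "regular_maps_pow G s V (Suc n) =
     (\<lambda>f xs. case xs of [] \<Rightarrow> 0 | x # ys \<Rightarrow> f x ys) `
       regular_maps G (fscale s) (regular_maps_pow G s V n)"

definition std_resolution ::
    "('g, 'k::field) alg_group \<Rightarrow> ('g, 'k, 'v::ab_group_add) gmodule \<Rightarrow> nat \<Rightarrow>
     ('g, 'k, 'g list \<Rightarrow> 'v) gmodule" where
  "std_resolution G N n =
     \<lparr>space = regular_maps_pow G (scale N) (space N) (Suc n),
      scale = fscale (scale N),
      act = (\<lambda>y f xs. if set xs \<subseteq> carrier G
               then act N y (f (map (\<lambda>x. inv\<^bsub>G\<^esub> y \<otimes>\<^bsub>G\<^esub> x) xs)) else 0)\<rparr>"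

definition std_augmentation :: "('g, 'k) alg_group \<Rightarrow> 'v \<Rightarrow> 'g list \<Rightarrow> 'v::zero" where
  "std_augmentation G v xs = (if length xs = 1 \<and> set xs \<subseteq> carrier G then v else 0)"

definition std_differential ::
    "('g, 'k) alg_group \<Rightarrow> ('g list \<Rightarrow> 'v::ab_group_add) \<Rightarrow> 'g list \<Rightarrow> 'v" where
  "std_differential G f xs = (if set xs \<subseteq> carrier G
     then \<Sum>i<length xs. (if even i then f (take i xs @ drop (Suc i) xs)
                                  else - f (take i xs @ drop (Suc i) xs)) else 0)"

definition ghoms ::
    "('g, 'k::field) alg_group \<Rightarrow> ('g, 'k, 'v::ab_group_add) gmodule \<Rightarrow>
     ('g, 'k, 'w::ab_group_add) gmodule \<Rightarrow> ('v \<Rightarrow> 'w) set" where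
  "ghoms G M N = {f. ghom G M N f \<and> (\<forall>v. v \<notin> space M \<longrightarrow> f v = 0)}"

text \<open>The quotient of a subspace \<open>Z\<close> by a subspace \<open>B\<close>, as the vector space of cosets. The ring
  multiplication of the library's module record plays no role.\<close>

definition quotient_space ::
    "('k \<Rightarrow> 'v \<Rightarrow> 'v) \<Rightarrow> 'v::ab_group_add set \<Rightarrow> 'v set \<Rightarrow> ('k, 'v set) module" where
  "quotient_space s Z B =
     \<lparr>carrier = {(+) z ` B | z. z \<in> Z},
      monoid.mult = undefined, one = undefined,
      zero = B, add = (\<lambda>X Y. {x + y | x y. x \<in> X \<and> y \<in> Y}),
      smult = (\<lambda>c X. {s c x + b | x b. x \<in> X \<and> b \<in> B})\<rparr>"

definition Ext ::
    "('g, 'k::field) alg_group \<Rightarrow> nat \<Rightarrow> ('g, 'k, 'u::ab_group_add) gmodule \<Rightarrow>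
     ('g, 'k, 'v::ab_group_add) gmodule \<Rightarrow> ('k, ('u \<Rightarrow> 'g list \<Rightarrow> 'v) set) module" where
  "Ext G n M N = quotient_space (fscale (fscale (scale N)))
     {\<phi> \<in> ghoms G M (std_resolution G N n). \<forall>u. std_differential G (\<phi> u) = 0}
     (case n of 0 \<Rightarrow> {0}
      | Suc m \<Rightarrow> (\<lambda>\<psi> u. std_differential G (\<psi> u)) ` ghoms G M (std_resolution G N m))"

definition vanishes :: "('k, 'x) module \<Rightarrow> bool" where
  "vanishes E \<longleftrightarrow> carrier E = {\<zero>\<^bsub>E\<^esub>}"

definition vs_isomorphic :: "('k, 'x) module \<Rightarrow> ('k, 'y) module \<Rightarrow> bool" where
  "vs_isomorphic E E' \<longleftrightarrow> (\<exists>\<phi>. bij_betw \<phi> (carrier E) (carrier E') \<and>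
     (\<forall>x\<in>carrier E. \<forall>y\<in>carrier E. \<phi> (x \<oplus>\<^bsub>E\<^esub> y) = \<phi> x \<oplus>\<^bsub>E'\<^esub> \<phi> y) \<and>
     (\<forall>c. \<forall>x\<in>carrier E. \<phi> (c \<odot>\<^bsub>E\<^esub> x) = c \<odot>\<^bsub>E'\<^esub> \<phi> x))"

text \<open>The cohomology \<open>H\<^sup>n(\<Gamma>, M) = Ext\<^sup>n\<^bsub>k\<Gamma>\<^esub>(k, M)\<close> of a finite subgroup \<open>\<Gamma>\<close>: a finite group is an
  algebraic group on which every function is regular, and all of its modules are rational. The
  complex is the one of homogeneous cochains \<open>\<Gamma>\<^sup>n\<^sup>+\<^sup>1 \<rightarrow> M\<close>.\<close>

definition finite_alg_group :: "('g, 'k::zero) alg_group \<Rightarrow> 'g set \<Rightarrow> ('g, 'k) alg_group" where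
  "finite_alg_group G \<Gamma> = \<lparr>carrier = \<Gamma>, monoid.mult = monoid.mult G, one = one G,
     coord = {f. \<forall>x. x \<notin> \<Gamma> \<longrightarrow> f x = 0}\<rparr>"

definition group_cohomology ::
    "('g, 'k::field) alg_group \<Rightarrow> 'g set \<Rightarrow> nat \<Rightarrow> ('g, 'k, 'v::ab_group_add) gmodule \<Rightarrow>
     ('k, ('k \<Rightarrow> 'g list \<Rightarrow> 'v) set) module" where
  "group_cohomology G \<Gamma> n M = Ext (finite_alg_group G \<Gamma>) n trivial_module M"


section \<open>The standard resolution is an injective resolution by rational modules\<close>

lemma fscale_apply: "fscale s c f x = s c (f x)"
  by (simp add: fscale_def)

lemma vector_space_fscale: "vector_space s \<Longrightarrow> vector_space (fscale s)"
  unfolding vector_space_def by (auto simp: fun_eq_iff fscale_def)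

locale coord_group = group G for G :: "('g, 'k::field) alg_group" (structure) +
  assumes alg: "fun_algebra (carrier G) UNIV (coord G)"
    and hopf: "hopf_closed G (coord G)"
begin

lemma coord_outside: "a \<in> coord G \<Longrightarrow> x \<notin> carrier G \<Longrightarrow> a x = 0"
  using alg by (auto simp: fun_algebra_def)

lemma coord_one: "restr (carrier G) (\<lambda>_. 1) \<in> coord G"
  using alg by (auto simp: fun_algebra_def)

lemma coord_mult: "a \<in> coord G \<Longrightarrow> b \<in> coord G \<Longrightarrow> (\<lambda>x. a x * b x) \<in> coord G"
  using alg by (auto simp: fun_algebra_def)

lemma coord_scale: "a \<in> coord G \<Longrightarrow> (\<lambda>x. c * a x) \<in> coord G"
  using alg by (auto simp: fun_algebra_def)

lemma coord_inv: "a \<in> coord G \<Longrightarrow> restr (carrier G) (\<lambda>x. a (inv x)) \<in> coord G"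
  using hopf by (auto simp: hopf_closed_def)

lemma coord_comult:
  assumes "a \<in> coord G"
  shows "\<exists>n u v. (\<forall>i<n::nat. u i \<in> coord G \<and> v i \<in> coord G) \<and>
    (\<forall>x\<in>carrier G. \<forall>y\<in>carrier G. a (x \<otimes> y) = (\<Sum>i<n. u i x * v i y))"
  using hopf assms unfolding hopf_closed_def by blast

lemma reg_subspace:
  assumes "vector_space s"
  shows "module.subspace (fscale s) (regular_maps G s V)"
proof -
  interpret vector_space "fscale s" by (rule vector_space_fscale) fact
  show ?thesis unfolding regular_maps_def by (rule subspace_span)
qed

lemma subspaceD:
  assumes "vector_space s" "module.subspace s V"
  shows "0 \<in> V" "\<And>v w. v \<in> V \<Longrightarrow> w \<in> V \<Longrightarrow> v + w \<in> V" "\<And>c v. v \<in> V \<Longrightarrow> s c v \<in> V"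
    "\<And>v w. v \<in> V \<Longrightarrow> w \<in> V \<Longrightarrow> v - w \<in> V" "\<And>v. v \<in> V \<Longrightarrow> - v \<in> V"
proof -
  interpret vector_space s by fact
  show "0 \<in> V" "\<And>v w. v \<in> V \<Longrightarrow> w \<in> V \<Longrightarrow> v + w \<in> V" "\<And>c v. v \<in> V \<Longrightarrow> s c v \<in> V"
    "\<And>v w. v \<in> V \<Longrightarrow> w \<in> V \<Longrightarrow> v - w \<in> V" "\<And>v. v \<in> V \<Longrightarrow> - v \<in> V"
    using assms(2) subspace_0 subspace_add subspace_scale subspace_diff subspace_neg by auto
qed

lemma reg_closed:
  assumes "vector_space s"
  shows "0 \<in> regular_maps G s V"
    "f \<in> regular_maps G s V \<Longrightarrow> g \<in> regular_maps G s V \<Longrightarrow> f + g \<in> regular_maps G s V"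
    "f \<in> regular_maps G s V \<Longrightarrow> g \<in> regular_maps G s V \<Longrightarrow> f - g \<in> regular_maps G s V"
    "f \<in> regular_maps G s V \<Longrightarrow> fscale s c f \<in> regular_maps G s V"
    "f \<in> regular_maps G s V \<Longrightarrow> - f \<in> regular_maps G s V"
    "(\<lambda>_. 0) \<in> regular_maps G s V"
  using subspaceD[OF vector_space_fscale[OF assms] reg_subspace[OF assms]]
  by (auto simp: zero_fun_def)

lemma reg_sum:
  assumes "vector_space s" "\<And>i. i \<in> I \<Longrightarrow> f i \<in> regular_maps G s V"
  shows "(\<Sum>i\<in>I. f i) \<in> regular_maps G s V"
proof -
  interpret vector_space "fscale s" by (rule vector_space_fscale) fact
  show ?thesis using reg_subspace[OF assms(1)] assms(2) by (intro subspace_sum)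
qed

lemma reg_pure:
  assumes "vector_space s" "a \<in> coord G" "v \<in> V"
  shows "(\<lambda>x. s (a x) v) \<in> regular_maps G s V"
proof -
  interpret vector_space "fscale s" by (rule vector_space_fscale) fact
  show ?thesis unfolding regular_maps_def using assms(2,3)
    by (intro span_base CollectI exI[of _ a] exI[of _ v]) simp
qed

lemma reg_induct [consumes 2, case_names zero step]:
  assumes "f \<in> regular_maps G s V" "vector_space s" "P (\<lambda>_. 0)"
    and step: "\<And>a v f. a \<in> coord G \<Longrightarrow> v \<in> V \<Longrightarrow> f \<in> regular_maps G s V \<Longrightarrow> P f \<Longrightarrow>
       P (\<lambda>x. s (a x) v + f x)"
  shows "P f"
proof -
  interpret S: vector_space s by fact
  interpret vector_space "fscale s" by (rule vector_space_fscale) fact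
  have "f \<in> regular_maps G s V \<and> P f"
    using assms(1) unfolding regular_maps_def
  proof (induction rule: span_induct_alt)
    case base
    from assms(3) show ?case by (intro conjI span_zero) (simp add: zero_fun_def)
  next
    case (step c g f)
    then obtain a v where g: "g = (\<lambda>x. s (a x) v)" "a \<in> coord G" "v \<in> V" by auto
    have eq: "fscale s c g + f = (\<lambda>x. s (c * a x) v + f x)" by (auto simp: g fscale_apply)
    have "P (fscale s c g + f)" unfolding eq
      using step g by (intro assms(4)) (auto simp: regular_maps_def coord_scale)
    moreover have "fscale s c g + f \<in> span {(\<lambda>x. s (a x) v) | a v. a \<in> coord G \<and> v \<in> V}"
      by (rule span_add[OF span_scale[OF span_base[OF step(1)]] conjunct1[OF step(2)]])
    ultimately show ?case by blast
  qed
  thus ?thesis by blast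
qed

lemma reg_in: 
  assumes "f \<in> regular_maps G s V" "vector_space s" "module.subspace s V"
  shows "f x \<in> V"
  using assms(1,2)
  by (induction rule: reg_induct) (auto intro: subspaceD[OF assms(2,3)])

lemma reg_outside: 
  assumes "f \<in> regular_maps G s V" "vector_space s" "x \<notin> carrier G"
  shows "f x = 0"
proof -
  interpret S: vector_space s by fact
  show ?thesis using assms(1,2) by (induction rule: reg_induct) (auto simp: coord_outside assms)
qed

lemma reg_const:
  assumes "vector_space s" "v \<in> V"
  shows "(\<lambda>x. if x \<in> carrier G then v else 0) \<in> regular_maps G s V"
proof -
  interpret S: vector_space s by fact
  have "(\<lambda>x. if x \<in> carrier G then v else 0) = (\<lambda>x. s (restr (carrier G) (\<lambda>_. 1) x) v)"
    by (auto simp: restr_def)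
  thus ?thesis using reg_pure[OF assms(1) coord_one assms(2)] by simp
qed

lemma reg_mult:
  assumes "f \<in> regular_maps G s V" "vector_space s" "b \<in> coord G"
  shows "(\<lambda>x. s (b x) (f x)) \<in> regular_maps G s V"
proof -
  interpret S: vector_space s by fact
  show ?thesis using assms(1,2)
  proof (induction rule: reg_induct)
    case zero
    show ?case using reg_closed(6)[OF assms(2), of V] reg_closed(1)[OF assms(2)] by (simp add: zero_fun_def)
  next
    case (step a v f)
    have "(\<lambda>x. s (b x * a x) v) + (\<lambda>x. s (b x) (f x)) \<in> regular_maps G s V"
      using step assms by (intro reg_closed(2) reg_pure coord_mult)
    thus ?case by (simp add: S.scale_right_distrib plus_fun_def)
  qed
qed

lemma reg_bilin:
  assumes "f \<in> regular_maps G s V" "vector_space s" "vector_space t" "module.subspace s V"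
    and reg: "\<And>v. v \<in> V \<Longrightarrow> (\<lambda>x. if x \<in> carrier G then h x v else 0) \<in> regular_maps G t W"
    and add: "\<And>x v w. x \<in> carrier G \<Longrightarrow> v \<in> V \<Longrightarrow> w \<in> V \<Longrightarrow> h x (v + w) = h x v + h x w"
    and sc: "\<And>x c v. x \<in> carrier G \<Longrightarrow> v \<in> V \<Longrightarrow> h x (s c v) = t c (h x v)"
  shows "(\<lambda>x. if x \<in> carrier G then h x (f x) else 0) \<in> regular_maps G t W"
proof -
  interpret S: vector_space s by fact
  interpret T: vector_space t by fact
  note V = subspaceD[OF assms(2,4)]
  show ?thesis using assms(1,2)
  proof (induction rule: reg_induct)
    case zero
    have "h x 0 = 0" if "x \<in> carrier G" for x
      using sc[OF that V(1), of 0] by simp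
    hence "(\<lambda>x. if x \<in> carrier G then h x 0 else 0) = 0" by auto
    then show ?case using reg_closed(1)[OF assms(3)] by simp
  next
    case (step a v f)
    have fx: "f x \<in> V" for x using reg_in step assms by blast
    have "(\<lambda>x. t (a x) (if x \<in> carrier G then h x v else 0)) +
       (\<lambda>x. if x \<in> carrier G then h x (f x) else 0) \<in> regular_maps G t W"
      using step assms by (intro reg_closed(2) reg_mult reg) auto
    also have "(\<lambda>x. t (a x) (if x \<in> carrier G then h x v else 0)) +
       (\<lambda>x. if x \<in> carrier G then h x (f x) else 0) =
       (\<lambda>x. if x \<in> carrier G then h x (s (a x) v + f x) else 0)"
      using step fx V by (auto simp: add sc fun_eq_iff)
    finally show ?case .
  qed
qed

lemma reg_linear:
  assumes "f \<in> regular_maps G s V" "vector_space s" "vector_space t" "module.subspace s V"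
    and im: "\<And>v. v \<in> V \<Longrightarrow> h v \<in> W"
    and add: "\<And>v w. v \<in> V \<Longrightarrow> w \<in> V \<Longrightarrow> h (v + w) = h v + h w"
    and sc: "\<And>c v. v \<in> V \<Longrightarrow> h (s c v) = t c (h v)"
  shows "(\<lambda>x. h (f x)) \<in> regular_maps G t W"
proof -
  interpret S: vector_space s by fact
  interpret T: vector_space t by fact
  have "h 0 = 0" using sc[of 0 0] subspaceD(1)[OF assms(2,4)] by simp
  hence "(\<lambda>x. h (f x)) = (\<lambda>x. if x \<in> carrier G then h (f x) else 0)"
    using reg_outside[OF assms(1,2)] by auto
  also have "\<dots> \<in> regular_maps G t W"
    by (rule reg_bilin[OF assms(1-4), where h = "\<lambda>_. h"]) (simp_all add: reg_const[OF assms(3) im] add sc)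
  finally show ?thesis .
qed

lemma reg_inv:
  assumes "f \<in> regular_maps G s V" "vector_space s"
  shows "(\<lambda>x. if x \<in> carrier G then f (inv x) else 0) \<in> regular_maps G s V"
proof -
  interpret S: vector_space s by fact
  show ?thesis using assms(1,2)
  proof (induction rule: reg_induct)
    case zero
    show ?case using reg_closed(6)[OF assms(2), of V] reg_closed(1)[OF assms(2)] by (simp add: zero_fun_def)
  next
    case (step a v f)
    have "(\<lambda>x. s (restr (carrier G) (\<lambda>x. a (inv x)) x) v) +
       (\<lambda>x. if x \<in> carrier G then f (inv x) else 0) \<in> regular_maps G s V"
      using step assms by (intro reg_closed(2) reg_pure coord_inv)
    moreover have "(\<lambda>x. s (restr (carrier G) (\<lambda>x. a (inv x)) x) v) +
       (\<lambda>x. if x \<in> carrier G then f (inv x) else 0) =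
       (\<lambda>x. if x \<in> carrier G then s (a (inv x)) v + f (inv x) else 0)"
      by (auto simp: restr_def)
    ultimately show ?case by simp
  qed
qed

lemma reg_translate:
  assumes "f \<in> regular_maps G s V" "vector_space s"
  shows "(\<lambda>y x. if y \<in> carrier G \<and> x \<in> carrier G then f (inv y \<otimes> x) else 0)
           \<in> regular_maps G (fscale s) (regular_maps G s V)"
proof -
  interpret S: vector_space s by fact
  note FS = vector_space_fscale[OF assms(2)]
  show ?thesis using assms(1,2)
  proof (induction rule: reg_induct)
    case zero
    show ?case using reg_closed(6)[OF FS] reg_closed(1)[OF FS] by (simp add: zero_fun_def)
  next
    case (step a v f)
    obtain n u w where c': "\<forall>i<n::nat. u i \<in> coord G \<and> w i \<in> coord G"
      "\<forall>x\<in>carrier G. \<forall>y\<in>carrier G. a (x \<otimes> y) = (\<Sum>i<n. u i x * w i y)"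
      using coord_comult[OF \<open>a \<in> coord G\<close>] by (elim exE conjE)
    have c: "\<And>i. i < n \<Longrightarrow> u i \<in> coord G" "\<And>i. i < n \<Longrightarrow> w i \<in> coord G"
      "\<And>x y. x \<in> carrier G \<Longrightarrow> y \<in> carrier G \<Longrightarrow> a (x \<otimes> y) = (\<Sum>i<n. u i x * w i y)"
      using c' by blast+
    let ?l = "\<Sum>i<n. (\<lambda>y. fscale s (restr (carrier G) (\<lambda>x. u i (inv x)) y) (\<lambda>x. s (w i x) v))"
    let ?r = "\<lambda>y x. if y \<in> carrier G \<and> x \<in> carrier G then f (inv y \<otimes> x) else 0"
    have 1: "(\<lambda>y. fscale s (restr (carrier G) (\<lambda>x. u i (inv x)) y) (\<lambda>x. s (w i x) v))
        \<in> regular_maps G (fscale s) (regular_maps G s V)" if "i < n" for i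
    proof (rule reg_pure[OF FS])
      show "restr (carrier G) (\<lambda>x. u i (inv x)) \<in> coord G" using c(1)[OF that] by (rule coord_inv)
      show "(\<lambda>x. s (w i x) v) \<in> regular_maps G s V"
        using c(2)[OF that] step.hyps(2) by (rule reg_pure[OF assms(2)])
    qed
    have 2: "?l \<in> regular_maps G (fscale s) (regular_maps G s V)"
      by (rule reg_sum[OF FS 1]) simp
    have "?l + ?r \<in> regular_maps G (fscale s) (regular_maps G s V)"
      by (rule reg_closed(2)[OF FS 2 step.IH])
    moreover have "?l + ?r =
      (\<lambda>y x. if y \<in> carrier G \<and> x \<in> carrier G then s (a (inv y \<otimes> x)) v + f (inv y \<otimes> x) else 0)"
    proof (intro ext)
      fix y x :: 'g
      have sm: "(\<Sum>i<m. (\<lambda>y. fscale s (g i y) (k i))) y x = (\<Sum>i<m. s (g i y) (k i x))"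
        for g k and m :: nat and y x :: 'g by (induction m) (auto simp: fscale_apply)
      have "a (inv y \<otimes> x) = (\<Sum>i<n. u i (inv y) * w i x)" if "x \<in> carrier G" "y \<in> carrier G"
        using c(3)[of "inv y" x] that by simp
      moreover have "(\<Sum>i<n. s (restr (carrier G) (\<lambda>x. u i (inv x)) y) (s (w i x) v)) = 0"
        if "\<not> (x \<in> carrier G \<and> y \<in> carrier G)"
        using that coord_outside[OF c(2), of _ x] by (intro sum.neutral) (auto simp: restr_def)
      ultimately show "(?l + ?r) y x = (if y \<in> carrier G \<and> x \<in> carrier G then s (a (inv y \<otimes> x)) v + f (inv y \<otimes> x) else 0)"
        by (auto simp: sm restr_def fscale_apply S.scale_sum_left)
    qed
    ultimately show ?case by simp
  qed
qed

end

lemma linear_extend: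
  assumes "vector_space s" "vector_space t" "module.subspace s A" "module.subspace t W"
    and im: "\<And>v. v \<in> A \<Longrightarrow> L v \<in> W"
    and add: "\<And>v w. v \<in> A \<Longrightarrow> w \<in> A \<Longrightarrow> L (v + w) = L v + L w"
    and sc: "\<And>c v. v \<in> A \<Longrightarrow> L (s c v) = t c (L v)"
  shows "\<exists>L'. (\<forall>v. L' v \<in> W) \<and> (\<forall>v w. L' (v + w) = L' v + L' w) \<and>
    (\<forall>c v. L' (s c v) = t c (L' v)) \<and> (\<forall>v\<in>A. L' v = L v)"
proof -
  interpret S: vector_space s by fact
  interpret T: vector_space t by fact
  interpret P: vector_space_pair s t ..
  obtain B where B: "B \<subseteq> A" "S.independent B" "A \<subseteq> S.span B"
    using S.maximal_independent_subset[of A] by blast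
  obtain g where g: "Vector_Spaces.linear s t g" "\<forall>x\<in>B. g x = L x" "range g = T.span (L ` B)"
    using P.linear_independent_extend_subspace[OF B(2), of L] by blast
  interpret g: Vector_Spaces.linear s t g by fact
  have "T.span (L ` B) \<subseteq> W"
    using B(1) im assms(4) by (intro T.span_minimal) auto
  hence 1: "g v \<in> W" for v using g(3) by auto
  have "S.subspace {v \<in> A. g v = L v}"
    unfolding S.subspace_def
    using S.subspace_0[OF assms(3)] S.subspace_add[OF assms(3)] S.subspace_scale[OF assms(3)] sc[of 0 0]
    by (auto simp: add sc g.add g.scale g.zero)
  moreover have "B \<subseteq> {v \<in> A. g v = L v}" using B(1) g(2) by auto
  ultimately have "S.span B \<subseteq> {v \<in> A. g v = L v}" by (intro S.span_minimal)
  with B(3) have 2: "\<forall>v\<in>A. g v = L v" by auto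
  show ?thesis using 1 2 g.add g.scale by blast
qed

context coord_group
begin

lemma pow_0_iff: "g \<in> regular_maps_pow G s V 0 \<longleftrightarrow> g [] \<in> V \<and> (\<forall>xs. xs \<noteq> [] \<longrightarrow> g xs = 0)"
  by (auto simp: image_iff fun_eq_iff)

lemma pow_Suc_iff:
  "g \<in> regular_maps_pow G s V (Suc n) \<longleftrightarrow>
     g [] = 0 \<and> (\<lambda>x ys. g (x # ys)) \<in> regular_maps G (fscale s) (regular_maps_pow G s V n)"
proof
  assume "g [] = 0 \<and> (\<lambda>x ys. g (x # ys)) \<in> regular_maps G (fscale s) (regular_maps_pow G s V n)"
  moreover from this have "g = (\<lambda>xs. case xs of [] \<Rightarrow> 0 | x # ys \<Rightarrow> (\<lambda>x ys. g (x # ys)) x ys)"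
    by (auto simp: fun_eq_iff split: list.splits)
  ultimately show "g \<in> regular_maps_pow G s V (Suc n)" by auto
qed auto

lemma pow_subspace:
  fixes s :: "'k \<Rightarrow> 'v::ab_group_add \<Rightarrow> 'v"
  assumes "vector_space s" "module.subspace s V"
  shows "module.subspace (fscale s) (regular_maps_pow G s V n)"
proof (induction n)
  case 0
  interpret S: vector_space s by fact
  interpret F: vector_space "fscale s" by (rule vector_space_fscale) fact
  show ?case unfolding F.subspace_def
    using subspaceD[OF assms] by (auto simp: pow_0_iff fscale_apply simp del: regular_maps_pow.simps)
next
  case (Suc n)
  interpret S: vector_space s by fact
  interpret F: vector_space "fscale s" by (rule vector_space_fscale) fact
  note R = reg_closed[OF F.vector_space_axioms, where V = "regular_maps_pow G s V n"]
  have 0: "(\<lambda>x ys. (0 :: 'g list \<Rightarrow> _) (x # ys)) = 0" by (simp add: fun_eq_iff)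
  have 1: "(\<lambda>x ys. (f + g) (x # ys)) = (\<lambda>x ys. f (x # ys)) + (\<lambda>x ys. g (x # ys))" for f g :: "'g list \<Rightarrow> 'v"
    by (simp add: fun_eq_iff)
  have 2: "(\<lambda>x ys. (fscale s c f) (x # ys)) = fscale (fscale s) c (\<lambda>x ys. f (x # ys))" for c f
    by (auto simp: fscale_apply fun_eq_iff)
  show ?case unfolding F.subspace_def pow_Suc_iff 0 1 2
    using R by (auto simp: fscale_apply)
qed

lemma pow_outside:
  assumes "f \<in> regular_maps_pow G s V n" "vector_space s" "length xs \<noteq> n \<or> \<not> set xs \<subseteq> carrier G"
  shows "f xs = 0"
  using assms(1,3)
proof (induction n arbitrary: f xs)
  case 0
  then show ?case by (auto simp: pow_0_iff simp del: regular_maps_pow.simps)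
next
  case (Suc n)
  note FS = vector_space_fscale[OF assms(2)]
  show ?case
  proof (cases xs)
    case Nil
    then show ?thesis using Suc.prems by (auto simp: pow_Suc_iff simp del: regular_maps_pow.simps)
  next
    case (Cons x ys)
    have F: "(\<lambda>x ys. f (x # ys)) \<in> regular_maps G (fscale s) (regular_maps_pow G s V n)"
      using Suc.prems pow_Suc_iff by blast
    show ?thesis
    proof (cases "x \<in> carrier G")
      case False
      have "(\<lambda>ys. f (x # ys)) = 0" using reg_outside[OF F FS False] .
      thus ?thesis using Cons by (simp add: fun_eq_iff)
    next
      case True
      have *: "length ys \<noteq> n \<or> \<not> set ys \<subseteq> carrier G" using Suc.prems Cons True by auto
      define g where "g = (\<lambda>x ys. f (x # ys))"
      interpret S: vector_space s by fact
      have "g x ys = 0" using F[folded g_def] FS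
      proof (induction rule: reg_induct)
        case zero
        then show ?case by simp
      next
        case (step a v h)
        then show ?case using Suc.IH[OF step(2) *] by (simp add: fscale_apply)
      qed
      thus ?thesis using Cons by (simp add: g_def)
    qed
  qed
qed

lemma pow_in:
  assumes "f \<in> regular_maps_pow G s V n" "vector_space s" "module.subspace s V"
  shows "f xs \<in> V"
  using assms(1)
proof (induction n arbitrary: f xs)
  case 0
  then show ?case using subspaceD(1)[OF assms(2,3)]
    by (cases xs) (auto simp: pow_0_iff simp del: regular_maps_pow.simps)
next
  case (Suc n)
  show ?case
  proof (cases xs)
    case Nil
    then show ?thesis using Suc.prems subspaceD(1)[OF assms(2,3)]
      by (auto simp: pow_Suc_iff simp del: regular_maps_pow.simps)
  next
    case (Cons x ys)
    have "(\<lambda>x ys. f (x # ys)) \<in> regular_maps G (fscale s) (regular_maps_pow G s V n)"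
      using Suc.prems pow_Suc_iff by blast
    from reg_in[OF this vector_space_fscale[OF assms(2)] pow_subspace[OF assms(2,3)], of x]
    show ?thesis using Suc.IH Cons by blast
  qed
qed

definition tact :: "('g, 'k, 'v::ab_group_add) gmodule \<Rightarrow> 'g \<Rightarrow> ('g list \<Rightarrow> 'v) \<Rightarrow> 'g list \<Rightarrow> 'v" where
  "tact N y f = (\<lambda>xs. if set xs \<subseteq> carrier G then act N y (f (map (\<lambda>x. inv y \<otimes> x) xs)) else 0)"

lemma std_sel:
  "space (std_resolution G N n) = regular_maps_pow G (scale N) (space N) (Suc n)"
  "scale (std_resolution G N n) = fscale (scale N)"
  "act (std_resolution G N n) = tact N"
  by (simp_all add: std_resolution_def tact_def fun_eq_iff del: regular_maps_pow.simps)

lemma rationalD: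
  assumes "rational_module G M"
  shows "vector_space (scale M)" "module.subspace (scale M) (space M)"
    "\<And>x v. x \<in> carrier G \<Longrightarrow> v \<in> space M \<Longrightarrow> act M x v \<in> space M"
    "\<And>x v w. x \<in> carrier G \<Longrightarrow> v \<in> space M \<Longrightarrow> w \<in> space M \<Longrightarrow> act M x (v + w) = act M x v + act M x w"
    "\<And>x c v. x \<in> carrier G \<Longrightarrow> v \<in> space M \<Longrightarrow> act M x (scale M c v) = scale M c (act M x v)"
    "\<And>v. v \<in> space M \<Longrightarrow> act M \<one> v = v"
    "\<And>x y v. x \<in> carrier G \<Longrightarrow> y \<in> carrier G \<Longrightarrow> v \<in> space M \<Longrightarrow> act M (x \<otimes> y) v = act M x (act M y v)"
    "\<And>v. v \<in> space M \<Longrightarrow>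
      (\<lambda>x. if x \<in> carrier G then act M x v else 0) \<in> regular_maps G (scale M) (space M)"
  using assms unfolding rational_module_def by blast+

context
  fixes N :: "('g, 'k, 'v::ab_group_add) gmodule"
  assumes N: "rational_module G N"
begin

lemmas Nd = rationalD[OF N]
lemmas Ns = subspaceD[OF Nd(1,2)]

lemma act_zero: "x \<in> carrier G \<Longrightarrow> act N x 0 = 0"
  using Nd(4)[of x 0 0] Ns(1) by simp

lemma act_minus: "x \<in> carrier G \<Longrightarrow> v \<in> space N \<Longrightarrow> act N x (- v) = - act N x v"
  using Nd(4)[of x v "- v"] Ns(5)[of v] act_zero[of x] by (simp add: eq_neg_iff_add_eq_0 add.commute)

lemma act_diff: "x \<in> carrier G \<Longrightarrow> v \<in> space N \<Longrightarrow> w \<in> space N \<Longrightarrow> act N x (v - w) = act N x v - act N x w"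
  using Nd(4)[of x v "- w"] act_minus Ns(5) by simp

abbreviation "pw n \<equiv> regular_maps_pow G (scale N) (space N) n"

lemmas pw_in = pow_in[OF _ Nd(1,2)]
lemmas pw_outside = pow_outside[OF _ Nd(1)]
lemmas pw_vs = vector_space_fscale[OF Nd(1)]
lemmas pw_subspace = pow_subspace[OF Nd(1,2)]
lemmas pw_closed = subspaceD[OF pw_vs pw_subspace]

lemma tact_add:
  "\<lbrakk>y \<in> carrier G; \<And>xs. f xs \<in> space N; \<And>xs. g xs \<in> space N\<rbrakk> \<Longrightarrow> tact N y (f + g) = tact N y f + tact N y g"
  by (auto simp: tact_def fun_eq_iff Nd)

lemma tact_scale:
  assumes "y \<in> carrier G" "\<And>xs. f xs \<in> space N"
  shows "tact N y (fscale (scale N) c f) = fscale (scale N) c (tact N y f)"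
proof -
  interpret S: vector_space "scale N" by (rule Nd)
  show ?thesis using assms by (auto simp: tact_def fun_eq_iff Nd fscale_apply)
qed

lemma tact_zero: "y \<in> carrier G \<Longrightarrow> tact N y 0 = 0"
  by (auto simp: tact_def fun_eq_iff act_zero)

lemma tact_rational:
  "f \<in> pw n \<Longrightarrow> (\<lambda>y. if y \<in> carrier G then tact N y f else 0) \<in> regular_maps G (fscale (scale N)) (pw n)"
proof (induction n arbitrary: f)
  case 0
  have f: "f [] \<in> space N" "\<And>xs. xs \<noteq> [] \<Longrightarrow> f xs = 0"
    using 0 unfolding pow_0_iff by blast+
  let ?h = "\<lambda>v xs. if xs = [] then v else (0::'v)"
  have "(\<lambda>y. ?h (if y \<in> carrier G then act N y (f []) else 0)) \<in> regular_maps G (fscale (scale N)) (pw 0)"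
  proof (rule reg_linear[OF Nd(8)[OF f(1)] Nd(1) pw_vs Nd(2)])
    interpret S: vector_space "scale N" by (rule Nd)
    fix c v w
    show "?h (v + w) = ?h v + ?h w" by auto
    show "?h (scale N c v) = fscale (scale N) c (?h v)" by (auto simp: fscale_apply fun_eq_iff)
  qed (auto simp: pow_0_iff simp del: regular_maps_pow.simps)
  also have "(\<lambda>y. ?h (if y \<in> carrier G then act N y (f []) else 0)) = (\<lambda>y. if y \<in> carrier G then tact N y f else 0)"
    using f by (auto simp: tact_def fun_eq_iff act_zero)
  finally show ?case .
next
  case (Suc n)
  let ?s = "fscale (scale N)" and ?P = "regular_maps G (fscale (scale N)) (pw n)"
  note vs2 = vector_space_fscale[OF pw_vs]
  interpret S: vector_space ?s by (rule pw_vs)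
  define F where "F = (\<lambda>x ys. f (x # ys))"
  have F: "F \<in> ?P" and f0: "f [] = 0" using Suc.prems unfolding pow_Suc_iff F_def by auto
  define Ft where "Ft = (\<lambda>y x. if y \<in> carrier G \<and> x \<in> carrier G then F (inv y \<otimes> x) else 0)"
  have Ft: "Ft \<in> regular_maps G (fscale ?s) ?P"
    unfolding Ft_def by (rule reg_translate[OF F pw_vs])
  define h where "h = (\<lambda>y H x. if x \<in> carrier G then tact N y (H x) else (0 :: 'g list \<Rightarrow> 'v))"
  have inN: "H x ys \<in> space N" if "H \<in> ?P" for H x ys
    using pw_in[OF reg_in[OF that pw_vs pw_subspace]] .
  have hreg: "(\<lambda>y. if y \<in> carrier G then h y H else 0) \<in> regular_maps G (fscale ?s) ?P" if "H \<in> ?P" for H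
    using that pw_vs
  proof (induction rule: reg_induct)
    case zero
    have "(\<lambda>y. if y \<in> carrier G then h y (\<lambda>_. 0) else 0) = (0 :: 'g \<Rightarrow> 'g \<Rightarrow> 'g list \<Rightarrow> 'v)"
      by (auto simp: h_def fun_eq_iff tact_zero)
    then show ?case using reg_closed(1)[OF vs2] by simp
  next
    case (step a v H)
    have 1: "(\<lambda>y. (\<lambda>w x. ?s (a x) w) (if y \<in> carrier G then tact N y v else 0)) \<in> regular_maps G (fscale ?s) ?P"
    proof (rule reg_linear[OF Suc.IH[OF step(2)] pw_vs vs2 pw_subspace])
      interpret S0: vector_space "scale N" by (rule Nd)
      fix c v w
      show "(\<lambda>x. ?s (a x) v) \<in> ?P" if "v \<in> pw n" by (rule reg_pure[OF pw_vs step(1) that])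
      show "(\<lambda>x. ?s (a x) (v + w)) = (\<lambda>x. ?s (a x) v) + (\<lambda>x. ?s (a x) w)"
        by (auto simp: fun_eq_iff fscale_apply S0.scale_right_distrib)
      show "(\<lambda>x. ?s (a x) (?s c v)) = fscale ?s c (\<lambda>x. ?s (a x) v)"
        by (auto simp: fun_eq_iff fscale_apply mult.commute)
    qed
    have "(\<lambda>y. (\<lambda>w x. ?s (a x) w) (if y \<in> carrier G then tact N y v else 0)) +
        (\<lambda>y. if y \<in> carrier G then h y H else 0) =
      (\<lambda>y. if y \<in> carrier G then h y (\<lambda>x. ?s (a x) v + H x) else 0)" (is "?A + ?B = ?C")
    proof (intro ext)
      fix y x xs
      have "?s (a x) v ys \<in> space N" for ys using pw_in[OF pw_closed(3)[OF step(2)]] .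
      moreover have "v ys \<in> space N" for ys using pw_in[OF step(2)] .
      ultimately show "(?A + ?B) y x xs = ?C y x xs"
        using inN[OF step(3)] coord_outside[OF step(1)] by (simp add: h_def tact_add tact_scale)
    qed
    with reg_closed(2)[OF vs2 1 step(4)] show ?case by simp
  qed
  let ?U = "\<lambda>g xs. case xs of [] \<Rightarrow> (0::'v) | x # ys \<Rightarrow> g x ys"
  have 2: "(\<lambda>y. if y \<in> carrier G then h y (Ft y) else 0) \<in> regular_maps G (fscale ?s) ?P"
  proof (rule reg_bilin[OF Ft vs2 vs2 reg_subspace[OF pw_vs] hreg])
    fix y c H H' assume y: "y \<in> carrier G" "H \<in> ?P"
    show "h y (H + H') = h y H + h y H'" if "H' \<in> ?P"
      using y inN[OF y(2)] inN[OF that] by (auto simp: h_def fun_eq_iff tact_add)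
    have "tact N y (?s c (H x)) = ?s c (tact N y (H x))" for x
      using tact_scale[OF y(1)] inN[OF y(2)] by blast
    thus "h y (fscale ?s c H) = fscale ?s c (h y H)"
      by (auto simp: h_def fscale_apply[of ?s] fun_eq_iff S.scale_zero_right[unfolded fun_eq_iff])
  qed
  have "(\<lambda>y. ?U (if y \<in> carrier G then h y (Ft y) else 0)) \<in> regular_maps G ?s (pw (Suc n))"
  proof (rule reg_linear[OF 2 vs2 pw_vs reg_subspace[OF pw_vs]])
    interpret S0: vector_space "scale N" by (rule Nd)
    fix c g g'
    show "?U g \<in> pw (Suc n)" if "g \<in> ?P" using that by auto
    show "?U (g + g') = ?U g + ?U g'" by (auto simp: fun_eq_iff split: list.splits)
    show "?U (fscale ?s c g) = ?s c (?U g)" by (auto simp: fun_eq_iff fscale_apply split: list.splits)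
  qed
  also have "(\<lambda>y. ?U (if y \<in> carrier G then h y (Ft y) else 0)) = (\<lambda>y. if y \<in> carrier G then tact N y f else 0)"
    using f0 by (auto simp: fun_eq_iff tact_def h_def Ft_def F_def act_zero split: list.splits)
  finally show ?case .
qed

lemma tact_in: "f \<in> pw n \<Longrightarrow> y \<in> carrier G \<Longrightarrow> tact N y f \<in> pw n"
  using reg_in[OF tact_rational pw_vs pw_subspace, of f n y] by simp

lemma tact_one: assumes "f \<in> pw n" shows "tact N \<one> f = f"
proof
  fix xs
  have "map (\<lambda>x. inv \<one> \<otimes> x) xs = xs" if "set xs \<subseteq> carrier G"
    using that by (intro map_idI) auto
  thus "tact N \<one> f xs = f xs"
    using pw_outside[OF assms, of xs] Nd(6) pw_in[OF assms] by (auto simp: tact_def)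
qed

lemma tact_mult:
  assumes "\<And>xs. f xs \<in> space N" "x \<in> carrier G" "y \<in> carrier G"
  shows "tact N (x \<otimes> y) f = tact N x (tact N y f)"
proof
  fix xs
  have "map (\<lambda>z. inv (x \<otimes> y) \<otimes> z) xs = map (\<lambda>z. inv y \<otimes> z) (map (\<lambda>z. inv x \<otimes> z) xs)"
    if "set xs \<subseteq> carrier G"
    using that assms by (auto simp: inv_mult_group m_assoc)
  moreover have "set (map (\<lambda>z. inv x \<otimes> z) xs) \<subseteq> carrier G" if "set xs \<subseteq> carrier G"
    using that assms by auto
  ultimately show "tact N (x \<otimes> y) f xs = tact N x (tact N y f) xs"
    using assms by (auto simp: tact_def Nd(7) simp del: map_map map_eq_conv)
qed

lemma std_resolution_rational': "rational_module G (std_resolution G N n)"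
  unfolding rational_module_def std_sel
proof (intro conjI ballI allI)
  fix x y v w c assume x: "x \<in> carrier G" and v: "v \<in> pw (Suc n)"
  note vi = pw_in[OF v]
  show "tact N x v \<in> pw (Suc n)" by (rule tact_in[OF v x])
  show "tact N x (v + w) = tact N x v + tact N x w" if "w \<in> pw (Suc n)"
    by (rule tact_add[OF x vi pw_in[OF that]])
  show "tact N x (fscale (scale N) c v) = fscale (scale N) c (tact N x v)"
    by (rule tact_scale[OF x vi])
  show "tact N (x \<otimes> y) v = tact N x (tact N y v)" if "y \<in> carrier G"
    by (rule tact_mult[OF vi x that])
qed (rule pw_vs pw_subspace tact_one tact_rational, assumption?)+

lemma std_resolution_injective':
  fixes M :: "('g, 'k, 'm::ab_group_add) gmodule"
  assumes M: "rational_module G M" and M': "gsubmodule G M M'"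
    and \<phi>: "ghom G (M\<lparr>space := M'\<rparr>) (std_resolution G N n) \<phi>"
  shows "\<exists>\<psi>. ghom G M (std_resolution G N n) \<psi> \<and> (\<forall>v\<in>M'. \<psi> v = \<phi> v)"
proof -
  note Md = rationalD[OF M]
  let ?s = "fscale (scale N)"
  note vs2 = vector_space_fscale[OF pw_vs]
  have sub: "M' \<subseteq> space M" "module.subspace (scale M) M'"
    "\<And>x v. x \<in> carrier G \<Longrightarrow> v \<in> M' \<Longrightarrow> act M x v \<in> M'"
    using M' unfolding gsubmodule_def by auto
  have ph: "\<And>v. v \<in> M' \<Longrightarrow> \<phi> v \<in> pw (Suc n)" "\<And>v w. v \<in> M' \<Longrightarrow> w \<in> M' \<Longrightarrow> \<phi> (v + w) = \<phi> v + \<phi> w"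
    "\<And>c v. v \<in> M' \<Longrightarrow> \<phi> (scale M c v) = ?s c (\<phi> v)"
    "\<And>x v. x \<in> carrier G \<Longrightarrow> v \<in> M' \<Longrightarrow> \<phi> (act M x v) = tact N x (\<phi> v)"
    using \<phi> unfolding ghom_def std_sel by (simp_all del: regular_maps_pow.simps)
  define L where "L = (\<lambda>v xs. \<phi> v (\<one> # xs))"
  have "\<exists>L'. (\<forall>v. L' v \<in> pw n) \<and> (\<forall>v w. L' (v + w) = L' v + L' w) \<and>
    (\<forall>c v. L' (scale M c v) = ?s c (L' v)) \<and> (\<forall>v\<in>M'. L' v = L v)"
  proof (rule linear_extend[OF Md(1) pw_vs sub(2) pw_subspace])
    fix v assume "v \<in> M'"
    hence "(\<lambda>x ys. \<phi> v (x # ys)) \<in> regular_maps G ?s (pw n)" using ph(1) pow_Suc_iff by blast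
    from reg_in[OF this pw_vs pw_subspace, of "\<one>"] show "L v \<in> pw n" by (simp add: L_def)
  qed (auto simp: L_def ph fun_eq_iff fscale_apply)
  then obtain L' where L': "\<And>v. L' v \<in> pw n" "\<And>v w. L' (v + w) = L' v + L' w"
    "\<And>c v. L' (scale M c v) = ?s c (L' v)" "\<And>v. v \<in> M' \<Longrightarrow> L' v = L v" by metis
  define \<Psi> where "\<Psi> = (\<lambda>b x. if x \<in> carrier G then tact N x (L' (act M (inv x) b)) else 0)"
  define \<psi> where "\<psi> = (\<lambda>b xs. case xs of [] \<Rightarrow> 0 | x # ys \<Rightarrow> \<Psi> b x ys)"
  have reg: "\<Psi> b \<in> regular_maps G ?s (pw n)" if b: "b \<in> space M" for b
  proof -
    have 1: "(\<lambda>x. if x \<in> carrier G then (if inv x \<in> carrier G then act M (inv x) b else 0) else 0)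
       \<in> regular_maps G (scale M) (space M)"
      by (rule reg_inv[OF Md(8)[OF b] Md(1)])
    have "(\<lambda>x. if x \<in> carrier G then tact N x (L' (if x \<in> carrier G then
        (if inv x \<in> carrier G then act M (inv x) b else 0) else 0)) else 0) \<in> regular_maps G ?s (pw n)"
      by (rule reg_bilin[OF 1 Md(1) pw_vs Md(2), where h = "\<lambda>x v. tact N x (L' v)"])
        (auto simp: L' intro: tact_rational tact_add[OF _ pw_in[OF L'(1)] pw_in[OF L'(1)]]
           tact_scale[OF _ pw_in[OF L'(1)]])
    also have "(\<lambda>x. if x \<in> carrier G then tact N x (L' (if x \<in> carrier G then
        (if inv x \<in> carrier G then act M (inv x) b else 0) else 0)) else 0) = \<Psi> b"
      by (auto simp: \<Psi>_def fun_eq_iff)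
    finally show ?thesis .
  qed
  have "ghom G M (std_resolution G N n) \<psi>"
    unfolding ghom_def std_sel
  proof (intro conjI ballI allI)
    interpret S: vector_space "scale N" by (rule Nd)
    fix v assume v: "v \<in> space M"
    show "\<psi> v \<in> pw (Suc n)" unfolding pow_Suc_iff using reg[OF v] by (simp add: \<psi>_def)
    show "\<psi> (v + w) = \<psi> v + \<psi> w" if "w \<in> space M" for w
      using v that by (auto simp: \<psi>_def \<Psi>_def fun_eq_iff Md L' tact_add[OF _ pw_in[OF L'(1)] pw_in[OF L'(1)]]
          split: list.splits)
    show "\<psi> (scale M c v) = ?s c (\<psi> v)" for c
      using v by (auto simp: \<psi>_def \<Psi>_def fun_eq_iff Md L' tact_scale[OF _ pw_in[OF L'(1)]] fscale_apply
          split: list.splits)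
    show "\<psi> (act M y v) = tact N y (\<psi> v)" if y: "y \<in> carrier G" for y
    proof
      fix xs
      show "\<psi> (act M y v) xs = tact N y (\<psi> v) xs"
      proof (cases xs)
        case Nil
        then show ?thesis using y by (simp add: \<psi>_def tact_def act_zero)
      next
        case (Cons x ys)
        show ?thesis
        proof (cases "set xs \<subseteq> carrier G")
          case True
          hence x: "x \<in> carrier G" using Cons by auto
          have e1: "act M (inv x) (act M y v) = act M (inv (inv y \<otimes> x)) v"
            using x y v by (simp flip: Md(7) add: inv_mult_group)
          have e2: "tact N x f = tact N y (tact N (inv y \<otimes> x) f)" if "f \<in> pw n" for f
            using x y that by (simp flip: tact_mult[OF pw_in[OF that]] add: m_assoc[symmetric])
          show ?thesis using x y Cons True
            by (simp add: \<psi>_def \<Psi>_def e1 e2[OF L'(1)]) (simp add: tact_def)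
        next
          case False
          have "\<psi> (act M y v) xs = 0"
            using False Cons by (auto simp: \<psi>_def \<Psi>_def tact_def)
          thus ?thesis using False by (simp add: tact_def)
        qed
      qed
    qed
  qed
  moreover have "\<psi> v = \<phi> v" if v: "v \<in> M'" for v
  proof
    fix xs
    show "\<psi> v xs = \<phi> v xs"
    proof (cases "xs \<noteq> [] \<and> set xs \<subseteq> carrier G")
      case False
      have "\<phi> v xs = 0" using False pw_outside[OF ph(1)[OF v], of xs] by auto
      moreover have "\<psi> v xs = 0" using False by (auto simp: \<psi>_def \<Psi>_def tact_def split: list.splits)
      ultimately show ?thesis by simp
    next
      case True
      then obtain x ys where xs: "xs = x # ys" "x \<in> carrier G" "set ys \<subseteq> carrier G" by (cases xs) auto
      have a: "act M (inv x) v \<in> M'" using sub(3) v xs by simp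
      have "\<psi> v xs = tact N x (L (act M (inv x) v)) ys" using xs L'(4)[OF a] by (simp add: \<psi>_def \<Psi>_def)
      also have "\<dots> = act N x (\<phi> (act M (inv x) v) (\<one> # map (\<lambda>z. inv x \<otimes> z) ys))"
        using xs by (simp add: tact_def L_def)
      also have "\<dots> = tact N x (\<phi> (act M (inv x) v)) xs"
        using xs by (simp add: tact_def)
      also have "\<dots> = \<phi> (act M x (act M (inv x) v)) xs" using ph(4)[OF xs(2) a] by simp
      also have "act M x (act M (inv x) v) = v"
        using xs v sub(1) by (subst Md(7)[symmetric]) (auto simp: Md(6))
      finally show ?thesis .
    qed
  qed
  ultimately show ?thesis by blast
qed

end
end

context coord_group
begin

lemma diff_Nil [simp]: "std_differential G f [] = 0"
  by (simp add: std_differential_def)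

lemma diff_outside: "\<not> set xs \<subseteq> carrier G \<Longrightarrow> std_differential G f xs = 0"
  unfolding std_differential_def by (rule if_not_P)

lemma diff_Cons:
  assumes "x \<in> carrier G"
  shows "std_differential G f (x # xs) =
    (if set xs \<subseteq> carrier G then f xs else 0) - std_differential G (\<lambda>ys. f (x # ys)) xs"
proof (cases "set xs \<subseteq> carrier G")
  case True
  have "std_differential G f (x # xs) = (\<Sum>i<Suc (length xs). (if even i then f (take i (x # xs) @ drop (Suc i) (x # xs))
      else - f (take i (x # xs) @ drop (Suc i) (x # xs))))"
    using assms True by (simp add: std_differential_def)
  also have "\<dots> = f xs + (\<Sum>i<length xs. - (if even i then f (x # (take i xs @ drop (Suc i) xs))
      else - f (x # (take i xs @ drop (Suc i) xs))))"
    by (subst sum.lessThan_Suc_shift) (auto intro!: sum.cong)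
  also have "\<dots> = f xs - std_differential G (\<lambda>ys. f (x # ys)) xs"
    using True by (simp add: std_differential_def sum_negf)
  finally show ?thesis using True by simp
next
  case False
  thus ?thesis by (simp add: diff_outside)
qed

lemma diff_add: "std_differential G (f + g) = std_differential G f + std_differential G g"
proof
  fix xs show "std_differential G (f + g) xs = (std_differential G f + std_differential G g) xs"
  proof (induction xs arbitrary: f g)
    case (Cons x xs)
    have *: "(\<lambda>ys. (f + g) (x # ys)) = (\<lambda>ys. f (x # ys)) + (\<lambda>ys. g (x # ys))" by auto
    show ?case
    proof (cases "set (x # xs) \<subseteq> carrier G")
      case True
      hence x: "x \<in> carrier G" "set xs \<subseteq> carrier G" by auto
      have "std_differential G (f + g) (x # xs) = (f + g) xs -
          std_differential G ((\<lambda>ys. f (x # ys)) + (\<lambda>ys. g (x # ys))) xs"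
        by (simp only: diff_Cons[OF x(1)] x(2) if_True *)
      also have "\<dots> = (f + g) xs - (std_differential G (\<lambda>ys. f (x # ys)) + std_differential G (\<lambda>ys. g (x # ys))) xs"
        by (simp only: Cons.IH)
      finally show ?thesis using x by (simp add: diff_Cons)
    next
      case False
      show ?thesis unfolding plus_fun_apply[of "std_differential G f"] diff_outside[OF False] by simp
    qed
  qed simp
qed

lemma diff_scale:
  assumes "vector_space s"
  shows "std_differential G (fscale s c f) = fscale s c (std_differential G f)"
proof
  interpret S: vector_space s by fact
  fix xs show "std_differential G (fscale s c f) xs = fscale s c (std_differential G f) xs"
  proof (induction xs arbitrary: f)
    case (Cons x xs)
    have *: "(\<lambda>ys. fscale s c f (x # ys)) = fscale s c (\<lambda>ys. f (x # ys))" by (auto simp: fscale_apply)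
    show ?case
    proof (cases "set (x # xs) \<subseteq> carrier G")
      case True
      thus ?thesis by (simp add: diff_Cons * Cons.IH) (simp add: fscale_apply diff_Cons S.scale_right_diff_distrib)
    next
      case False
      show ?thesis unfolding diff_outside[OF False] fscale_def by simp
    qed
  qed (simp add: fscale_apply)
qed

lemma diff_zero: "std_differential G 0 = 0"
  by (rule ext) (auto simp: std_differential_def intro: sum.neutral)

lemma diff_uminus: "std_differential G (- f) = - std_differential G f"
proof -
  have "std_differential G f + std_differential G (- f) = 0"
    by (simp add: diff_zero flip: diff_add)
  thus ?thesis by (simp add: eq_neg_iff_add_eq_0 add.commute)
qed

lemma diff_diff:
  assumes "\<And>xs. \<not> set xs \<subseteq> carrier G \<Longrightarrow> f xs = 0"
  shows "std_differential G (std_differential G f) = 0"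
proof
  fix xs show "std_differential G (std_differential G f) xs = 0 xs"
    using assms
  proof (induction xs arbitrary: f)
    case (Cons x xs)
    show ?case
    proof (cases "x \<in> carrier G \<and> set xs \<subseteq> carrier G")
      case True
      let ?F = "\<lambda>ys. f (x # ys)"
      have "(\<lambda>ys. std_differential G f (x # ys)) = f + - std_differential G ?F"
        using True Cons.prems by (auto simp: diff_Cons fun_eq_iff)
      moreover have "std_differential G (f + - std_differential G ?F) xs =
          std_differential G f xs - std_differential G (std_differential G ?F) xs"
        unfolding diff_add diff_uminus by simp
      ultimately have "std_differential G (\<lambda>ys. std_differential G f (x # ys)) xs =
          std_differential G f xs - std_differential G (std_differential G ?F) xs"
        by simp
      moreover have "std_differential G (std_differential G ?F) xs = 0 xs"
        using Cons.prems by (intro Cons.IH) auto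
      ultimately show ?thesis using True by (simp add: diff_Cons)
    next
      case False
      thus ?thesis by (auto simp: diff_outside)
    qed
  qed simp
qed

context
  fixes N :: "('g, 'k, 'v::ab_group_add) gmodule"
  assumes N: "rational_module G N"
begin

abbreviation "pp n \<equiv> regular_maps_pow G (scale N) (space N) n"

lemmas N_d = rationalD[OF N]
lemmas N_s = subspaceD[OF N_d(1,2)]
lemmas pp_vs = vector_space_fscale[OF N_d(1)]
lemmas pp_subspace = pow_subspace[OF N_d(1,2)]
lemmas pp_in = pow_in[OF _ N_d(1,2)]
lemmas pp_outside = pow_outside[OF _ N_d(1)]

lemma diff_pow: "f \<in> pp n \<Longrightarrow> std_differential G f \<in> pp (Suc n)"
proof (induction n arbitrary: f)
  case 0
  have *: "(\<lambda>ys. f (x # ys)) = 0" for x using 0 unfolding pow_0_iff by (auto simp: fun_eq_iff)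
  have "(\<lambda>x ys. std_differential G f (x # ys)) = (\<lambda>x. if x \<in> carrier G then f else 0)"
  proof (intro ext)
    fix x ys
    show "std_differential G f (x # ys) = (if x \<in> carrier G then f else 0) ys"
      using pp_outside[OF 0, of ys]
      by (cases "set ys \<subseteq> carrier G") (auto simp: diff_Cons diff_outside * diff_zero)
  qed
  thus ?case unfolding pow_Suc_iff using reg_const[OF pp_vs 0] by simp
next
  case (Suc n)
  let ?s = "fscale (scale N)"
  have F: "(\<lambda>x ys. f (x # ys)) \<in> regular_maps G ?s (pp n)"
    using Suc.prems pow_Suc_iff by blast
  have 1: "(\<lambda>x. std_differential G (\<lambda>ys. f (x # ys))) \<in> regular_maps G ?s (pp (Suc n))"
    by (rule reg_linear[OF F pp_vs pp_vs pp_subspace Suc.IH]) (assumption | rule diff_add diff_scale[OF N_d(1)])+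
  have "(\<lambda>x. if x \<in> carrier G then f else 0) - (\<lambda>x. std_differential G (\<lambda>ys. f (x # ys)))
      \<in> regular_maps G ?s (pp (Suc n))" (is "?R \<in> _")
    by (rule reg_closed(3)[OF pp_vs reg_const[OF pp_vs Suc.prems] 1])
  also have "?R = (\<lambda>x ys. std_differential G f (x # ys))"
  proof (intro ext)
    fix x ys
    have "(\<lambda>ys. f (x # ys)) = 0" if "x \<notin> carrier G"
      using reg_outside[OF F pp_vs that] .
    thus "?R x ys = std_differential G f (x # ys)"
      using pp_outside[OF Suc.prems, of ys] by (auto simp: diff_Cons diff_outside diff_zero)
  qed
  finally show ?case unfolding pow_Suc_iff by simp
qed

lemma diff_in: "(\<And>xs. f xs \<in> space N) \<Longrightarrow> std_differential G f xs \<in> space N"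
proof (induction xs arbitrary: f)
  case (Cons x xs)
  show ?case
    by (cases "x \<in> carrier G")
      (auto simp: diff_Cons diff_outside N_s(1) intro!: N_s(4) Cons)
qed (simp add: N_s(1))

lemma diff_tact:
  assumes "y \<in> carrier G" "\<And>xs. f xs \<in> space N"
  shows "std_differential G (tact N y f) = tact N y (std_differential G f)"
proof
  fix xs
  show "std_differential G (tact N y f) xs = tact N y (std_differential G f) xs"
    using assms(2)
  proof (induction xs arbitrary: f)
    case Nil
    then show ?case using assms(1) by (simp add: tact_def act_zero[OF N])
  next
    case (Cons x xs)
    show ?case
    proof (cases "x \<in> carrier G \<and> set xs \<subseteq> carrier G")
      case True
      hence "(\<lambda>ys. tact N y f (x # ys)) = tact N y (\<lambda>ys. f (inv y \<otimes> x # ys))"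
        by (auto simp: tact_def fun_eq_iff)
      moreover have "std_differential G (tact N y (\<lambda>ys. f (inv y \<otimes> x # ys))) xs =
          tact N y (std_differential G (\<lambda>ys. f (inv y \<otimes> x # ys))) xs"
        by (rule Cons.IH) (rule Cons.prems)
      moreover have "set (map (\<lambda>x. inv y \<otimes> x) xs) \<subseteq> carrier G" using True assms(1) by auto
      ultimately show ?thesis
        using True assms(1) Cons.prems
        by (simp add: diff_Cons) (auto simp: tact_def diff_Cons act_diff[OF N] diff_in)
    next
      case False
      thus ?thesis by (auto simp: tact_def diff_outside)
    qed
  qed
qed

lemma diff_ghom: "ghom G (std_resolution G N n) (std_resolution G N (Suc n)) (std_differential G)"
  unfolding ghom_def std_sel
proof (intro conjI ballI allI)
  fix v w c x assume v: "v \<in> pp (Suc n)"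
  show "std_differential G v \<in> pp (Suc (Suc n))" by (rule diff_pow[OF v])
  show "std_differential G (tact N x v) = tact N x (std_differential G v)" if "x \<in> carrier G"
    by (rule diff_tact[OF that pp_in[OF v]])
qed (assumption | rule diff_add diff_scale[OF N_d(1)])+

lemma diff_exact:
  assumes "f \<in> pp (Suc n)" "std_differential G f = 0"
  shows "\<exists>g\<in>pp n. f = std_differential G g"
proof (intro bexI)
  have "(\<lambda>x ys. f (x # ys)) \<in> regular_maps G (fscale (scale N)) (pp n)"
    using assms pow_Suc_iff by blast
  from reg_in[OF this pp_vs pp_subspace] show g: "(\<lambda>ys. f (\<one> # ys)) \<in> pp n" .
  show "f = std_differential G (\<lambda>ys. f (\<one> # ys))"
  proof
    fix xs
    show "f xs = std_differential G (\<lambda>ys. f (\<one> # ys)) xs"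
    proof (cases "set xs \<subseteq> carrier G")
      case True
      have "std_differential G f (\<one> # xs) = 0" using assms(2) by simp
      thus ?thesis using True by (simp add: diff_Cons)
    next
      case False
      thus ?thesis using pp_outside[OF assms(1)] by (simp add: diff_outside)
    qed
  qed
qed

lemma augmentation_eq: "std_augmentation G v = std_differential G (\<lambda>xs. if xs = [] then v else 0)"
proof
  fix xs
  show "std_augmentation G v xs = std_differential G (\<lambda>xs. if xs = [] then v else 0) xs"
  proof (cases xs)
    case (Cons x ys)
    have *: "(\<lambda>ys. if x # ys = [] then v else 0) = 0" by auto
    show ?thesis unfolding Cons
      by (cases "x \<in> carrier G")
        (auto simp: diff_Cons diff_outside std_augmentation_def diff_zero[unfolded zero_fun_def] zero_fun_def)
  qed (simp add: std_augmentation_def)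
qed

lemma std_resolution_exact':
  shows "ghom G N (std_resolution G N 0) (std_augmentation G)" (is ?a)
    and "inj_on (std_augmentation G) (space N)" (is ?b)
    and "std_augmentation G ` space N = {f \<in> space (std_resolution G N 0). std_differential G f = 0}" (is ?c)
    and "std_differential G ` space (std_resolution G N n) =
      {f \<in> space (std_resolution G N (Suc n)). std_differential G f = 0}" (is ?d)
proof -
  interpret S: vector_space "scale N" by (rule N_d)
  let ?k = "\<lambda>v xs. if xs = [] then v else (0::'v)"
  have k: "?k v \<in> pp 0" if "v \<in> space N" for v using that by (auto simp: pow_0_iff simp del: regular_maps_pow.simps)
  have dd: "std_differential G (std_differential G f) = 0" if "f \<in> pp m" for f m
    using pp_outside[OF that] by (intro diff_diff) auto
  show ?a unfolding ghom_def std_sel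
  proof (intro conjI ballI allI)
    fix v assume v: "v \<in> space N"
    show "std_augmentation G v \<in> pp (Suc 0)"
      unfolding augmentation_eq by (rule diff_pow[OF k[OF v]])
    show "std_augmentation G (act N x v) = tact N x (std_augmentation G v)" if "x \<in> carrier G" for x
      using that by (auto simp: std_augmentation_def tact_def fun_eq_iff act_zero[OF N])
  qed (auto simp: std_augmentation_def fun_eq_iff fscale_apply)
  show ?b
  proof (rule inj_onI)
    fix v w assume "std_augmentation G v = std_augmentation G w"
    hence "std_augmentation G v [\<one>] = std_augmentation G w [\<one>]" by simp
    thus "v = w" by (simp add: std_augmentation_def)
  qed
  show ?d
    unfolding std_sel using diff_pow[of _ "Suc n"] dd[of _ "Suc n"] diff_exact[of _ "Suc n"]
    by blast
  show ?c
  proof (intro equalityI subsetI)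
    fix f assume "f \<in> std_augmentation G ` space N"
    then obtain v where v: "v \<in> space N" "f = std_differential G (?k v)" using augmentation_eq by blast
    show "f \<in> {f \<in> space (std_resolution G N 0). std_differential G f = 0}"
      unfolding v(2) std_sel using diff_pow[OF k[OF v(1)]] dd[OF k[OF v(1)]] by blast
  next
    fix f assume "f \<in> {f \<in> space (std_resolution G N 0). std_differential G f = 0}"
    then obtain g where g: "g \<in> pp 0" "f = std_differential G g" unfolding std_sel using diff_exact by blast
    have g0: "g [] \<in> space N" "?k (g []) = g" using g(1) unfolding pow_0_iff by (auto simp: fun_eq_iff)
    have "f = std_augmentation G (g [])" unfolding augmentation_eq g0(2) by (rule g(2))
    thus "f \<in> std_augmentation G ` space N" using g0(1) by (rule image_eqI)
  qed
qed

end
end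

lemma coord_group_affine: "affine_alg_group G \<Longrightarrow> coord_group G"
  unfolding affine_alg_group_def coord_group_def coord_group_axioms_def by blast

text \<open>The type of \<open>M\<close> in the second theorem is arbitrary, so the terms are injective with respect
  to all rational modules.\<close>

theorem std_resolution_rational:
  assumes "affine_alg_group G" "rational_module G N"
  shows "rational_module G (std_resolution G N n)"
  by (rule coord_group.std_resolution_rational'[OF coord_group_affine[OF assms(1)] assms(2)])

theorem std_resolution_injective:
  assumes "affine_alg_group G" "rational_module G N" "rational_module G M" "gsubmodule G M M'"
    and "ghom G (M\<lparr>space := M'\<rparr>) (std_resolution G N n) \<phi>"
  shows "\<exists>\<psi>. ghom G M (std_resolution G N n) \<psi> \<and> (\<forall>v\<in>M'. \<psi> v = \<phi> v)"
  by (rule coord_group.std_resolution_injective'[OF coord_group_affine[OF assms(1)] assms(2-)])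

theorem std_resolution_exact:
  assumes "affine_alg_group G" "rational_module G N"
  shows "ghom G N (std_resolution G N 0) (std_augmentation G)"
    and "inj_on (std_augmentation G) (space N)"
    and "std_augmentation G ` space N =
      {f \<in> space (std_resolution G N 0). std_differential G f = 0}"
    and "ghom G (std_resolution G N n) (std_resolution G N (Suc n)) (std_differential G)"
    and "std_differential G ` space (std_resolution G N n) =
      {f \<in> space (std_resolution G N (Suc n)). std_differential G f = 0}"
proof -
  interpret coord_group G by (rule coord_group_affine[OF assms(1)])
  show "ghom G N (std_resolution G N 0) (std_augmentation G)"
    and "inj_on (std_augmentation G) (space N)"
    and "std_augmentation G ` space N =
      {f \<in> space (std_resolution G N 0). std_differential G f = 0}"
    and "ghom G (std_resolution G N n) (std_resolution G N (Suc n)) (std_differential G)"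
    and "std_differential G ` space (std_resolution G N n) =
      {f \<in> space (std_resolution G N (Suc n)). std_differential G f = 0}"
    by (rule std_resolution_exact'[OF assms(2)] diff_ghom[OF assms(2)])+
qed

end

theory Submission
  imports Defs
begin

text \<open>
  A regular function whose translates over the finite group sum to \<open>1\<close> yields a partition of unity,
  and averaging with it gives Shapiro's lemma on the level of homogeneous cochains: the cohomology of
  \<open>G(F\<^sub>q)\<close> in \<open>L\<close> is that of \<open>G\<close> in \<open>Gr \<otimes> L\<close>. By (b) and (c) the groups \<open>Ext\<^sup>2\<close> and \<open>Ext\<^sup>3\<close> with
  coefficients in \<open>S_lt \<otimes> L\<close> vanish, so \<open>Gr\<close> may be replaced by \<open>Q_nlt\<close>. The filtration of \<open>Q_nlt\<close>
  contains \<open>HH \<sigma>\<close> exactly once, whence \<open>Ext\<^sup>2\<close> with coefficients in \<open>Q_nlt \<otimes> L\<close> is a subquotient of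
  \<open>Ext\<^sup>2\<close> with coefficients in \<open>HH \<sigma> \<otimes> L\<close>; by (d) the latter embeds in the former. Two vector spaces
  that are subquotients of each other are isomorphic.
\<close>

section \<open>Subquotients\<close>

text \<open>It is normalised to be \<open>1\<close> at the identity and \<open>0\<close> at the
  other points of the finite group, which makes averaging the identity on tuples from that group.
  The groups to be compared are quotients of cochain spaces of different types, and the natural maps
  between them rest on choices of lifts. They are therefore encoded as linear relations:
  \<open>subquotient\<close> asks for a relation that is total on \<open>Z\<close> and in which
  elements of \<open>B'\<close> correspond only to elements of \<open>B\<close>, so
  \<open>Z/B\<close> is a quotient of a subspace of \<open>Z'/B'\<close>. Such relations compose
  freely, and no long exact sequence has to be built: each use of exactness is one relation between
  cocycles, valid when a neighbouring group vanishes. A filtration may be infinite. A regular map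
  involves only finitely many vectors, so each cocycle already lives in a finite stage. Rationality
  of the sections is obtained from their being quotients of stages.\<close>

definition subquotient ::
    "('k \<Rightarrow> 'v::ab_group_add \<Rightarrow> 'v) \<Rightarrow> 'v set \<Rightarrow> 'v set \<Rightarrow>
     ('k \<Rightarrow> 'w::ab_group_add \<Rightarrow> 'w) \<Rightarrow> 'w set \<Rightarrow> 'w set \<Rightarrow> bool" where
  "subquotient s Z B t Z' B' \<longleftrightarrow> (\<exists>r.
     (\<forall>x y. r x y \<longrightarrow> x \<in> Z \<and> y \<in> Z') \<and>
     (\<forall>x y x' y'. r x y \<and> r x' y' \<longrightarrow> r (x + x') (y + y')) \<and>
     (\<forall>c x y. r x y \<longrightarrow> r (s c x) (t c y)) \<and>
     (\<forall>x\<in>Z. \<exists>y. r x y) \<and>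
     (\<forall>x y. r x y \<and> y \<in> B' \<longrightarrow> x \<in> B))"

lemma subquotientI:
  assumes "\<And>x y. r x y \<Longrightarrow> x \<in> Z \<and> y \<in> Z'"
    and "\<And>x y x' y'. r x y \<Longrightarrow> r x' y' \<Longrightarrow> r (x + x') (y + y')"
    and "\<And>c x y. r x y \<Longrightarrow> r (s c x) (t c y)"
    and "\<And>x. x \<in> Z \<Longrightarrow> \<exists>y. r x y"
    and "\<And>x y. r x y \<Longrightarrow> y \<in> B' \<Longrightarrow> x \<in> B"
  shows "subquotient s Z B t Z' B'"
  unfolding subquotient_def using assms by (intro exI[of _ r]) blast

lemma subquotientE:
  assumes "subquotient s Z B t Z' B'"
  obtains r where "\<And>x y. r x y \<Longrightarrow> x \<in> Z \<and> y \<in> Z'"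
    and "\<And>x y x' y'. r x y \<Longrightarrow> r x' y' \<Longrightarrow> r (x + x') (y + y')"
    and "\<And>c x y. r x y \<Longrightarrow> r (s c x) (t c y)"
    and "\<And>x. x \<in> Z \<Longrightarrow> \<exists>y. r x y"
    and "\<And>x y. r x y \<Longrightarrow> y \<in> B' \<Longrightarrow> x \<in> B"
proof -
  from assms obtain r where r: "\<forall>x y. r x y \<longrightarrow> x \<in> Z \<and> y \<in> Z'"
    "\<forall>x y x' y'. r x y \<and> r x' y' \<longrightarrow> r (x + x') (y + y')"
    "\<forall>c x y. r x y \<longrightarrow> r (s c x) (t c y)"
    "\<forall>x\<in>Z. \<exists>y. r x y" "\<forall>x y. r x y \<and> y \<in> B' \<longrightarrow> x \<in> B"
    unfolding subquotient_def by (elim exE conjE)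
  show thesis by (rule that[of r]) (simp_all add: r)
qed

lemma subquotient_trans:
  assumes "subquotient s Z B t Z' B'" "subquotient t Z' B' u Z'' B''"
  shows "subquotient s Z B u Z'' B''"
proof -
  obtain r where r: "\<And>x y. r x y \<Longrightarrow> x \<in> Z \<and> y \<in> Z'"
    "\<And>x y x' y'. r x y \<Longrightarrow> r x' y' \<Longrightarrow> r (x + x') (y + y')"
    "\<And>c x y. r x y \<Longrightarrow> r (s c x) (t c y)"
    "\<And>x. x \<in> Z \<Longrightarrow> \<exists>y. r x y" "\<And>x y. r x y \<Longrightarrow> y \<in> B' \<Longrightarrow> x \<in> B"
    by (rule subquotientE[OF assms(1)]) blast
  obtain q where q: "\<And>x y. q x y \<Longrightarrow> x \<in> Z' \<and> y \<in> Z''"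
    "\<And>x y x' y'. q x y \<Longrightarrow> q x' y' \<Longrightarrow> q (x + x') (y + y')"
    "\<And>c x y. q x y \<Longrightarrow> q (t c x) (u c y)"
    "\<And>x. x \<in> Z' \<Longrightarrow> \<exists>y. q x y" "\<And>x y. q x y \<Longrightarrow> y \<in> B'' \<Longrightarrow> x \<in> B'"
    by (rule subquotientE[OF assms(2)]) blast
  show ?thesis
  proof (rule subquotientI[where r = "\<lambda>x z. \<exists>y. r x y \<and> q y z"])
    show "x \<in> Z \<and> y \<in> Z''" if "\<exists>w. r x w \<and> q w y" for x y
      using that r(1) q(1) by blast
    show "\<exists>w. r (x + x') w \<and> q w (y + y')"
      if "\<exists>w. r x w \<and> q w y" "\<exists>w. r x' w \<and> q w y'" for x y x' y'
      using that r(2) q(2) by blast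
    show "\<exists>w. r (s c x) w \<and> q w (u c y)" if "\<exists>w. r x w \<and> q w y" for c x y
      using that r(3) q(3) by blast
    show "\<exists>y w. r x w \<and> q w y" if "x \<in> Z" for x
      using r(1,4) q(4) that by meson
    show "x \<in> B" if "\<exists>w. r x w \<and> q w y" "y \<in> B''" for x y
      using that r(5) q(5) by blast
  qed
qed

text \<open>The form in which vanishing is passed on: if \<open>Z'/B'\<close> is zero, so is every
  quotient of its subspaces.\<close>

lemma subquotient_vanish:
  assumes "subquotient s Z B t Z' B'" "Z' \<subseteq> B'" shows "Z \<subseteq> B"
  using assms unfolding subquotient_def by blast

text \<open>A basis \<open>b\<close> of \<open>B\<close> is extended to a basis \<open>E\<close> of
  \<open>Z\<close>; \<open>X = E - b\<close> then spans a complement of \<open>B\<close> in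
  \<open>Z\<close>, and \<open>P\<close> kills \<open>b\<close> and fixes \<open>X\<close>. It is
  extended to the whole type, so that ordinary linear maps can be composed with it.\<close>

lemma complement_projection:
  assumes "vector_space s" "module.subspace s Z" "module.subspace s B" "B \<subseteq> Z"
  obtains X P where "\<not> module.dependent s X" "module.span s X \<subseteq> Z" "Vector_Spaces.linear s s P"
    "range P \<subseteq> module.span s X" "\<And>v. v \<in> module.span s X \<Longrightarrow> P v = v"
    "\<And>v. v \<in> Z \<Longrightarrow> v - P v \<in> B" "\<And>v. v \<in> B \<Longrightarrow> P v = 0"
proof -
  interpret vector_space s by fact
  interpret VP: vector_space_pair s s ..
  obtain b where b: "b \<subseteq> B" "independent b" "B \<subseteq> span b" using maximal_independent_subset[of B] by blast
  obtain E where E: "b \<subseteq> E" "E \<subseteq> Z" "independent E" "Z \<subseteq> span E"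
    using maximal_independent_subset_extend[OF subset_trans[OF b(1) assms(4)] b(2)] by blast
  let ?f = "\<lambda>x. if x \<in> b then 0 else x"
  obtain P where P: "Vector_Spaces.linear s s P" "\<And>x. x \<in> E \<Longrightarrow> P x = ?f x" "range P = span (?f ` E)"
    using VP.linear_independent_extend_subspace[OF E(3), of ?f] by blast
  interpret P: Vector_Spaces.linear s s P by fact
  show ?thesis
  proof
    show "independent (E - b)" using E(3) by (rule independent_mono) auto
    show "span (E - b) \<subseteq> Z" using E(2) assms(2) by (intro span_minimal) auto
    show "Vector_Spaces.linear s s P" by fact
    have "?f ` E \<subseteq> span (E - b)" by (auto intro: span_base span_zero)
    thus "range P \<subseteq> span (E - b)" unfolding P(3) by (rule span_minimal) (rule subspace_span)
    show "P v = v" if "v \<in> span (E - b)" for v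
      using that
    proof (induction rule: span_induct)
      case base show ?case unfolding subspace_def by (auto simp: P.zero P.add P.scale)
    next
      case (step x) thus ?case using P(2)[of x] by auto
    qed
    have bB: "span b = B" using b assms(3) span_minimal by blast
    show "v - P v \<in> B" if "v \<in> Z" for v
    proof -
      have "v \<in> span E" using that E(4) by blast
      thus ?thesis
      proof (induction rule: span_induct)
        case base
        have "x - P x + (y - P y) \<in> B" if "x - P x \<in> B" "y - P y \<in> B" for x y
          using subspace_add[OF assms(3) that] .
        moreover have "s c (x - P x) \<in> B" if "x - P x \<in> B" for c x
          using subspace_scale[OF assms(3) that] .
        ultimately show ?case unfolding subspace_def
          using subspace_0[OF assms(3)]
          by (simp add: P.zero P.add P.scale scale_right_diff_distrib add_diff_add)
      next
        case (step x) thus ?case using P(2)[of x] b(1) subspace_0[OF assms(3)] by auto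
      qed
    qed
    show "P v = 0" if "v \<in> B" for v
      using that unfolding bB[symmetric]
    proof (induction rule: span_induct)
      case base show ?case unfolding subspace_def by (auto simp: P.zero P.add P.scale)
    next
      case (step x) thus ?case using P(2)[of x] E(1) by auto
    qed
  qed
qed

text \<open>The inequality of dimensions behind a subquotient. A partner is chosen for each vector
  of \<open>X\<close> and the choice is extended linearly to \<open>Y\<close>, so the relation
  contains the graph of a map on the complement of \<open>B\<close>. Following \<open>Y\<close> by
  the projection \<open>P\<close> modulo \<open>B'\<close> stays injective:
  \<open>P (Y v) = 0\<close> puts \<open>Y v\<close> into \<open>B'\<close>, hence \<open>v\<close>
  into \<open>B\<close>, which meets the complement in \<open>0\<close> only.\<close>

lemma subquotient_basis_inj:
  fixes s :: "'k::field \<Rightarrow> 'v::ab_group_add \<Rightarrow> 'v" and t :: "'k \<Rightarrow> 'w::ab_group_add \<Rightarrow> 'w"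
  assumes "vector_space s" "vector_space t" and sq: "subquotient s Z B t Z' B'"
    and X: "\<not> module.dependent s X" "module.span s X \<subseteq> Z"
      "\<And>v. v \<in> module.span s X \<Longrightarrow> v \<in> B \<Longrightarrow> v = 0" "0 \<in> Z"
    and X': "\<not> module.dependent t X'" "Vector_Spaces.linear t t P" "range P \<subseteq> module.span t X'"
      "\<And>v. v \<in> Z' \<Longrightarrow> v - P v \<in> B'"
  shows "\<exists>f. inj_on f X \<and> f ` X \<subseteq> X'"
proof -
  interpret S: vector_space s by fact
  interpret T: vector_space t by fact
  interpret VP: vector_space_pair s t ..
  interpret P: Vector_Spaces.linear t t P by fact
  obtain r where r: "\<And>x y. r x y \<Longrightarrow> x \<in> Z \<and> y \<in> Z'"
    "\<And>x y x' y'. r x y \<Longrightarrow> r x' y' \<Longrightarrow> r (x + x') (y + y')"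
    "\<And>c x y. r x y \<Longrightarrow> r (s c x) (t c y)"
    "\<And>x. x \<in> Z \<Longrightarrow> \<exists>y. r x y" "\<And>x y. r x y \<Longrightarrow> y \<in> B' \<Longrightarrow> x \<in> B"
    by (rule subquotientE[OF sq]) blast
  obtain y where y: "\<And>x. x \<in> Z \<Longrightarrow> r x (y x)" using r(4) by metis
  obtain Y where Y: "Vector_Spaces.linear s t Y" "\<And>x. x \<in> X \<Longrightarrow> Y x = y x"
    using VP.linear_independent_extend[OF X(1), of y] by blast
  interpret Y: Vector_Spaces.linear s t Y by fact
  have r0: "r 0 0" using r(3)[OF y[OF X(4)], of 0] by simp
  have rY: "r v (Y v)" if "v \<in> S.span X" for v
    using that
  proof (induction rule: S.span_induct)
    case base
    show ?case unfolding S.subspace_def using r0 r(2,3) by (simp add: Y.zero Y.add Y.scale)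
  next
    case (step x)
    thus ?case using y[of x] X(2) S.span_base[of x X] Y(2)[of x] by auto
  qed
  have lin: "Vector_Spaces.linear s t (P \<circ> Y)"
    using Y(1) X'(2) by (rule Vector_Spaces.linear_compose)
  interpret L: Vector_Spaces.linear s t "P \<circ> Y" by (rule lin)
  have inj: "inj_on (P \<circ> Y) (S.span X)"
    unfolding L.inj_on_iff_eq_0[OF S.subspace_span]
  proof (intro ballI impI)
    fix v assume v: "v \<in> S.span X" "(P \<circ> Y) v = 0"
    have "Y v \<in> B'" using X'(4)[of "Y v"] r(1)[OF rY[OF v(1)]] v(2) by simp
    from r(5)[OF rY[OF v(1)] this] X(3) v(1) show "v = 0" by blast
  qed
  have ind: "T.independent ((P \<circ> Y) ` X)"
    using X(1) inj by (rule L.independent_injective_image)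
  \<comment> \<open>An independent set inside the span of \<open>X'\<close> is completed to a basis
    \<open>E\<close> of that span; two bases of one space are in bijection, also in infinite
    dimension.\<close>
  have "(P \<circ> Y) ` X \<subseteq> T.span X'" using X'(3) by auto
  then obtain E where E: "(P \<circ> Y) ` X \<subseteq> E" "E \<subseteq> T.span X'" "T.independent E" "T.span X' \<subseteq> T.span E"
    using T.maximal_independent_subset_extend[OF _ ind, of "T.span X'"] by auto
  have "T.span E = T.span X'"
    using E(2,4) T.span_minimal[OF E(2) T.subspace_span] by auto
  then obtain g where g: "bij_betw g E X'" using T.bij_if_span_eq_span_bases[OF E(3) X'(1)] by blast
  have "inj_on (P \<circ> Y) X" using inj S.span_superset by (rule inj_on_subset)
  moreover have "inj_on g ((P \<circ> Y) ` X)" using g E(1) by (auto simp: bij_betw_def intro: inj_on_subset)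
  ultimately have "inj_on (g \<circ> (P \<circ> Y)) X" by (rule comp_inj_on)
  moreover have "(g \<circ> (P \<circ> Y)) ` X \<subseteq> X'" using g E(1) by (auto simp: bij_betw_def)
  ultimately show ?thesis by blast
qed

section \<open>Cosets and isomorphisms of quotient spaces\<close>

lemma coset_arith:
  assumes "vector_space s" "module.subspace s B"
  shows "x \<in> (+) z ` B \<longleftrightarrow> x - z \<in> B"
    and "{x + y | x y. x \<in> (+) z ` B \<and> y \<in> (+) w ` B} = (+) (z + w) ` B"
    and "{s c x + b | x b. x \<in> (+) z ` B \<and> b \<in> B} = (+) (s c z) ` B"
    and "(+) z ` B = (+) w ` B \<longleftrightarrow> z - w \<in> B"
proof -
  interpret vector_space s by fact
  note S = subspace_0[OF assms(2)] subspace_add[OF assms(2)] subspace_diff[OF assms(2)] subspace_scale[OF assms(2)]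
  have mem: "x \<in> (+) z ` B \<longleftrightarrow> x - z \<in> B" for x z
  proof
    assume "x - z \<in> B"
    hence "z + (x - z) \<in> (+) z ` B" by (rule imageI)
    thus "x \<in> (+) z ` B" by simp
  qed auto
  show "x \<in> (+) z ` B \<longleftrightarrow> x - z \<in> B" by (rule mem)
  show "{x + y | x y. x \<in> (+) z ` B \<and> y \<in> (+) w ` B} = (+) (z + w) ` B"
  proof (intro equalityI subsetI)
    fix v assume "v \<in> (+) (z + w) ` B"
    hence "v - w - z \<in> B" unfolding mem by (simp add: diff_diff_eq add.commute)
    hence "v = (v - w) + w" "v - w \<in> (+) z ` B" "w \<in> (+) w ` B"
      unfolding mem using S(1) by simp_all
    thus "v \<in> {x + y | x y. x \<in> (+) z ` B \<and> y \<in> (+) w ` B}" by blast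
  next
    fix v assume "v \<in> {x + y | x y. x \<in> (+) z ` B \<and> y \<in> (+) w ` B}"
    then obtain x y where v: "v = x + y" "x - z \<in> B" "y - w \<in> B" unfolding mem by blast
    from S(2)[OF v(2,3)] show "v \<in> (+) (z + w) ` B" unfolding mem v(1) by (simp add: add_diff_add)
  qed
  show "{s c x + b | x b. x \<in> (+) z ` B \<and> b \<in> B} = (+) (s c z) ` B"
  proof (intro equalityI subsetI)
    fix v assume "v \<in> (+) (s c z) ` B"
    hence "v = s c z + (v - s c z)" "v - s c z \<in> B" "z \<in> (+) z ` B" unfolding mem using S(1) by simp_all
    thus "v \<in> {s c x + b | x b. x \<in> (+) z ` B \<and> b \<in> B}" by blast
  next
    fix v assume "v \<in> {s c x + b | x b. x \<in> (+) z ` B \<and> b \<in> B}"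
    then obtain x b where v: "v = s c x + b" "x - z \<in> B" "b \<in> B" unfolding mem by blast
    have "v - s c z = s c (x - z) + b" unfolding v(1) by (simp add: scale_right_diff_distrib)
    with S(2)[OF S(4)[OF v(2), of c] v(3)] show "v \<in> (+) (s c z) ` B" unfolding mem by simp
  qed
  show "(+) z ` B = (+) w ` B \<longleftrightarrow> z - w \<in> B"
  proof
    assume "(+) z ` B = (+) w ` B"
    moreover have "z \<in> (+) z ` B" unfolding mem using S(1) by simp
    ultimately have "z \<in> (+) w ` B" by simp
    thus "z - w \<in> B" by (simp only: mem)
  next
    assume a: "z - w \<in> B"
    have "x - z \<in> B \<longleftrightarrow> x - w \<in> B" for x
      using S(2)[OF _ a, of "x - z"] S(3)[OF _ a, of "x - w"] by auto
    thus "(+) z ` B = (+) w ` B" unfolding set_eq_iff mem by blast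
  qed
qed

lemma quotient_space_iso:
  fixes s :: "'k::field \<Rightarrow> 'v::ab_group_add \<Rightarrow> 'v" and t :: "'k \<Rightarrow> 'w::ab_group_add \<Rightarrow> 'w"
  assumes "vector_space s" "vector_space t"
    and Z: "module.subspace s Z" "module.subspace s B" "B \<subseteq> Z"
    and Z': "module.subspace t Z'" "module.subspace t B'" "B' \<subseteq> Z'"
    and T: "Vector_Spaces.linear s t T" "\<And>z. z \<in> Z \<Longrightarrow> T z \<in> Z'"
      "\<And>z. z \<in> Z \<Longrightarrow> T z \<in> B' \<longleftrightarrow> z \<in> B"
      "\<And>z'. z' \<in> Z' \<Longrightarrow> \<exists>z\<in>Z. z' - T z \<in> B'"
  shows "vs_isomorphic (quotient_space s Z B) (quotient_space t Z' B')"
proof -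
  interpret S: vector_space s by fact
  interpret T: vector_space t by fact
  interpret L: Vector_Spaces.linear s t T by fact
  let ?Q = "quotient_space s Z B" and ?Q' = "quotient_space t Z' B'"
  note S0 = S.subspace_0[OF Z(2)]
  note SZ = S.subspace_add[OF Z(1)] S.subspace_diff[OF Z(1)] S.subspace_scale[OF Z(1)]
  note cs = coset_arith[OF assms(1) Z(2)] and ct = coset_arith[OF assms(2) Z'(2)]
  \<comment> \<open>The representative picked by \<open>SOME\<close> does not matter: another one
    differs by an element of \<open>B\<close>, which \<open>T\<close> sends into
    \<open>B'\<close>.\<close>
  define \<phi> where "\<phi> K = (+) (T (SOME z. z \<in> K)) ` B'" for K
  have \<phi>: "\<phi> ((+) z ` B) = (+) (T z) ` B'" if z: "z \<in> Z" for z
  proof -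
    have "z \<in> (+) z ` B" unfolding cs(1) using S0 by simp
    hence "(SOME x. x \<in> (+) z ` B) \<in> (+) z ` B" by (rule someI)
    hence *: "(SOME x. x \<in> (+) z ` B) - z \<in> B" by (simp only: cs(1))
    hence "T ((SOME x. x \<in> (+) z ` B) - z) \<in> B'" using T(3) Z(3) by blast
    thus ?thesis unfolding \<phi>_def ct(4) by (simp add: L.diff)
  qed
  have car: "carrier ?Q = {(+) z ` B | z. z \<in> Z}" "carrier ?Q' = {(+) z ` B' | z. z \<in> Z'}"
    by (simp_all add: quotient_space_def)
  have "inj_on \<phi> (carrier ?Q)"
  proof (rule inj_onI)
    fix K K' assume "K \<in> carrier ?Q" "K' \<in> carrier ?Q" and e: "\<phi> K = \<phi> K'"
    then obtain z z' where z: "z \<in> Z" "K = (+) z ` B" "z' \<in> Z" "K' = (+) z' ` B" unfolding car by blast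
    have "T z - T z' \<in> B'" using e z \<phi> ct(4) by simp
    hence "z - z' \<in> B" using T(3)[OF SZ(2)[OF z(1,3)]] by (simp add: L.diff)
    thus "K = K'" using z cs(4) by simp
  qed
  moreover have "\<phi> ` carrier ?Q = carrier ?Q'"
  proof (intro equalityI subsetI)
    fix K assume "K \<in> \<phi> ` carrier ?Q" 
    then obtain z where "z \<in> Z" "K = \<phi> ((+) z ` B)" unfolding car by blast
    thus "K \<in> carrier ?Q'" unfolding car using \<phi>[of z] T(2)[of z] by auto
  next
    fix K assume "K \<in> carrier ?Q'"
    then obtain z' where z': "z' \<in> Z'" "K = (+) z' ` B'" unfolding car by blast
    obtain z where z: "z \<in> Z" "z' - T z \<in> B'" using T(4)[OF z'(1)] by blast
    have "K = \<phi> ((+) z ` B)" using z ct(4) \<phi> z' by simp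
    thus "K \<in> \<phi> ` carrier ?Q" unfolding car using z(1) by blast
  qed
  moreover have "\<phi> (K \<oplus>\<^bsub>?Q\<^esub> K') = \<phi> K \<oplus>\<^bsub>?Q'\<^esub> \<phi> K'" if K: "K \<in> carrier ?Q" "K' \<in> carrier ?Q" for K K'
  proof -
    obtain z z' where z: "z \<in> Z" "K = (+) z ` B" "z' \<in> Z" "K' = (+) z' ` B" using K unfolding car by blast
    show ?thesis unfolding z(2,4) \<phi>[OF z(1)] \<phi>[OF z(3)]
      by (simp add: quotient_space_def cs(2) ct(2) \<phi>[OF SZ(1)[OF z(1,3)]] L.add)
  qed
  moreover have "\<phi> (c \<odot>\<^bsub>?Q\<^esub> K) = c \<odot>\<^bsub>?Q'\<^esub> \<phi> K" if K: "K \<in> carrier ?Q" for c K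
  proof -
    obtain z where z: "z \<in> Z" "K = (+) z ` B" using K unfolding car by blast
    show ?thesis unfolding z(2) \<phi>[OF z(1)]
      by (simp add: quotient_space_def cs(3) ct(3) \<phi>[OF SZ(3)[OF z(1)]] L.scale)
  qed
  ultimately show ?thesis unfolding vs_isomorphic_def bij_betw_def by (intro exI[of _ \<phi>]) simp
qed

text \<open>The Schroeder-Bernstein theorem for vector spaces, applied to bases of complements.\<close>

theorem subquotient_antisym:
  fixes s :: "'k::field \<Rightarrow> 'v::ab_group_add \<Rightarrow> 'v" and t :: "'k \<Rightarrow> 'w::ab_group_add \<Rightarrow> 'w"
  assumes vs: "vector_space s" "vector_space t"
    and Z: "module.subspace s Z" "module.subspace s B" "B \<subseteq> Z"
    and Z': "module.subspace t Z'" "module.subspace t B'" "B' \<subseteq> Z'"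
    and sq: "subquotient s Z B t Z' B'" "subquotient t Z' B' s Z B"
  shows "vs_isomorphic (quotient_space s Z B) (quotient_space t Z' B')"
proof -
  interpret S: vector_space s by fact
  interpret T: vector_space t by fact
  interpret VP: vector_space_pair s t ..
  obtain X P where X: "S.independent X" "S.span X \<subseteq> Z" and P: "Vector_Spaces.linear s s P"
    "range P \<subseteq> S.span X" "\<And>v. v \<in> S.span X \<Longrightarrow> P v = v"
    "\<And>v. v \<in> Z \<Longrightarrow> v - P v \<in> B" "\<And>v. v \<in> B \<Longrightarrow> P v = 0"
    using complement_projection[OF vs(1) Z] by blast
  obtain X' P' where X': "T.independent X'" "T.span X' \<subseteq> Z'" and P': "Vector_Spaces.linear t t P'"
    "range P' \<subseteq> T.span X'" "\<And>v. v \<in> T.span X' \<Longrightarrow> P' v = v"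
    "\<And>v. v \<in> Z' \<Longrightarrow> v - P' v \<in> B'" "\<And>v. v \<in> B' \<Longrightarrow> P' v = 0"
    using complement_projection[OF vs(2) Z'] by blast
  have 1: "v = 0" if "v \<in> S.span X" "v \<in> B" for v using P(3)[OF that(1)] P(5)[OF that(2)] by simp
  have 2: "v = 0" if "v \<in> T.span X'" "v \<in> B'" for v using P'(3)[OF that(1)] P'(5)[OF that(2)] by simp
  have "\<exists>f. inj_on f X \<and> f ` X \<subseteq> X'"
    by (rule subquotient_basis_inj[OF vs sq(1) X 1 S.subspace_0[OF Z(1)] X'(1) P'(1,2,4)])
  then obtain i where i: "inj_on i X" "i ` X \<subseteq> X'" by blast
  have "\<exists>f. inj_on f X' \<and> f ` X' \<subseteq> X"
    by (rule subquotient_basis_inj[OF vs(2,1) sq(2) X' 2 T.subspace_0[OF Z'(1)] X(1) P(1,2,4)])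
  then obtain j where j: "inj_on j X'" "j ` X' \<subseteq> X" by blast
  obtain h where h: "bij_betw h X X'" using Schroeder_Bernstein[OF i j] by (elim exE) (rule that)
  obtain g where g: "Vector_Spaces.linear s t g" "\<And>x. x \<in> X \<Longrightarrow> g x = h x"
    using VP.linear_independent_extend[OF X(1), of h] by blast
  interpret g: Vector_Spaces.linear s t g by fact
  interpret P: Vector_Spaces.linear s s P by fact
  interpret P': Vector_Spaces.linear t t P' by fact
  have gX: "g ` X = X'" using h g(2) by (auto simp: bij_betw_def)
  hence gs: "g ` S.span X = T.span X'" using g.span_image[of X] by metis
  have "inj_on g X" using h g(2) by (auto simp: bij_betw_def inj_on_def)
  hence gi: "inj_on g (S.span X)"
    using g.inj_on_span_iff_independent_image[of X] X'(1) gX X(1) by blast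
  \<comment> \<open>The isomorphism is induced by projecting onto the complement spanned by
    \<open>X\<close> and then moving \<open>X\<close> to \<open>X'\<close> along the bijection from
    Schroeder-Bernstein.\<close>
  show ?thesis
  proof (rule quotient_space_iso[OF vs Z Z', of "g \<circ> P"])
    show "Vector_Spaces.linear s t (g \<circ> P)" using P(1) g(1) by (rule Vector_Spaces.linear_compose)
    have gP: "g (P z) \<in> T.span X'" for z using P(2) gs by blast
    show "(g \<circ> P) z \<in> Z'" if "z \<in> Z" for z using gP X'(2) by auto
    show "(g \<circ> P) z \<in> B' \<longleftrightarrow> z \<in> B" if "z \<in> Z" for z
    proof
      assume "(g \<circ> P) z \<in> B'"
      hence "g (P z) = g 0" using P'(3)[OF gP, of z] P'(5)[of "g (P z)"] by (simp add: g.zero)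
      hence "P z = 0" using P(2) S.span_zero by (intro inj_onD[OF gi]) auto
      thus "z \<in> B" using P(4)[OF that] by simp
    next
      assume "z \<in> B" thus "(g \<circ> P) z \<in> B'" using P(5) T.subspace_0[OF Z'(2)] by (simp add: g.zero)
    qed
    show "\<exists>z\<in>Z. z' - (g \<circ> P) z \<in> B'" if z': "z' \<in> Z'" for z'
    proof -
      obtain z where z: "z \<in> S.span X" "P' z' = g z" using P'(2) gs by blast
      thus ?thesis using P'(4)[OF z'] P(3)[OF z(1)] X(2) by (intro bexI[of _ z]) auto
    qed
  qed
qed

section \<open>Elements of trace one\<close>

context coord_group
begin

lemma coord_add: "a \<in> coord G \<Longrightarrow> b \<in> coord G \<Longrightarrow> (\<lambda>x. a x + b x) \<in> coord G"
  using alg by (auto simp: fun_algebra_def)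

lemma coord_sum: "(\<And>i. i \<in> I \<Longrightarrow> f i \<in> coord G) \<Longrightarrow> (\<lambda>x. \<Sum>i\<in>I. f i x) \<in> coord G"
proof (induction I rule: infinite_finite_induct)
  case (insert i I)
  have "(\<lambda>x. f i x + (\<Sum>i\<in>I. f i x)) \<in> coord G"
    using insert alg by (auto simp: fun_algebra_def)
  thus ?case using insert by simp
qed (use coord_scale[OF coord_one, of 0] in simp_all)

lemma coord_prod:
  "(\<And>i. i \<in> I \<Longrightarrow> f i \<in> coord G) \<Longrightarrow> restr (carrier G) (\<lambda>x. \<Prod>i\<in>I. f i x) \<in> coord G"
proof (induction I rule: infinite_finite_induct)
  case (insert i I)
  have "(\<lambda>x. f i x * restr (carrier G) (\<lambda>x. \<Prod>i\<in>I. f i x) x) \<in> coord G"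
    using insert by (intro coord_mult) auto
  also have "(\<lambda>x. f i x * restr (carrier G) (\<lambda>x. \<Prod>i\<in>I. f i x) x) =
      restr (carrier G) (\<lambda>x. \<Prod>i\<in>insert i I. f i x)"
    using insert by (auto simp: restr_def)
  finally show ?case .
qed (use coord_one in simp_all)

text \<open>Freezing the second argument of the comultiplication at \<open>h\<close> writes the
  translate as a linear combination of coordinate functions.\<close>

lemma coord_translate:
  assumes "a \<in> coord G" "h \<in> carrier G"
  shows "restr (carrier G) (\<lambda>x. a (x \<otimes> h)) \<in> coord G"
proof -
  obtain n u v where c: "\<forall>i<n::nat. u i \<in> coord G \<and> v i \<in> coord G"
    "\<forall>x\<in>carrier G. \<forall>y\<in>carrier G. a (x \<otimes> y) = (\<Sum>i<n. u i x * v i y)"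
    using coord_comult[OF assms(1)] by (elim exE conjE)
  have "(\<lambda>x. \<Sum>i<n. v i h * u i x) \<in> coord G"
    using c(1) by (intro coord_sum coord_scale) auto
  also have "(\<lambda>x. \<Sum>i<n. v i h * u i x) = restr (carrier G) (\<lambda>x. a (x \<otimes> h))"
    using c assms(2) coord_outside by (auto simp: restr_def fun_eq_iff mult.commute intro!: sum.neutral)
  finally show ?thesis .
qed

text \<open>For each \<open>h\<close> other than the identity, a function separating the two points
  can be normalised affinely to take the values \<open>1\<close> and \<open>0\<close> there; the
  product over all such \<open>h\<close> is a delta function on \<open>H\<close>.\<close>

lemma coord_delta:
  assumes sep: "\<And>x y. x \<in> carrier G \<Longrightarrow> y \<in> carrier G \<Longrightarrow> x \<noteq> y \<Longrightarrow> \<exists>f\<in>coord G. f x \<noteq> f y"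
    and H: "finite H" "H \<subseteq> carrier G"
  shows "\<exists>e\<in>coord G. e \<one> = 1 \<and> (\<forall>h\<in>H - {\<one>}. e h = 0)"
proof -
  have "\<exists>f\<in>coord G. f \<one> = 1 \<and> f h = 0" if h: "h \<in> H - {\<one>}" for h
  proof -
    obtain f where f: "f \<in> coord G" "f \<one> \<noteq> f h" using sep[of \<one> h] h H(2) by auto
    let ?g = "\<lambda>x. inverse (f \<one> - f h) * (f x + - f h * restr (carrier G) (\<lambda>_. 1) x)"
    have "(\<lambda>x. f x + - f h * restr (carrier G) (\<lambda>_. 1) x) \<in> coord G"
      by (rule coord_add[OF f(1) coord_scale[OF coord_one]])
    hence "?g \<in> coord G" by (rule coord_scale)
    moreover have "?g \<one> = 1" "?g h = 0" using f(2) h H(2) by (auto simp: restr_def)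
    ultimately show ?thesis by (intro bexI[of _ ?g]) auto
  qed
  then obtain f where f: "\<And>h. h \<in> H - {\<one>} \<Longrightarrow> f h \<in> coord G \<and> f h \<one> = 1 \<and> f h h = 0" by metis
  show ?thesis
  proof (intro bexI conjI ballI)
    show "restr (carrier G) (\<lambda>x. \<Prod>h\<in>H - {\<one>}. f h x) \<in> coord G" using f by (intro coord_prod) auto
  qed (use f H in \<open>auto simp: restr_def intro!: prod.neutral prod_zero\<close>)
qed

lemma subgroup_sum_translate:
  assumes "subgroup H G" "h \<in> H"
  shows "(\<Sum>g\<in>H. f (h \<otimes> g)) = (\<Sum>g\<in>H. f g)" "(\<Prod>g\<in>H. (k (h \<otimes> g) :: 'k)) = (\<Prod>g\<in>H. k g)"
proof -
  interpret H: subgroup H G by fact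
  have *: "h \<otimes> g \<in> H" "inv h \<otimes> g \<in> H" "inv h \<otimes> (h \<otimes> g) = g" "h \<otimes> (inv h \<otimes> g) = g" if "g \<in> H" for g
    using that assms(2) by (auto simp: m_assoc[symmetric])
  show "(\<Sum>g\<in>H. f (h \<otimes> g)) = (\<Sum>g\<in>H. f g)"
    by (rule sum.reindex_bij_witness[of _ "\<lambda>g. inv h \<otimes> g" "\<lambda>g. h \<otimes> g"]) (auto simp: *)
  show "(\<Prod>g\<in>H. k (h \<otimes> g)) = (\<Prod>g\<in>H. k g)"
    by (rule prod.reindex_bij_witness[of _ "\<lambda>g. inv h \<otimes> g" "\<lambda>g. h \<otimes> g"]) (auto simp: *)
qed

text \<open>The image of the trace is an ideal of the ring of invariants that generates the unit ideal of
  the coordinate ring. Expanding the norm of an expression of \<open>1\<close> and collecting the terms with the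
  same product of traces gives coefficients that are invariant, so \<open>1\<close> itself is a trace.\<close>

lemma trace_one:
  fixes n :: nat
  assumes H: "subgroup H G" "finite H"
    and b: "\<And>i. i < n \<Longrightarrow> b i \<in> coord G" and v: "\<And>i. i < n \<Longrightarrow> v i \<in> coord G"
    and one: "\<And>x. x \<in> carrier G \<Longrightarrow> (\<Sum>i<n. b i x * (\<Sum>h\<in>H. v i (x \<otimes> h))) = 1"
  shows "\<exists>c\<in>coord G. \<forall>x\<in>carrier G. (\<Sum>h\<in>H. c (x \<otimes> h)) = 1"
proof -
  interpret H: subgroup H G by fact
  have HG: "h \<in> carrier G" if "h \<in> H" for h using that by simp
  define a where "a i x = (\<Sum>h\<in>H. v i (x \<otimes> h))" for i x
  have a_inv: "a i (x \<otimes> g) = a i x" if "x \<in> carrier G" "g \<in> H" for i x g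
    using subgroup_sum_translate(1)[OF H(1) that(2), of "\<lambda>h. v i (x \<otimes> h)"] that
    by (simp add: a_def m_assoc)
  have a_coord: "restr (carrier G) (a i) \<in> coord G" if "i < n" for i
  proof -
    have "(\<lambda>x. \<Sum>h\<in>H. restr (carrier G) (\<lambda>x. v i (x \<otimes> h)) x) \<in> coord G"
      using v[OF that] by (intro coord_sum coord_translate) auto
    also have "(\<lambda>x. \<Sum>h\<in>H. restr (carrier G) (\<lambda>x. v i (x \<otimes> h)) x) = restr (carrier G) (a i)"
      by (auto simp: restr_def a_def)
    finally show ?thesis .
  qed
  \<comment> \<open>The choice functions index the terms of the expanded norm: the factor at
    \<open>g\<close> contributes its summand number \<open>\<phi> g\<close>.\<close>
  define \<Phi> where "\<Phi> = PiE H (\<lambda>_. {..<n})"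
  have fin: "finite \<Phi>" unfolding \<Phi>_def using H(2) by (intro finite_PiE) auto
  have \<Phi>: "\<phi> g < n" if "\<phi> \<in> \<Phi>" "g \<in> H" for \<phi> g using that by (auto simp: \<Phi>_def PiE_def)
  define A where "A \<phi> x = (\<Prod>g\<in>H. b (\<phi> g) (x \<otimes> g))" for \<phi> x
  \<comment> \<open>Terms are collected by equality of the trace products as functions. This is
    coarse enough for the grouping to be stable under permuting the factors, and it lets the common
    trace product be pulled out of each group.\<close>
  define key where "key \<phi> = (\<lambda>x. \<Prod>g\<in>H. a (\<phi> g) x)" for \<phi>
  define C where "C \<kappa> = {\<phi> \<in> \<Phi>. key \<phi> = \<kappa>}" for \<kappa>
  define R where "R \<kappa> x = (\<Sum>\<phi>\<in>C \<kappa>. A \<phi> x)" for \<kappa> x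
  have expand: "(\<Sum>\<kappa>\<in>key ` \<Phi>. R \<kappa> x * \<kappa> x) = 1" if x: "x \<in> carrier G" for x
  proof -
    have "1 = (\<Prod>g\<in>H. \<Sum>i<n. b i (x \<otimes> g) * a i (x \<otimes> g))"
      using one[of "x \<otimes> g" for g] x by (simp add: a_def)
    also have "\<dots> = (\<Prod>g\<in>H. \<Sum>i<n. b i (x \<otimes> g) * a i x)"
      using a_inv[OF x] by (intro prod.cong sum.cong) auto
    also have "\<dots> = (\<Sum>\<phi>\<in>\<Phi>. \<Prod>g\<in>H. b (\<phi> g) (x \<otimes> g) * a (\<phi> g) x)"
      unfolding \<Phi>_def using H(2) by (subst prod_sum_PiE) auto
    also have "\<dots> = (\<Sum>\<phi>\<in>\<Phi>. A \<phi> x * key \<phi> x)" by (simp add: prod.distrib A_def key_def)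
    also have "\<dots> = (\<Sum>\<kappa>\<in>key ` \<Phi>. \<Sum>\<phi>\<in>C \<kappa>. A \<phi> x * key \<phi> x)"
      unfolding C_def by (rule sum.image_gen[OF fin])
    also have "\<dots> = (\<Sum>\<kappa>\<in>key ` \<Phi>. R \<kappa> x * \<kappa> x)"
      unfolding R_def sum_distrib_right by (intro sum.cong refl) (auto simp: C_def)
    finally show ?thesis by simp
  qed
  \<comment> \<open>Right translation by \<open>h\<close> permutes the choice functions. A trace
    product is a product over all of \<open>H\<close>, so it does not notice the permutation and
    each group \<open>C \<kappa>\<close> is mapped to itself.\<close>
  have R_inv: "R \<kappa> (x \<otimes> h) = R \<kappa> x" if x: "x \<in> carrier G" and h: "h \<in> H" for \<kappa> x h
  proof -
    define T where "T k \<phi> = restrict (\<lambda>g. \<phi> (k \<otimes> g)) H" for k and \<phi> :: "'g \<Rightarrow> nat"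
    have T: "T k \<phi> \<in> C \<kappa>" if "\<phi> \<in> C \<kappa>" "k \<in> H" for \<phi> k
    proof -
      have "key (T k \<phi>) = key \<phi>"
        using subgroup_sum_translate(2)[OF H(1) that(2), of "\<lambda>g. a (\<phi> g) x" for x]
        by (auto simp: key_def T_def)
      moreover have "T k \<phi> \<in> \<Phi>" using that by (auto simp: C_def \<Phi>_def T_def)
      ultimately show ?thesis using that by (simp add: C_def)
    qed
    have TT: "T k (T k' \<phi>) = \<phi>" if "\<phi> \<in> C \<kappa>" "k \<in> H" "k' \<in> H" "k' \<otimes> k = \<one>" for \<phi> k k'
    proof
      fix g
      have "\<phi> g = undefined" if "g \<notin> H" using \<open>\<phi> \<in> C \<kappa>\<close> that by (auto simp: C_def \<Phi>_def PiE_def extensional_def)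
      moreover have "k' \<otimes> (k \<otimes> g) = g" if "g \<in> H"
        using that \<open>k \<in> H\<close> \<open>k' \<in> H\<close> \<open>k' \<otimes> k = \<one>\<close> by (simp add: m_assoc[symmetric])
      ultimately show "T k (T k' \<phi>) g = \<phi> g" using that by (auto simp: T_def)
    qed
    have AT: "A (T (inv h) \<phi>) x = A \<phi> (x \<otimes> h)" if "\<phi> \<in> C \<kappa>" for \<phi>
    proof -
      have "A (T (inv h) \<phi>) x = (\<Prod>g\<in>H. b (\<phi> (inv h \<otimes> g)) (x \<otimes> g))"
        by (auto simp: A_def T_def intro: prod.cong)
      also have "\<dots> = (\<Prod>g\<in>H. b (\<phi> (inv h \<otimes> (h \<otimes> g))) (x \<otimes> (h \<otimes> g)))"
        by (rule subgroup_sum_translate(2)[OF H(1) h, symmetric])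
      also have "\<dots> = A \<phi> (x \<otimes> h)"
        unfolding A_def using x h by (intro prod.cong) (auto simp: m_assoc[symmetric])
      finally show ?thesis .
    qed
    show ?thesis unfolding R_def
      by (rule sum.reindex_bij_witness[of _ "T h" "T (inv h)"])
        (use h T TT AT in \<open>auto\<close>)
  qed
  have "\<exists>\<phi>. \<phi> \<in> \<Phi> \<and> key \<phi> = \<kappa>" if "\<kappa> \<in> key ` \<Phi>" for \<kappa> using that by auto
  then obtain f where f: "\<And>\<kappa>. \<kappa> \<in> key ` \<Phi> \<Longrightarrow> f \<kappa> \<in> \<Phi>" "\<And>\<kappa>. \<kappa> \<in> key ` \<Phi> \<Longrightarrow> key (f \<kappa>) = \<kappa>" by metis
  \<comment> \<open>From a representative of each trace product the factor at the identity is split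
    off. The remaining factors are traces, hence invariant, and may be moved with \<open>R\<close>
    inside the trace of the one factor left over; this exhibits the whole sum as the trace of
    \<open>c\<close>.\<close>
  define m where "m \<kappa> x = (\<Prod>g\<in>H - {\<one>}. a (f \<kappa> g) x)" for \<kappa> x
  have m_inv: "m \<kappa> (x \<otimes> h) = m \<kappa> x" if "x \<in> carrier G" "h \<in> H" for \<kappa> x h
    unfolding m_def using a_inv[OF that] by simp
  have m: "\<kappa> x = m \<kappa> x * a (f \<kappa> \<one>) x" if "\<kappa> \<in> key ` \<Phi>" for \<kappa> x
  proof -
    have "\<kappa> x = (\<Prod>g\<in>H. a (f \<kappa> g) x)" using fun_cong[OF f(2)[OF that], of x] by (simp add: key_def)
    also have "\<dots> = a (f \<kappa> \<one>) x * m \<kappa> x" unfolding m_def by (rule prod.remove) (use H(2) in auto)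
    finally show ?thesis by simp
  qed
  have mc: "restr (carrier G) (m \<kappa>) \<in> coord G" if "\<kappa> \<in> key ` \<Phi>" for \<kappa>
  proof -
    have "restr (carrier G) (\<lambda>x. \<Prod>g\<in>H - {\<one>}. restr (carrier G) (a (f \<kappa> g)) x) \<in> coord G"
      using \<Phi>[OF f(1)[OF that]] by (intro coord_prod a_coord) auto
    also have "restr (carrier G) (\<lambda>x. \<Prod>g\<in>H - {\<one>}. restr (carrier G) (a (f \<kappa> g)) x) = restr (carrier G) (m \<kappa>)"
      by (auto simp: restr_def m_def)
    finally show ?thesis .
  qed
  have Rc: "restr (carrier G) (R \<kappa>) \<in> coord G" for \<kappa>
  proof -
    have "(\<lambda>x. \<Sum>\<phi>\<in>C \<kappa>. restr (carrier G) (\<lambda>x. \<Prod>g\<in>H. restr (carrier G) (\<lambda>x. b (\<phi> g) (x \<otimes> g)) x) x) \<in> coord G"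
      using \<Phi> by (intro coord_sum coord_prod coord_translate b) (auto simp: C_def)
    also have "(\<lambda>x. \<Sum>\<phi>\<in>C \<kappa>. restr (carrier G) (\<lambda>x. \<Prod>g\<in>H. restr (carrier G) (\<lambda>x. b (\<phi> g) (x \<otimes> g)) x) x) =
        restr (carrier G) (R \<kappa>)"
      by (auto simp: restr_def R_def A_def)
    finally show ?thesis .
  qed
  define c where "c x = (\<Sum>\<kappa>\<in>key ` \<Phi>.
    restr (carrier G) (R \<kappa>) x * restr (carrier G) (m \<kappa>) x * v (f \<kappa> \<one>) x)" for x
  show ?thesis
  proof (intro bexI ballI)
    show "c \<in> coord G" unfolding c_def
      using \<Phi>[OF f(1)] by (intro coord_sum coord_mult Rc mc v) auto
    fix x assume x: "x \<in> carrier G"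
    have "(\<Sum>h\<in>H. c (x \<otimes> h)) = (\<Sum>h\<in>H. \<Sum>\<kappa>\<in>key ` \<Phi>. R \<kappa> x * m \<kappa> x * v (f \<kappa> \<one>) (x \<otimes> h))"
      unfolding c_def using x R_inv m_inv by (intro sum.cong refl) (auto simp: restr_def)
    also have "\<dots> = (\<Sum>\<kappa>\<in>key ` \<Phi>. \<Sum>h\<in>H. R \<kappa> x * m \<kappa> x * v (f \<kappa> \<one>) (x \<otimes> h))" by (rule sum.swap)
    also have "\<dots> = (\<Sum>\<kappa>\<in>key ` \<Phi>. R \<kappa> x * \<kappa> x)"
      by (intro sum.cong refl) (simp add: m a_def sum_distrib_left mult.assoc)
    finally show "(\<Sum>h\<in>H. c (x \<otimes> h)) = 1" using expand[OF x] by simp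
  qed
qed

text \<open>A delta function \<open>e\<close> at the identity has trace \<open>1\<close> on
  \<open>H\<close>. Comultiplication applied to it shows that traces generate the unit ideal, so
  some \<open>c0\<close> has trace \<open>1\<close> everywhere; \<open>c0\<close> is then corrected
  to agree with \<open>e\<close> on \<open>H\<close>.\<close>

lemma exists_trace_one:
  assumes sep: "\<And>x y. x \<in> carrier G \<Longrightarrow> y \<in> carrier G \<Longrightarrow> x \<noteq> y \<Longrightarrow> \<exists>f\<in>coord G. f x \<noteq> f y"
    and H: "subgroup H G" "finite H"
  shows "\<exists>c\<in>coord G. (\<forall>x\<in>carrier G. (\<Sum>h\<in>H. c (x \<otimes> h)) = 1) \<and> c \<one> = 1 \<and> (\<forall>h\<in>H - {\<one>}. c h = 0)"
proof -
  interpret H: subgroup H G by fact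
  have HG: "H \<subseteq> carrier G" by (rule H.subset)
  obtain e where e: "e \<in> coord G" "e \<one> = 1" "\<And>h. h \<in> H - {\<one>} \<Longrightarrow> e h = 0"
    using coord_delta[OF sep H(2) HG] by blast
  have esum: "(\<Sum>h\<in>H. e (g \<otimes> h)) = 1" if "g \<in> H" for g
  proof -
    have "(\<Sum>h\<in>H. e h) = e \<one> + (\<Sum>h\<in>H - {\<one>}. e h)" using H(2) by (intro sum.remove) auto
    thus ?thesis using e(2,3) subgroup_sum_translate(1)[OF H(1) that, of e] by simp
  qed
  obtain n u v where uv: "\<forall>i<n::nat. u i \<in> coord G \<and> v i \<in> coord G"
    "\<forall>x\<in>carrier G. \<forall>y\<in>carrier G. e (x \<otimes> y) = (\<Sum>i<n. u i x * v i y)"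
    using coord_comult[OF e(1)] by (elim exE conjE)
  \<comment> \<open>Since \<open>h = inv x \<otimes> (x \<otimes> h)\<close>, expanding
    \<open>e\<close> on this product gives \<open>1\<close> as the sum of \<open>u i (inv x)\<close>
    times the trace of \<open>v i\<close> at \<open>x\<close>.\<close>
  have "\<exists>c\<in>coord G. \<forall>x\<in>carrier G. (\<Sum>h\<in>H. c (x \<otimes> h)) = 1"
  proof (rule trace_one[OF H, where b = "\<lambda>i. restr (carrier G) (\<lambda>x. u i (inv x))" and v = v])
    fix x assume x: "x \<in> carrier G"
    have "(\<Sum>i<n. restr (carrier G) (\<lambda>x. u i (inv x)) x * (\<Sum>h\<in>H. v i (x \<otimes> h))) =
        (\<Sum>h\<in>H. \<Sum>i<n. u i (inv x) * v i (x \<otimes> h))"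
      unfolding sum_distrib_left using x by (subst sum.swap) (simp add: restr_def)
    also have "\<dots> = (\<Sum>h\<in>H. e (inv x \<otimes> (x \<otimes> h)))" using uv(2) x by (intro sum.cong) auto
    also have "\<dots> = (\<Sum>h\<in>H. e (\<one> \<otimes> h))" using x by (intro sum.cong) (auto simp: m_assoc[symmetric])
    also have "\<dots> = 1" by (rule esum) simp
    finally show "(\<Sum>i<n. restr (carrier G) (\<lambda>x. u i (inv x)) x * (\<Sum>h\<in>H. v i (x \<otimes> h))) = 1" .
  qed (use uv(1) coord_inv in auto)
  then obtain c0 where c0: "c0 \<in> coord G" "\<And>x. x \<in> carrier G \<Longrightarrow> (\<Sum>h\<in>H. c0 (x \<otimes> h)) = 1" by blast
  define t where "t x = (\<Sum>h\<in>H. restr (carrier G) (\<lambda>x. e (x \<otimes> h)) x)" for x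
  have t: "t \<in> coord G" unfolding t_def using e(1) by (intro coord_sum coord_translate) auto
  have t_inv: "t (x \<otimes> g) = t x" if "x \<in> carrier G" "g \<in> H" for x g
    using subgroup_sum_translate(1)[OF H(1) that(2), of "\<lambda>h. e (x \<otimes> h)"] that
    by (simp add: t_def restr_def m_assoc)
  \<comment> \<open>With \<open>t\<close> the trace of \<open>e\<close>, the trace of
    \<open>e + c0 - t * c0\<close> is \<open>t + 1 - t\<close>, because \<open>t\<close> is
    invariant. On \<open>H\<close> one has \<open>t = 1\<close>, so the two terms with
    \<open>c0\<close> cancel and \<open>c\<close> equals \<open>e\<close> there.\<close>
  define c where "c x = e x + c0 x + - 1 * (t x * c0 x)" for x
  show ?thesis
  proof (intro bexI conjI ballI)
    show "c \<in> coord G" unfolding c_def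
      by (rule coord_add[OF coord_add[OF e(1) c0(1)] coord_scale[OF coord_mult[OF t c0(1)]]])
    fix x assume x: "x \<in> carrier G"
    have "(\<Sum>h\<in>H. c (x \<otimes> h)) = (\<Sum>h\<in>H. e (x \<otimes> h) + c0 (x \<otimes> h) - t x * c0 (x \<otimes> h))"
      unfolding c_def using t_inv[OF x] by (intro sum.cong) auto
    also have "\<dots> = (\<Sum>h\<in>H. e (x \<otimes> h)) + 1 - t x * (\<Sum>h\<in>H. c0 (x \<otimes> h))"
      using c0(2)[OF x] by (simp add: sum.distrib sum_subtractf flip: sum_distrib_left)
    also have "\<dots> = 1" using c0(2)[OF x] x by (simp add: t_def restr_def)
    finally show "(\<Sum>h\<in>H. c (x \<otimes> h)) = 1" .
  next
    have t1: "t h = 1" if "h \<in> H" for h using esum[OF that] that by (simp add: t_def restr_def)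
    show "c \<one> = 1" using e(2) t1[of \<one>] by (simp add: c_def)
    show "c h = 0" if "h \<in> H - {\<one>}" for h using e(3)[OF that] t1[of h] that by (simp add: c_def)
  qed
qed

end

section \<open>Cochains and long exact sequences\<close>

text \<open>Maps of modules are controlled on \<open>space M\<close> only and may take any value
  elsewhere, so linearity is relative to a subspace.\<close>

definition lin_on ::
    "('k \<Rightarrow> 'v::ab_group_add \<Rightarrow> 'v) \<Rightarrow> ('k \<Rightarrow> 'w::ab_group_add \<Rightarrow> 'w) \<Rightarrow> 'v set \<Rightarrow> 'w set \<Rightarrow> ('v \<Rightarrow> 'w) \<Rightarrow> bool" where
  "lin_on s t V W f \<longleftrightarrow> (\<forall>v\<in>V. f v \<in> W) \<and> (\<forall>v\<in>V. \<forall>w\<in>V. f (v + w) = f v + f w) \<and>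
     (\<forall>c. \<forall>v\<in>V. f (s c v) = t c (f v))"

lemma lin_onD:
  assumes "lin_on s t V W f"
  shows "\<And>v. v \<in> V \<Longrightarrow> f v \<in> W" "\<And>v w. v \<in> V \<Longrightarrow> w \<in> V \<Longrightarrow> f (v + w) = f v + f w"
    "\<And>c v. v \<in> V \<Longrightarrow> f (s c v) = t c (f v)"
  using assms unfolding lin_on_def by simp_all

lemma lin_on_diff:
  assumes "lin_on s t V W f" "vector_space s" "vector_space t" "module.subspace s V"
  shows "f 0 = 0" "\<And>v w. v \<in> V \<Longrightarrow> w \<in> V \<Longrightarrow> f (v - w) = f v - f w"
proof -
  interpret S: vector_space s by fact
  interpret T: vector_space t by fact
  note f = lin_onD[OF assms(1)] and V = S.subspace_0[OF assms(4)] S.subspace_diff[OF assms(4)]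
  show "f 0 = 0" using f(3)[OF V(1), of 0] by simp
  show "f (v - w) = f v - f w" if "v \<in> V" "w \<in> V" for v w
    using f(2)[OF V(2)[OF that] that(2)] by simp
qed

lemma lin_on_extend:
  assumes "lin_on s t V W f" "vector_space s" "vector_space t" "module.subspace s V" "module.subspace t W"
  obtains F where "Vector_Spaces.linear s t F" "\<And>v. F v \<in> W" "\<And>v. v \<in> V \<Longrightarrow> F v = f v"
proof -
  from linear_extend[OF assms(2-5), of f] lin_onD[OF assms(1)]
  have "\<exists>L'. (\<forall>v. L' v \<in> W) \<and> (\<forall>v w. L' (v + w) = L' v + L' w) \<and>
    (\<forall>c v. L' (s c v) = t c (L' v)) \<and> (\<forall>v\<in>V. L' v = f v)"
    by simp
  then obtain F where "\<forall>v. F v \<in> W" "\<forall>v w. F (v + w) = F v + F w" "\<forall>c v. F (s c v) = t c (F v)" "\<forall>v\<in>V. F v = f v"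
    by (elim exE conjE)
  moreover from this have "Vector_Spaces.linear s t F" using assms(2,3) by (simp add: Vector_Spaces.linear_iff)
  ultimately show thesis using that by simp
qed

text \<open>Every injection of vector spaces splits. The splitting is linear but in general not
  equivariant; where invariance matters it has to be restored by another argument.\<close>

lemma lin_on_left_inverse:
  assumes "lin_on s t V W f" "vector_space s" "vector_space t" "module.subspace s V" "module.subspace t W"
    and "inj_on f V"
  obtains h where "lin_on t s W V h" "\<And>v. v \<in> V \<Longrightarrow> h (f v) = v"
proof -
  interpret vector_space_pair s t by (simp add: vector_space_pair_def assms)
  obtain F where F: "Vector_Spaces.linear s t F" "\<And>v. v \<in> V \<Longrightarrow> F v = f v"
    by (rule lin_on_extend[OF assms(1-5)]) (rule that)
  have "inj_on F V" using assms(6) F(2) by (simp add: inj_on_def)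
  then obtain h where h: "h ` UNIV \<subseteq> V" "Vector_Spaces.linear t s h" "\<forall>v\<in>V. h (F v) = v"
    using linear_exists_left_inverse_on[OF F(1) assms(4)] by blast
  have "lin_on t s W V h" unfolding lin_on_def using h(1,2) by (auto simp: Vector_Spaces.linear_iff)
  with that[of h] h(3) F(2) show thesis by simp
qed

lemma lin_on_right_inverse:
  assumes "lin_on s t V W f" "vector_space s" "vector_space t" "module.subspace s V" "module.subspace t W"
    and "f ` V = W"
  obtains h where "lin_on t s W V h" "\<And>w. w \<in> W \<Longrightarrow> f (h w) = w"
proof -
  interpret vector_space_pair s t by (simp add: vector_space_pair_def assms)
  obtain F where F: "Vector_Spaces.linear s t F" "\<And>v. v \<in> V \<Longrightarrow> F v = f v"
    by (rule lin_on_extend[OF assms(1-5)]) (rule that)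
  have "F ` V = W" using assms(6) F(2) by auto
  then obtain h where h: "h ` UNIV \<subseteq> V" "Vector_Spaces.linear t s h" "\<forall>w\<in>W. F (h w) = w"
    using linear_exists_right_inverse_on[OF F(1) assms(4)] by blast
  have "lin_on t s W V h" unfolding lin_on_def using h(1,2) by (auto simp: Vector_Spaces.linear_iff)
  moreover have "h w \<in> V" for w using h(1) by auto
  ultimately show thesis using that[of h] h(3) F(2) by simp
qed

lemma ghomD:
  assumes "ghom G M N f"
  shows "\<And>v. v \<in> space M \<Longrightarrow> f v \<in> space N"
    "\<And>v w. v \<in> space M \<Longrightarrow> w \<in> space M \<Longrightarrow> f (v + w) = f v + f w"
    "\<And>c v. v \<in> space M \<Longrightarrow> f (scale M c v) = scale N c (f v)"
    "\<And>x v. x \<in> carrier G \<Longrightarrow> v \<in> space M \<Longrightarrow> f (act M x v) = act N x (f v)"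
  using assms unfolding ghom_def by simp_all

lemma ghom_lin_on: "ghom G M N f \<Longrightarrow> lin_on (scale M) (scale N) (space M) (space N) f"
  unfolding ghom_def lin_on_def by simp

lemma space_update_sel:
  "space (M\<lparr>space := K\<rparr>) = K" "scale (M\<lparr>space := K\<rparr>) = scale M" "act (M\<lparr>space := K\<rparr>) = act M"
  by simp_all

text \<open>The fixed points of the \<open>n\<close>-th term of the standard resolution, that is,
  the values at \<open>1\<close> of the homomorphisms from the trivial module. Degree
  \<open>n\<close> means tuples of length \<open>n + 1\<close>.\<close>

definition cochains ::
    "('g, 'k::field) alg_group \<Rightarrow> ('g, 'k, 'v::ab_group_add) gmodule \<Rightarrow> nat \<Rightarrow> ('g list \<Rightarrow> 'v) set" where
  "cochains G N n = {f \<in> space (std_resolution G N n). \<forall>y\<in>carrier G. act (std_resolution G N n) y f = f}"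

definition cocycles ::
    "('g, 'k::field) alg_group \<Rightarrow> ('g, 'k, 'v::ab_group_add) gmodule \<Rightarrow> nat \<Rightarrow> ('g list \<Rightarrow> 'v) set" where
  "cocycles G N n = {f \<in> cochains G N n. std_differential G f = 0}"

text \<open>Indexed by the degree of the source: these are the coboundaries of degree \<open>n + 1\<close>.\<close>

definition coboundaries ::
    "('g, 'k::field) alg_group \<Rightarrow> ('g, 'k, 'v::ab_group_add) gmodule \<Rightarrow> nat \<Rightarrow> ('g list \<Rightarrow> 'v) set" where
  "coboundaries G N n = std_differential G ` cochains G N n"

section \<open>The complex of invariant cochains and its functoriality\<close>

context coord_group
begin

lemma cochains_iff:
  "f \<in> cochains G N n \<longleftrightarrow>
     f \<in> regular_maps_pow G (scale N) (space N) (Suc n) \<and> (\<forall>y\<in>carrier G. tact N y f = f)"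
  unfolding cochains_def std_sel by blast

lemma pow_linear:
  assumes "lin_on s t V W f" "vector_space s" "vector_space t" "module.subspace s V" "module.subspace t W"
  shows "\<phi> \<in> regular_maps_pow G s V n \<Longrightarrow> f \<circ> \<phi> \<in> regular_maps_pow G t W n"
proof (induction n arbitrary: \<phi>)
  case 0
  thus ?case unfolding pow_0_iff using lin_onD(1)[OF assms(1)] lin_on_diff(1)[OF assms(1-4)] by simp
next
  case (Suc n)
  have F: "\<phi> [] = 0" "(\<lambda>x ys. \<phi> (x # ys)) \<in> regular_maps G (fscale s) (regular_maps_pow G s V n)"
    using Suc.prems unfolding pow_Suc_iff by auto
  have "(\<lambda>x. f \<circ> (\<lambda>ys. \<phi> (x # ys))) \<in> regular_maps G (fscale t) (regular_maps_pow G t W n)"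
  proof (rule reg_linear[OF F(2) vector_space_fscale[OF assms(2)] vector_space_fscale[OF assms(3)]
        pow_subspace[OF assms(2,4)]])
    fix v w :: "'g list \<Rightarrow> _" and c
    assume v: "v \<in> regular_maps_pow G s V n"
    show "f \<circ> v \<in> regular_maps_pow G t W n" by (rule Suc.IH[OF v])
    show "f \<circ> (v + w) = (f \<circ> v) + (f \<circ> w)" if "w \<in> regular_maps_pow G s V n"
      using lin_onD(2)[OF assms(1)] pow_in[OF v assms(2,4)] pow_in[OF that assms(2,4)] by (simp add: fun_eq_iff)
    show "f \<circ> fscale s c v = fscale t c (f \<circ> v)"
      using lin_onD(3)[OF assms(1)] pow_in[OF v assms(2,4)] by (simp add: fun_eq_iff fscale_apply)
  qed
  thus ?case unfolding pow_Suc_iff using F(1) lin_on_diff(1)[OF assms(1-4)] by (simp add: comp_def)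
qed

lemma diff_minus: "std_differential G (f - g) = std_differential G f - std_differential G g"
  using diff_add[of f "- g"] diff_uminus[of g] by simp

lemma diff_subspace:
  assumes "vector_space s" "module.subspace s V"
  shows "(\<And>xs. f xs \<in> V) \<Longrightarrow> std_differential G f xs \<in> V"
proof (induction xs arbitrary: f)
  case (Cons x xs)
  show ?case
    by (cases "x \<in> carrier G")
      (auto simp: diff_Cons diff_outside subspaceD(1)[OF assms] intro!: subspaceD(4)[OF assms] Cons)
qed (simp add: subspaceD(1)[OF assms])

lemma diff_comp:
  assumes "lin_on s t V W f" "vector_space s" "vector_space t" "module.subspace s V"
    and "\<And>xs. \<phi> xs \<in> V"
  shows "std_differential G (f \<circ> \<phi>) = f \<circ> std_differential G \<phi>"
proof
  note f0 = lin_on_diff[OF assms(1-4)]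
  fix xs show "std_differential G (f \<circ> \<phi>) xs = (f \<circ> std_differential G \<phi>) xs"
    using assms(5)
  proof (induction xs arbitrary: \<phi>)
    case (Cons x xs)
    show ?case
    proof (cases "x \<in> carrier G")
      case True
      have "std_differential G (\<lambda>ys. (f \<circ> \<phi>) (x # ys)) xs = f (std_differential G (\<lambda>ys. \<phi> (x # ys)) xs)"
        using Cons.IH[of "\<lambda>ys. \<phi> (x # ys)"] Cons.prems by (simp add: comp_def)
      moreover have "std_differential G (\<lambda>ys. \<phi> (x # ys)) xs \<in> V"
        using Cons.prems by (intro diff_subspace[OF assms(2,4)])
      ultimately show ?thesis
        using True Cons.prems subspaceD(1)[OF assms(2,4)] by (simp add: diff_Cons f0)
    qed (simp add: diff_outside f0)
  qed (simp add: f0)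
qed

lemma tact_comp:
  assumes "ghom G M N f" "f 0 = 0" "y \<in> carrier G" "\<And>xs. \<phi> xs \<in> space M"
  shows "f \<circ> tact M y \<phi> = tact N y (f \<circ> \<phi>)"
  using assms unfolding ghom_def by (auto simp: tact_def fun_eq_iff)

context
  fixes N :: "('g, 'k, 'v::ab_group_add) gmodule"
  assumes N: "rational_module G N"
begin

private lemmas D = rationalD[OF N]
private lemmas NVS = vector_space_fscale[OF D(1)]
private lemmas PS = subspaceD[OF NVS pow_subspace[OF D(1,2)]]

lemma cochains_in: "f \<in> cochains G N n \<Longrightarrow> f xs \<in> space N"
  unfolding cochains_iff by (rule pow_in[OF conjunct1 D(1,2)])

lemma cochains_closed:
  "0 \<in> cochains G N n" "f \<in> cochains G N n \<Longrightarrow> g \<in> cochains G N n \<Longrightarrow> f + g \<in> cochains G N n"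
  "f \<in> cochains G N n \<Longrightarrow> fscale (scale N) c f \<in> cochains G N n"
  "f \<in> cochains G N n \<Longrightarrow> g \<in> cochains G N n \<Longrightarrow> f - g \<in> cochains G N n"
proof -
  have in_N: "h xs \<in> space N" if "h \<in> regular_maps_pow G (scale N) (space N) m" for h m xs
    using pow_in[OF that D(1,2)] .
  note c = cochains_iff[THEN iffD1, THEN conjunct1] cochains_iff[THEN iffD1, THEN conjunct2, rule_format]
  show 1: "0 \<in> cochains G N n" unfolding cochains_iff using PS(1) tact_zero[OF N] by blast
  show 2: "f + g \<in> cochains G N n" if f: "f \<in> cochains G N n" and g: "g \<in> cochains G N n" for f g
    unfolding cochains_iff
    using PS(2)[OF c(1)[OF f] c(1)[OF g]] tact_add[OF N _ in_N[OF c(1)[OF f]] in_N[OF c(1)[OF g]]]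
      c(2)[OF f] c(2)[OF g] by (simp del: regular_maps_pow.simps)
  show 3: "fscale (scale N) c f \<in> cochains G N n" if f: "f \<in> cochains G N n" for f c
    unfolding cochains_iff
    using PS(3)[OF c(1)[OF f]] tact_scale[OF N _ in_N[OF c(1)[OF f]]] c(2)[OF f]
    by (simp del: regular_maps_pow.simps)
  show "f - g \<in> cochains G N n" if "f \<in> cochains G N n" "g \<in> cochains G N n"
  proof -
    interpret vector_space "scale N" by (rule D(1))
    have "f - g = f + fscale (scale N) (- 1) g" by (simp add: fun_eq_iff fscale_apply)
    thus ?thesis using 2[OF that(1) 3[OF that(2), of "- 1"]] by (simp only:)
  qed
qed

lemma diff_cochain: "f \<in> cochains G N n \<Longrightarrow> std_differential G f \<in> cochains G N (Suc n)"
proof -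
  assume f: "f \<in> cochains G N n"
  have "tact N y (std_differential G f) = std_differential G f" if "y \<in> carrier G" for y
  proof -
    have "std_differential G (tact N y f) = tact N y (std_differential G f)"
      by (rule diff_tact[OF N that cochains_in[OF f]])
    moreover have "tact N y f = f" using f that unfolding cochains_iff by blast
    ultimately show ?thesis by simp
  qed
  thus ?thesis using diff_pow[OF N, of f] f unfolding cochains_iff by blast
qed

lemma diff_diff_cochain: "f \<in> cochains G N n \<Longrightarrow> std_differential G (std_differential G f) = 0"
  unfolding cochains_iff using pow_outside[OF _ D(1), of f] by (intro diff_diff) blast

lemma cocycles_subspace: "module.subspace (fscale (scale N)) (cocycles G N n)"
proof -
  interpret F: vector_space "fscale (scale N)" by (rule NVS)
  show ?thesis unfolding F.subspace_def cocycles_def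
    using cochains_closed by (auto simp: diff_zero diff_add diff_scale[OF D(1)])
qed

lemma coboundaries_subspace: "module.subspace (fscale (scale N)) (coboundaries G N n)"
proof -
  interpret F: vector_space "fscale (scale N)" by (rule NVS)
  show ?thesis unfolding F.subspace_def coboundaries_def
  proof (intro conjI ballI allI)
    show "0 \<in> std_differential G ` cochains G N n"
      using cochains_closed(1) diff_zero by (intro image_eqI[of _ _ 0]) auto
    fix x y c assume "x \<in> std_differential G ` cochains G N n"
    then obtain f where f: "f \<in> cochains G N n" "x = std_differential G f" by blast
    show "fscale (scale N) c x \<in> std_differential G ` cochains G N n"
      using f cochains_closed(3) by (intro image_eqI[of _ _ "fscale (scale N) c f"]) (auto simp: diff_scale[OF D(1)])
    assume "y \<in> std_differential G ` cochains G N n"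
    then obtain g where g: "g \<in> cochains G N n" "y = std_differential G g" by blast
    show "x + y \<in> std_differential G ` cochains G N n"
      using f g cochains_closed(2) by (intro image_eqI[of _ _ "f + g"]) (auto simp: diff_add)
  qed
qed

lemma coboundaries_subset: "coboundaries G N n \<subseteq> cocycles G N (Suc n)"
  unfolding coboundaries_def cocycles_def using diff_cochain diff_diff_cochain by blast

end

lemma comp_cochain:
  assumes "rational_module G M" "rational_module G N" "ghom G M N f" "\<phi> \<in> cochains G M n"
  shows "f \<circ> \<phi> \<in> cochains G N n" "std_differential G (f \<circ> \<phi>) = f \<circ> std_differential G \<phi>"
proof -
  note DM = rationalD[OF assms(1)] and DN = rationalD[OF assms(2)]
  note L = ghom_lin_on[OF assms(3)]
  note f0 = lin_on_diff(1)[OF L DM(1) DN(1) DM(2)]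
  have "tact N y (f \<circ> \<phi>) = f \<circ> \<phi>" if "y \<in> carrier G" for y
    using tact_comp[OF assms(3) f0 that, of \<phi>] cochains_in[OF assms(1,4)] assms(4) that
    unfolding cochains_iff by simp
  thus "f \<circ> \<phi> \<in> cochains G N n"
    using pow_linear[OF L DM(1) DN(1) DM(2) DN(2), of \<phi>] assms(4) unfolding cochains_iff by blast
  show "std_differential G (f \<circ> \<phi>) = f \<circ> std_differential G \<phi>"
    by (rule diff_comp[OF L DM(1) DN(1) DM(2) cochains_in[OF assms(1,4)]])
qed

section \<open>Cochains of a short exact sequence of modules\<close>

context
  fixes M1 :: "('g, 'k, 'u::ab_group_add) gmodule" and M2 :: "('g, 'k, 'v::ab_group_add) gmodule"
    and M3 :: "('g, 'k, 'w::ab_group_add) gmodule" and f g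
  assumes rat: "rational_module G M1" "rational_module G M2" "rational_module G M3"
    and ex: "short_exact G M1 f M2 g M3"
begin

private lemma fg: "ghom G M1 M2 f" "ghom G M2 M3 g" "inj_on f (space M1)"
  "f ` space M1 = {v \<in> space M2. g v = 0}" "g ` space M2 = space M3"
  using ex unfolding short_exact_def by simp_all

private lemmas R1 = rationalD[OF rat(1)]
private lemmas R2 = rationalD[OF rat(2)]
private lemmas R3 = rationalD[OF rat(3)]
private lemmas Lf = ghom_lin_on[OF fg(1)]
private lemmas Lg = ghom_lin_on[OF fg(2)]
private lemmas f0 = lin_on_diff[OF Lf R1(1) R2(1) R1(2)]
private lemmas g0 = lin_on_diff[OF Lg R2(1) R3(1) R2(2)]

private lemma gf: "v \<in> space M1 \<Longrightarrow> g (f v) = 0" using fg(4) by auto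

private lemma f_add: "(\<And>xs. a xs \<in> space M1) \<Longrightarrow> (\<And>xs. b xs \<in> space M1) \<Longrightarrow> f \<circ> (a + b) = (f \<circ> a) + (f \<circ> b)"
  by (intro ext) (simp only: o_apply plus_fun_apply lin_onD(2)[OF Lf])

private lemma g_diff: "(\<And>xs. a xs \<in> space M2) \<Longrightarrow> (\<And>xs. b xs \<in> space M2) \<Longrightarrow> g \<circ> (a - b) = (g \<circ> a) - (g \<circ> b)"
  by (intro ext) (simp only: o_apply minus_apply g0(2))

private lemma f_inj:
  assumes "\<And>xs. a xs \<in> space M1" "\<And>xs. b xs \<in> space M1" "f \<circ> a = f \<circ> b"
  shows "a = b"
proof
  fix xs show "a xs = b xs" using fun_cong[OF assms(3), of xs] by (intro inj_onD[OF fg(3) _ assms(1,2)]) simp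
qed

text \<open>A preimage has to be a regular map again, so it is produced by composing with a linear
  left inverse of \<open>f\<close>, which preserves regularity.\<close>

private lemma pow_kernel:
  assumes "\<phi> \<in> regular_maps_pow G (scale M2) (space M2) n" "g \<circ> \<phi> = 0"
  shows "\<exists>\<psi>\<in>regular_maps_pow G (scale M1) (space M1) n. \<phi> = f \<circ> \<psi>"
proof -
  obtain h where h: "lin_on (scale M2) (scale M1) (space M2) (space M1) h" "\<And>v. v \<in> space M1 \<Longrightarrow> h (f v) = v"
    by (rule lin_on_left_inverse[OF Lf R1(1) R2(1) R1(2) R2(2) fg(3)]) (rule that)
  have 1: "h \<circ> \<phi> \<in> regular_maps_pow G (scale M1) (space M1) n"
    by (rule pow_linear[OF h(1) R2(1) R1(1) R2(2) R1(2) assms(1)])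
  have "\<phi> = f \<circ> (h \<circ> \<phi>)"
  proof
    fix xs
    have "\<phi> xs \<in> f ` space M1"
      unfolding fg(4) using pow_in[OF assms(1) R2(1,2)] fun_cong[OF assms(2), of xs] by simp
    thus "\<phi> xs = (f \<circ> (h \<circ> \<phi>)) xs" using h(2) by auto
  qed
  thus ?thesis using 1 by (rule bexI)
qed

text \<open>The linear left inverse used for the preimage is not equivariant, but \<open>f\<close>
  is equivariant and injective, so invariance of \<open>f \<circ> \<psi>\<close> forces that of
  \<open>\<psi>\<close>.\<close>

lemma cochain_kernel:
  assumes "\<phi> \<in> cochains G M2 n" "g \<circ> \<phi> = 0"
  shows "\<exists>\<psi>\<in>cochains G M1 n. \<phi> = f \<circ> \<psi>"
proof -
  have "\<phi> \<in> regular_maps_pow G (scale M2) (space M2) (Suc n)" using assms(1) unfolding cochains_iff by blast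
  from pow_kernel[OF this assms(2)]
  obtain \<psi> where p: "\<psi> \<in> regular_maps_pow G (scale M1) (space M1) (Suc n)" "\<phi> = f \<circ> \<psi>"
    by (elim bexE)
  have "tact M1 y \<psi> = \<psi>" if y: "y \<in> carrier G" for y
  proof (rule f_inj)
    show "tact M1 y \<psi> xs \<in> space M1" for xs using pow_in[OF tact_in[OF rat(1) p(1) y] R1(1,2)] .
    show "\<psi> xs \<in> space M1" for xs using pow_in[OF p(1) R1(1,2)] .
    have "f \<circ> tact M1 y \<psi> = tact M2 y (f \<circ> \<psi>)"
      by (rule tact_comp[OF fg(1) f0(1) y pow_in[OF p(1) R1(1,2)]])
    thus "f \<circ> tact M1 y \<psi> = f \<circ> \<psi>" using assms(1) y unfolding cochains_iff p(2) by simp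
  qed
  hence "\<psi> \<in> cochains G M1 n" using p(1) unfolding cochains_iff by blast
  with p(2) show ?thesis by (rule bexI)
qed

text \<open>The standard resolution of the kernel is injective, so it is a direct summand of that of the
  middle term.\<close>

lemma cochain_lift:
  assumes "\<phi> \<in> cochains G M3 n"
  shows "\<exists>\<psi>\<in>cochains G M2 n. g \<circ> \<psi> = \<phi>"
proof -
  let ?P = "\<lambda>M. regular_maps_pow G (scale M) (space M) (Suc n)"
  obtain h where h: "lin_on (scale M2) (scale M1) (space M2) (space M1) h" "\<And>v. v \<in> space M1 \<Longrightarrow> h (f v) = v"
    by (rule lin_on_left_inverse[OF Lf R1(1) R2(1) R1(2) R2(2) fg(3)]) (rule that)
  obtain s where s: "lin_on (scale M3) (scale M2) (space M3) (space M2) s" "\<And>w. w \<in> space M3 \<Longrightarrow> g (s w) = w"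
    by (rule lin_on_right_inverse[OF Lg R2(1) R3(1) R2(2) R3(2) fg(5)]) (rule that)
  \<comment> \<open>\<open>K\<close> is the copy of the resolution of \<open>M1\<close> inside that
    of \<open>M2\<close>.\<close>
  define K where "K = (\<circ>) f ` ?P M1"
  have in1: "a xs \<in> space M1" if "a \<in> ?P M1" for a xs using pow_in[OF that R1(1,2)] .
  have in2: "a xs \<in> space M2" if "a \<in> ?P M2" for a xs using pow_in[OF that R2(1,2)] .
  have fP: "f \<circ> a \<in> ?P M2" if "a \<in> ?P M1" for a
    by (rule pow_linear[OF Lf R1(1) R2(1) R1(2) R2(2) that])
  have ft: "f \<circ> tact M1 y a = tact M2 y (f \<circ> a)" if "y \<in> carrier G" "a \<in> ?P M1" for y a
    by (rule tact_comp[OF fg(1) f0(1) that(1) in1[OF that(2)]])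
  have hf: "h \<circ> (f \<circ> a) = a" if "a \<in> ?P M1" for a
    using h(2) in1[OF that] by (simp add: fun_eq_iff)
  note C1 = subspaceD[OF vector_space_fscale[OF R1(1)] pow_subspace[OF R1(1,2), where n = "Suc n"]]
  note C2 = subspaceD[OF vector_space_fscale[OF R2(1)] pow_subspace[OF R2(1,2), where n = "Suc n"]]
  have sc: "f \<circ> fscale (scale M1) c a = fscale (scale M2) c (f \<circ> a)" if "a \<in> ?P M1" for c a
    using lin_onD(3)[OF Lf in1[OF that]] by (simp add: fun_eq_iff fscale_apply)
  have sub: "gsubmodule G (std_resolution G M2 n) K"
    unfolding gsubmodule_def std_sel
  proof (intro conjI ballI)
    show "K \<subseteq> ?P M2" unfolding K_def using fP by blast
    interpret F: vector_space "fscale (scale M2)" by (rule vector_space_fscale[OF R2(1)])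
    show "F.subspace K" unfolding F.subspace_def K_def
    proof (intro conjI ballI allI)
      show "0 \<in> (\<circ>) f ` ?P M1" using C1(1) f0(1) by (intro image_eqI[of _ _ 0]) (auto simp: fun_eq_iff)
      fix x y c assume "x \<in> (\<circ>) f ` ?P M1"
      then obtain a where a: "a \<in> ?P M1" "x = f \<circ> a" by blast
      show "fscale (scale M2) c x \<in> (\<circ>) f ` ?P M1" unfolding a(2) sc[OF a(1), symmetric] using C1(3)[OF a(1)] by blast
      assume "y \<in> (\<circ>) f ` ?P M1"
      then obtain b where b: "b \<in> ?P M1" "y = f \<circ> b" by blast
      show "x + y \<in> (\<circ>) f ` ?P M1"
        unfolding a(2) b(2) f_add[OF in1[OF a(1)] in1[OF b(1)], symmetric] using C1(2)[OF a(1) b(1)] by blast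
    qed
    fix x v assume x: "x \<in> carrier G" and "v \<in> K"
    then obtain a where a: "a \<in> ?P M1" "v = f \<circ> a" unfolding K_def by blast
    show "tact M2 x v \<in> K" unfolding a(2) K_def ft[OF x a(1), symmetric] using tact_in[OF rat(1) a(1) x] by blast
  qed
  have hom: "ghom G ((std_resolution G M2 n)\<lparr>space := K\<rparr>) (std_resolution G M1 n) ((\<circ>) h)"
    unfolding ghom_def space_update_sel std_sel
  proof (intro conjI ballI allI)
    fix v assume "v \<in> K"
    then obtain a where a: "a \<in> ?P M1" "v = f \<circ> a" unfolding K_def by blast
    show "h \<circ> v \<in> ?P M1" unfolding a(2) hf[OF a(1)] by (rule a(1))
    show "h \<circ> (v + w) = (h \<circ> v) + (h \<circ> w)" if "w \<in> K" for w
    proof -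
      from that have "w \<in> (\<circ>) f ` ?P M1" unfolding K_def .
      then obtain b where b: "b \<in> ?P M1" "w = f \<circ> b" by blast
      show ?thesis unfolding a(2) b(2) hf[OF a(1)] hf[OF b(1)] f_add[OF in1[OF a(1)] in1[OF b(1)], symmetric]
        by (rule hf[OF C1(2)[OF a(1) b(1)]])
    qed
    show "h \<circ> fscale (scale M2) c v = fscale (scale M1) c (h \<circ> v)" for c
      unfolding a(2) hf[OF a(1)] sc[OF a(1), symmetric] by (rule hf[OF C1(3)[OF a(1)]])
    show "h \<circ> tact M2 x v = tact M1 x (h \<circ> v)" if "x \<in> carrier G" for x
      unfolding a(2) hf[OF a(1)] ft[OF that a(1), symmetric] by (rule hf[OF tact_in[OF rat(1) a(1) that]])
  qed
  \<comment> \<open>On \<open>K\<close>, composition with \<open>h\<close> is the inverse of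
    composition with \<open>f\<close> and hence equivariant, although \<open>h\<close> itself is
    not. Injectivity of the resolution of \<open>M1\<close> extends it to an equivariant retraction
    \<open>\<pi>\<close> of the whole resolution.\<close>
  obtain \<pi> where \<pi>: "ghom G (std_resolution G M2 n) (std_resolution G M1 n) \<pi>" "\<forall>v\<in>K. \<pi> v = h \<circ> v"
    using std_resolution_injective'[OF rat(1) std_resolution_rational'[OF rat(2)] sub hom] by (elim exE conjE)
  note pi = ghomD[OF \<pi>(1), unfolded std_sel]
  have p3: "\<phi> \<in> ?P M3" "\<And>y. y \<in> carrier G \<Longrightarrow> tact M3 y \<phi> = \<phi>"
    using assms unfolding cochains_iff by blast+
  define a where "a = s \<circ> \<phi>"
  have a: "a \<in> ?P M2" unfolding a_def by (rule pow_linear[OF s(1) R3(1) R2(1) R3(2) R2(2) p3(1)])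
  have ga: "g \<circ> a = \<phi>" using s(2) pow_in[OF p3(1) R3(1,2)] by (auto simp: a_def fun_eq_iff)
  \<comment> \<open>The linear lift \<open>a\<close> of \<open>\<phi>\<close> is not invariant:
    acting by \<open>y\<close> changes it by some \<open>u\<close> that lies in \<open>K\<close>,
    because \<open>\<phi>\<close> is invariant. Subtracting the component seen by
    \<open>\<pi>\<close> removes exactly this change, since
    \<open>f \<circ> \<pi> u = u\<close>.\<close>
  define b where "b = a - (f \<circ> \<pi> a)"
  have fpa: "f \<circ> \<pi> a \<in> ?P M2" by (rule fP[OF pi(1)[OF a]])
  have b: "b \<in> ?P M2" unfolding b_def by (rule C2(4)[OF a fpa])
  have gb: "g \<circ> b = \<phi>"
    unfolding b_def g_diff[OF in2[OF a] in2[OF fpa]] ga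
    using gf[OF in1[OF pi(1)[OF a]]] by (simp add: fun_eq_iff)
  have "tact M2 y b = b" if y: "y \<in> carrier G" for y
  proof -
    have ya: "tact M2 y a \<in> ?P M2" by (rule tact_in[OF rat(2) a y])
    define u where "u = tact M2 y a - a"
    have u: "u \<in> ?P M2" unfolding u_def by (rule C2(4)[OF ya a])
    have "g \<circ> tact M2 y a = tact M3 y (g \<circ> a)" by (rule tact_comp[OF fg(2) g0(1) y in2[OF a]])
    hence "g \<circ> u = 0" unfolding u_def g_diff[OF in2[OF ya] in2[OF a]] ga using p3(2)[OF y] by simp
    then obtain v where v: "v \<in> ?P M1" "u = f \<circ> v" using pow_kernel[OF u] by blast
    have pu: "f \<circ> \<pi> u = u" using bspec[OF \<pi>(2), of u] v hf[OF v(1)] unfolding K_def by auto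
    have e: "tact M2 y a = a + u" unfolding u_def by simp
    have "tact M2 y b = tact M2 y a - tact M2 y (f \<circ> \<pi> a)"
      unfolding b_def tact_def using act_diff[OF rat(2) y] in2[OF a] in2[OF fpa] by (auto simp: fun_eq_iff)
    also have "tact M2 y (f \<circ> \<pi> a) = f \<circ> \<pi> (tact M2 y a)"
      unfolding pi(4)[OF y a] by (rule ft[OF y pi(1)[OF a], symmetric])
    also have "\<dots> = (f \<circ> \<pi> a) + (f \<circ> \<pi> u)"
      unfolding e pi(2)[OF a u] by (rule f_add[OF in1[OF pi(1)[OF a]] in1[OF pi(1)[OF u]]])
    finally have "tact M2 y b = tact M2 y a - ((f \<circ> \<pi> a) + (f \<circ> \<pi> u))" .
    also have "\<dots> = b" unfolding pu unfolding e b_def by simp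
    finally show ?thesis .
  qed
  hence "b \<in> cochains G M2 n" using b unfolding cochains_iff by blast
  with gb show ?thesis by (rule bexI)
qed

end

end

section \<open>Ext from the trivial module as cocycles modulo coboundaries\<close>

context coord_group
begin

context
  fixes N :: "('g, 'k, 'v::ab_group_add) gmodule"
  assumes N: "rational_module G N"
begin

private lemmas ND = rationalD[OF N]
private lemmas NV = vector_space_fscale[OF ND(1)]

abbreviation (input) scalars :: "('g list \<Rightarrow> 'v) \<Rightarrow> 'k \<Rightarrow> 'g list \<Rightarrow> 'v" where
  "scalars f \<equiv> \<lambda>c. fscale (scale N) c f"

text \<open>A homomorphism from the trivial module is determined by its value at \<open>1\<close>,
  which is fixed by the group; conversely each fixed \<open>f\<close> gives the homomorphism
  \<open>scalars f\<close>.\<close>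

lemma ghoms_trivial: "ghoms G trivial_module (std_resolution G N n) = scalars ` cochains G N n"
proof (intro equalityI subsetI)
  interpret F: vector_space "fscale (scale N)" by (rule NV)
  fix \<phi> :: "'k \<Rightarrow> 'g list \<Rightarrow> 'v" assume "\<phi> \<in> ghoms G trivial_module (std_resolution G N n)"
  hence h: "ghom G trivial_module (std_resolution G N n) \<phi>" unfolding ghoms_def by blast
  note t = trivial_module_def
  have "\<phi> 1 \<in> cochains G N n"
    using ghomD(1)[OF h, of 1] ghomD(4)[OF h, of _ 1] unfolding cochains_def by (simp add: t)
  moreover have "\<phi> = scalars (\<phi> 1)"
  proof
    fix c show "\<phi> c = fscale (scale N) c (\<phi> 1)"
      using ghomD(3)[OF h, of 1 c] by (simp add: t std_sel del: regular_maps_pow.simps)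
  qed
  ultimately show "\<phi> \<in> scalars ` cochains G N n" by (intro image_eqI[of _ _ "\<phi> 1"])
next
  interpret F: vector_space "fscale (scale N)" by (rule NV)
  fix \<phi> :: "'k \<Rightarrow> 'g list \<Rightarrow> 'v" assume "\<phi> \<in> scalars ` cochains G N n"
  then obtain f where f: "f \<in> cochains G N n" "\<phi> = scalars f" by (rule imageE)
  have in_C: "fscale (scale N) c f \<in> cochains G N n" for c by (rule cochains_closed(3)[OF N f(1)])
  have "ghom G trivial_module (std_resolution G N n) \<phi>"
    unfolding ghom_def f(2)
    using in_C unfolding cochains_def
    by (simp add: trivial_module_def std_sel F.scale_left_distrib del: regular_maps_pow.simps)
  thus "\<phi> \<in> ghoms G trivial_module (std_resolution G N n)"
    unfolding ghoms_def by (simp add: trivial_module_def)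
qed

lemma Ext_trivial:
  "Ext G (Suc n) trivial_module N = quotient_space (fscale (fscale (scale N)))
     (scalars ` cocycles G N (Suc n)) (scalars ` coboundaries G N n)"
proof -
  interpret F: vector_space "fscale (scale N)" by (rule NV)
  have "{\<phi> \<in> scalars ` cochains G N (Suc n). \<forall>u. std_differential G (\<phi> u) = 0} = scalars ` cocycles G N (Suc n)"
  proof (intro equalityI subsetI)
    fix \<phi> :: "'k \<Rightarrow> 'g list \<Rightarrow> 'v"
    assume "\<phi> \<in> {\<phi> \<in> scalars ` cochains G N (Suc n). \<forall>u. std_differential G (\<phi> u) = 0}"
    then obtain f where f: "f \<in> cochains G N (Suc n)" "\<phi> = scalars f" "\<forall>u. std_differential G (\<phi> u) = 0" by blast
    have "f \<in> cocycles G N (Suc n)" using f(1) spec[OF f(3), of 1] unfolding f(2) cocycles_def by simp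
    thus "\<phi> \<in> scalars ` cocycles G N (Suc n)" unfolding f(2) by (rule imageI)
  next
    fix \<phi> :: "'k \<Rightarrow> 'g list \<Rightarrow> 'v" assume "\<phi> \<in> scalars ` cocycles G N (Suc n)"
    then obtain f where f: "f \<in> cocycles G N (Suc n)" "\<phi> = scalars f" by (rule imageE)
    show "\<phi> \<in> {\<phi> \<in> scalars ` cochains G N (Suc n). \<forall>u. std_differential G (\<phi> u) = 0}"
      using f(1) unfolding f(2) cocycles_def by (simp add: diff_scale[OF ND(1)])
  qed
  moreover have "(\<lambda>\<psi> u. std_differential G (\<psi> u)) ` scalars ` cochains G N n = scalars ` coboundaries G N n"
    unfolding coboundaries_def image_image by (simp add: diff_scale[OF ND(1)])
  ultimately show ?thesis unfolding Ext_def ghoms_trivial by simp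
qed

private lemma scalars_lin:
  "scalars (f + g) = scalars f + scalars g" "scalars (fscale (scale N) c f) = fscale (fscale (scale N)) c (scalars f)"
proof -
  interpret F: vector_space "fscale (scale N)" by (rule NV)
  show "scalars (f + g) = scalars f + scalars g" by (simp add: fun_eq_iff F.scale_right_distrib[unfolded fun_eq_iff])
  show "scalars (fscale (scale N) c f) = fscale (fscale (scale N)) c (scalars f)"
    by (intro ext) (simp add: fscale_apply[of "fscale (scale N)"] mult.commute)
qed

private lemma scalars_inj: "scalars f = scalars g \<Longrightarrow> f = g"
proof -
  interpret F: vector_space "fscale (scale N)" by (rule NV)
  assume "scalars f = scalars g"
  from fun_cong[OF this, of 1] show "f = g" by simp
qed

private lemma scalars_subspace:
  assumes "module.subspace (fscale (scale N)) Z"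
  shows "module.subspace (fscale (fscale (scale N))) (scalars ` Z)"
proof -
  interpret F: vector_space "fscale (scale N)" by (rule NV)
  interpret E: vector_space "fscale (fscale (scale N))" by (rule vector_space_fscale[OF NV])
  show ?thesis unfolding E.subspace_def
  proof (intro conjI ballI allI)
    show "0 \<in> scalars ` Z"
      using F.subspace_0[OF assms] by (intro image_eqI[of _ _ 0]) (auto simp: fun_eq_iff F.scale_zero_right[unfolded fun_eq_iff])
    fix x y c assume "x \<in> scalars ` Z"
    then obtain f where f: "f \<in> Z" "x = scalars f" by (rule imageE)
    show "fscale (fscale (scale N)) c x \<in> scalars ` Z"
      unfolding f(2) scalars_lin(2)[symmetric] by (rule imageI) (rule F.subspace_scale[OF assms f(1)])
    assume "y \<in> scalars ` Z"
    then obtain g where g: "g \<in> Z" "y = scalars g" by (rule imageE)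
    show "x + y \<in> scalars ` Z"
      unfolding f(2) g(2) scalars_lin(1)[symmetric] by (rule imageI) (rule F.subspace_add[OF assms f(1) g(1)])
  qed
qed

lemma Ext_trivial_subspaces:
  "vector_space (fscale (fscale (scale N)))"
  "module.subspace (fscale (fscale (scale N))) (scalars ` cocycles G N n)"
  "module.subspace (fscale (fscale (scale N))) (scalars ` coboundaries G N n)"
  "scalars ` coboundaries G N n \<subseteq> scalars ` cocycles G N (Suc n)"
  using vector_space_fscale[OF NV] scalars_subspace[OF cocycles_subspace[OF N]]
    scalars_subspace[OF coboundaries_subspace[OF N]] coboundaries_subset[OF N] by (blast intro: image_mono)+

text \<open>Evaluation at \<open>1\<close> and its inverse, stated as relations, so that comparisons
  may be carried out on cocycles and transferred to \<open>Ext\<close> at the end.\<close>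

lemma Ext_trivial_subquotient:
  "subquotient (fscale (fscale (scale N))) (scalars ` cocycles G N (Suc n)) (scalars ` coboundaries G N n)
     (fscale (scale N)) (cocycles G N (Suc n)) (coboundaries G N n)"
  "subquotient (fscale (scale N)) (cocycles G N (Suc n)) (coboundaries G N n)
     (fscale (fscale (scale N))) (scalars ` cocycles G N (Suc n)) (scalars ` coboundaries G N n)"
proof -
  note Z = subspaceD[OF NV cocycles_subspace[OF N]]
  show "subquotient (fscale (fscale (scale N))) (scalars ` cocycles G N (Suc n)) (scalars ` coboundaries G N n)
     (fscale (scale N)) (cocycles G N (Suc n)) (coboundaries G N n)"
    by (rule subquotientI[where r = "\<lambda>\<phi> f. f \<in> cocycles G N (Suc n) \<and> \<phi> = scalars f"])
      (auto simp: scalars_lin Z intro: Z)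
  show "subquotient (fscale (scale N)) (cocycles G N (Suc n)) (coboundaries G N n)
     (fscale (fscale (scale N))) (scalars ` cocycles G N (Suc n)) (scalars ` coboundaries G N n)"
    by (rule subquotientI[where r = "\<lambda>f \<phi>. f \<in> cocycles G N (Suc n) \<and> \<phi> = scalars f"])
      (auto simp: scalars_lin Z intro: Z dest: scalars_inj)
qed

text \<open>The entrance for hypotheses (b), (c) and (d): vanishing of \<open>Ext\<close> becomes
  the statement that every cocycle is a coboundary, the form used in all diagram chases.\<close>

lemma vanishes_Ext_trivial:
  "vanishes (Ext G (Suc n) trivial_module N) \<longleftrightarrow> cocycles G N (Suc n) \<subseteq> coboundaries G N n"
proof -
  note S = Ext_trivial_subspaces
  let ?Z = "scalars ` cocycles G N (Suc n)" and ?B = "scalars ` coboundaries G N n"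
  interpret E: vector_space "fscale (fscale (scale N))" by (rule S(1))
  have z: "0 \<in> ?Z" by (rule E.subspace_0[OF S(2)])
  have eq: "(+) z ` ?B = ?B \<longleftrightarrow> z \<in> ?B" for z 
    using coset_arith(4)[OF S(1) S(3)[of n], where z = z and w = 0] by simp
  have "{(+) z ` ?B | z. z \<in> ?Z} = {?B} \<longleftrightarrow> (\<forall>z\<in>?Z. (+) z ` ?B = ?B)"
  proof
    assume l: "{(+) z ` ?B | z. z \<in> ?Z} = {?B}"
    show "\<forall>z\<in>?Z. (+) z ` ?B = ?B"
    proof
      fix z assume "z \<in> ?Z"
      hence "(+) z ` ?B \<in> {(+) z ` ?B | z. z \<in> ?Z}" by blast
      thus "(+) z ` ?B = ?B" unfolding l by (rule singletonD)
    qed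
  next
    assume r: "\<forall>z\<in>?Z. (+) z ` ?B = ?B"
    have "{(+) z ` ?B | z. z \<in> ?Z} = (\<lambda>z. (+) z ` ?B) ` ?Z" by (rule Setcompr_eq_image)
    also have "\<dots> = (\<lambda>_. ?B) ` ?Z" using r by (intro image_cong refl) blast
    also have "\<dots> = {?B}" using z by (intro image_constant)
    finally show "{(+) z ` ?B | z. z \<in> ?Z} = {?B}" .
  qed
  hence "vanishes (Ext G (Suc n) trivial_module N) \<longleftrightarrow> (\<forall>z\<in>?Z. z \<in> ?B)"
    unfolding vanishes_def Ext_trivial quotient_space_def eq by simp
  also have "\<dots> \<longleftrightarrow> cocycles G N (Suc n) \<subseteq> coboundaries G N n"
  proof
    assume a: "\<forall>z\<in>?Z. z \<in> ?B"
    show "cocycles G N (Suc n) \<subseteq> coboundaries G N n"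
    proof
      fix z assume "z \<in> cocycles G N (Suc n)"
      hence "scalars z \<in> ?B" using a by blast
      then obtain b where b: "b \<in> coboundaries G N n" "scalars z = scalars b" by (rule imageE)
      show "z \<in> coboundaries G N n" using b(1) scalars_inj[OF b(2)] by simp
    qed
  qed blast
  finally show ?thesis .
qed

end

end

text \<open>Two groups are allowed because the comparison is eventually between the finite group and
  \<open>G\<close>.\<close>

theorem Ext_trivial_iso:
  fixes G :: "('g, 'k::field) alg_group" and G' :: "('h, 'k) alg_group"
    and N :: "('g, 'k, 'v::ab_group_add) gmodule" and N' :: "('h, 'k, 'w::ab_group_add) gmodule"
  assumes "coord_group G" "coord_group G'" "rational_module G N" "rational_module G' N'"
    and sq: "subquotient (fscale (scale N)) (cocycles G N (Suc n)) (coboundaries G N n)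
      (fscale (scale N')) (cocycles G' N' (Suc n')) (coboundaries G' N' n')"
      "subquotient (fscale (scale N')) (cocycles G' N' (Suc n')) (coboundaries G' N' n')
      (fscale (scale N)) (cocycles G N (Suc n)) (coboundaries G N n)"
  shows "vs_isomorphic (Ext G (Suc n) trivial_module N) (Ext G' (Suc n') trivial_module N')"
proof -
  interpret G: coord_group G by fact
  interpret G': coord_group G' by fact
  note S = G.Ext_trivial_subspaces[OF assms(3)] and S' = G'.Ext_trivial_subspaces[OF assms(4)]
  note T = G.Ext_trivial_subquotient[OF assms(3)] and T' = G'.Ext_trivial_subquotient[OF assms(4)]
  show ?thesis unfolding G.Ext_trivial[OF assms(3)] G'.Ext_trivial[OF assms(4)]
    by (rule subquotient_antisym[OF S(1) S'(1) S(2-4) S'(2-4)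
      subquotient_trans[OF T(1) subquotient_trans[OF sq(1) T'(2)]]
      subquotient_trans[OF T'(1) subquotient_trans[OF sq(2) T(2)]]])
qed

section \<open>Exactness of cohomology next to a vanishing term\<close>

context coord_group
begin

context
  fixes M1 :: "('g, 'k, 'u::ab_group_add) gmodule" and M2 :: "('g, 'k, 'v::ab_group_add) gmodule"
    and M3 :: "('g, 'k, 'w::ab_group_add) gmodule" and f g
  assumes rat: "rational_module G M1" "rational_module G M2" "rational_module G M3"
    and ex: "short_exact G M1 f M2 g M3"
begin

private lemma exact: "ghom G M1 M2 f" "ghom G M2 M3 g" "inj_on f (space M1)"
  "f ` space M1 = {v \<in> space M2. g v = 0}" "g ` space M2 = space M3"
  using ex unfolding short_exact_def by simp_all

private lemmas rat1 = rationalD[OF rat(1)]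
private lemmas rat2 = rationalD[OF rat(2)]
private lemmas rat3 = rationalD[OF rat(3)]
private lemmas f_lin_on = ghom_lin_on[OF exact(1)]
private lemmas g_lin_on = ghom_lin_on[OF exact(2)]
private lemmas f_cochain = comp_cochain[OF rat(1,2) exact(1)]
private lemmas g_cochain = comp_cochain[OF rat(2,3) exact(2)]

private lemma f_lin:
  "a \<in> cochains G M1 n \<Longrightarrow> b \<in> cochains G M1 n \<Longrightarrow> f \<circ> (a + b) = (f \<circ> a) + (f \<circ> b)"
  "a \<in> cochains G M1 n \<Longrightarrow> f \<circ> (fscale (scale M1) c a) = fscale (scale M2) c (f \<circ> a)"
  using lin_onD(2,3)[OF f_lin_on] cochains_in[OF rat(1)] by (simp_all add: fun_eq_iff fscale_apply)

private lemma g_lin: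
  "a \<in> cochains G M2 n \<Longrightarrow> b \<in> cochains G M2 n \<Longrightarrow> g \<circ> (a + b) = (g \<circ> a) + (g \<circ> b)"
  "a \<in> cochains G M2 n \<Longrightarrow> b \<in> cochains G M2 n \<Longrightarrow> g \<circ> (a - b) = (g \<circ> a) - (g \<circ> b)"
  "a \<in> cochains G M2 n \<Longrightarrow> g \<circ> (fscale (scale M2) c a) = fscale (scale M3) c (g \<circ> a)"
  using lin_onD(2,3)[OF g_lin_on] lin_on_diff(2)[OF g_lin_on rat2(1) rat3(1) rat2(2)] cochains_in[OF rat(2)]
  by (simp_all add: fun_eq_iff fscale_apply)

private lemma f_cocycle:
  assumes "a \<in> cocycles G M1 n" shows "f \<circ> a \<in> cocycles G M2 n"
proof -
  have a: "a \<in> cochains G M1 n" "std_differential G a = 0" using assms unfolding cocycles_def by auto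
  have "std_differential G (f \<circ> a) = 0"
    unfolding f_cochain(2)[OF a(1)] a(2) using lin_on_diff(1)[OF f_lin_on rat1(1) rat2(1) rat1(2)] by (simp add: fun_eq_iff)
  thus ?thesis using f_cochain(1)[OF a(1)] unfolding cocycles_def by blast
qed

private lemma g_cocycle:
  assumes "a \<in> cocycles G M2 n" shows "g \<circ> a \<in> cocycles G M3 n"
proof -
  have a: "a \<in> cochains G M2 n" "std_differential G a = 0" using assms unfolding cocycles_def by auto
  have "std_differential G (g \<circ> a) = 0"
    unfolding g_cochain(2)[OF a(1)] a(2) using lin_on_diff(1)[OF g_lin_on rat2(1) rat3(1) rat2(2)] by (simp add: fun_eq_iff)
  thus ?thesis using g_cochain(1)[OF a(1)] unfolding cocycles_def by blast
qed

private lemma g_comp_f: "a \<in> cochains G M1 n \<Longrightarrow> g \<circ> (f \<circ> a) = 0"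
  using exact(4) cochains_in[OF rat(1)] by (auto simp: fun_eq_iff)

private lemma f_inj_cochain: "a \<in> cochains G M1 n \<Longrightarrow> b \<in> cochains G M1 n \<Longrightarrow> f \<circ> a = f \<circ> b \<Longrightarrow> a = b"
proof
  fix xs assume a: "a \<in> cochains G M1 n" "b \<in> cochains G M1 n" "f \<circ> a = f \<circ> b"
  show "a xs = b xs"
    using fun_cong[OF a(3), of xs] by (intro inj_onD[OF exact(3) _ cochains_in[OF rat(1) a(1)] cochains_in[OF rat(1) a(2)]]) simp
qed

private lemma kernel_cocycle:
  assumes "z \<in> cocycles G M2 n" "g \<circ> z = 0"
  shows "\<exists>z'\<in>cocycles G M1 n. z = f \<circ> z'"
proof -
  have zc: "z \<in> cochains G M2 n" "std_differential G z = 0" using assms(1) unfolding cocycles_def by auto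
  from cochain_kernel[OF rat ex zc(1) assms(2)]
  obtain z' where z': "z' \<in> cochains G M1 n" "z = f \<circ> z'" by (elim bexE)
  have "f \<circ> std_differential G z' = f \<circ> 0"
    using zc(2) f_cochain(2)[OF z'(1)] lin_on_diff(1)[OF f_lin_on rat1(1) rat2(1) rat1(2)] z'(2) by (simp add: fun_eq_iff)
  hence "std_differential G z' = 0"
    by (rule f_inj_cochain[OF diff_cochain[OF rat(1) z'(1)] cochains_closed(1)[OF rat(1)]])
  thus ?thesis using z' unfolding cocycles_def by (intro bexI[of _ z']) auto
qed

private lemmas cc = cochains_closed[OF rat(2)]

text \<open>The image of \<open>z\<close> in \<open>M3\<close> is the boundary of some
  \<open>e\<close>. Lifting \<open>e\<close> to \<open>M2\<close> and subtracting its boundary from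
  \<open>z\<close> leaves a cocycle with values in the kernel of \<open>g\<close>, hence one from
  \<open>M1\<close>.\<close>

lemma cocycle_from_sub:
  assumes "cocycles G M3 (Suc n) \<subseteq> coboundaries G M3 n" "z \<in> cocycles G M2 (Suc n)"
  shows "\<exists>z'\<in>cocycles G M1 (Suc n). z - (f \<circ> z') \<in> coboundaries G M2 n"
proof -
  have "g \<circ> z \<in> coboundaries G M3 n" using g_cocycle[OF assms(2)] assms(1) by blast
  then obtain e where e: "e \<in> cochains G M3 n" "g \<circ> z = std_differential G e" unfolding coboundaries_def by blast
  from cochain_lift[OF rat ex e(1)] obtain d where d: "d \<in> cochains G M2 n" "g \<circ> d = e" by (elim bexE)
  have zc: "z \<in> cochains G M2 (Suc n)" using assms(2) unfolding cocycles_def by blast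
  have w: "z - std_differential G d \<in> cocycles G M2 (Suc n)"
    using assms(2) cc(4)[OF zc diff_cochain[OF rat(2) d(1)]] diff_diff_cochain[OF rat(2) d(1)]
    unfolding cocycles_def by (simp add: diff_minus)
  have "g \<circ> (z - std_differential G d) = 0"
    using g_lin(2)[OF zc diff_cochain[OF rat(2) d(1)]] e(2) g_cochain(2)[OF d(1)] d(2) by simp
  from kernel_cocycle[OF w this]
  obtain z' where z': "z' \<in> cocycles G M1 (Suc n)" "z - std_differential G d = f \<circ> z'" by (elim bexE)
  have "z - (f \<circ> z') = std_differential G d" using z'(2) by (simp add: algebra_simps)
  thus ?thesis using z'(1) d(1) unfolding coboundaries_def by (intro bexI[of _ z']) auto
qed

text \<open>Vanishing in degree \<open>n\<close> for \<open>M3\<close> kills the connecting map, so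
  degree \<open>n + 1\<close> of \<open>M1\<close> embeds into that of \<open>M2\<close>. Since
  \<open>coboundaries\<close> is indexed by the source, \<open>n - 1\<close> refers to the
  coboundaries of degree \<open>n\<close>.\<close>

lemma Ext_sub_subquotient:
  assumes "cocycles G M3 n \<subseteq> coboundaries G M3 (n - 1)" "n > 0"
  shows "subquotient (fscale (scale M1)) (cocycles G M1 (Suc n)) (coboundaries G M1 n)
    (fscale (scale M2)) (cocycles G M2 (Suc n)) (coboundaries G M2 n)"
proof (rule subquotientI[where r = "\<lambda>z' z. z' \<in> cocycles G M1 (Suc n) \<and> z = f \<circ> z'"])
  note Z = subspaceD[OF vector_space_fscale[OF rat1(1)] cocycles_subspace[OF rat(1)]]
  have C: "z \<in> cochains G M1 (Suc n)" if "z \<in> cocycles G M1 (Suc n)" for z using that unfolding cocycles_def by blast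
  show "\<And>x y. x \<in> cocycles G M1 (Suc n) \<and> y = f \<circ> x \<Longrightarrow> x \<in> cocycles G M1 (Suc n) \<and> y \<in> cocycles G M2 (Suc n)"
    using f_cocycle by blast
  show "x + x' \<in> cocycles G M1 (Suc n) \<and> y + y' = f \<circ> (x + x')"
    if "x \<in> cocycles G M1 (Suc n) \<and> y = f \<circ> x" "x' \<in> cocycles G M1 (Suc n) \<and> y' = f \<circ> x'" for x y x' y'
    using that Z(2)[of x "Suc n" x'] f_lin(1)[OF C C, of x x'] by auto
  show "fscale (scale M1) c x \<in> cocycles G M1 (Suc n) \<and> fscale (scale M2) c y = f \<circ> fscale (scale M1) c x"
    if "x \<in> cocycles G M1 (Suc n) \<and> y = f \<circ> x" for c x y
    using that Z(3)[of x "Suc n" c] f_lin(2)[OF C, of x c] by auto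
  show "\<And>x. x \<in> cocycles G M1 (Suc n) \<Longrightarrow> \<exists>y. x \<in> cocycles G M1 (Suc n) \<and> y = f \<circ> x" by simp
  fix x y assume x: "x \<in> cocycles G M1 (Suc n) \<and> y = f \<circ> x" and "y \<in> coboundaries G M2 n"
  then obtain e where e: "e \<in> cochains G M2 n" "f \<circ> x = std_differential G e" unfolding coboundaries_def by blast
  obtain m where m: "n = Suc m" using assms(2) by (cases n) auto
  have "g \<circ> e \<in> cocycles G M3 n"
    using g_cochain[OF e(1)] g_comp_f[OF C[of x]] x e(2) unfolding cocycles_def by simp
  hence "g \<circ> e \<in> coboundaries G M3 m" using assms(1) m by auto
  then obtain c where c: "c \<in> cochains G M3 m" "g \<circ> e = std_differential G c" unfolding coboundaries_def by blast
  from cochain_lift[OF rat ex c(1)] obtain d where d: "d \<in> cochains G M2 m" "g \<circ> d = c" by (elim bexE)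
  have dd: "std_differential G d \<in> cochains G M2 n" unfolding m by (rule diff_cochain[OF rat(2) d(1)])
  have "g \<circ> (e - std_differential G d) = 0"
    using g_lin(2)[OF e(1) dd] c(2) g_cochain(2)[OF d(1)] d(2) by simp
  from cochain_kernel[OF rat ex cc(4)[OF e(1) dd] this]
  obtain e' where e': "e' \<in> cochains G M1 n" "e - std_differential G d = f \<circ> e'" by (elim bexE)
  have "f \<circ> std_differential G e' = std_differential G (e - std_differential G d)"
    using f_cochain(2)[OF e'(1)] e'(2) by simp
  also have "\<dots> = f \<circ> x" using e(2) diff_diff_cochain[OF rat(2) d(1)] by (simp add: diff_minus)
  finally have "x = std_differential G e'" using f_inj_cochain[OF diff_cochain[OF rat(1) e'(1)] C[of x]] x by simp
  thus "x \<in> coboundaries G M1 n" using e'(1) unfolding coboundaries_def by blast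
qed

text \<open>Vanishing for \<open>M1\<close> in degree \<open>n + 1\<close> makes the map induced by
  \<open>g\<close> injective: modulo the boundary of a lift, a cocycle that dies in
  \<open>M3\<close> comes from \<open>M1\<close>, where it is a boundary.\<close>

lemma Ext_middle_subquotient:
  assumes "cocycles G M1 (Suc n) \<subseteq> coboundaries G M1 n"
  shows "subquotient (fscale (scale M2)) (cocycles G M2 (Suc n)) (coboundaries G M2 n)
    (fscale (scale M3)) (cocycles G M3 (Suc n)) (coboundaries G M3 n)"
proof (rule subquotientI[where r = "\<lambda>z z'. z \<in> cocycles G M2 (Suc n) \<and> z' = g \<circ> z"])
  note Z = subspaceD[OF vector_space_fscale[OF rat2(1)] cocycles_subspace[OF rat(2)]]
  have C: "z \<in> cochains G M2 (Suc n)" if "z \<in> cocycles G M2 (Suc n)" for z using that unfolding cocycles_def by blast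
  show "\<And>x y. x \<in> cocycles G M2 (Suc n) \<and> y = g \<circ> x \<Longrightarrow> x \<in> cocycles G M2 (Suc n) \<and> y \<in> cocycles G M3 (Suc n)"
    using g_cocycle by blast
  show "x + x' \<in> cocycles G M2 (Suc n) \<and> y + y' = g \<circ> (x + x')"
    if "x \<in> cocycles G M2 (Suc n) \<and> y = g \<circ> x" "x' \<in> cocycles G M2 (Suc n) \<and> y' = g \<circ> x'" for x y x' y'
    using that Z(2)[of x "Suc n" x'] g_lin(1)[OF C C, of x x'] by auto
  show "fscale (scale M2) c x \<in> cocycles G M2 (Suc n) \<and> fscale (scale M3) c y = g \<circ> fscale (scale M2) c x"
    if "x \<in> cocycles G M2 (Suc n) \<and> y = g \<circ> x" for c x y
    using that Z(3)[of x "Suc n" c] g_lin(3)[OF C, of x c] by auto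
  show "\<And>x. x \<in> cocycles G M2 (Suc n) \<Longrightarrow> \<exists>y. x \<in> cocycles G M2 (Suc n) \<and> y = g \<circ> x" by simp
  fix x y assume x: "x \<in> cocycles G M2 (Suc n) \<and> y = g \<circ> x" and "y \<in> coboundaries G M3 n"
  then obtain e where e: "e \<in> cochains G M3 n" "g \<circ> x = std_differential G e" unfolding coboundaries_def by blast
  from cochain_lift[OF rat ex e(1)] obtain d where d: "d \<in> cochains G M2 n" "g \<circ> d = e" by (elim bexE)
  note dd = diff_cochain[OF rat(2) d(1)]
  have xc: "x \<in> cochains G M2 (Suc n)" using C x by blast
  have w: "x - std_differential G d \<in> cocycles G M2 (Suc n)"
    using x cc(4)[OF xc dd] diff_diff_cochain[OF rat(2) d(1)] unfolding cocycles_def by (simp add: diff_minus)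
  have "g \<circ> (x - std_differential G d) = 0"
    using g_lin(2)[OF xc dd] e(2) g_cochain(2)[OF d(1)] d(2) by simp
  from kernel_cocycle[OF w this]
  obtain z' where z': "z' \<in> cocycles G M1 (Suc n)" "x - std_differential G d = f \<circ> z'" by (elim bexE)
  have "z' \<in> coboundaries G M1 n" using z'(1) assms by blast
  then obtain b where b: "b \<in> cochains G M1 n" "z' = std_differential G b" unfolding coboundaries_def by blast
  have "x = std_differential G d + (f \<circ> z')" using z'(2) by (simp add: algebra_simps)
  also have "\<dots> = std_differential G (d + (f \<circ> b))" unfolding b(2) diff_add f_cochain(2)[OF b(1)] ..
  finally show "x \<in> coboundaries G M2 n" using cc(2)[OF d(1) f_cochain(1)[OF b(1)]] unfolding coboundaries_def by blast
qed

text \<open>Here the relation is the graph of \<open>g\<close> read backwards. Vanishing for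
  \<open>M1\<close> in degree \<open>n + 2\<close> makes it total: the boundary of any lift of a
  cocycle of \<open>M3\<close> comes from \<open>M1\<close>, is a boundary there, and so the lift
  can be corrected to a cocycle.\<close>

lemma Ext_quotient_subquotient:
  assumes "cocycles G M1 (Suc (Suc n)) \<subseteq> coboundaries G M1 (Suc n)"
  shows "subquotient (fscale (scale M3)) (cocycles G M3 (Suc n)) (coboundaries G M3 n)
    (fscale (scale M2)) (cocycles G M2 (Suc n)) (coboundaries G M2 n)"
proof (rule subquotientI[where r = "\<lambda>z' z. z \<in> cocycles G M2 (Suc n) \<and> z' = g \<circ> z"])
  note Z = subspaceD[OF vector_space_fscale[OF rat2(1)] cocycles_subspace[OF rat(2)]]
  have C: "z \<in> cochains G M2 (Suc n)" if "z \<in> cocycles G M2 (Suc n)" for z using that unfolding cocycles_def by blast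
  show "\<And>y x. x \<in> cocycles G M2 (Suc n) \<and> y = g \<circ> x \<Longrightarrow> y \<in> cocycles G M3 (Suc n) \<and> x \<in> cocycles G M2 (Suc n)"
    using g_cocycle by blast
  show "x + x' \<in> cocycles G M2 (Suc n) \<and> y + y' = g \<circ> (x + x')"
    if "x \<in> cocycles G M2 (Suc n) \<and> y = g \<circ> x" "x' \<in> cocycles G M2 (Suc n) \<and> y' = g \<circ> x'" for x y x' y'
    using that Z(2)[of x "Suc n" x'] g_lin(1)[OF C C, of x x'] by auto
  show "fscale (scale M2) c x \<in> cocycles G M2 (Suc n) \<and> fscale (scale M3) c y = g \<circ> fscale (scale M2) c x"
    if "x \<in> cocycles G M2 (Suc n) \<and> y = g \<circ> x" for c x y
    using that Z(3)[of x "Suc n" c] g_lin(3)[OF C, of x c] by auto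
  show "\<exists>x. x \<in> cocycles G M2 (Suc n) \<and> y = g \<circ> x" if y: "y \<in> cocycles G M3 (Suc n)" for y
  proof -
    have yc: "y \<in> cochains G M3 (Suc n)" "std_differential G y = 0" using y unfolding cocycles_def by auto
    from cochain_lift[OF rat ex yc(1)] obtain x where x: "x \<in> cochains G M2 (Suc n)" "g \<circ> x = y" by (elim bexE)
    have dx: "std_differential G x \<in> cocycles G M2 (Suc (Suc n))"
      using diff_cochain[OF rat(2) x(1)] diff_diff_cochain[OF rat(2) x(1)] unfolding cocycles_def by blast
    have "g \<circ> std_differential G x = 0" using g_cochain(2)[OF x(1)] x(2) yc(2) by simp
    from kernel_cocycle[OF dx this]
    obtain z' where z': "z' \<in> cocycles G M1 (Suc (Suc n))" "std_differential G x = f \<circ> z'" by (elim bexE)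
    have "z' \<in> coboundaries G M1 (Suc n)" using z'(1) assms by blast
    then obtain b where b: "b \<in> cochains G M1 (Suc n)" "z' = std_differential G b" unfolding coboundaries_def by blast
    have "x - (f \<circ> b) \<in> cocycles G M2 (Suc n)"
      using cc(4)[OF x(1) f_cochain(1)[OF b(1)]] f_cochain(2)[OF b(1)] z'(2) b(2) unfolding cocycles_def by (simp add: diff_minus)
    moreover have "y = g \<circ> (x - (f \<circ> b))"
      using g_lin(2)[OF x(1) f_cochain(1)[OF b(1)]] g_comp_f[OF b(1)] x(2) by simp
    ultimately show ?thesis by (intro exI[of _ "x - (f \<circ> b)"]) (rule conjI)
  qed
  fix y x assume x: "x \<in> cocycles G M2 (Suc n) \<and> y = g \<circ> x" and "x \<in> coboundaries G M2 n"
  then obtain e where e: "e \<in> cochains G M2 n" "x = std_differential G e" unfolding coboundaries_def by blast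
  have "y = std_differential G (g \<circ> e)" using x e(2) g_cochain(2)[OF e(1)] by simp
  thus "y \<in> coboundaries G M3 n" using g_cochain(1)[OF e(1)] unfolding coboundaries_def by blast
qed

end

end

section \<open>Tensor products\<close>

lemma vector_space_mult: "vector_space ((*) :: 'k::field \<Rightarrow> 'k \<Rightarrow> 'k)"
  by unfold_locales (simp_all add: algebra_simps)

lemma tensor_sel:
  "space (M \<otimes>\<^sub>k N) = module.span (fscale (*)) {pure_tensor M N v w | v w. v \<in> space M \<and> w \<in> space N}"
  "scale (M \<otimes>\<^sub>k N) = fscale (*)"
  "act (M \<otimes>\<^sub>k N) x \<Theta> = (\<lambda>\<beta>. if bilinear_form M N \<beta> then \<Theta> (\<lambda>v w. \<beta> (act M x v) (act N x w)) else 0)"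
  by (simp_all add: tensor_def)

lemma bilinear_formD:
  assumes "bilinear_form M N \<beta>"
  shows "\<And>v v' w. v \<in> space M \<Longrightarrow> v' \<in> space M \<Longrightarrow> w \<in> space N \<Longrightarrow> \<beta> (v + v') w = \<beta> v w + \<beta> v' w"
    "\<And>v w w'. v \<in> space M \<Longrightarrow> w \<in> space N \<Longrightarrow> w' \<in> space N \<Longrightarrow> \<beta> v (w + w') = \<beta> v w + \<beta> v w'"
    "\<And>c v w. v \<in> space M \<Longrightarrow> w \<in> space N \<Longrightarrow> \<beta> (scale M c v) w = c * \<beta> v w"
    "\<And>c v w. v \<in> space M \<Longrightarrow> w \<in> space N \<Longrightarrow> \<beta> v (scale N c w) = c * \<beta> v w"
  using assms unfolding bilinear_form_def by simp_all

lemma pure_tensor_bilinear: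
  "v \<in> space M \<Longrightarrow> v' \<in> space M \<Longrightarrow> w \<in> space N \<Longrightarrow>
     pure_tensor M N (v + v') w = pure_tensor M N v w + pure_tensor M N v' w"
  "v \<in> space M \<Longrightarrow> w \<in> space N \<Longrightarrow> w' \<in> space N \<Longrightarrow>
     pure_tensor M N v (w + w') = pure_tensor M N v w + pure_tensor M N v w'"
  "v \<in> space M \<Longrightarrow> w \<in> space N \<Longrightarrow> pure_tensor M N (scale M c v) w = fscale (*) c (pure_tensor M N v w)"
  "v \<in> space M \<Longrightarrow> w \<in> space N \<Longrightarrow> pure_tensor M N v (scale N c w) = fscale (*) c (pure_tensor M N v w)"
  by (auto simp: pure_tensor_def fun_eq_iff fscale_apply bilinear_formD)

lemma pure_tensor_zero:
  "0 \<in> space M \<Longrightarrow> w \<in> space N \<Longrightarrow> pure_tensor M N 0 w = 0"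
  "v \<in> space M \<Longrightarrow> 0 \<in> space N \<Longrightarrow> pure_tensor M N v 0 = 0"
  using pure_tensor_bilinear(1)[of 0 M 0 w N] pure_tensor_bilinear(2)[of v M 0 N 0] by simp_all

lemma tensor_vector_space: "vector_space (scale (M \<otimes>\<^sub>k N))"
  unfolding tensor_sel by (rule vector_space_fscale[OF vector_space_mult])

lemma tensor_subspace: "module.subspace (scale (M \<otimes>\<^sub>k N)) (space (M \<otimes>\<^sub>k N))"
proof -
  interpret vector_space "scale (M \<otimes>\<^sub>k N)" by (rule tensor_vector_space)
  show ?thesis using subspace_span unfolding tensor_sel .
qed

lemma pure_tensor_in:
  fixes M :: "('g, 'k::field, 'v::ab_group_add) gmodule" and N :: "('g, 'k, 'w::ab_group_add) gmodule"
  assumes "v \<in> space M" "w \<in> space N"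
  shows "pure_tensor M N v w \<in> space (M \<otimes>\<^sub>k N)"
proof -
  interpret vector_space "fscale (*) :: 'k \<Rightarrow> (('v \<Rightarrow> 'w \<Rightarrow> 'k) \<Rightarrow> 'k) \<Rightarrow> _"
    by (rule vector_space_fscale[OF vector_space_mult])
  from assms
  have "pure_tensor M N v w \<in> {pure_tensor M N v w | v w. v \<in> space M \<and> w \<in> space N}" by blast
  thus ?thesis unfolding tensor_sel by (rule span_base)
qed

lemma tensor_closed:
  "0 \<in> space (M \<otimes>\<^sub>k N)"
  "\<Theta> \<in> space (M \<otimes>\<^sub>k N) \<Longrightarrow> \<Theta>' \<in> space (M \<otimes>\<^sub>k N) \<Longrightarrow> \<Theta> + \<Theta>' \<in> space (M \<otimes>\<^sub>k N)"
  "\<Theta> \<in> space (M \<otimes>\<^sub>k N) \<Longrightarrow> fscale (*) c \<Theta> \<in> space (M \<otimes>\<^sub>k N)"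
proof -
  interpret vector_space "scale (M \<otimes>\<^sub>k N)" by (rule tensor_vector_space)
  note S = subspace_0[OF tensor_subspace] subspace_add[OF tensor_subspace] subspace_scale[OF tensor_subspace]
  show "0 \<in> space (M \<otimes>\<^sub>k N)" by (rule S(1))
  show "\<Theta> \<in> space (M \<otimes>\<^sub>k N) \<Longrightarrow> \<Theta>' \<in> space (M \<otimes>\<^sub>k N) \<Longrightarrow> \<Theta> + \<Theta>' \<in> space (M \<otimes>\<^sub>k N)" by (rule S(2))
  show "\<Theta> \<in> space (M \<otimes>\<^sub>k N) \<Longrightarrow> fscale (*) c \<Theta> \<in> space (M \<otimes>\<^sub>k N)" using S(3)[of \<Theta> c] unfolding tensor_sel(2) .
qed

text \<open>Scalars are absorbed into the first factor, which is why closure of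
  \<open>space M\<close> under scaling is required and why the step adds a pure tensor without a
  coefficient.\<close>

lemma tensor_induct [consumes 2, case_names zero step]:
  fixes M :: "('g, 'k::field, 'v::ab_group_add) gmodule" and N :: "('g, 'k, 'w::ab_group_add) gmodule"
  assumes "\<Theta> \<in> space (M \<otimes>\<^sub>k N)" "\<forall>c. \<forall>v\<in>space M. scale M c v \<in> space M" "P 0"
    and step: "\<And>v w \<Theta>. v \<in> space M \<Longrightarrow> w \<in> space N \<Longrightarrow> \<Theta> \<in> space (M \<otimes>\<^sub>k N) \<Longrightarrow> P \<Theta> \<Longrightarrow>
      P (pure_tensor M N v w + \<Theta>)"
  shows "P \<Theta>"
proof -
  interpret vector_space "fscale (*) :: 'k \<Rightarrow> (('v \<Rightarrow> 'w \<Rightarrow> 'k) \<Rightarrow> 'k) \<Rightarrow> _"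
    by (rule vector_space_fscale[OF vector_space_mult])
  have "\<Theta> \<in> space (M \<otimes>\<^sub>k N) \<and> P \<Theta>"
    using assms(1) unfolding tensor_sel(1)
  proof (induction rule: span_induct_alt)
    case base show ?case using assms(3) span_zero by blast
  next
    case (step c x \<Theta>)
    from step(1) obtain v w where x: "x = pure_tensor M N v w" "v \<in> space M" "w \<in> space N" by blast
    have T: "\<Theta> \<in> space (M \<otimes>\<^sub>k N)" "P \<Theta>" using step(2) unfolding tensor_sel by auto
    have cv: "scale M c v \<in> space M" by (rule bspec[OF spec[OF assms(2)] x(2)])
    have e: "fscale (*) c x + \<Theta> = pure_tensor M N (scale M c v) w + \<Theta>"
      unfolding x(1) pure_tensor_bilinear(3)[OF x(2,3)] ..
    have "P (pure_tensor M N (scale M c v) w + \<Theta>)" by (rule assms(4)[OF cv x(3) T])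
    moreover have "pure_tensor M N (scale M c v) w + \<Theta> \<in> space (M \<otimes>\<^sub>k N)"
      by (rule tensor_closed(2)[OF pure_tensor_in[OF cv x(3)] T(1)])
    ultimately show ?case unfolding e tensor_sel by blast
  qed
  thus ?thesis ..
qed

text \<open>This is \<open>f\<close> tensored with the identity of \<open>N\<close>. Tensors are
  functionals on bilinear forms, so the map works by pulling forms back along
  \<open>f\<close>.\<close>

definition tensor_map ::
    "('g, 'k::field, 'w::ab_group_add) gmodule \<Rightarrow> ('g, 'k, 'u::ab_group_add) gmodule \<Rightarrow> ('v \<Rightarrow> 'w) \<Rightarrow>
     (('v \<Rightarrow> 'u \<Rightarrow> 'k) \<Rightarrow> 'k) \<Rightarrow> ('w \<Rightarrow> 'u \<Rightarrow> 'k) \<Rightarrow> 'k" where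
  "tensor_map M N f \<Theta> = (\<lambda>\<beta>. if bilinear_form M N \<beta> then \<Theta> (\<lambda>v w. \<beta> (f v) w) else 0)"

lemma tensor_map_linear:
  "tensor_map M N f (\<Theta> + \<Theta>') = tensor_map M N f \<Theta> + tensor_map M N f \<Theta>'"
  "tensor_map M N f (fscale (*) c \<Theta>) = fscale (*) c (tensor_map M N f \<Theta>)"
  "tensor_map M N f 0 = 0"
  by (auto simp: tensor_map_def fun_eq_iff fscale_apply)

lemma tensor_map_pure:
  assumes "lin_on (scale M) (scale M') (space M) (space M') f"
  shows "tensor_map M' N f (pure_tensor M N v w) = pure_tensor M' N (f v) w"
proof
  fix \<beta>
  have "bilinear_form M N (\<lambda>v w. \<beta> (f v) w)" if "bilinear_form M' N \<beta>"
    unfolding bilinear_form_def using lin_onD[OF assms] bilinear_formD[OF that] by simp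
  thus "tensor_map M' N f (pure_tensor M N v w) \<beta> = pure_tensor M' N (f v) w \<beta>"
    by (simp add: tensor_map_def pure_tensor_def)
qed

lemma tensor_map_lin_on:
  assumes "lin_on (scale M) (scale M') (space M) (space M') f" "\<forall>c. \<forall>v\<in>space M. scale M c v \<in> space M"
  shows "lin_on (scale (M \<otimes>\<^sub>k N)) (scale (M' \<otimes>\<^sub>k N)) (space (M \<otimes>\<^sub>k N)) (space (M' \<otimes>\<^sub>k N)) (tensor_map M' N f)"
  unfolding lin_on_def
proof (intro conjI ballI allI)
  fix \<Theta> assume "\<Theta> \<in> space (M \<otimes>\<^sub>k N)"
  thus "tensor_map M' N f \<Theta> \<in> space (M' \<otimes>\<^sub>k N)" using assms(2)
  proof (induction rule: tensor_induct)
    case zero show ?case unfolding tensor_map_linear by (rule tensor_closed(1))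
  next
    case (step v w \<Theta>)
    show ?case unfolding tensor_map_linear tensor_map_pure[OF assms(1)]
      by (rule tensor_closed(2)[OF pure_tensor_in[OF lin_onD(1)[OF assms(1) step(1)] step(2)] step(4)])
  qed
qed (simp_all add: tensor_sel(2) tensor_map_linear)

lemma tensor_map_comp:
  assumes "lin_on (scale M) (scale M') (space M) (space M') f" "\<forall>c. \<forall>v\<in>space M. scale M c v \<in> space M"
    and "lin_on (scale M') (scale M'') (space M') (space M'') g"
    and "lin_on (scale M) (scale M'') (space M) (space M'') h" "\<And>v. v \<in> space M \<Longrightarrow> g (f v) = h v"
    and "\<Theta> \<in> space (M \<otimes>\<^sub>k N)"
  shows "tensor_map M'' N g (tensor_map M' N f \<Theta>) = tensor_map M'' N h \<Theta>"
  using assms(6,2)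
proof (induction rule: tensor_induct)
  case zero show ?case by (simp only: tensor_map_linear add_0_left)
next
  case (step v w \<Theta>)
  show ?case
    by (simp only: tensor_map_linear tensor_map_pure[OF assms(1)] tensor_map_pure[OF assms(3)]
        tensor_map_pure[OF assms(4)] step(4) assms(5)[OF step(1)])
qed

lemma tensor_map_ident:
  assumes "\<forall>c. \<forall>v\<in>space M. scale M c v \<in> space M" "\<And>v. v \<in> space M \<Longrightarrow> f v = v" 
    and "lin_on (scale M) (scale M) (space M) (space M) f" "\<Theta> \<in> space (M \<otimes>\<^sub>k N)"
  shows "tensor_map M N f \<Theta> = \<Theta>"
  using assms(4,1)
proof (induction rule: tensor_induct)
  case zero show ?case by (simp only: tensor_map_linear add_0_left)
next
  case (step v w \<Theta>)
  show ?case by (simp only: tensor_map_linear tensor_map_pure[OF assms(3)] step(4) assms(2)[OF step(1)])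
qed

section \<open>Tensor products of rational modules\<close>

context coord_group
begin

context
  fixes N :: "('g, 'k, 'w::ab_group_add) gmodule"
  assumes N: "rational_module G N"
begin

private lemmas RN = rationalD[OF N]

lemma tensor_act_linear:
  "act (M \<otimes>\<^sub>k N) x (\<Theta> + \<Theta>') = act (M \<otimes>\<^sub>k N) x \<Theta> + act (M \<otimes>\<^sub>k N) x \<Theta>'"
  "act (M \<otimes>\<^sub>k N) x (fscale (*) c \<Theta>) = fscale (*) c (act (M \<otimes>\<^sub>k N) x \<Theta>)"
  "act (M \<otimes>\<^sub>k N) x 0 = 0"
  by (auto simp: tensor_sel(3) fun_eq_iff fscale_apply)

lemma tensor_act_pure:
  assumes "rational_module G M" "x \<in> carrier G"
  shows "act (M \<otimes>\<^sub>k N) x (pure_tensor M N v w) = pure_tensor M N (act M x v) (act N x w)"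
proof
  note RM = rationalD[OF assms(1)]
  fix \<beta>
  have "bilinear_form M N (\<lambda>v w. \<beta> (act M x v) (act N x w))" if "bilinear_form M N \<beta>"
    unfolding bilinear_form_def using assms(2) bilinear_formD[OF that]
    by (simp add: RM(3-5) RN(3-5))
  thus "act (M \<otimes>\<^sub>k N) x (pure_tensor M N v w) \<beta> = pure_tensor M N (act M x v) (act N x w) \<beta>"
    by (simp add: tensor_sel(3) pure_tensor_def)
qed

lemma tensor_rational:
  assumes M: "rational_module G M"
  shows "rational_module G (M \<otimes>\<^sub>k N)"
proof -
  note RM = rationalD[OF M]
  have sM: "\<forall>c. \<forall>v\<in>space M. scale M c v \<in> space M" using subspaceD(3)[OF RM(1,2)] by simp
  let ?T = "M \<otimes>\<^sub>k N"
  note act_pure = tensor_act_pure[OF M]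
  have vs: "vector_space (fscale (*) :: 'k \<Rightarrow> (('a \<Rightarrow> 'w \<Rightarrow> 'k) \<Rightarrow> 'k) \<Rightarrow> _)"
    by (rule vector_space_fscale[OF vector_space_mult])
  have act_in: "act ?T x \<Theta> \<in> space ?T" if x: "x \<in> carrier G" and "\<Theta> \<in> space ?T" for x \<Theta>
    using that(2) sM
  proof (induction rule: tensor_induct)
    case zero show ?case unfolding tensor_act_linear by (rule tensor_closed(1))
  next
    case (step v w \<Theta>)
    show ?case unfolding tensor_act_linear act_pure[OF x]
      by (rule tensor_closed(2)[OF pure_tensor_in[OF RM(3)[OF x step(1)] RN(3)[OF x step(2)]] step(4)])
  qed
  have act_one: "act ?T \<one> \<Theta> = \<Theta>" if "\<Theta> \<in> space ?T" for \<Theta>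
    using that sM
  proof (induction rule: tensor_induct)
    case zero show ?case by (rule tensor_act_linear(3))
  next
    case (step v w \<Theta>)
    show ?case unfolding tensor_act_linear act_pure[OF one_closed] step(4) RM(6)[OF step(1)] RN(6)[OF step(2)] ..
  qed
  have act_mult: "act ?T (x \<otimes> y) \<Theta> = act ?T x (act ?T y \<Theta>)"
    if x: "x \<in> carrier G" and y: "y \<in> carrier G" and "\<Theta> \<in> space ?T" for x y \<Theta>
    using that(3) sM
  proof (induction rule: tensor_induct)
    case zero show ?case by (simp only: tensor_act_linear(3))
  next
    case (step v w \<Theta>)
    show ?case unfolding tensor_act_linear act_pure[OF x] act_pure[OF y] act_pure[OF m_closed[OF x y]] step(4)
      RM(7)[OF x y step(1)] RN(7)[OF x y step(2)] ..
  qed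
  have act_reg: "(\<lambda>x. if x \<in> carrier G then act ?T x \<Theta> else 0) \<in> regular_maps G (fscale (*)) (space ?T)"
    if "\<Theta> \<in> space ?T" for \<Theta>
    using that sM
  proof (induction rule: tensor_induct)
    case zero
    show ?case unfolding tensor_act_linear if_cancel by (rule reg_closed(6)[OF vs])
  next
    case (step v w \<Theta>)
    \<comment> \<open>Regularity of the orbit of a pure tensor, where both factors move. For a fixed
      first factor \<open>u\<close> the map is a linear image of the orbit map of \<open>w\<close>;
      \<open>reg_bilin\<close> then lets \<open>u\<close> vary along the orbit of
      \<open>v\<close>.\<close>
    have A: "(\<lambda>x. if x \<in> carrier G then (\<lambda>x v. pure_tensor M N v (act N x w)) x
        (if x \<in> carrier G then act M x v else 0) else 0) \<in> regular_maps G (fscale (*)) (space ?T)"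
    proof (rule reg_bilin[OF RM(8)[OF step(1)] RM(1) vs RM(2)])
      fix u assume u: "u \<in> space M"
      have 1: "(\<lambda>x. pure_tensor M N u (if x \<in> carrier G then act N x w else 0)) \<in> regular_maps G (fscale (*)) (space ?T)"
        by (rule reg_linear[OF RN(8)[OF step(2)] RN(1) vs RN(2)])
          (auto intro: pure_tensor_in[OF u] pure_tensor_bilinear(2,4)[OF u])
      have 2: "pure_tensor M N u 0 = 0"
        by (rule pure_tensor_zero(2)[OF u subspaceD(1)[OF RN(1,2)]])
      have "(\<lambda>x. pure_tensor M N u (if x \<in> carrier G then act N x w else 0)) =
          (\<lambda>x. if x \<in> carrier G then pure_tensor M N u (act N x w) else 0)"
        using 2 by auto
      with 1 show "(\<lambda>x. if x \<in> carrier G then pure_tensor M N u (act N x w) else 0) \<in> regular_maps G (fscale (*)) (space ?T)"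
        by simp
    next
      fix x u u' c assume x: "x \<in> carrier G" and u: "u \<in> space M"
      note xw = RN(3)[OF x step(2)]
      show "pure_tensor M N (u + u') (act N x w) = pure_tensor M N u (act N x w) + pure_tensor M N u' (act N x w)"
        if "u' \<in> space M" by (rule pure_tensor_bilinear(1)[OF u that xw])
      show "pure_tensor M N (scale M c u) (act N x w) = fscale (*) c (pure_tensor M N u (act N x w))"
        by (rule pure_tensor_bilinear(3)[OF u xw])
    qed
    have "(\<lambda>x. if x \<in> carrier G then (\<lambda>x v. pure_tensor M N v (act N x w)) x
        (if x \<in> carrier G then act M x v else 0) else 0) =
      (\<lambda>x. if x \<in> carrier G then pure_tensor M N (act M x v) (act N x w) else 0)"
      by (rule ext) simp
    from reg_closed(2)[OF vs A[unfolded this] step(4)]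
    have "(\<lambda>x. if x \<in> carrier G then pure_tensor M N (act M x v) (act N x w) else 0) +
       (\<lambda>x. if x \<in> carrier G then act ?T x \<Theta> else 0) \<in> regular_maps G (fscale (*)) (space ?T)" .
    also have "(\<lambda>x. if x \<in> carrier G then pure_tensor M N (act M x v) (act N x w) else 0) +
       (\<lambda>x. if x \<in> carrier G then act ?T x \<Theta> else 0) =
       (\<lambda>x. if x \<in> carrier G then act ?T x (pure_tensor M N v w + \<Theta>) else 0)"
      by (rule ext) (simp add: tensor_act_linear(1) act_pure)
    finally show ?case .
  qed
  show ?thesis unfolding rational_module_def
  proof (intro conjI ballI allI)
    show "vector_space (scale ?T)" by (rule tensor_vector_space)
    show "module.subspace (scale ?T) (space ?T)" by (rule tensor_subspace)
    fix x y \<Theta> \<Theta>' c assume "\<Theta> \<in> space ?T"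
    show "act ?T x (\<Theta> + \<Theta>') = act ?T x \<Theta> + act ?T x \<Theta>'" by (rule tensor_act_linear)
    show "act ?T x (scale ?T c \<Theta>) = scale ?T c (act ?T x \<Theta>)" unfolding tensor_sel(2) by (rule tensor_act_linear)
    show "act ?T \<one> \<Theta> = \<Theta>" by (rule act_one) fact
    show "act ?T x \<Theta> \<in> space ?T" if "x \<in> carrier G" by (rule act_in) fact+
    show "act ?T (x \<otimes> y) \<Theta> = act ?T x (act ?T y \<Theta>)" if "x \<in> carrier G" "y \<in> carrier G" by (rule act_mult) fact+
    show "(\<lambda>x. if x \<in> carrier G then act ?T x \<Theta> else 0) \<in> regular_maps G (scale ?T) (space ?T)"
      unfolding tensor_sel(2) by (rule act_reg) fact
  qed
qed

lemma tensor_map_ghom: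
  assumes "rational_module G M" "rational_module G M'" "ghom G M M' f"
  shows "ghom G (M \<otimes>\<^sub>k N) (M' \<otimes>\<^sub>k N) (tensor_map M' N f)"
proof -
  note RM = rationalD[OF assms(1)] and L = ghom_lin_on[OF assms(3)]
  have sM: "\<forall>c. \<forall>v\<in>space M. scale M c v \<in> space M" using subspaceD(3)[OF RM(1,2)] by simp
  have "tensor_map M' N f (act (M \<otimes>\<^sub>k N) x \<Theta>) = act (M' \<otimes>\<^sub>k N) x (tensor_map M' N f \<Theta>)"
    if x: "x \<in> carrier G" and "\<Theta> \<in> space (M \<otimes>\<^sub>k N)" for x \<Theta>
    using that(2) sM
  proof (induction rule: tensor_induct)
    case zero show ?case by (simp only: tensor_act_linear(3) tensor_map_linear(3))
  next
    case (step v w \<Theta>)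
    show ?case
      unfolding tensor_act_linear tensor_map_linear step(4) tensor_act_pure[OF assms(1) x]
        tensor_map_pure[OF L] tensor_act_pure[OF assms(2) x] ghomD(4)[OF assms(3) x step(1)] ..
  qed
  with tensor_map_lin_on[OF L sM] show ?thesis unfolding lin_on_def ghom_def by simp
qed

text \<open>Over a field the sequence splits linearly, and the identities expressing the splitting
  survive tensoring. The splitting serves only to find preimages; the maps themselves remain
  equivariant.\<close>

lemma tensor_short_exact:
  assumes rat: "rational_module G M1" "rational_module G M2" "rational_module G M3"
    and ex: "short_exact G M1 f M2 g M3"
  shows "short_exact G (M1 \<otimes>\<^sub>k N) (tensor_map M2 N f) (M2 \<otimes>\<^sub>k N) (tensor_map M3 N g) (M3 \<otimes>\<^sub>k N)"
proof -
  note R1 = rationalD[OF rat(1)] and R2 = rationalD[OF rat(2)] and R3 = rationalD[OF rat(3)]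
  have fg: "ghom G M1 M2 f" "ghom G M2 M3 g" "inj_on f (space M1)"
    "f ` space M1 = {v \<in> space M2. g v = 0}" "g ` space M2 = space M3"
    using ex unfolding short_exact_def by simp_all
  note Lf = ghom_lin_on[OF fg(1)] and Lg = ghom_lin_on[OF fg(2)]
  have s1: "\<forall>c. \<forall>v\<in>space M1. scale M1 c v \<in> space M1" using subspaceD(3)[OF R1(1,2)] by simp
  have s2: "\<forall>c. \<forall>v\<in>space M2. scale M2 c v \<in> space M2" using subspaceD(3)[OF R2(1,2)] by simp
  have s3: "\<forall>c. \<forall>v\<in>space M3. scale M3 c v \<in> space M3" using subspaceD(3)[OF R3(1,2)] by simp
  note g0 = lin_on_diff[OF Lg R2(1) R3(1) R2(2)]
  obtain h where h: "lin_on (scale M2) (scale M1) (space M2) (space M1) h" "\<And>v. v \<in> space M1 \<Longrightarrow> h (f v) = v"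
    by (rule lin_on_left_inverse[OF Lf R1(1) R2(1) R1(2) R2(2) fg(3)]) (rule that)
  obtain s where s: "lin_on (scale M3) (scale M2) (space M3) (space M2) s" "\<And>w. w \<in> space M3 \<Longrightarrow> g (s w) = w"
    by (rule lin_on_right_inverse[OF Lg R2(1) R3(1) R2(2) R3(2) fg(5)]) (rule that)
  \<comment> \<open>The left inverse \<open>h\<close> and the section \<open>s\<close> are unrelated
    choices. Evaluating \<open>h\<close> after removing \<open>s (g v)\<close> makes them
    compatible: \<open>f (h' v) + s (g v) = v\<close>.\<close>
  define h' where "h' v = h (v - s (g v))" for v
  have sg: "s (g v) \<in> space M2" if "v \<in> space M2" for v using lin_onD(1)[OF s(1) lin_onD(1)[OF Lg that]] .
  have vsg: "v - s (g v) \<in> space M2" if "v \<in> space M2" for v using subspaceD(4)[OF R2(1,2) that sg[OF that]] .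
  have h': "lin_on (scale M2) (scale M1) (space M2) (space M1) h'"
    unfolding lin_on_def
  proof (intro conjI ballI allI)
    interpret V: vector_space "scale M2" by (rule R2(1))
    fix v w c assume v: "v \<in> space M2"
    show "h' v \<in> space M1" unfolding h'_def by (rule lin_onD(1)[OF h(1) vsg[OF v]])
    show "h' (scale M2 c v) = scale M1 c (h' v)"
      unfolding h'_def lin_onD(3)[OF Lg v] lin_onD(3)[OF s(1) lin_onD(1)[OF Lg v]]
        V.scale_right_diff_distrib[symmetric] by (rule lin_onD(3)[OF h(1) vsg[OF v]])
    assume w: "w \<in> space M2"
    show "h' (v + w) = h' v + h' w"
      unfolding h'_def lin_onD(2)[OF Lg v w] lin_onD(2)[OF s(1) lin_onD(1)[OF Lg v] lin_onD(1)[OF Lg w]]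
        add_diff_add by (rule lin_onD(2)[OF h(1) vsg[OF v] vsg[OF w]])
  qed
  have fh': "f (h' v) = v - s (g v)" if v: "v \<in> space M2" for v
  proof -
    have "g (v - s (g v)) = 0"
      using g0(2)[OF v sg[OF v]] s(2)[OF lin_onD(1)[OF Lg v]] by simp
    hence "v - s (g v) \<in> f ` space M1" unfolding fg(4) using vsg[OF v] by blast
    then obtain u where u: "u \<in> space M1" "v - s (g v) = f u" by blast
    thus ?thesis unfolding h'_def using h(2)[OF u(1)] by simp
  qed
  have id1: "lin_on (scale M1) (scale M1) (space M1) (space M1) (\<lambda>v. v)"
    and id3: "lin_on (scale M3) (scale M3) (space M3) (space M3) (\<lambda>v. v)"
    by (simp_all add: lin_on_def)
  have split: "\<Theta> = tensor_map M2 N f (tensor_map M1 N h' \<Theta>) + tensor_map M2 N s (tensor_map M3 N g \<Theta>)"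
    if "\<Theta> \<in> space (M2 \<otimes>\<^sub>k N)" for \<Theta>
    using that s2
  proof (induction rule: tensor_induct)
    case zero show ?case by (simp only: tensor_map_linear add_0_left)
  next
    case (step v w \<Theta>)
    let ?F = "tensor_map M2 N f (tensor_map M1 N h' \<Theta>)" and ?S = "tensor_map M2 N s (tensor_map M3 N g \<Theta>)"
    have "pure_tensor M2 N v w = pure_tensor M2 N (f (h' v) + s (g v)) w" using fh'[OF step(1)] by simp
    also have "\<dots> = pure_tensor M2 N (f (h' v)) w + pure_tensor M2 N (s (g v)) w"
      by (rule pure_tensor_bilinear(1)[OF lin_onD(1)[OF Lf lin_onD(1)[OF h' step(1)]] sg[OF step(1)] step(2)])
    finally have "pure_tensor M2 N v w + \<Theta> =
        (pure_tensor M2 N (f (h' v)) w + pure_tensor M2 N (s (g v)) w) + (?F + ?S)"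
      by (rule arg_cong2[where f = "(+)", OF _ step(4)])
    also have "\<dots> = (pure_tensor M2 N (f (h' v)) w + ?F) + (pure_tensor M2 N (s (g v)) w + ?S)"
      by (simp only: ac_simps)
    finally show ?case
      unfolding tensor_map_linear tensor_map_pure[OF h'] tensor_map_pure[OF Lf] tensor_map_pure[OF Lg]
        tensor_map_pure[OF s(1)] .
  qed
  have zero: "tensor_map M3 N g (tensor_map M2 N f \<Theta>) = 0" if "\<Theta> \<in> space (M1 \<otimes>\<^sub>k N)" for \<Theta>
    using that s1
  proof (induction rule: tensor_induct)
    case zero show ?case by (simp only: tensor_map_linear add_0_left)
  next
    case (step v w \<Theta>)
    have "g (f v) = 0" using fg(4) step(1) by blast
    moreover have "pure_tensor M3 N 0 w = 0"
      by (rule pure_tensor_zero(1)[OF subspaceD(1)[OF R3(1,2)] step(2)])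
    ultimately show ?case
      by (simp only: tensor_map_linear tensor_map_pure[OF Lf] tensor_map_pure[OF Lg] step(4) add_0)
  qed
  note Tf = tensor_map_lin_on[OF Lf s1] and Tg = tensor_map_lin_on[OF Lg s2]
    and Th = tensor_map_lin_on[OF h' s2] and Ts = tensor_map_lin_on[OF s(1) s3]
  show ?thesis unfolding short_exact_def
  proof (intro conjI)
    show "ghom G (M1 \<otimes>\<^sub>k N) (M2 \<otimes>\<^sub>k N) (tensor_map M2 N f)" by (rule tensor_map_ghom[OF rat(1,2) fg(1)])
    show "ghom G (M2 \<otimes>\<^sub>k N) (M3 \<otimes>\<^sub>k N) (tensor_map M3 N g)" by (rule tensor_map_ghom[OF rat(2,3) fg(2)])
    have hf: "tensor_map M1 N h (tensor_map M2 N f \<Theta>) = \<Theta>" if "\<Theta> \<in> space (M1 \<otimes>\<^sub>k N)" for \<Theta>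
      using tensor_map_comp[OF Lf s1 h(1) id1 h(2) that] tensor_map_ident[OF s1 refl id1 that] by simp
    show "inj_on (tensor_map M2 N f) (space (M1 \<otimes>\<^sub>k N))" by (rule inj_on_inverseI[where g = "tensor_map M1 N h"]) (rule hf)
    show "tensor_map M2 N f ` space (M1 \<otimes>\<^sub>k N) = {\<Theta> \<in> space (M2 \<otimes>\<^sub>k N). tensor_map M3 N g \<Theta> = 0}"
    proof (intro equalityI subsetI)
      fix \<Theta> assume "\<Theta> \<in> tensor_map M2 N f ` space (M1 \<otimes>\<^sub>k N)"
      then obtain \<Theta>' where "\<Theta>' \<in> space (M1 \<otimes>\<^sub>k N)" "\<Theta> = tensor_map M2 N f \<Theta>'" by (rule imageE)
      thus "\<Theta> \<in> {\<Theta> \<in> space (M2 \<otimes>\<^sub>k N). tensor_map M3 N g \<Theta> = 0}"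
        using lin_onD(1)[OF Tf] zero by simp
    next
      fix \<Theta> assume "\<Theta> \<in> {\<Theta> \<in> space (M2 \<otimes>\<^sub>k N). tensor_map M3 N g \<Theta> = 0}"
      hence t: "\<Theta> \<in> space (M2 \<otimes>\<^sub>k N)" "tensor_map M3 N g \<Theta> = 0" by auto
      have "tensor_map M2 N f (tensor_map M1 N h' \<Theta>) = \<Theta>"
        using split[OF t(1)] unfolding t(2) tensor_map_linear(3) add_0_right by (rule sym)
      with imageI[OF lin_onD(1)[OF Th t(1)], of "tensor_map M2 N f"]
      show "\<Theta> \<in> tensor_map M2 N f ` space (M1 \<otimes>\<^sub>k N)" by (simp only:)
    qed
    show "tensor_map M3 N g ` space (M2 \<otimes>\<^sub>k N) = space (M3 \<otimes>\<^sub>k N)"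
    proof (intro equalityI subsetI)
      fix \<Theta> assume "\<Theta> \<in> tensor_map M3 N g ` space (M2 \<otimes>\<^sub>k N)"
      then obtain \<Theta>' where "\<Theta>' \<in> space (M2 \<otimes>\<^sub>k N)" "\<Theta> = tensor_map M3 N g \<Theta>'" by (rule imageE)
      thus "\<Theta> \<in> space (M3 \<otimes>\<^sub>k N)" using lin_onD(1)[OF Tg] by simp
    next
      fix \<Theta> assume t: "\<Theta> \<in> space (M3 \<otimes>\<^sub>k N)"
      have "tensor_map M3 N g (tensor_map M2 N s \<Theta>) = \<Theta>"
        using tensor_map_comp[OF s(1) s3 Lg id3 s(2) t] tensor_map_ident[OF s3 refl id3 t] by simp
      with imageI[OF lin_onD(1)[OF Ts t], of "tensor_map M3 N g"]
      show "\<Theta> \<in> tensor_map M3 N g ` space (M2 \<otimes>\<^sub>k N)" by (simp only:)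
    qed
  qed
qed

end

end

section \<open>Rational modules and finite subgroups\<close>

lemma linear_functionals_separate:
  fixes t :: "'k::field \<Rightarrow> 'u::ab_group_add \<Rightarrow> 'u"
  assumes "vector_space t" "\<And>l. Vector_Spaces.linear t (*) l \<Longrightarrow> l x = l y"
  shows "x = y"
proof (rule ccontr)
  interpret T: vector_space t by fact
  interpret K: vector_space "(*) :: 'k \<Rightarrow> 'k \<Rightarrow> 'k" by (rule vector_space_mult)
  interpret P: vector_space_pair t "(*) :: 'k \<Rightarrow> 'k \<Rightarrow> 'k" ..
  assume "x \<noteq> y"
  hence "T.independent {x - y}" by (simp add: T.dependent_single)
  from P.linear_independent_extend[OF this, of "\<lambda>_. 1"]
  obtain l where l: "Vector_Spaces.linear t (*) l" "l (x - y) = 1" by auto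
  have "l (x - y + y) = l (x - y) + l y" using l(1) unfolding Vector_Spaces.linear_iff by blast
  thus False using l(2) assms(2)[OF l(1)] by simp
qed

text \<open>The universal property of the tensor product for targets other than \<open>k\<close>.
  The value at \<open>\<Theta>\<close> is the vector \<open>u\<close> with
  \<open>l u = \<Theta> (\<lambda>v w. l (b v w))\<close> for all functionals \<open>l\<close>.
  Functionals separate points, which gives uniqueness and hence linearity; existence is clear on
  pure tensors and additive.\<close>

lemma tensor_lift:
  fixes M :: "('g, 'k::field, 'v::ab_group_add) gmodule" and N :: "('g, 'k, 'w::ab_group_add) gmodule"
    and t :: "'k \<Rightarrow> 'u::ab_group_add \<Rightarrow> 'u"
  assumes sM: "\<forall>c. \<forall>v\<in>space M. scale M c v \<in> space M" and t: "vector_space t" "module.subspace t W"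
    and b: "\<And>v w. v \<in> space M \<Longrightarrow> w \<in> space N \<Longrightarrow> b v w \<in> W"
      "\<And>v v' w. v \<in> space M \<Longrightarrow> v' \<in> space M \<Longrightarrow> w \<in> space N \<Longrightarrow> b (v + v') w = b v w + b v' w"
      "\<And>v w w'. v \<in> space M \<Longrightarrow> w \<in> space N \<Longrightarrow> w' \<in> space N \<Longrightarrow> b v (w + w') = b v w + b v w'"
      "\<And>c v w. v \<in> space M \<Longrightarrow> w \<in> space N \<Longrightarrow> b (scale M c v) w = t c (b v w)"
      "\<And>c v w. v \<in> space M \<Longrightarrow> w \<in> space N \<Longrightarrow> b v (scale N c w) = t c (b v w)"
  obtains L where "lin_on (scale (M \<otimes>\<^sub>k N)) t (space (M \<otimes>\<^sub>k N)) W L"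
    "\<And>v w. v \<in> space M \<Longrightarrow> w \<in> space N \<Longrightarrow> L (pure_tensor M N v w) = b v w"
proof -
  interpret T: vector_space t by fact
  define rep where "rep \<Theta> u \<longleftrightarrow> u \<in> W \<and>
    (\<forall>l. Vector_Spaces.linear t (*) l \<longrightarrow> \<Theta> (\<lambda>v w. l (b v w)) = l u)" for \<Theta> u
  note W = T.subspace_0[OF t(2)] T.subspace_add[OF t(2)] T.subspace_scale[OF t(2)]
  have uniq: "u = u'" if "rep \<Theta> u" "rep \<Theta> u'" for \<Theta> u u'
  proof (rule linear_functionals_separate[OF t(1)])
    fix l :: "'u \<Rightarrow> 'k" assume "Vector_Spaces.linear t (*) l"
    thus "l u = l u'" using that unfolding rep_def by metis
  qed
  have pure: "rep (pure_tensor M N v w) (b v w)" if "v \<in> space M" "w \<in> space N" for v w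
  proof -
    have "bilinear_form M N (\<lambda>v w. l (b v w))" if "Vector_Spaces.linear t (*) l" for l
      unfolding bilinear_form_def using that b by (simp add: Vector_Spaces.linear_iff)
    thus ?thesis using that b(1) by (simp add: rep_def pure_tensor_def)
  qed
  have add: "rep (\<Theta> + \<Theta>') (u + u')" if "rep \<Theta> u" "rep \<Theta>' u'" for \<Theta> \<Theta>' u u'
    using that W(2) by (simp add: rep_def Vector_Spaces.linear_iff)
  have scale: "rep (fscale (*) c \<Theta>) (t c u)" if "rep \<Theta> u" for c \<Theta> u
    using that W(3) by (simp add: rep_def Vector_Spaces.linear_iff fscale_apply)
  have ex: "\<exists>u. rep \<Theta> u" if "\<Theta> \<in> space (M \<otimes>\<^sub>k N)" for \<Theta>
    using that sM
  proof (induction rule: tensor_induct)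
    case zero
    have "l 0 = 0" if l: "Vector_Spaces.linear t (*) l" for l :: "'u \<Rightarrow> 'k"
    proof -
      have "l (t 0 0) = 0 * l 0" using l unfolding Vector_Spaces.linear_iff by blast
      thus ?thesis by simp
    qed
    hence "rep 0 0" using W(1) by (simp add: rep_def)
    thus ?case ..
  next
    case (step v w \<Theta>)
    then obtain u where "rep \<Theta> u" by blast
    from add[OF pure[OF step(1,2)] this] show ?case ..
  qed
  define L where "L \<Theta> = (SOME u. rep \<Theta> u)" for \<Theta>
  have L: "rep \<Theta> (L \<Theta>)" if "\<Theta> \<in> space (M \<otimes>\<^sub>k N)" for \<Theta>
    unfolding L_def by (rule someI_ex[OF ex[OF that]])
  show thesis
  proof (rule that[of L])
    show "lin_on (scale (M \<otimes>\<^sub>k N)) t (space (M \<otimes>\<^sub>k N)) W L"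
      unfolding lin_on_def tensor_sel(2)
    proof (intro conjI ballI allI)
      fix \<Theta> \<Theta>' c assume h: "\<Theta> \<in> space (M \<otimes>\<^sub>k N)"
      show "L \<Theta> \<in> W" using L[OF h] unfolding rep_def by blast
      show "L (fscale (*) c \<Theta>) = t c (L \<Theta>)" by (rule uniq[OF L[OF tensor_closed(3)[OF h]] scale[OF L[OF h]]])
      show "L (\<Theta> + \<Theta>') = L \<Theta> + L \<Theta>'" if "\<Theta>' \<in> space (M \<otimes>\<^sub>k N)"
        by (rule uniq[OF L[OF tensor_closed(2)[OF h that]] add[OF L[OF h] L[OF that]]])
    qed
    show "L (pure_tensor M N v w) = b v w" if "v \<in> space M" "w \<in> space N" for v w
      by (rule uniq[OF L[OF pure_tensor_in[OF that]] pure[OF that]])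
  qed
qed

section \<open>Rationality of submodules, quotients and induced modules\<close>

context coord_group
begin

text \<open>The orbit map of a vector of \<open>K\<close> is regular with values in
  \<open>space M\<close>. A linear projection onto \<open>K\<close> fixes its values and shows that
  it is regular as a map into \<open>K\<close>.\<close>

lemma submodule_rational:
  assumes M: "rational_module G M" and sub: "gsubmodule G M K"
  shows "rational_module G (M\<lparr>space := K\<rparr>)"
proof -
  note R = rationalD[OF M]
  have K: "K \<subseteq> space M" "module.subspace (scale M) K" "\<And>x v. x \<in> carrier G \<Longrightarrow> v \<in> K \<Longrightarrow> act M x v \<in> K"
    using sub unfolding gsubmodule_def by auto
  have "lin_on (scale M) (scale M) K (space M) (\<lambda>v. v)" using K(1) by (auto simp: lin_on_def)
  then obtain h where h: "lin_on (scale M) (scale M) (space M) K h" "\<And>v. v \<in> K \<Longrightarrow> h v = v"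
    by (rule lin_on_left_inverse[OF _ R(1,1) K(2) R(2)]) (simp, rule that)
  have "(\<lambda>x. if x \<in> carrier G then act M x v else 0) \<in> regular_maps G (scale M) K" if v: "v \<in> K" for v
  proof -
    have "(\<lambda>x. h (if x \<in> carrier G then act M x v else 0)) \<in> regular_maps G (scale M) K"
      by (rule reg_linear[OF R(8)[OF subsetD[OF K(1) v]] R(1,1,2)]) (rule lin_onD[OF h(1)], assumption+)+
    also have "(\<lambda>x. h (if x \<in> carrier G then act M x v else 0)) = (\<lambda>x. if x \<in> carrier G then act M x v else 0)"
      using h(2) K(3)[OF _ v] subspaceD(1)[OF R(1) K(2)] by auto
    finally show ?thesis .
  qed
  thus ?thesis unfolding rational_module_def space_update_sel
    using R K by (simp add: subset_iff)
qed

text \<open>This supplies the rationality of the sections \<open>HH \<mu>\<close> of a filtration,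
  so that regularity of the Frobenius twist need not be examined directly.\<close>

lemma quotient_rational:
  assumes M: "rational_module G M" and N: "vector_space (scale N)" "module.subspace (scale N) (space N)"
    and g: "ghom G M N g" "g ` space M = space N"
  shows "rational_module G N"
proof -
  note R = rationalD[OF M] and gD = ghomD[OF g(1)]
  have ex: "\<exists>v\<in>space M. w = g v" if "w \<in> space N" for w using that g(2) by blast
  show ?thesis unfolding rational_module_def
  proof (intro conjI ballI allI)
    fix x y w w' c assume "w \<in> space N"
    then obtain v where v: "v \<in> space M" "w = g v" using ex by blast
    show "act N \<one> w = w" using gD(4)[OF one_closed v(1)] R(6)[OF v(1)] v(2) by simp
    show "act N x w \<in> space N" if x: "x \<in> carrier G"
      using gD(1)[OF R(3)[OF x v(1)]] gD(4)[OF x v(1)] v(2) by simp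
    show "act N x (scale N c w) = scale N c (act N x w)" if x: "x \<in> carrier G"
    proof -
      have "scale M c v \<in> space M" by (rule subspaceD(3)[OF R(1,2) v(1)])
      from gD(4)[OF x this] show ?thesis
        using gD(3)[OF v(1), of c] gD(3)[OF R(3)[OF x v(1)], of c] gD(4)[OF x v(1)] R(5)[OF x v(1), of c] v(2) by simp
    qed
    show "act N (x \<otimes> y) w = act N x (act N y w)" if x: "x \<in> carrier G" and y: "y \<in> carrier G"
      using gD(4)[OF m_closed[OF x y] v(1)] gD(4)[OF x R(3)[OF y v(1)]] gD(4)[OF y v(1)] R(7)[OF x y v(1)] v(2) by simp
    show "act N x (w + w') = act N x w + act N x w'" if x: "x \<in> carrier G" and w': "w' \<in> space N"
    proof -
      obtain v' where v': "v' \<in> space M" "w' = g v'" using ex[OF w'] by blast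
      have "v + v' \<in> space M" by (rule subspaceD(2)[OF R(1,2) v(1) v'(1)])
      from gD(4)[OF x this] show ?thesis
        using gD(2)[OF v(1) v'(1)] gD(2)[OF R(3)[OF x v(1)] R(3)[OF x v'(1)]] gD(4)[OF x v(1)] gD(4)[OF x v'(1)]
          R(4)[OF x v(1) v'(1)] v(2) v'(2) by simp
    qed
    have "(\<lambda>x. g (if x \<in> carrier G then act M x v else 0)) \<in> regular_maps G (scale N) (space N)"
      by (rule reg_linear[OF R(8)[OF v(1)] R(1) N(1) R(2)]) (rule gD, assumption+)+
    also have "(\<lambda>x. g (if x \<in> carrier G then act M x v else 0)) = (\<lambda>x. if x \<in> carrier G then act N x w else 0)"
      using gD(4)[OF _ v(1)] lin_on_diff(1)[OF ghom_lin_on[OF g(1)] R(1) N(1) R(2)] v(2) by auto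
    finally show "(\<lambda>x. if x \<in> carrier G then act N x w else 0) \<in> regular_maps G (scale N) (space N)" .
  qed (rule N)+
qed

lemma regular_maps_scalar: "regular_maps G (*) UNIV = coord G"
proof (intro equalityI subsetI)
  fix f :: "'g \<Rightarrow> 'k" assume "f \<in> regular_maps G (*) UNIV"
  thus "f \<in> coord G" using vector_space_mult
  proof (induction rule: reg_induct)
    case zero show ?case using coord_scale[OF coord_one, of 0] by simp
  next
    case (step a v f)
    show ?case using coord_add[OF coord_scale[OF step(1), of v] step(4)] by (simp add: mult.commute)
  qed
next
  fix f :: "'g \<Rightarrow> 'k" assume "f \<in> coord G"
  from reg_pure[OF vector_space_mult this, of 1 UNIV] show "f \<in> regular_maps G (*) UNIV" by simp
qed

definition translate :: "'g \<Rightarrow> ('g \<Rightarrow> 'k) \<Rightarrow> 'g \<Rightarrow> 'k" where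
  "translate y f = (\<lambda>x. if x \<in> carrier G then f (inv y \<otimes> x) else 0)"

lemma regular_representation:
  "rational_module G \<lparr>space = coord G, scale = fscale (*), act = translate\<rparr>" (is "rational_module G ?M")
proof -
  note vs = vector_space_fscale[OF vector_space_mult]
  have reg: "(\<lambda>y. if y \<in> carrier G then translate y f else 0) \<in> regular_maps G (fscale (*)) (coord G)"
    if "f \<in> coord G" for f
  proof -
    have "(\<lambda>y x. if y \<in> carrier G \<and> x \<in> carrier G then f (inv y \<otimes> x) else 0)
        \<in> regular_maps G (fscale (*)) (regular_maps G (*) UNIV)"
      by (rule reg_translate[OF _ vector_space_mult]) (simp add: regular_maps_scalar that)
    also have "(\<lambda>y x. if y \<in> carrier G \<and> x \<in> carrier G then f (inv y \<otimes> x) else 0) =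
        (\<lambda>y. if y \<in> carrier G then translate y f else 0)"
      by (auto simp: translate_def fun_eq_iff)
    finally show ?thesis unfolding regular_maps_scalar .
  qed
  have sub: "module.subspace (fscale (*)) (coord G)"
    using reg_subspace[OF vector_space_mult, of UNIV] unfolding regular_maps_scalar .
  show ?thesis unfolding rational_module_def gmodule.simps
  proof (intro conjI ballI allI)
    show "translate x f \<in> coord G" if "x \<in> carrier G" "f \<in> coord G" for x f
      using reg_in[OF reg[OF that(2)] vs sub, of x] that(1) by simp
    show "translate \<one> f = f" if "f \<in> coord G" for f
      using coord_outside[OF that] by (auto simp: translate_def)
    show "translate (x \<otimes> y) f = translate x (translate y f)" if "x \<in> carrier G" "y \<in> carrier G" for x y f
      using that by (auto simp: translate_def inv_mult_group m_assoc)
  qed (use vs sub reg in \<open>auto simp: translate_def fscale_apply fun_eq_iff\<close>)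
qed

text \<open>Induction from a one-dimensional module gives a submodule of the regular representation.
  The two uses are \<open>H0\<close>, with a character of the Borel subgroup, and the functions on
  \<open>G/H\<close>, with \<open>\<chi> = 1\<close>.\<close>

lemma induced_rational:
  fixes M :: "('g, 'k, 'k) gmodule"
  assumes H: "H \<subseteq> carrier G" and M: "space M = UNIV" "scale M = (*)" "\<And>h c. act M h c = \<chi> h * c"
  shows "rational_module G (induced_module G H M)"
proof -
  let ?R = "\<lparr>space = coord G, scale = fscale (*), act = translate\<rparr>"
  let ?K = "{f \<in> coord G. \<forall>x\<in>carrier G. \<forall>h\<in>H. f (x \<otimes> h) = \<chi> (inv h) * f x}"
  have eq: "induced_module G H M = ?R\<lparr>space := ?K\<rparr>"
    unfolding induced_module_def M regular_maps_scalar by (simp add: translate_def fun_eq_iff)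
  interpret F: vector_space "fscale (*) :: 'k \<Rightarrow> ('g \<Rightarrow> 'k) \<Rightarrow> _"
    by (rule vector_space_fscale[OF vector_space_mult])
  have "gsubmodule G ?R ?K"
    unfolding gsubmodule_def gmodule.simps
  proof (intro conjI ballI)
    note R = rationalD[OF regular_representation, unfolded gmodule.simps]
    show "F.subspace ?K" unfolding F.subspace_def
      using subspaceD(1-3)[OF R(1,2)] by (auto simp: fscale_apply algebra_simps)
    fix x f assume x: "x \<in> carrier G" and f: "f \<in> ?K"
    have "translate x f (y \<otimes> h) = \<chi> (inv h) * translate x f y" if "y \<in> carrier G" "h \<in> H" for y h
      using that H x f by (auto simp: translate_def m_assoc[symmetric])
    thus "translate x f \<in> ?K" using R(3)[OF x] f by blast
  qed auto
  from submodule_rational[OF regular_representation this] show ?thesis unfolding eq .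
qed

end

section \<open>A finite subgroup as an algebraic group\<close>

locale finite_subgroup = coord_group G for G :: "('g, 'k::field) alg_group" (structure) +
  fixes H :: "'g set"
  assumes subgroup: "subgroup H G" and finite: "finite H"
begin

abbreviation GH where "GH \<equiv> finite_alg_group G H"

lemma GH_sel: "carrier GH = H" "monoid.mult GH = monoid.mult G" "one GH = \<one>" "coord GH = {f. \<forall>x. x \<notin> H \<longrightarrow> f x = 0}"
  by (simp_all add: finite_alg_group_def)

sublocale H: subgroup H G by (rule subgroup)

lemma GH_group: "group GH"
proof (rule groupI)
  fix x assume "x \<in> carrier GH"
  thus "\<exists>y\<in>carrier GH. y \<otimes>\<^bsub>GH\<^esub> x = \<one>\<^bsub>GH\<^esub>"
    by (intro bexI[of _ "inv x"]) (auto simp: GH_sel)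
qed (auto simp: GH_sel m_assoc)

lemma GH_inv: "h \<in> H \<Longrightarrow> inv\<^bsub>GH\<^esub> h = inv h"
  by (rule group.inv_equality[OF GH_group]) (auto simp: GH_sel)

text \<open>On a finite group \<open>f (x \<otimes> y)\<close> is the sum over \<open>h\<close> of
  the delta function at \<open>h\<close> in \<open>x\<close> times \<open>f (h \<otimes> y)\<close>,
  which is a comultiplication; the enumeration \<open>e\<close> puts the elements \<open>h\<close>
  into the required indexing by natural numbers.\<close>

sublocale GH: coord_group GH
proof (rule coord_group.intro[OF GH_group], unfold_locales)
  show "fun_algebra (carrier GH) UNIV (coord GH)"
    by (auto simp: fun_algebra_def GH_sel restr_def)
  obtain e n where e: "bij_betw e {..<n::nat} H"
    using ex_bij_betw_nat_finite[OF finite] by (auto simp: atLeast0LessThan)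
  show "hopf_closed GH (coord GH)"
    unfolding hopf_closed_def GH_sel
  proof (intro conjI ballI)
    fix f :: "'g \<Rightarrow> 'k" assume "f \<in> {f. \<forall>x. x \<notin> H \<longrightarrow> f x = 0}"
    show "restr H (\<lambda>x. f (inv\<^bsub>GH\<^esub> x)) \<in> {f. \<forall>x. x \<notin> H \<longrightarrow> f x = 0}" by (simp add: restr_def)
    let ?u = "\<lambda>i x. if x = e i then 1 else (0 :: 'k)" and ?v = "\<lambda>i y. if y \<in> H then f (e i \<otimes> y) else 0"
    have eH: "e i \<in> H" if "i < n" for i using e that by (auto simp: bij_betw_def)
    show "\<exists>n u v. (\<forall>i<n::nat. u i \<in> {f. \<forall>x. x \<notin> H \<longrightarrow> f x = 0} \<and> v i \<in> {f. \<forall>x. x \<notin> H \<longrightarrow> f x = 0}) \<and>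
        (\<forall>x\<in>H. \<forall>y\<in>H. f (x \<otimes> y) = (\<Sum>i<n. u i x * v i y))"
    proof (intro exI conjI ballI allI impI)
      fix x y assume xy: "x \<in> H" "y \<in> H"
      then obtain j where j: "j < n" "x = e j" using e by (auto simp: bij_betw_def)
      have "(\<Sum>i<n. ?u i x * ?v i y) = (\<Sum>i<n. if i = j then f (x \<otimes> y) else 0)"
        using e j xy by (intro sum.cong) (auto simp: bij_betw_def inj_on_def)
      thus "f (x \<otimes> y) = (\<Sum>i<n. ?u i x * ?v i y)" using j by simp
    qed (use eH in auto)
  qed
qed

text \<open>Every function on a finite set is a sum of delta functions with vector coefficients, so
  regularity amounts to support in \<open>H\<close> and values in \<open>V\<close>.\<close>

lemma GH_regular_maps:
  assumes "vector_space s" "module.subspace s V"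
  shows "f \<in> regular_maps GH s V \<longleftrightarrow> (\<forall>x. f x \<in> V) \<and> (\<forall>x. x \<notin> H \<longrightarrow> f x = 0)"
proof
  assume f: "f \<in> regular_maps GH s V"
  show "(\<forall>x. f x \<in> V) \<and> (\<forall>x. x \<notin> H \<longrightarrow> f x = 0)"
    using GH.reg_in[OF f assms] GH.reg_outside[OF f assms(1)] by (auto simp: GH_sel)
next
  interpret vector_space s by fact
  assume f: "(\<forall>x. f x \<in> V) \<and> (\<forall>x. x \<notin> H \<longrightarrow> f x = 0)"
  have "(\<Sum>h\<in>H. (\<lambda>x. s (if x = h then 1 else 0) (f h))) \<in> regular_maps GH s V"
  proof (intro GH.reg_sum[OF assms(1)] GH.reg_pure[OF assms(1)])
    fix h assume "h \<in> H"
    thus "(\<lambda>x. if x = h then 1 else 0) \<in> coord GH" "f h \<in> V" using f by (auto simp: GH_sel)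
  qed
  also have "(\<Sum>h\<in>H. (\<lambda>x. s (if x = h then 1 else 0) (f h))) = f"
  proof
    fix x
    have "(\<Sum>h\<in>H. (\<lambda>x. s (if x = h then 1 else 0) (f h))) x = (\<Sum>h\<in>H. s (if x = h then 1 else 0) (f h))"
      using finite by (induction H rule: finite_induct) auto
    also have "\<dots> = (\<Sum>h\<in>H. if h = x then f x else 0)" by (intro sum.cong) auto
    also have "\<dots> = f x" using finite f by simp
    finally show "(\<Sum>h\<in>H. (\<lambda>x. s (if x = h then 1 else 0) (f h))) x = f x" .
  qed
  finally show "f \<in> regular_maps GH s V" .
qed

lemma GH_pow:
  assumes "vector_space s" "module.subspace s V"
  shows "f \<in> regular_maps_pow GH s V n \<longleftrightarrow>
    (\<forall>xs. f xs \<in> V) \<and> (\<forall>xs. length xs \<noteq> n \<or> \<not> set xs \<subseteq> H \<longrightarrow> f xs = 0)"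
proof
  assume f: "f \<in> regular_maps_pow GH s V n"
  show "(\<forall>xs. f xs \<in> V) \<and> (\<forall>xs. length xs \<noteq> n \<or> \<not> set xs \<subseteq> H \<longrightarrow> f xs = 0)"
    using GH.pow_in[OF f assms] GH.pow_outside[OF f assms(1)] unfolding GH_sel by blast
next
  show "(\<forall>xs. f xs \<in> V) \<and> (\<forall>xs. length xs \<noteq> n \<or> \<not> set xs \<subseteq> H \<longrightarrow> f xs = 0) \<Longrightarrow>
      f \<in> regular_maps_pow GH s V n"
  proof (induction n arbitrary: f)
    case 0
    thus ?case unfolding GH.pow_0_iff by auto
  next
    case (Suc n)
    have "(\<lambda>ys. f (x # ys)) \<in> regular_maps_pow GH s V n" for x
      using Suc.prems by (intro Suc.IH) auto
    moreover have "(\<lambda>ys. f (x # ys)) = 0" if "x \<notin> H" for x using Suc.prems that by (auto simp: fun_eq_iff)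
    ultimately show ?case
      unfolding GH.pow_Suc_iff GH_regular_maps[OF vector_space_fscale[OF assms(1)] GH.pow_subspace[OF assms]]
      using Suc.prems by auto
  qed
qed

lemma GH_rational:
  assumes M: "rational_module G M"
  shows "rational_module GH M"
proof -
  note R = rationalD[OF M]
  have "(\<lambda>x. if x \<in> H then act M x v else 0) \<in> regular_maps GH (scale M) (space M)" if "v \<in> space M" for v
    unfolding GH_regular_maps[OF R(1,2)] using that R(3) subspaceD(1)[OF R(1,2)] by auto
  thus ?thesis unfolding rational_module_def GH_sel using R by simp
qed

end

section \<open>Shapiro's lemma\<close>

lemma sum_fun_apply: "(\<Sum>i\<in>I. f i) x = (\<Sum>i\<in>I. f i x)"
  by (induction I rule: infinite_finite_induct) auto

locale averaging = finite_subgroup G H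
  for G :: "('g, 'k::field) alg_group" (structure) and H :: "'g set" +
  fixes c :: "'g \<Rightarrow> 'k"
  assumes c_coord: "c \<in> coord G" and c_trace: "\<And>x. x \<in> carrier G \<Longrightarrow> (\<Sum>h\<in>H. c (x \<otimes> h)) = 1"
    and c_one: "c \<one> = 1" and c_zero: "\<And>h. h \<in> H \<Longrightarrow> h \<noteq> \<one> \<Longrightarrow> c h = 0"
begin

text \<open>The weight of \<open>h\<close> at \<open>y\<close> depends on
  \<open>inv y \<otimes> h\<close> only. Trace one makes the weights sum to \<open>1\<close> over
  \<open>h\<close>, and moving both points by an element of \<open>H\<close> changes nothing; the
  latter makes averaging equivariant.\<close>

definition wt :: "'g \<Rightarrow> 'g \<Rightarrow> 'k" where
  "wt h = restr (carrier G) (\<lambda>y. c (inv y \<otimes> h))"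

lemma wt_coord: "h \<in> H \<Longrightarrow> wt h \<in> coord G"
proof -
  assume h: "h \<in> H"
  have "restr (carrier G) (\<lambda>y. restr (carrier G) (\<lambda>x. c (x \<otimes> h)) (inv y)) \<in> coord G"
    using h by (intro coord_inv coord_translate c_coord) auto
  also have "restr (carrier G) (\<lambda>y. restr (carrier G) (\<lambda>x. c (x \<otimes> h)) (inv y)) = wt h"
    by (auto simp: wt_def restr_def)
  finally show ?thesis .
qed

lemma wt_outside: "y \<notin> carrier G \<Longrightarrow> wt h y = 0"
  by (simp add: wt_def restr_def)

lemma wt_sum: "y \<in> carrier G \<Longrightarrow> (\<Sum>h\<in>H. wt h y) = 1"
  using c_trace[of "inv y"] by (simp add: wt_def restr_def)

lemma wt_subgroup: "h \<in> H \<Longrightarrow> y \<in> H \<Longrightarrow> wt h y = (if h = y then 1 else 0)"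
proof -
  assume hy: "h \<in> H" "y \<in> H"
  have "inv y \<otimes> h = \<one> \<longleftrightarrow> h = y"
  proof
    assume "inv y \<otimes> h = \<one>"
    hence "y \<otimes> (inv y \<otimes> h) = y" using hy by simp
    thus "h = y" using hy by (simp add: m_assoc[symmetric])
  qed (use hy in simp)
  thus ?thesis using hy c_one c_zero[of "inv y \<otimes> h"] by (auto simp: wt_def restr_def)
qed

lemma wt_translate: "g \<in> H \<Longrightarrow> h \<in> H \<Longrightarrow> y \<in> carrier G \<Longrightarrow> wt (g \<otimes> h) y = wt h (inv g \<otimes> y)"
  by (simp add: wt_def restr_def inv_mult_group m_assoc)

text \<open>A cochain on the subgroup is extended to the whole group by averaging it over the subgroup in
  each variable; the weights \<open>wt h y\<close> form a partition of unity.\<close>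

primrec average :: "('k \<Rightarrow> 'v \<Rightarrow> 'v) \<Rightarrow> 'g list \<Rightarrow> ('g list \<Rightarrow> 'v::ab_group_add) \<Rightarrow> 'v" where
  "average s [] = (\<lambda>f. f [])"
| "average s (y # ys) = (\<lambda>f. \<Sum>h\<in>H. s (wt h y) (average s ys (\<lambda>hs. f (h # hs))))"

text \<open>The prism operator is the simplicial homotopy between averaging and the identity.\<close>

primrec prism :: "('k \<Rightarrow> 'v \<Rightarrow> 'v) \<Rightarrow> 'g list \<Rightarrow> ('g list \<Rightarrow> 'v::ab_group_add) \<Rightarrow> 'v" where
  "prism s [] = (\<lambda>f. 0)"
| "prism s (y # ys) = (\<lambda>f. \<Sum>h\<in>H. s (wt h y) (f (h # y # ys) - prism s ys (\<lambda>zs. f (h # zs))))"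

lemma average_cong:
  "(\<And>hs. set hs \<subseteq> H \<Longrightarrow> length hs = length xs \<Longrightarrow> f hs = g hs) \<Longrightarrow> average s xs f = average s xs g"
proof (induction xs arbitrary: f g)
  case (Cons y ys)
  show ?case unfolding average.simps
    by (intro sum.cong refl arg_cong[where f = "s _"] Cons.IH Cons.prems) auto
qed simp

section \<open>Averaging and prism operators\<close>

context
  fixes s :: "'k \<Rightarrow> 'v::ab_group_add \<Rightarrow> 'v"
  assumes s: "vector_space s"
begin

interpretation S: vector_space s by (rule s)

lemma average_zero: "average s xs (\<lambda>_. 0) = 0"
  by (induction xs) simp_all

lemma average_minus: "average s xs (\<lambda>hs. f hs - g hs) = average s xs f - average s xs g"
  by (induction xs arbitrary: f g) (simp_all add: S.scale_right_diff_distrib sum_subtractf)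

lemma average_outside: "\<not> set xs \<subseteq> carrier G \<Longrightarrow> average s xs f = 0"
proof (induction xs arbitrary: f)
  case (Cons y ys)
  show ?case
  proof (cases "y \<in> carrier G")
    case True thus ?thesis using Cons by simp
  next
    case False thus ?thesis by (simp add: wt_outside)
  qed
qed simp

lemma wt_sum_scale: "y \<in> carrier G \<Longrightarrow> (\<Sum>h\<in>H. s (wt h y) v) = v"
  by (simp add: wt_sum flip: S.scale_sum_left)

lemma prism_zero: "(\<And>zs. length zs = Suc (length xs) \<Longrightarrow> f zs = 0) \<Longrightarrow> prism s xs f = 0"
proof (induction xs arbitrary: f)
  case (Cons y ys)
  have "prism s ys (\<lambda>zs. f (h # zs)) = 0" for h by (rule Cons.IH) (simp add: Cons.prems)
  thus ?case using Cons.prems by simp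
qed simp

lemma prism_minus: "prism s xs (\<lambda>zs. f zs - g zs) = prism s xs f - prism s xs g"
proof (induction xs arbitrary: f g)
  case (Cons y ys)
  have "a - b - (p - q) = a - p - (b - q)" for a b p q :: 'v by (simp add: algebra_simps)
  thus ?case
    by (simp only: prism.simps Cons.IH S.scale_right_diff_distrib sum_subtractf)
qed simp

lemma diff_lincomb:
  "std_differential G (\<lambda>ys. \<Sum>h\<in>H. s (w h) (f h ys)) xs = (\<Sum>h\<in>H. s (w h) (std_differential G (f h) xs))"
proof -
  have "std_differential G (\<Sum>h\<in>I. fscale s (w h) (f h)) = (\<Sum>h\<in>I. fscale s (w h) (std_differential G (f h)))" for I
  proof (induction I rule: infinite_finite_induct)
    case (infinite I) show ?case unfolding sum.infinite[OF infinite] by (rule diff_zero)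
  next
    case empty show ?case unfolding sum.empty by (rule diff_zero)
  next
    case (insert i I)
    show ?case unfolding sum.insert[OF insert(1,2)] diff_add diff_scale[OF s] insert(3) ..
  qed
  moreover have "(\<lambda>ys. \<Sum>h\<in>H. s (w h) (f h ys)) = (\<Sum>h\<in>H. fscale s (w h) (f h))"
    by (rule ext) (simp add: sum_fun_apply fscale_apply)
  ultimately show ?thesis by (simp only: sum_fun_apply fscale_apply)
qed

text \<open>Averaging commutes with the faces: when a variable is deleted, the sum over its weights
  is \<open>1\<close>. The induction peels off the first variable on both sides.\<close>

lemma diff_average: "std_differential G (\<lambda>xs. average s xs f) xs = average s xs (std_differential GH f)"
proof (induction xs arbitrary: f)
  case Nil show ?case by (simp add: std_differential_def)
next
  case (Cons y ys)
  show ?case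
  proof (cases "y \<in> carrier G")
    case False thus ?thesis by (simp add: diff_outside wt_outside)
  next
    case True
    have "std_differential G (\<lambda>xs. average s xs f) (y # ys) =
        average s ys f - std_differential G (\<lambda>zs. average s (y # zs) f) ys"
      using average_outside[of ys f] by (simp only: diff_Cons[OF True] split: if_split) simp
    also have "std_differential G (\<lambda>zs. average s (y # zs) f) ys =
        (\<Sum>h\<in>H. s (wt h y) (average s ys (std_differential GH (\<lambda>hs. f (h # hs)))))"
      unfolding average.simps diff_lincomb Cons.IH ..
    also have "average s ys f - \<dots> =
        (\<Sum>h\<in>H. s (wt h y) (average s ys (\<lambda>hs. f hs - std_differential GH (\<lambda>hs. f (h # hs)) hs)))"
      unfolding average_minus S.scale_right_diff_distrib sum_subtractf wt_sum_scale[OF True] ..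
    also have "\<dots> = (\<Sum>h\<in>H. s (wt h y) (average s ys (\<lambda>hs. std_differential GH f (h # hs))))"
      by (intro sum.cong refl arg_cong[where f = "s _"] average_cong) (simp add: GH.diff_Cons GH_sel)
    finally show ?thesis by simp
  qed
qed

lemma average_subgroup: "set xs \<subseteq> H \<Longrightarrow> average s xs f = f xs"
proof (induction xs arbitrary: f)
  case (Cons y ys)
  have "(\<Sum>h\<in>H. s (wt h y) (average s ys (\<lambda>hs. f (h # hs)))) = (\<Sum>h\<in>H. if h = y then f (y # ys) else 0)"
    using Cons by (intro sum.cong refl) (auto simp: wt_subgroup)
  also have "\<dots> = f (y # ys)" using Cons.prems finite by simp
  finally show ?case by simp
qed simp

text \<open>Unfolded, the prism is the alternating sum over \<open>i\<close> of the averages of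
  \<open>f\<close> at the tuples whose entries before and at position \<open>i\<close> are the
  averaged ones and whose entries from position \<open>i\<close> on are the original ones; entry
  \<open>i\<close> occurs in both versions. The faces of neighbouring prisms cancel, leaving the
  unaveraged and the fully averaged tuple. The recursion does this one variable at a time.\<close>

lemma prism_homotopy:
  "set xs \<subseteq> carrier G \<Longrightarrow> std_differential G (\<lambda>xs. prism s xs f) xs + prism s xs (std_differential G f) =
     f xs - average s xs f"
proof (induction xs arbitrary: f)
  case (Cons y ys)
  hence y: "y \<in> carrier G" and ys: "set ys \<subseteq> carrier G" by auto
  have hG: "h \<in> carrier G" if "h \<in> H" for h using that by simp
  let ?d = "std_differential G"
  let ?fh = "\<lambda>h zs. f (h # zs)"
  have 1: "?d (\<lambda>xs. prism s xs f) (y # ys) = prism s ys f - ?d (\<lambda>zs. prism s (y # zs) f) ys"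
    using ys by (simp only: diff_Cons[OF y] if_True)
  have 2: "?d (\<lambda>zs. prism s (y # zs) f) ys =
      (\<Sum>h\<in>H. s (wt h y) (?d (\<lambda>zs. f (h # y # zs)) ys - ?d (\<lambda>zs. prism s zs (?fh h)) ys))"
  proof -
    have "?d (\<lambda>zs. f (h # y # zs) - prism s zs (?fh h)) ys =
        ?d (\<lambda>zs. f (h # y # zs)) ys - ?d (\<lambda>zs. prism s zs (?fh h)) ys" for h
      using diff_minus[of "\<lambda>zs. f (h # y # zs)" "\<lambda>zs. prism s zs (?fh h)"] by (simp add: fun_diff_def)
    thus ?thesis unfolding prism.simps diff_lincomb by simp
  qed
  have 3: "prism s ys (\<lambda>zs. ?d f (h # zs)) = prism s ys f - prism s ys (?d (?fh h))" if "h \<in> H" for h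
  proof -
    have "prism s ys (\<lambda>zs. ?d f (h # zs)) = prism s ys (\<lambda>zs. (if set zs \<subseteq> carrier G then f zs else 0) - ?d (?fh h) zs)"
      by (simp only: diff_Cons[OF hG[OF that]])
    also have "\<dots> = prism s ys (\<lambda>zs. if set zs \<subseteq> carrier G then f zs else 0) - prism s ys (?d (?fh h))"
      by (rule prism_minus)
    \<comment> \<open>\<open>diff_Cons\<close> cuts off outside lists of group elements. The cutoff
      is harmless because the prism over a list from the group evaluates its argument on such lists
      only.\<close>
    also have "prism s zs (\<lambda>zs. if set zs \<subseteq> carrier G then g zs else 0) = prism s zs g"
      if "set zs \<subseteq> carrier G" for zs g
      using that
    proof (induction zs arbitrary: g)
      case (Cons z zs)
      have "prism s zs (\<lambda>zs. if set (h # zs) \<subseteq> carrier G then g (h # zs) else 0) = prism s zs (\<lambda>zs. g (h # zs))"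
        if "h \<in> H" for h
        using Cons.IH[of "\<lambda>zs. g (h # zs)"] Cons.prems hG[OF that] by simp
      thus ?case using Cons.prems hG unfolding prism.simps by (intro sum.cong refl) auto
    qed simp
    from this[OF ys, of f] have "prism s ys (\<lambda>zs. if set zs \<subseteq> carrier G then f zs else 0) = prism s ys f" .
    finally show ?thesis .
  qed
  have 4: "?d f (h # y # ys) = f (y # ys) - f (h # ys) + ?d (\<lambda>zs. f (h # y # zs)) ys" if "h \<in> H" for h
    using y ys by (simp add: diff_Cons[OF hG[OF that]] diff_Cons[OF y])
  have "prism s (y # ys) (?d f) = (\<Sum>h\<in>H. s (wt h y) (f (y # ys) - f (h # ys) + ?d (\<lambda>zs. f (h # y # zs)) ys
      - prism s ys f + prism s ys (?d (?fh h))))"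
    unfolding prism.simps by (intro sum.cong refl) (simp add: 3 4)
  hence "?d (\<lambda>xs. prism s xs f) (y # ys) + prism s (y # ys) (?d f) =
     (\<Sum>h\<in>H. s (wt h y) (prism s ys f)) - ?d (\<lambda>zs. prism s (y # zs) f) ys +
     (\<Sum>h\<in>H. s (wt h y) (f (y # ys) - f (h # ys) + ?d (\<lambda>zs. f (h # y # zs)) ys
      - prism s ys f + prism s ys (?d (?fh h))))"
    unfolding 1 wt_sum_scale[OF y] by simp
  also have "\<dots> = (\<Sum>h\<in>H. s (wt h y) (f (y # ys) - (f (h # ys)
      - (?d (\<lambda>zs. prism s zs (?fh h)) ys + prism s ys (?d (?fh h))))))"
    unfolding 2 sum_subtractf[symmetric] sum.distrib[symmetric] S.scale_right_diff_distrib[symmetric]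
      S.scale_right_distrib[symmetric]
    by (intro sum.cong refl arg_cong[where f = "s _"]) (simp add: algebra_simps)
  also have "\<dots> = (\<Sum>h\<in>H. s (wt h y) (f (y # ys) - average s ys (?fh h)))"
    unfolding Cons.IH[OF ys] by simp
  also have "\<dots> = f (y # ys) - average s (y # ys) f"
    unfolding S.scale_right_diff_distrib sum_subtractf wt_sum_scale[OF y] by simp
  finally show ?case .
qed (simp add: std_differential_def)

text \<open>The dependence on the arguments is through the weights alone, and these are coordinate
  functions; the cochain contributes constants.\<close>

lemma average_regular:
  assumes V: "module.subspace s V" and f: "\<And>hs. f hs \<in> V" "\<And>hs. length hs \<noteq> n \<Longrightarrow> f hs = 0"
  shows "(\<lambda>xs. average s xs f) \<in> regular_maps_pow G s V n"
  using f
proof (induction n arbitrary: f)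
  case 0
  have "average s xs f = 0" if "xs \<noteq> []" for xs
    using average_cong[of xs f "\<lambda>_. 0" s] average_zero 0(2) that by auto
  thus ?case unfolding pow_0_iff using 0(1) by simp
next
  case (Suc n)
  note vs = vector_space_fscale[OF s]
  have "(\<Sum>h\<in>H. (\<lambda>y. fscale s (wt h y) (\<lambda>ys. average s ys (\<lambda>hs. f (h # hs)))))
      \<in> regular_maps G (fscale s) (regular_maps_pow G s V n)"
    using Suc.prems by (intro reg_sum[OF vs] reg_pure[OF vs] wt_coord Suc.IH) auto
  also have "(\<Sum>h\<in>H. (\<lambda>y. fscale s (wt h y) (\<lambda>ys. average s ys (\<lambda>hs. f (h # hs))))) =
      (\<lambda>y ys. average s (y # ys) f)"
    by (intro ext) (simp add: sum_fun_apply fscale_apply)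
  finally show ?case unfolding pow_Suc_iff using Suc.prems(2)[of "[]"] by simp
qed

text \<open>Unlike the average, the prism keeps some of the original variables, so regularity of
  \<open>f\<close> enters: each summand has a frozen first entry \<open>h\<close> and is multiplied
  by a weight.\<close>

lemma prism_regular:
  assumes V: "module.subspace s V"
  shows "f \<in> regular_maps_pow G s V (Suc n) \<Longrightarrow> (\<lambda>xs. prism s xs f) \<in> regular_maps_pow G s V n"
proof (induction n arbitrary: f)
  case 0
  have "prism s xs f = 0" for xs
  proof (cases xs)
    case (Cons y ys)
    have "f zs = 0" if "length zs = Suc (length xs)" for zs
      using pow_outside[OF 0 s] that Cons by simp
    thus ?thesis by (rule prism_zero)
  qed simp
  thus ?case unfolding pow_0_iff using subspaceD(1)[OF s V] by simp
next
  case (Suc n)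
  note vs = vector_space_fscale[OF s]
  let ?R = "regular_maps G (fscale s) (regular_maps_pow G s V n)"
  have F: "(\<lambda>x ys. f (x # ys)) \<in> regular_maps G (fscale s) (regular_maps_pow G s V (Suc n))"
    using Suc.prems unfolding pow_Suc_iff[of f _ _ "Suc n"] by blast
  have fh: "(\<lambda>ys. f (h # ys)) \<in> regular_maps_pow G s V (Suc n)" for h
    by (rule reg_in[OF F vs pow_subspace[OF s V]])
  have "(\<lambda>y ys. f (h # y # ys)) \<in> ?R" for h
    using fh[of h] unfolding pow_Suc_iff by blast
  from reg_mult[OF this vs wt_coord]
  have 1: "(\<lambda>y. fscale s (wt h y) (\<lambda>ys. f (h # y # ys))) \<in> ?R" if "h \<in> H" for h using that .
  have 2: "(\<lambda>y. fscale s (wt h y) (\<lambda>ys. prism s ys (\<lambda>zs. f (h # zs)))) \<in> ?R" if "h \<in> H" for h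
    by (rule reg_pure[OF vs wt_coord[OF that] Suc.IH[OF fh]])
  have "(\<Sum>h\<in>H. (\<lambda>y. fscale s (wt h y) (\<lambda>ys. f (h # y # ys))) -
      (\<lambda>y. fscale s (wt h y) (\<lambda>ys. prism s ys (\<lambda>zs. f (h # zs))))) \<in> ?R"
    by (intro reg_sum[OF vs] reg_closed(3)[OF vs 1 2])
  also have "(\<Sum>h\<in>H. (\<lambda>y. fscale s (wt h y) (\<lambda>ys. f (h # y # ys))) -
      (\<lambda>y. fscale s (wt h y) (\<lambda>ys. prism s ys (\<lambda>zs. f (h # zs))))) = (\<lambda>y ys. prism s (y # ys) f)"
    by (intro ext) (simp add: sum_fun_apply fscale_apply S.scale_right_diff_distrib)
  finally show ?case unfolding pow_Suc_iff by simp
qed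

end

context
  fixes M :: "('g, 'k, 'v::ab_group_add) gmodule"
  assumes M: "rational_module G M"
begin

private lemmas R = rationalD[OF M]
private lemmas RS = subspaceD[OF R(1,2)]

lemma lincomb_in: "(\<And>h. h \<in> H \<Longrightarrow> f h \<in> space M) \<Longrightarrow> (\<Sum>h\<in>H. scale M (w h) (f h)) \<in> space M"
proof -
  interpret vector_space "scale M" by (rule R(1))
  assume "\<And>h. h \<in> H \<Longrightarrow> f h \<in> space M"
  thus ?thesis by (intro subspace_sum[OF R(2)] RS(3))
qed

lemma act_lincomb:
  assumes g: "g \<in> carrier G" and f: "\<And>h. h \<in> H \<Longrightarrow> f h \<in> space M"
  shows "act M g (\<Sum>h\<in>H. scale M (w h) (f h)) = (\<Sum>h\<in>H. scale M (w h) (act M g (f h)))"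
proof -
  interpret vector_space "scale M" by (rule R(1))
  have "I \<subseteq> H \<Longrightarrow> act M g (\<Sum>h\<in>I. scale M (w h) (f h)) = (\<Sum>h\<in>I. scale M (w h) (act M g (f h)))" for I
  proof (induction I rule: infinite_finite_induct)
    case (insert h I)
    have 1: "f h \<in> space M" "scale M (w h) (f h) \<in> space M" using insert.prems f RS(3) by auto
    have 2: "(\<Sum>h\<in>I. scale M (w h) (f h)) \<in> space M"
      using insert.prems f by (intro subspace_sum[OF R(2)] RS(3)) auto
    show ?case using insert R(4)[OF g 1(2) 2] R(5)[OF g 1(1)] by simp
  qed (simp_all add: act_zero[OF M g])
  thus ?thesis by blast
qed

lemma average_in: "(\<And>hs. set hs \<subseteq> H \<Longrightarrow> f hs \<in> space M) \<Longrightarrow> average (scale M) xs f \<in> space M"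
proof (induction xs arbitrary: f)
  case (Cons y ys)
  show ?case unfolding average.simps by (intro lincomb_in Cons.IH Cons.prems) auto
qed simp

lemma prism_in: "(\<And>zs. f zs \<in> space M) \<Longrightarrow> prism (scale M) xs f \<in> space M"
proof (induction xs arbitrary: f)
  case (Cons y ys)
  show ?case unfolding prism.simps by (intro lincomb_in RS(4) Cons.IH Cons.prems) 
qed (simp add: RS(1))

lemma sum_translate: "g \<in> H \<Longrightarrow> (\<Sum>h\<in>H. F (g \<otimes> h)) = (\<Sum>h\<in>H. F h)"
  by (rule subgroup_sum_translate(1)[OF subgroup])

text \<open>Replacing \<open>h\<close> by \<open>g \<otimes> h\<close> in the sum over each variable
  moves the translation by \<open>g\<close> from the cochain to the weights, where it becomes a
  translation of the arguments.\<close>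

lemma average_equivariant:
  assumes g: "g \<in> H"
  shows "(\<And>hs. set hs \<subseteq> H \<Longrightarrow> f hs \<in> space M) \<Longrightarrow> set xs \<subseteq> carrier G \<Longrightarrow>
    average (scale M) xs (\<lambda>hs. act M g (f (map (\<lambda>x. inv g \<otimes> x) hs))) =
      act M g (average (scale M) (map (\<lambda>x. inv g \<otimes> x) xs) f)"
proof (induction xs arbitrary: f)
  case (Cons y ys)
  have gG: "g \<in> carrier G" and y: "y \<in> carrier G" using g Cons.prems by auto
  let ?m = "map (\<lambda>x. inv g \<otimes> x)"
  have IH: "average (scale M) ys (\<lambda>hs. act M g (f (h # ?m hs))) = act M g (average (scale M) (?m ys) (\<lambda>hs. f (h # hs)))"
    if "h \<in> H" for h
    using Cons.IH[of "\<lambda>hs. f (h # hs)"] Cons.prems that by simp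
  have "average (scale M) (y # ys) (\<lambda>hs. act M g (f (?m hs))) =
      (\<Sum>h\<in>H. scale M (wt h y) (average (scale M) ys (\<lambda>hs. act M g (f ((inv g \<otimes> h) # ?m hs)))))" by simp
  also have "\<dots> = (\<Sum>h\<in>H. scale M (wt (g \<otimes> h) y) (average (scale M) ys (\<lambda>hs. act M g (f ((inv g \<otimes> (g \<otimes> h)) # ?m hs)))))"
    by (rule sum_translate[OF g, symmetric])
  also have "\<dots> = (\<Sum>h\<in>H. scale M (wt h (inv g \<otimes> y)) (act M g (average (scale M) (?m ys) (\<lambda>hs. f (h # hs)))))"
  proof (intro sum.cong refl)
    fix h assume h: "h \<in> H"
    have "inv g \<otimes> (g \<otimes> h) = h" using g h by (simp add: m_assoc[symmetric])
    thus "scale M (wt (g \<otimes> h) y) (average (scale M) ys (\<lambda>hs. act M g (f ((inv g \<otimes> (g \<otimes> h)) # ?m hs)))) =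
        scale M (wt h (inv g \<otimes> y)) (act M g (average (scale M) (?m ys) (\<lambda>hs. f (h # hs))))"
      by (simp only: wt_translate[OF g h y] IH[OF h])
  qed
  also have "\<dots> = act M g (\<Sum>h\<in>H. scale M (wt h (inv g \<otimes> y)) (average (scale M) (?m ys) (\<lambda>hs. f (h # hs))))"
    by (rule act_lincomb[OF gG, symmetric]) (intro average_in Cons.prems, simp)
  finally show ?case by simp
qed simp

lemma prism_equivariant:
  assumes g: "g \<in> H"
  shows "(\<And>zs. f zs \<in> space M) \<Longrightarrow> set xs \<subseteq> carrier G \<Longrightarrow>
    prism (scale M) xs (\<lambda>zs. act M g (f (map (\<lambda>x. inv g \<otimes> x) zs))) =
      act M g (prism (scale M) (map (\<lambda>x. inv g \<otimes> x) xs) f)"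
proof (induction xs arbitrary: f)
  case Nil show ?case using g act_zero[OF M] by simp
next
  case (Cons y ys)
  have gG: "g \<in> carrier G" and y: "y \<in> carrier G" using g Cons.prems by auto
  let ?m = "map (\<lambda>x. inv g \<otimes> x)"
  have IH: "prism (scale M) ys (\<lambda>zs. act M g (f (h # ?m zs))) = act M g (prism (scale M) (?m ys) (\<lambda>zs. f (h # zs)))"
    for h using Cons.IH[of "\<lambda>zs. f (h # zs)"] Cons.prems by simp
  have "prism (scale M) (y # ys) (\<lambda>zs. act M g (f (?m zs))) =
      (\<Sum>h\<in>H. scale M (wt h y) (act M g (f ((inv g \<otimes> h) # ?m (y # ys))) -
        prism (scale M) ys (\<lambda>zs. act M g (f ((inv g \<otimes> h) # ?m zs)))))" by simp
  also have "\<dots> = (\<Sum>h\<in>H. scale M (wt (g \<otimes> h) y) (act M g (f ((inv g \<otimes> (g \<otimes> h)) # ?m (y # ys))) -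
        prism (scale M) ys (\<lambda>zs. act M g (f ((inv g \<otimes> (g \<otimes> h)) # ?m zs)))))"
    by (rule sum_translate[OF g, symmetric])
  also have "\<dots> = (\<Sum>h\<in>H. scale M (wt h (inv g \<otimes> y)) (act M g (f (h # ?m (y # ys)) -
        prism (scale M) (?m ys) (\<lambda>zs. f (h # zs)))))"
  proof (intro sum.cong refl)
    fix h assume h: "h \<in> H"
    have e: "inv g \<otimes> (g \<otimes> h) = h" using g h by (simp add: m_assoc[symmetric])
    show "scale M (wt (g \<otimes> h) y) (act M g (f ((inv g \<otimes> (g \<otimes> h)) # ?m (y # ys))) -
        prism (scale M) ys (\<lambda>zs. act M g (f ((inv g \<otimes> (g \<otimes> h)) # ?m zs)))) =
      scale M (wt h (inv g \<otimes> y)) (act M g (f (h # ?m (y # ys)) - prism (scale M) (?m ys) (\<lambda>zs. f (h # zs))))"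
      unfolding e IH wt_translate[OF g h y] act_diff[OF M gG Cons.prems(1) prism_in[of "\<lambda>zs. f (h # zs)", OF Cons.prems(1)]] ..
  qed
  also have "\<dots> = act M g (\<Sum>h\<in>H. scale M (wt h (inv g \<otimes> y)) (f (h # ?m (y # ys)) - prism (scale M) (?m ys) (\<lambda>zs. f (h # zs))))"
    by (rule act_lincomb[OF gG, symmetric]) (intro RS(4) prism_in Cons.prems)
  finally show ?case by simp
qed

end

end

lemma bilinear_form_zero:
  assumes "bilinear_form M N \<beta>"
  shows "0 \<in> space M \<Longrightarrow> w \<in> space N \<Longrightarrow> \<beta> 0 w = 0" "v \<in> space M \<Longrightarrow> 0 \<in> space N \<Longrightarrow> \<beta> v 0 = 0"
proof -
  assume "0 \<in> space M" "w \<in> space N"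
  from bilinear_formD(1)[OF assms this(1) this] have "\<beta> 0 w + 0 = \<beta> 0 w + \<beta> 0 w" by (simp only: add_0_left add_0_right)
  thus "\<beta> 0 w = 0" by (metis add_left_cancel)
next
  assume "v \<in> space M" "0 \<in> space N"
  from bilinear_formD(2)[OF assms this this(2)] have "\<beta> v 0 + 0 = \<beta> v 0 + \<beta> v 0" by (simp only: add_0_left add_0_right)
  thus "\<beta> v 0 = 0" by (metis add_left_cancel)
qed

context coord_group
begin

text \<open>Exchanges the factors of \<open>k[G] \<otimes> k[G] \<otimes> ... \<otimes> M\<close>: a
  regular family of cochains becomes a cochain with values in regular functions. It is needed to
  build a cochain with coefficients in functions on \<open>G/H\<close> from an
  \<open>M\<close>-valued one.\<close>

lemma pow_swap:
  fixes s :: "'k \<Rightarrow> 'v::ab_group_add \<Rightarrow> 'v"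
  assumes s: "vector_space s" and V: "module.subspace s V"
    and F: "F \<in> regular_maps G (fscale s) (regular_maps_pow G s V m)"
  shows "(\<lambda>ys x. F x ys) \<in> regular_maps_pow G (fscale s) (regular_maps G s V) m"
proof -
  interpret S: vector_space s by fact
  note vs = vector_space_fscale[OF s] and sub = reg_subspace[OF s, of V]
  note P = subspaceD[OF vector_space_fscale[OF vs] pow_subspace[OF vs sub]]
  show ?thesis using F vs
  proof (induction rule: reg_induct)
    case zero
    from P(1)[of m] show ?case by (simp only: zero_fun_def)
  next
    case (step a v F)
    have "lin_on s (fscale s) V (regular_maps G s V) (\<lambda>u x. s (a x) u)"
      unfolding lin_on_def using reg_pure[OF s step(1)]
      by (simp add: fun_eq_iff fscale_apply S.scale_right_distrib mult.commute)
    from P(2)[OF pow_linear[OF this s vs V sub step(2)] step(4)]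
    have "((\<lambda>u x. s (a x) u) \<circ> v) + (\<lambda>ys x. F x ys) \<in> regular_maps_pow G (fscale s) (regular_maps G s V) m" .
    also have "((\<lambda>u x. s (a x) u) \<circ> v) + (\<lambda>ys x. F x ys) = (\<lambda>ys x. (fscale s (a x) v + F x) ys)"
      by (simp add: fun_eq_iff fscale_apply)
    finally show ?case .
  qed
qed

end

section \<open>Functions on the quotient by the finite subgroup, with values in a module\<close>

context finite_subgroup
begin

text \<open>The coordinate ring of \<open>G/H\<close>; for \<open>H\<close> the group of rational
  points it is the module \<open>Gr\<close>.\<close>

definition invariants :: "('g, 'k, 'g \<Rightarrow> 'k) gmodule" where
  "invariants = induced_module G H trivial_module"

lemma invariants_sel:
  "space invariants = {a \<in> coord G. \<forall>x\<in>carrier G. \<forall>h\<in>H. a (x \<otimes> h) = a x}"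
  "scale invariants = fscale (*)" "act invariants = translate"
  by (simp_all add: invariants_def induced_module_def trivial_module_def regular_maps_scalar translate_def fun_eq_iff)

lemma invariants_rational: "rational_module G invariants"
  unfolding invariants_def
  by (rule induced_rational[where \<chi> = "\<lambda>_. 1"]) (auto simp: trivial_module_def)

context
  fixes M :: "('g, 'k, 'v::ab_group_add) gmodule"
  assumes M: "rational_module G M"
begin

private lemmas R = rationalD[OF M]
private lemmas RS = subspaceD[OF R(1,2)]
private lemmas VS = vector_space_fscale[OF R(1)]

private abbreviation "T \<equiv> invariants \<otimes>\<^sub>k M"
private abbreviation "Reg \<equiv> regular_maps G (scale M) (space M)"

private lemmas T = rationalD[OF tensor_rational[OF M invariants_rational]]

private lemma inv_scale: "\<forall>c. \<forall>a\<in>space invariants. scale invariants c a \<in> space invariants"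
  using subspaceD(3)[OF rationalD(1,2)[OF invariants_rational]] by simp

lemma realization_exists:
  "\<exists>L. lin_on (scale T) (fscale (scale M)) (space T) Reg L \<and>
     (\<forall>a\<in>space invariants. \<forall>v\<in>space M. L (pure_tensor invariants M a v) = (\<lambda>x. scale M (a x) v))"
proof -
  interpret S: vector_space "scale M" by (rule R(1))
  have co: "a \<in> coord G" if "a \<in> space invariants" for a using that unfolding invariants_sel by blast
  obtain L where "lin_on (scale T) (fscale (scale M)) (space T) Reg L"
    "\<And>a v. a \<in> space invariants \<Longrightarrow> v \<in> space M \<Longrightarrow> L (pure_tensor invariants M a v) = (\<lambda>x. scale M (a x) v)"
    by (rule tensor_lift[OF inv_scale VS reg_subspace[OF R(1)], of M "\<lambda>a v x. scale M (a x) v" "space M"])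
      (simp_all add: reg_pure[OF R(1) co] fun_eq_iff fscale_apply S.scale_left_distrib S.scale_right_distrib
        invariants_sel(2) mult.commute)
  thus ?thesis by blast
qed

text \<open>Elements of \<open>k[G/H] \<otimes> M\<close> viewed as functions from \<open>G\<close> to \<open>M\<close>.\<close>

definition realization :: "((('g \<Rightarrow> 'k) \<Rightarrow> 'v \<Rightarrow> 'k) \<Rightarrow> 'k) \<Rightarrow> 'g \<Rightarrow> 'v" where
  "realization = (SOME L. lin_on (scale T) (fscale (scale M)) (space T) Reg L \<and>
     (\<forall>a\<in>space invariants. \<forall>v\<in>space M. L (pure_tensor invariants M a v) = (\<lambda>x. scale M (a x) v)))"

lemma realization_lin: "lin_on (scale T) (fscale (scale M)) (space T) Reg realization"
  using someI_ex[OF realization_exists] unfolding realization_def by blast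

lemma realization_pure:
  "a \<in> space invariants \<Longrightarrow> v \<in> space M \<Longrightarrow> realization (pure_tensor invariants M a v) = (\<lambda>x. scale M (a x) v)"
  using someI_ex[OF realization_exists] unfolding realization_def by blast

private lemmas RL = lin_onD[OF realization_lin]

lemma realization_zero: "realization 0 = 0"
  by (rule lin_on_diff(1)[OF realization_lin T(1) VS T(2)])

lemma realization_in: "\<Theta> \<in> space T \<Longrightarrow> realization \<Theta> x \<in> space M"
  by (rule reg_in[OF RL(1) R(1,2)])

lemma realization_outside: "\<Theta> \<in> space T \<Longrightarrow> x \<notin> carrier G \<Longrightarrow> realization \<Theta> x = 0"
  by (rule reg_outside[OF RL(1) R(1)])

lemma realization_step:
  "a \<in> space invariants \<Longrightarrow> v \<in> space M \<Longrightarrow> \<Theta> \<in> space T \<Longrightarrow>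
    realization (pure_tensor invariants M a v + \<Theta>) x = scale M (a x) v + realization \<Theta> x"
  by (simp add: RL(2)[OF pure_tensor_in] realization_pure)

lemma realization_act:
  assumes y: "y \<in> carrier G" and x: "x \<in> carrier G" and "\<Theta> \<in> space T"
  shows "realization (act T y \<Theta>) x = act M y (realization \<Theta> (inv y \<otimes> x))"
  using assms(3) inv_scale
proof (induction rule: tensor_induct)
  case zero
  show ?case unfolding tensor_act_linear(3)[OF M] realization_zero using act_zero[OF M y] by simp
next
  case (step a v \<Theta>)
  have ya: "act invariants y a \<in> space invariants"
    by (rule rationalD(3)[OF invariants_rational y step(1)])
  note t = pure_tensor_in[OF ya R(3)[OF y step(2)]]
  have "realization (act T y (pure_tensor invariants M a v + \<Theta>)) x =
      scale M (act invariants y a x) (act M y v) + realization (act T y \<Theta>) x"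
    unfolding tensor_act_linear(1)[OF M] tensor_act_pure[OF M invariants_rational y]
    by (rule realization_step[OF ya R(3)[OF y step(2)] T(3)[OF y step(3)]])
  also have "act invariants y a x = a (inv y \<otimes> x)" using x by (simp add: invariants_sel translate_def)
  also have "scale M (a (inv y \<otimes> x)) (act M y v) = act M y (scale M (a (inv y \<otimes> x)) v)"
    by (rule R(5)[OF y step(2), symmetric])
  also have "act M y (scale M (a (inv y \<otimes> x)) v) + realization (act T y \<Theta>) x =
      act M y (scale M (a (inv y \<otimes> x)) v + realization \<Theta> (inv y \<otimes> x))"
    unfolding step(4) by (rule R(4)[OF y RS(3)[OF step(2)] realization_in[OF step(3)], symmetric])
  also have "\<dots> = act M y (realization (pure_tensor invariants M a v + \<Theta>) (inv y \<otimes> x))"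
    unfolding realization_step[OF step(1-3)] ..
  finally show ?case .
qed

lemma realization_invariant:
  assumes x: "x \<in> carrier G" "h \<in> H" and "\<Theta> \<in> space T"
  shows "realization \<Theta> (x \<otimes> h) = realization \<Theta> x"
  using assms(3) inv_scale
proof (induction rule: tensor_induct)
  case zero show ?case unfolding realization_zero by simp
next
  case (step a v \<Theta>)
  have "a (x \<otimes> h) = a x" using step(1) x unfolding invariants_sel by blast
  thus ?case unfolding realization_step[OF step(1-3)] step(4) by simp
qed

text \<open>In terms of a basis of \<open>space M\<close>, a tensor is the sum of its coefficient
  functions tensored with basis vectors, and these coefficients can be read off the realization. If
  the realization is zero, all coefficients vanish.\<close>

lemma realization_inj:
  assumes "\<Theta> \<in> space T" "realization \<Theta> = 0"
  shows "\<Theta> = 0"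
proof -
  interpret S: vector_space "scale M" by (rule R(1))
  obtain B where B: "B \<subseteq> space M" "S.independent B" "space M \<subseteq> S.span B"
    using S.maximal_independent_subset[of "space M"] by blast
  define rp where "rp = S.representation B"
  have rp_add: "rp (v + w) b = rp v b + rp w b" if "v \<in> space M" "w \<in> space M" for v w b
    using fun_cong[OF S.representation_add[OF B(2) subsetD[OF B(3) that(2)] subsetD[OF B(3) that(1)]], of b]
    unfolding rp_def .
  have rp_scale: "rp (scale M c v) b = c * rp v b" if "v \<in> space M" for c v b
    using fun_cong[OF S.representation_scale[OF B(2) subsetD[OF B(3) that]], of c b] unfolding rp_def .
  have rp_zero: "rp 0 b = 0" for b unfolding rp_def by (simp add: S.representation_zero)
  define co where "co F b = (\<lambda>x. rp (F x) b)" for F :: "'g \<Rightarrow> 'v" and b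
  note I = subspaceD[OF rationalD(1,2)[OF invariants_rational]]
  \<comment> \<open>\<open>B0\<close> is a finite support. The coefficients are also shown to lie in
    \<open>invariants\<close>, since a bilinear form is additive on that space only.\<close>
  have ex: "\<exists>B0. finite B0 \<and> B0 \<subseteq> B \<and> (\<forall>b. co (realization \<Theta>) b \<in> space invariants) \<and>
      (\<forall>b. b \<notin> B0 \<longrightarrow> co (realization \<Theta>) b = 0) \<and>
      (\<forall>\<beta>. bilinear_form invariants M \<beta> \<longrightarrow> \<Theta> \<beta> = (\<Sum>b\<in>B0. \<beta> (co (realization \<Theta>) b) b))"
    using assms(1) inv_scale
  proof (induction rule: tensor_induct)
    case zero
    have c0: "co (realization 0) b = 0" for b unfolding realization_zero co_def by (simp add: fun_eq_iff rp_zero)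
    show ?case
    proof (intro exI[of _ "{}"] conjI allI impI)
      show "co (realization 0) b \<in> space invariants" for b unfolding c0 by (rule I(1))
      show "co (realization 0) b = 0" for b by (rule c0)
    qed simp_all
  next
    case (step a v \<Theta>)
    from step(4) obtain B0 where B0: "finite B0" "B0 \<subseteq> B" "\<forall>b. co (realization \<Theta>) b \<in> space invariants"
      "\<forall>b. b \<notin> B0 \<longrightarrow> co (realization \<Theta>) b = 0"
      "\<forall>\<beta>. bilinear_form invariants M \<beta> \<longrightarrow> \<Theta> \<beta> = (\<Sum>b\<in>B0. \<beta> (co (realization \<Theta>) b) b)"
      by (elim exE conjE)
    define B1 where "B1 = {b. rp v b \<noteq> 0}"
    have B1: "finite B1" unfolding B1_def rp_def by (rule S.finite_representation)
    have B1B: "B1 \<subseteq> B" unfolding B1_def rp_def using S.representation_ne_zero by blast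
    have vs: "v \<in> S.span B" using step(2) B(3) by blast
    have v_eq: "v = (\<Sum>b\<in>B1. scale M (rp v b) b)"
      unfolding B1_def rp_def by (rule S.sum_nonzero_representation_eq[OF B(2) vs, symmetric])
    let ?ca = "\<lambda>b. fscale (*) (rp v b) a"
    have ca: "?ca b \<in> space invariants" for b
      using inv_scale step(1) unfolding invariants_sel(2) by blast
    have ca0: "?ca b = 0" if "b \<notin> B1" for b using that by (simp add: B1_def fun_eq_iff fscale_apply)
    have co_eq: "co (realization (pure_tensor invariants M a v + \<Theta>)) b = ?ca b + co (realization \<Theta>) b" for b
      unfolding co_def realization_step[OF step(1-3)] rp_add[OF RS(3)[OF step(2)] realization_in[OF step(3)]]
        rp_scale[OF step(2)] by (simp add: fun_eq_iff fscale_apply mult.commute)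
    show ?case
    proof (intro exI[of _ "B0 \<union> B1"] conjI allI impI)
      show "finite (B0 \<union> B1)" using B0(1) B1 by simp
      show "B0 \<union> B1 \<subseteq> B" using B0(2) B1B by simp
      show "co (realization (pure_tensor invariants M a v + \<Theta>)) b \<in> space invariants" for b
        unfolding co_eq by (rule I(2)[OF ca B0(3)[rule_format]])
      show "co (realization (pure_tensor invariants M a v + \<Theta>)) b = 0" if "b \<notin> B0 \<union> B1" for b
        unfolding co_eq using B0(4) ca0 that by simp
      fix \<beta> assume \<beta>: "bilinear_form invariants M \<beta>"
      note bil = bilinear_formD[OF \<beta>]
      have b0: "\<beta> 0 w = 0" if "w \<in> space M" for w by (rule bilinear_form_zero(1)[OF \<beta> I(1) that])
      have bM: "b \<in> space M" if "b \<in> B0 \<union> B1" for b using that B0(2) B1B B(1) by blast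
      have "\<beta> a (\<Sum>b\<in>C. scale M (rp v b) b) = (\<Sum>b\<in>C. \<beta> (?ca b) b)" if "C \<subseteq> B1" for C
        using that
      proof (induction C rule: infinite_finite_induct)
        case (infinite C) thus ?case using finite_subset[OF _ B1] by blast
      next
        case empty
        show ?case unfolding sum.empty by (rule bilinear_form_zero(2)[OF \<beta> step(1) RS(1)])
      next
        case (insert b C)
        have b: "b \<in> space M" using bM insert.prems by blast
        have sC: "(\<Sum>b\<in>C. scale M (rp v b) b) \<in> space M"
          using bM insert.prems by (intro S.subspace_sum[OF R(2)] RS(3)) blast
        have "\<beta> a (scale M (rp v b) b) = \<beta> (?ca b) b"
          using bil(4)[OF step(1) b] bil(3)[OF step(1) b] unfolding invariants_sel(2) by simp
        thus ?case using insert bil(2)[OF step(1) RS(3)[OF b] sC] by simp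
      qed
      from this[OF subset_refl] have 1: "\<beta> a v = (\<Sum>b\<in>B1. \<beta> (?ca b) b)" unfolding v_eq[symmetric] .
      also have "\<dots> = (\<Sum>b\<in>B0 \<union> B1. \<beta> (?ca b) b)"
        using B0(1) B1 bM by (intro sum.mono_neutral_left) (auto simp: ca0 b0)
      finally have 1: "\<beta> a v = (\<Sum>b\<in>B0 \<union> B1. \<beta> (?ca b) b)" .
      have "(\<Sum>b\<in>B0. \<beta> (co (realization \<Theta>) b) b) = (\<Sum>b\<in>B0 \<union> B1. \<beta> (co (realization \<Theta>) b) b)"
        using B0(1) B1 bM by (intro sum.mono_neutral_left) (auto simp: B0(4) b0)
      with 1 have "(pure_tensor invariants M a v + \<Theta>) \<beta> =
          (\<Sum>b\<in>B0 \<union> B1. \<beta> (?ca b) b + \<beta> (co (realization \<Theta>) b) b)"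
        using B0(5) \<beta> by (simp add: pure_tensor_def sum.distrib)
      also have "\<dots> = (\<Sum>b\<in>B0 \<union> B1. \<beta> (co (realization (pure_tensor invariants M a v + \<Theta>)) b) b)"
        unfolding co_eq by (intro sum.cong refl bil(1)[symmetric] ca B0(3)[rule_format] bM)
      finally show "(pure_tensor invariants M a v + \<Theta>) \<beta> =
          (\<Sum>b\<in>B0 \<union> B1. \<beta> (co (realization (pure_tensor invariants M a v + \<Theta>)) b) b)" .
    qed
  qed
  from ex obtain B0 where B0: "B0 \<subseteq> B"
    "\<forall>\<beta>. bilinear_form invariants M \<beta> \<longrightarrow> \<Theta> \<beta> = (\<Sum>b\<in>B0. \<beta> (co (realization \<Theta>) b) b)"
    by (elim exE conjE)
  have co0: "co (realization \<Theta>) b = 0" for b unfolding assms(2) co_def by (simp add: fun_eq_iff rp_zero)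
  \<comment> \<open>Off the bilinear forms a tensor has the default value \<open>0\<close>; this is
    needed to conclude equality of functionals everywhere.\<close>
  have out: "\<Theta> \<beta> = 0" if "\<not> bilinear_form invariants M \<beta>" for \<beta>
    using assms(1) inv_scale
  proof (induction rule: tensor_induct)
    case (step a v \<Theta>) thus ?case using that by (simp add: pure_tensor_def)
  qed simp
  show ?thesis
  proof
    fix \<beta> show "\<Theta> \<beta> = 0 \<beta>"
    proof (cases "bilinear_form invariants M \<beta>")
      case True
      have "\<beta> 0 b = 0" if "b \<in> B0" for b
        using bilinear_form_zero(1)[OF True I(1), of b] that B0(1) B(1) by blast
      thus ?thesis using B0(2) True co0 by simp
    qed (simp add: out)
  qed
qed

end

end

section \<open>Comparison of the cochain complexes of the group and its finite subgroup\<close>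

context averaging
begin

context
  fixes M :: "('g, 'k, 'v::ab_group_add) gmodule"
  assumes M: "rational_module G M"
begin

private lemmas MR = rationalD[OF M]
private lemmas MRS = subspaceD[OF MR(1,2)]
private lemmas VS = vector_space_fscale[OF MR(1)]

private abbreviation "TM \<equiv> invariants \<otimes>\<^sub>k M"
private abbreviation "RegM \<equiv> regular_maps G (scale M) (space M)"
private abbreviation "\<theta> \<equiv> realization M"

private lemmas TR = tensor_rational[OF M invariants_rational]
private lemmas T = rationalD[OF TR]
private lemmas RL = lin_onD[OF realization_lin[OF M]]
private lemmas RegS = reg_subspace[OF MR(1), of "space M"]

text \<open>The weighted sum over right translates projects functions on \<open>G\<close> to
  functions on \<open>G/H\<close>; on \<open>a\<close> tensored with \<open>v\<close> it is the
  trace of \<open>c * a\<close> tensored with \<open>v\<close>, which visibly lies in the tensor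
  product.\<close>

lemma realization_average:
  "F \<in> RegM \<Longrightarrow> \<exists>\<Theta>\<in>space TM. \<forall>x\<in>carrier G. \<theta> \<Theta> x = (\<Sum>h\<in>H. scale M (c (x \<otimes> h)) (F (x \<otimes> h)))"
proof -
  interpret S: vector_space "scale M" by (rule MR(1))
  assume "F \<in> RegM"
  thus ?thesis using MR(1)
  proof (induction rule: reg_induct)
    case zero
    show ?case by (rule bexI[OF _ tensor_closed(1)]) (unfold realization_zero[OF M], simp)
  next
    case (step a v F)
    from step(4) obtain \<Theta> where t: "\<Theta> \<in> space TM"
      "\<forall>x\<in>carrier G. \<theta> \<Theta> x = (\<Sum>h\<in>H. scale M (c (x \<otimes> h)) (F (x \<otimes> h)))" by (elim bexE)
    define b where "b x = (\<Sum>h\<in>H. restr (carrier G) (\<lambda>x. c (x \<otimes> h) * a (x \<otimes> h)) x)" for x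
    have "b \<in> coord G" unfolding b_def
      using coord_translate[OF coord_mult[OF c_coord step(1)]] by (intro coord_sum) simp
    moreover have "b (x \<otimes> g) = b x" if "x \<in> carrier G" "g \<in> H" for x g
      using subgroup_sum_translate(1)[OF subgroup that(2), of "\<lambda>h. c (x \<otimes> h) * a (x \<otimes> h)"] that
      by (simp add: b_def restr_def m_assoc)
    ultimately have b: "b \<in> space invariants" unfolding invariants_sel by blast
    show ?case
    proof (intro bexI ballI)
      show "pure_tensor invariants M b v + \<Theta> \<in> space TM"
        by (rule tensor_closed(2)[OF pure_tensor_in[OF b step(2)] t(1)])
      fix x assume x: "x \<in> carrier G"
      have "scale M (b x) v = (\<Sum>h\<in>H. scale M (c (x \<otimes> h)) (scale M (a (x \<otimes> h)) v))"
        using x by (simp add: b_def restr_def S.scale_sum_left)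
      thus "\<theta> (pure_tensor invariants M b v + \<Theta>) x =
          (\<Sum>h\<in>H. scale M (c (x \<otimes> h)) (scale M (a (x \<otimes> h)) v + F (x \<otimes> h)))"
        unfolding realization_step[OF M b step(2) t(1)] using t(2) x
        by (simp add: S.scale_right_distrib sum.distrib)
    qed
  qed
qed

text \<open>On a function that is already invariant, averaging with weights of total mass
  \<open>1\<close> does nothing, so the function is the realization of its average.\<close>

lemma realization_surj:
  assumes F: "F \<in> RegM" "\<And>x h. x \<in> carrier G \<Longrightarrow> h \<in> H \<Longrightarrow> F (x \<otimes> h) = F x"
  shows "\<exists>\<Theta>\<in>space TM. \<theta> \<Theta> = F"
proof -
  interpret S: vector_space "scale M" by (rule MR(1))
  from realization_average[OF F(1)] obtain \<Theta> where t: "\<Theta> \<in> space TM"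
    "\<forall>x\<in>carrier G. \<theta> \<Theta> x = (\<Sum>h\<in>H. scale M (c (x \<otimes> h)) (F (x \<otimes> h)))" by (elim bexE)
  have "\<theta> \<Theta> x = F x" for x
  proof (cases "x \<in> carrier G")
    case True
    have "\<theta> \<Theta> x = (\<Sum>h\<in>H. scale M (c (x \<otimes> h)) (F x))" using t(2) True F(2) by simp
    also have "\<dots> = F x" using c_trace[OF True] by (simp flip: S.scale_sum_left)
    finally show ?thesis .
  next
    case False
    thus ?thesis using realization_outside[OF M t(1)] reg_outside[OF F(1) MR(1)] by simp
  qed
  hence "\<theta> \<Theta> = F" by (rule ext)
  thus ?thesis using t(1) by (rule bexI)
qed

text \<open>The inverse is extended to a linear map on all regular functions, so that composing with
  it preserves regularity of cochains.\<close>

lemma realization_inverse: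
  obtains L where "lin_on (fscale (scale M)) (scale TM) RegM (space TM) L"
    "\<forall>F\<in>RegM. (\<forall>x\<in>carrier G. \<forall>h\<in>H. F (x \<otimes> h) = F x) \<longrightarrow> \<theta> (L F) = F"
proof -
  define N where "N = {F \<in> RegM. \<forall>x\<in>carrier G. \<forall>h\<in>H. F (x \<otimes> h) = F x}"
  interpret S: vector_space "fscale (scale M)" by (rule VS)
  have N: "S.subspace N"
    unfolding S.subspace_def N_def using subspaceD(1-3)[OF VS RegS] by (simp add: fscale_apply)
  have lin: "lin_on (scale TM) (fscale (scale M)) (space TM) N \<theta>"
    using RL realization_invariant[OF M] unfolding lin_on_def N_def by blast
  have onto: "\<theta> ` space TM = N"
  proof (intro equalityI subsetI)
    fix F assume "F \<in> \<theta> ` space TM" thus "F \<in> N" using lin_onD(1)[OF lin] by blast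
  next
    fix F assume F: "F \<in> N"
    have "\<exists>\<Theta>\<in>space TM. \<theta> \<Theta> = F" by (rule realization_surj) (use F in \<open>auto simp: N_def\<close>)
    thus "F \<in> \<theta> ` space TM" by blast
  qed
  obtain L where L: "lin_on (fscale (scale M)) (scale TM) N (space TM) L" "\<And>F. F \<in> N \<Longrightarrow> \<theta> (L F) = F"
    by (rule lin_on_right_inverse[OF lin T(1) VS T(2) N onto]) (rule that)
  obtain L' where L': "Vector_Spaces.linear (fscale (scale M)) (scale TM) L'"
    "\<And>F. L' F \<in> space TM" "\<And>F. F \<in> N \<Longrightarrow> L' F = L F"
    by (rule lin_on_extend[OF L(1) VS T(1) N T(2)]) (rule that)
  show thesis
  proof (rule that[of L'])
    show "lin_on (fscale (scale M)) (scale TM) RegM (space TM) L'" 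
      using L'(1,2) by (simp add: lin_on_def Vector_Spaces.linear_iff)
    show "\<forall>F\<in>RegM. (\<forall>x\<in>carrier G. \<forall>h\<in>H. F (x \<otimes> h) = F x) \<longrightarrow> \<theta> (L' F) = F"
    proof (intro ballI impI)
      fix F assume "F \<in> RegM" "\<forall>x\<in>carrier G. \<forall>h\<in>H. F (x \<otimes> h) = F x"
      hence "F \<in> N" by (simp add: N_def)
      thus "\<theta> (L' F) = F" using L'(3) L(2) by simp
    qed
  qed
qed

text \<open>Cochains on all of \<open>G\<close> that are invariant under \<open>H\<close> only: the
  standard resolution for \<open>G\<close>, used to compute the cohomology of \<open>H\<close>. They
  stand between the two complexes to be compared.\<close>

definition subgroup_cochains :: "nat \<Rightarrow> ('g list \<Rightarrow> 'v) set" where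
  "subgroup_cochains n = {\<omega> \<in> regular_maps_pow G (scale M) (space M) (Suc n). \<forall>g\<in>H. tact M g \<omega> = \<omega>}"

text \<open>Evaluation at the base point of \<open>G/H\<close>, the counit of Frobenius
  reciprocity.\<close>

private abbreviation "E \<psi> \<equiv> (\<lambda>\<Theta>. \<theta> \<Theta> \<one>) \<circ> \<psi>"

lemma eval_lin: "lin_on (scale TM) (scale M) (space TM) (space M) (\<lambda>\<Theta>. \<theta> \<Theta> \<one>)"
  unfolding lin_on_def using RL realization_in[OF M] by (simp add: fscale_apply)

lemma eval_zero: "E 0 = 0"
  by (rule ext) (unfold o_apply zero_fun_apply realization_zero[OF M], rule refl)

lemma eval_diff: "\<psi> \<in> cochains G TM n \<Longrightarrow> std_differential G (E \<psi>) = E (std_differential G \<psi>)"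
  by (rule diff_comp[OF eval_lin T(1) MR(1) T(2) cochains_in[OF TR]])

lemma cochain_translate:
  assumes "\<psi> \<in> cochains G TM n" "y \<in> carrier G" "set xs \<subseteq> carrier G"
  shows "\<psi> xs = act TM y (\<psi> (map (\<lambda>x. inv y \<otimes> x) xs))"
proof -
  have "tact TM y \<psi> = \<psi>" using assms(1,2) unfolding cochains_iff by blast
  from fun_cong[OF this, of xs] show ?thesis using assms(3) by (simp add: tact_def)
qed

text \<open>Elements of \<open>H\<close> fix the base point of \<open>G/H\<close>, so evaluation
  there turns invariance under \<open>G\<close> into invariance under \<open>H\<close>.\<close>

lemma eval_cochain:
  assumes \<psi>: "\<psi> \<in> cochains G TM n"
  shows "E \<psi> \<in> subgroup_cochains n"
proof -
  have pw: "\<psi> \<in> regular_maps_pow G (scale TM) (space TM) (Suc n)" using \<psi> unfolding cochains_iff by blast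
  have 1: "E \<psi> \<in> regular_maps_pow G (scale M) (space M) (Suc n)"
    by (rule pow_linear[OF eval_lin T(1) MR(1) T(2) MR(2) pw])
  have "tact M g (E \<psi>) = E \<psi>" if g: "g \<in> H" for g
  proof
    fix xs
    show "tact M g (E \<psi>) xs = (E \<psi>) xs"
    proof (cases "set xs \<subseteq> carrier G")
      case False
      thus ?thesis using pow_outside[OF 1 MR(1), of xs] by (simp add: tact_def)
    next
      case True
      let ?xs = "map (\<lambda>x. inv g \<otimes> x) xs"
      have gG: "g \<in> carrier G" using g by simp
      note pin = cochains_in[OF TR \<psi>, of ?xs]
      have "\<theta> (\<psi> xs) \<one> = act M g (\<theta> (\<psi> ?xs) (inv g \<otimes> \<one>))"
        unfolding cochain_translate[OF \<psi> gG True] by (rule realization_act[OF M gG one_closed pin])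
      also have "\<theta> (\<psi> ?xs) (inv g \<otimes> \<one>) = \<theta> (\<psi> ?xs) \<one>"
        using realization_invariant[OF M one_closed _ pin, of "inv g"] g by simp
      finally show ?thesis using True by (simp add: tact_def)
    qed
  qed
  thus ?thesis using 1 unfolding subgroup_cochains_def by blast
qed

text \<open>By invariance the value of the function \<open>\<psi> xs\<close> at \<open>x\<close> is
  \<open>x\<close> applied to the value at the identity of \<open>\<psi>\<close> on the tuple
  translated by \<open>inv x\<close>.\<close>

lemma eval_inj:
  assumes \<psi>: "\<psi> \<in> cochains G TM n" and z: "E \<psi> = 0"
  shows "\<psi> = 0"
proof
  have pw: "\<psi> \<in> regular_maps_pow G (scale TM) (space TM) (Suc n)" using \<psi> unfolding cochains_iff by blast
  fix xs show "\<psi> xs = 0 xs"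
  proof (cases "set xs \<subseteq> carrier G")
    case False
    thus ?thesis using pow_outside[OF pw T(1), of xs] by simp
  next
    case True
    note pin = cochains_in[OF TR \<psi>]
    have "\<theta> (\<psi> xs) x = 0" for x
    proof (cases "x \<in> carrier G")
      case False thus ?thesis by (rule realization_outside[OF M pin])
    next
      case x: True
      let ?xs = "map (\<lambda>z. inv x \<otimes> z) xs"
      have "\<theta> (\<psi> xs) x = act M x (\<theta> (\<psi> ?xs) (inv x \<otimes> x))"
        unfolding cochain_translate[OF \<psi> x True] by (rule realization_act[OF M x x pin])
      also have "\<theta> (\<psi> ?xs) (inv x \<otimes> x) = 0" using fun_cong[OF z, of ?xs] x by simp
      finally show ?thesis using act_zero[OF M x] by simp
    qed
    hence "\<theta> (\<psi> xs) = 0" by (simp add: fun_eq_iff)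
    from realization_inj[OF M pin this] show ?thesis by simp
  qed
qed

lemma eval_inj_diff:
  assumes "\<psi> \<in> cochains G TM n" "\<psi>' \<in> cochains G TM n" "E \<psi> = E \<psi>'"
  shows "\<psi> = \<psi>'"
proof -
  have "E (\<psi> - \<psi>') = 0"
  proof
    fix xs
    have "\<theta> (\<psi> xs - \<psi>' xs) \<one> = \<theta> (\<psi> xs) \<one> - \<theta> (\<psi>' xs) \<one>"
      by (rule lin_on_diff(2)[OF eval_lin T(1) MR(1) T(2)]) (rule cochains_in[OF TR] assms)+
    thus "E (\<psi> - \<psi>') xs = 0 xs" using fun_cong[OF assms(3), of xs] by simp
  qed
  from eval_inj[OF cochains_closed(4)[OF TR assms(1,2)] this] show ?thesis by simp
qed

text \<open>The preimage is dictated by equivariance: its function at \<open>xs\<close> sends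
  \<open>x\<close> to \<open>x\<close> applied to \<open>\<omega>\<close> on the translated tuple.
  Invariance of \<open>\<omega>\<close> under \<open>H\<close> makes this constant on cosets of
  \<open>H\<close>, so it is the realization of a tensor.\<close>

lemma eval_surj:
  assumes \<omega>: "\<omega> \<in> subgroup_cochains n"
  shows "\<exists>\<psi>\<in>cochains G TM n. E \<psi> = \<omega>"
proof -
  have w: "\<omega> \<in> regular_maps_pow G (scale M) (space M) (Suc n)" "\<And>g. g \<in> H \<Longrightarrow> tact M g \<omega> = \<omega>"
    using \<omega> unfolding subgroup_cochains_def by blast+
  note win = pow_in[OF w(1) MR(1,2)]
  obtain L where L: "lin_on (fscale (scale M)) (scale TM) RegM (space TM) L"
    "\<forall>F\<in>RegM. (\<forall>x\<in>carrier G. \<forall>h\<in>H. F (x \<otimes> h) = F x) \<longrightarrow> \<theta> (L F) = F"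
    by (rule realization_inverse) (rule that)
  define \<Omega> where "\<Omega> = (\<lambda>xs x. (if x \<in> carrier G then tact M x \<omega> else 0) xs)"
  have \<Omega>: "\<Omega> \<in> regular_maps_pow G (fscale (scale M)) RegM (Suc n)"
    unfolding \<Omega>_def by (rule pow_swap[OF MR(1,2) tact_rational[OF M w(1)]])
  have \<Omega>_val: "\<Omega> xs x = act M x (\<omega> (map (\<lambda>z. inv x \<otimes> z) xs))" if "set xs \<subseteq> carrier G" "x \<in> carrier G" for xs x
    using that by (simp add: \<Omega>_def tact_def)
  have \<Omega>_out: "\<Omega> xs x = 0" if "\<not> (set xs \<subseteq> carrier G \<and> x \<in> carrier G)" for xs x
    using that by (auto simp: \<Omega>_def tact_def)
  have \<Omega>_reg: "\<Omega> xs \<in> RegM" for xs by (rule pow_in[OF \<Omega> VS RegS])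
  have \<Omega>_inv: "\<Omega> xs (x \<otimes> h) = \<Omega> xs x" if x: "x \<in> carrier G" and h: "h \<in> H" for xs x h
  proof (cases "set xs \<subseteq> carrier G")
    case True
    let ?xs = "map (\<lambda>z. inv x \<otimes> z) xs"
    have xs: "set ?xs \<subseteq> carrier G" using True x by auto
    have hG: "h \<in> carrier G" using h by simp
    have e: "map (\<lambda>z. inv (x \<otimes> h) \<otimes> z) xs = map (\<lambda>z. inv h \<otimes> z) ?xs"
      using True x hG by (auto simp: inv_mult_group m_assoc)
    have "\<Omega> xs (x \<otimes> h) = act M (x \<otimes> h) (\<omega> (map (\<lambda>z. inv h \<otimes> z) ?xs))"
      unfolding e[symmetric] by (rule \<Omega>_val[OF True m_closed[OF x hG]])
    also have "\<dots> = act M x (act M h (\<omega> (map (\<lambda>z. inv h \<otimes> z) ?xs)))" by (rule MR(7)[OF x hG win])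
    also have "act M h (\<omega> (map (\<lambda>z. inv h \<otimes> z) ?xs)) = \<omega> ?xs"
      using fun_cong[OF w(2)[OF h], of ?xs] xs by (simp add: tact_def)
    also have "act M x (\<omega> ?xs) = \<Omega> xs x" by (rule \<Omega>_val[OF True x, symmetric])
    finally show ?thesis .
  qed (simp add: \<Omega>_out)
  define \<psi> where "\<psi> = L \<circ> \<Omega>"
  have pw: "\<psi> \<in> regular_maps_pow G (scale TM) (space TM) (Suc n)"
    unfolding \<psi>_def by (rule pow_linear[OF L(1) VS T(1) RegS T(2) \<Omega>])
  note pin = pow_in[OF pw T(1,2)]
  have \<theta>\<psi>: "\<theta> (\<psi> xs) = \<Omega> xs" for xs
    unfolding \<psi>_def o_apply using L(2) \<Omega>_reg \<Omega>_inv by simp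
  have "tact TM y \<psi> = \<psi>" if y: "y \<in> carrier G" for y
  proof
    fix xs
    show "tact TM y \<psi> xs = \<psi> xs"
    proof (cases "set xs \<subseteq> carrier G")
      case False
      thus ?thesis using pow_outside[OF pw T(1), of xs] by (simp add: tact_def)
    next
      case True
      let ?xs = "map (\<lambda>z. inv y \<otimes> z) xs"
      have xs: "set ?xs \<subseteq> carrier G" using True y by auto
      have "\<theta> (act TM y (\<psi> ?xs)) x = \<theta> (\<psi> xs) x" for x
      proof (cases "x \<in> carrier G")
        case False
        thus ?thesis using realization_outside[OF M T(3)[OF y pin]] realization_outside[OF M pin] by simp
      next
        case x: True
        have yx: "inv y \<otimes> x \<in> carrier G" using x y by simp
        have e: "map (\<lambda>z. inv (inv y \<otimes> x) \<otimes> z) ?xs = map (\<lambda>z. inv x \<otimes> z) xs"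
        proof -
          have "inv (inv y \<otimes> x) \<otimes> (inv y \<otimes> z) = inv x \<otimes> z" if z: "z \<in> carrier G" for z
          proof -
            have "y \<otimes> (inv y \<otimes> z) = z" using y z by (simp add: m_assoc[symmetric])
            thus ?thesis using x y z by (simp add: inv_mult_group m_assoc)
          qed
          thus ?thesis using True by auto
        qed
        have "\<theta> (act TM y (\<psi> ?xs)) x = act M y (\<Omega> ?xs (inv y \<otimes> x))"
          unfolding \<theta>\<psi>[symmetric] by (rule realization_act[OF M y x pin])
        also have "\<Omega> ?xs (inv y \<otimes> x) = act M (inv y \<otimes> x) (\<omega> (map (\<lambda>z. inv x \<otimes> z) xs))"
          unfolding e[symmetric] by (rule \<Omega>_val[OF xs yx])
        also have "act M y (act M (inv y \<otimes> x) (\<omega> (map (\<lambda>z. inv x \<otimes> z) xs))) =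
            act M (y \<otimes> (inv y \<otimes> x)) (\<omega> (map (\<lambda>z. inv x \<otimes> z) xs))"
          by (rule MR(7)[OF y yx win, symmetric])
        also have "y \<otimes> (inv y \<otimes> x) = x" using x y by (simp add: m_assoc[symmetric])
        also have "act M x (\<omega> (map (\<lambda>z. inv x \<otimes> z) xs)) = \<theta> (\<psi> xs) x"
          unfolding \<theta>\<psi> by (rule \<Omega>_val[OF True x, symmetric])
        finally show ?thesis .
      qed
      \<comment> \<open>Invariance is verified for the realizations, where the group acts by an
        explicit formula, and brought back by injectivity.\<close>
      hence eq: "\<theta> (act TM y (\<psi> ?xs)) = \<theta> (\<psi> xs)" by (rule ext)
      have ya: "act TM y (\<psi> ?xs) \<in> space TM" by (rule T(3)[OF y pin])
      have "\<theta> (act TM y (\<psi> ?xs) - \<psi> xs) = 0"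
        using lin_on_diff(2)[OF realization_lin[OF M] T(1) VS T(2) ya pin] eq by simp
      from realization_inj[OF M subspaceD(4)[OF T(1,2) ya pin] this]
      show ?thesis using True by (simp add: tact_def)
    qed
  qed
  hence "\<psi> \<in> cochains G TM n" using pw unfolding cochains_iff by blast
  moreover have "E \<psi> = \<omega>"
  proof
    fix xs
    show "E \<psi> xs = \<omega> xs"
    proof (cases "set xs \<subseteq> carrier G")
      case False
      thus ?thesis using pow_outside[OF w(1) MR(1), of xs] by (simp add: \<theta>\<psi> \<Omega>_out)
    next
      case True
      have "map (\<lambda>z. inv \<one> \<otimes> z) xs = xs" using True by (intro map_idI) auto
      thus ?thesis using \<Omega>_val[OF True one_closed] MR(6)[OF win] by (simp add: \<theta>\<psi>)
    qed
  qed
  ultimately show ?thesis by (intro bexI)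
qed

definition restrict_cochain :: "('g list \<Rightarrow> 'v) \<Rightarrow> 'g list \<Rightarrow> 'v" where
  "restrict_cochain \<omega> hs = (if set hs \<subseteq> H then \<omega> hs else 0)"

private abbreviation "av z \<equiv> (\<lambda>xs. average (scale M) xs z)"
private abbreviation "pr z \<equiv> (\<lambda>xs. prism (scale M) xs z)"

lemma GH_cochains:
  "z \<in> cochains GH M n \<longleftrightarrow> (\<forall>xs. z xs \<in> space M) \<and> (\<forall>xs. length xs \<noteq> Suc n \<or> \<not> set xs \<subseteq> H \<longrightarrow> z xs = 0) \<and>
     (\<forall>g\<in>H. \<forall>xs. set xs \<subseteq> H \<longrightarrow> act M g (z (map (\<lambda>x. inv g \<otimes> x) xs)) = z xs)"
proof -
  have "(GH.tact M g z = z) \<longleftrightarrow> (\<forall>xs. set xs \<subseteq> H \<longrightarrow> act M g (z (map (\<lambda>x. inv g \<otimes> x) xs)) = z xs)"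
    if "g \<in> H" "\<forall>xs. \<not> set xs \<subseteq> H \<longrightarrow> z xs = 0" for g
    using that unfolding GH.tact_def fun_eq_iff by (auto simp: GH_sel GH_inv)
  thus ?thesis unfolding GH.cochains_iff GH_pow[OF MR(1,2)] by (auto simp: GH_sel)
qed

lemma restrict_cochain:
  assumes "\<omega> \<in> subgroup_cochains n"
  shows "restrict_cochain \<omega> \<in> cochains GH M n"
proof -
  have w: "\<omega> \<in> regular_maps_pow G (scale M) (space M) (Suc n)" "\<And>g. g \<in> H \<Longrightarrow> tact M g \<omega> = \<omega>"
    using assms unfolding subgroup_cochains_def by blast+
  show ?thesis unfolding GH_cochains
  proof (intro conjI allI ballI impI)
    show "restrict_cochain \<omega> xs \<in> space M" for xs
      using pow_in[OF w(1) MR(1,2)] MRS(1) by (simp add: restrict_cochain_def)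
    show "restrict_cochain \<omega> xs = 0" if "length xs \<noteq> Suc n \<or> \<not> set xs \<subseteq> H" for xs
      using that pow_outside[OF w(1) MR(1), of xs] by (auto simp: restrict_cochain_def)
    fix g xs assume g: "g \<in> H" and xs: "set xs \<subseteq> H"
    have "set xs \<subseteq> carrier G" using xs H.subset by blast
    moreover have "set (map (\<lambda>x. inv g \<otimes> x) xs) \<subseteq> H" using xs g by auto
    ultimately show "act M g (restrict_cochain \<omega> (map (\<lambda>x. inv g \<otimes> x) xs)) = restrict_cochain \<omega> xs"
      using fun_cong[OF w(2)[OF g], of xs] xs by (simp add: tact_def restrict_cochain_def)
  qed
qed

lemma restrict_diff: "std_differential GH (restrict_cochain \<omega>) = restrict_cochain (std_differential G \<omega>)"
proof
  fix xs
  show "std_differential GH (restrict_cochain \<omega>) xs = restrict_cochain (std_differential G \<omega>) xs"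
  proof (cases "set xs \<subseteq> H")
    case True
    have "set (take i xs @ drop (Suc i) xs) \<subseteq> H" for i
      using True set_take_subset[of i xs] set_drop_subset[of "Suc i" xs] by auto
    thus ?thesis using True H.subset unfolding std_differential_def restrict_cochain_def GH_sel
      by (auto intro!: sum.cong)
  qed (simp add: std_differential_def restrict_cochain_def GH_sel)
qed

lemma average_cochain:
  assumes z: "z \<in> cochains GH M n"
  shows "av z \<in> subgroup_cochains n" "restrict_cochain (av z) = z"
    "std_differential G (av z) = av (std_differential GH z)"
proof -
  have zp: "\<And>xs. z xs \<in> space M" "\<And>xs. length xs \<noteq> Suc n \<or> \<not> set xs \<subseteq> H \<Longrightarrow> z xs = 0"
    "\<And>g xs. g \<in> H \<Longrightarrow> set xs \<subseteq> H \<Longrightarrow> act M g (z (map (\<lambda>x. inv g \<otimes> x) xs)) = z xs"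
    using z unfolding GH_cochains by blast+
  have reg: "av z \<in> regular_maps_pow G (scale M) (space M) (Suc n)"
    by (rule average_regular[OF MR(1,2)]) (simp_all add: zp)
  have "tact M g (av z) = av z" if g: "g \<in> H" for g
  proof
    fix xs
    show "tact M g (av z) xs = av z xs"
    proof (cases "set xs \<subseteq> carrier G")
      case True
      have "av z xs = average (scale M) xs (\<lambda>hs. act M g (z (map (\<lambda>x. inv g \<otimes> x) hs)))"
        by (rule average_cong) (simp add: zp(3)[OF g])
      also have "\<dots> = act M g (average (scale M) (map (\<lambda>x. inv g \<otimes> x) xs) z)"
        by (rule average_equivariant[OF M g zp(1) True])
      finally show ?thesis using True by (simp add: tact_def)
    next
      case False
      thus ?thesis using average_outside[OF MR(1), of xs z] by (simp add: tact_def)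
    qed
  qed
  thus "av z \<in> subgroup_cochains n" using reg unfolding subgroup_cochains_def by blast
  show "restrict_cochain (av z) = z"
    by (rule ext) (simp add: restrict_cochain_def average_subgroup[OF MR(1)] zp(2))
  show "std_differential G (av z) = av (std_differential GH z)"
    by (rule ext) (rule diff_average[OF MR(1)])
qed

lemma prism_cochain:
  assumes "\<omega> \<in> subgroup_cochains (Suc n)"
  shows "pr \<omega> \<in> subgroup_cochains n"
proof -
  have w: "\<omega> \<in> regular_maps_pow G (scale M) (space M) (Suc (Suc n))" "\<And>g. g \<in> H \<Longrightarrow> tact M g \<omega> = \<omega>"
    using assms unfolding subgroup_cochains_def by blast+
  note win = pow_in[OF w(1) MR(1,2)]
  have reg: "pr \<omega> \<in> regular_maps_pow G (scale M) (space M) (Suc n)"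
    by (rule prism_regular[OF MR(1,2) w(1)])
  \<comment> \<open>Invariance rewrites \<open>\<omega>\<close> on lists of group elements only, so
    a congruence rule restricted to such lists is required.\<close>
  have prism_eq: "prism (scale M) xs f = prism (scale M) xs f'"
    if "set xs \<subseteq> carrier G" "\<And>zs. set zs \<subseteq> carrier G \<Longrightarrow> f zs = f' zs" for xs f f'
    using that
  proof (induction xs arbitrary: f f')
    case (Cons y ys)
    have "prism (scale M) ys (\<lambda>zs. f (h # zs)) = prism (scale M) ys (\<lambda>zs. f' (h # zs))" if "h \<in> H" for h
      using that Cons.prems by (intro Cons.IH) auto
    moreover have "f (h # y # ys) = f' (h # y # ys)" if "h \<in> H" for h
      using that Cons.prems by (intro Cons.prems(2)) auto
    ultimately show ?case unfolding prism.simps by (intro sum.cong refl) simp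
  qed simp
  have "tact M g (pr \<omega>) = pr \<omega>" if g: "g \<in> H" for g
  proof
    fix xs
    show "tact M g (pr \<omega>) xs = pr \<omega> xs"
    proof (cases "set xs \<subseteq> carrier G")
      case True
      have "pr \<omega> xs = prism (scale M) xs (\<lambda>zs. act M g (\<omega> (map (\<lambda>x. inv g \<otimes> x) zs)))"
      proof (rule prism_eq[OF True])
        fix zs assume "set zs \<subseteq> carrier G"
        thus "\<omega> zs = act M g (\<omega> (map (\<lambda>x. inv g \<otimes> x) zs))"
          using fun_cong[OF w(2)[OF g], of zs] by (simp add: tact_def)
      qed
      also have "\<dots> = act M g (prism (scale M) (map (\<lambda>x. inv g \<otimes> x) xs) \<omega>)"
        by (rule prism_equivariant[OF M g win True])
      finally show ?thesis using True by (simp add: tact_def)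
    next
      case False
      thus ?thesis using pow_outside[OF reg MR(1), of xs] by (simp add: tact_def)
    qed
  qed
  thus ?thesis using reg unfolding subgroup_cochains_def by blast
qed

lemma subgroup_cochains_add:
  assumes "\<omega> \<in> subgroup_cochains n" "\<omega>' \<in> subgroup_cochains n"
  shows "\<omega> + \<omega>' \<in> subgroup_cochains n"
proof -
  have w: "\<omega> \<in> regular_maps_pow G (scale M) (space M) (Suc n)" "\<And>g. g \<in> H \<Longrightarrow> tact M g \<omega> = \<omega>"
    and w': "\<omega>' \<in> regular_maps_pow G (scale M) (space M) (Suc n)" "\<And>g. g \<in> H \<Longrightarrow> tact M g \<omega>' = \<omega>'"
    using assms unfolding subgroup_cochains_def by blast+
  have "tact M g (\<omega> + \<omega>') = \<omega> + \<omega>'" if "g \<in> H" for g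
    using tact_add[OF M H.mem_carrier[OF that] pow_in[OF w(1) MR(1,2)] pow_in[OF w'(1) MR(1,2)]] w(2)[OF that] w'(2)[OF that]
    by simp
  thus ?thesis using subspaceD(2)[OF VS pow_subspace[OF MR(1,2)] w(1) w'(1)]
    unfolding subgroup_cochains_def by blast
qed

text \<open>The comparison map on cochains: evaluation at the base point followed by restriction to
  tuples from \<open>H\<close>.\<close>

private abbreviation "\<rho> \<psi> \<equiv> restrict_cochain (E \<psi>)"

private lemma \<rho>_lin:
  assumes "\<psi> \<in> cochains G TM n"
  shows "\<psi>' \<in> cochains G TM n \<Longrightarrow> \<rho> (\<psi> + \<psi>') = \<rho> \<psi> + \<rho> \<psi>'" "\<rho> (fscale (scale TM) a \<psi>) = fscale (scale M) a (\<rho> \<psi>)"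
proof -
  interpret S: vector_space "scale M" by (rule MR(1))
  note L = lin_onD[OF eval_lin] and i = cochains_in[OF TR]
  show "\<rho> (\<psi> + \<psi>') = \<rho> \<psi> + \<rho> \<psi>'" if "\<psi>' \<in> cochains G TM n"
    using L(2)[OF i[OF assms] i[OF that]] by (simp add: restrict_cochain_def fun_eq_iff)
  show "\<rho> (fscale (scale TM) a \<psi>) = fscale (scale M) a (\<rho> \<psi>)"
    using L(3)[OF i[OF assms]] by (simp add: restrict_cochain_def fun_eq_iff fscale_apply)
qed

private lemma \<rho>_cocycle:
  assumes "\<psi> \<in> cocycles G TM n"
  shows "\<rho> \<psi> \<in> cocycles GH M n"
proof -
  have p: "\<psi> \<in> cochains G TM n" "std_differential G \<psi> = 0" using assms unfolding cocycles_def by auto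
  have "std_differential GH (\<rho> \<psi>) = restrict_cochain (E 0)"
    unfolding restrict_diff eval_diff[OF p(1)] p(2) ..
  also have "\<dots> = 0" unfolding eval_zero by (simp add: restrict_cochain_def fun_eq_iff)
  finally show ?thesis using restrict_cochain[OF eval_cochain[OF p(1)]] unfolding cocycles_def by blast
qed

text \<open>Both halves use the graph of \<open>\<rho>\<close>, read in the two directions.
  Averaging followed by restriction is the identity, so \<open>\<rho>\<close> reaches every cocycle
  of \<open>H\<close>; the prism homotopy shows that a cocycle whose restriction bounds is itself a
  boundary.\<close>

lemma shapiro:
  shows "subquotient (fscale (scale TM)) (cocycles G TM (Suc n)) (coboundaries G TM n)
      (fscale (scale M)) (cocycles GH M (Suc n)) (coboundaries GH M n)" (is ?A)
    and "subquotient (fscale (scale M)) (cocycles GH M (Suc n)) (coboundaries GH M n)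
      (fscale (scale TM)) (cocycles G TM (Suc n)) (coboundaries G TM n)" (is ?B)
proof -
  let ?Z = "cocycles G TM (Suc n)"
  note Z = subspaceD[OF vector_space_fscale[OF T(1)] cocycles_subspace[OF TR]]
  have C: "\<psi> \<in> cochains G TM (Suc n)" "std_differential G \<psi> = 0" if "\<psi> \<in> ?Z" for \<psi>
    using that unfolding cocycles_def by auto
  have add: "x + x' \<in> ?Z \<and> y + y' = \<rho> (x + x')" if "x \<in> ?Z \<and> y = \<rho> x" "x' \<in> ?Z \<and> y' = \<rho> x'" for x x' y y'
  proof -
    have "x \<in> ?Z" "x' \<in> ?Z" using that by auto
    with Z(2)[OF this] \<rho>_lin(1)[OF C(1) C(1)] that show ?thesis by simp
  qed
  have scale: "fscale (scale TM) a x \<in> ?Z \<and> fscale (scale M) a y = \<rho> (fscale (scale TM) a x)"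
    if "x \<in> ?Z \<and> y = \<rho> x" for a x y
  proof -
    have "x \<in> ?Z" using that by auto
    with Z(3)[OF this] \<rho>_lin(2)[OF C(1)] that show ?thesis by simp
  qed
  have cocycle: "\<rho> \<psi> \<in> cocycles GH M (Suc n)" if "\<psi> \<in> ?Z" for \<psi> by (rule \<rho>_cocycle[OF that])
  show ?A
  proof (rule subquotientI[where r = "\<lambda>\<psi> z. \<psi> \<in> ?Z \<and> z = \<rho> \<psi>"])
    show "\<And>x y. x \<in> ?Z \<and> y = \<rho> x \<Longrightarrow> x \<in> ?Z \<and> y \<in> cocycles GH M (Suc n)" using cocycle by simp
    show "\<And>x. x \<in> ?Z \<Longrightarrow> \<exists>y. x \<in> ?Z \<and> y = \<rho> x" by simp
    fix \<psi> z assume \<psi>: "\<psi> \<in> ?Z \<and> z = \<rho> \<psi>" and "z \<in> coboundaries GH M n"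
    then obtain g where g: "g \<in> cochains GH M n" "\<rho> \<psi> = std_differential GH g" unfolding coboundaries_def by blast
    have p: "\<psi> \<in> cochains G TM (Suc n)" "std_differential G \<psi> = 0" using C \<psi> by blast+
    let ?w = "E \<psi>"
    note w = eval_cochain[OF p(1)]
    have wp: "?w \<in> regular_maps_pow G (scale M) (space M) (Suc (Suc n))" using w unfolding subgroup_cochains_def by blast
    have dw: "std_differential G ?w = 0"
      unfolding eval_diff[OF p(1)] p(2) by (rule eval_zero)
    \<comment> \<open>The restriction of \<open>?w\<close> to \<open>H\<close> is the boundary of
      \<open>g\<close>, so the average of \<open>?w\<close> is the boundary of the average of
      \<open>g\<close>. As \<open>?w\<close> is a cocycle, the homotopy writes the difference
      between \<open>?w\<close> and its average as the boundary of the prism.\<close>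
    have "?w = std_differential G (av g + pr ?w)"
    proof
      fix xs
      show "?w xs = std_differential G (av g + pr ?w) xs"
      proof (cases "set xs \<subseteq> carrier G")
        case False
        thus ?thesis using pow_outside[OF wp MR(1), of xs] by (simp add: diff_outside)
      next
        case True
        have "average (scale M) xs ?w = average (scale M) xs (\<rho> \<psi>)"
          by (rule average_cong) (simp add: restrict_cochain_def)
        also have "\<dots> = std_differential G (av g) xs" unfolding g(2) average_cochain(3)[OF g(1)] ..
        finally have "?w xs = std_differential G (av g) xs + std_differential G (pr ?w) xs"
          using prism_homotopy[OF MR(1) True, of ?w] prism_zero[OF MR(1), of xs "std_differential G ?w"]
          unfolding dw by simp
        thus ?thesis unfolding diff_add by simp
      qed
    qed
    moreover obtain \<eta> where \<eta>: "\<eta> \<in> cochains G TM n" "E \<eta> = av g + pr ?w"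
      using eval_surj[OF subgroup_cochains_add[OF average_cochain(1)[OF g(1)] prism_cochain[OF w]]] by (elim bexE)
    ultimately have "E \<psi> = E (std_differential G \<eta>)" using eval_diff[OF \<eta>(1)] by simp
    from eval_inj_diff[OF p(1) diff_cochain[OF TR \<eta>(1)] this]
    show "\<psi> \<in> coboundaries G TM n" using \<eta>(1) unfolding coboundaries_def by blast
  qed (rule add scale, assumption+)+
  show ?B
  proof (rule subquotientI[where r = "\<lambda>z \<psi>. \<psi> \<in> ?Z \<and> z = \<rho> \<psi>"])
    show "\<And>y x. x \<in> ?Z \<and> y = \<rho> x \<Longrightarrow> y \<in> cocycles GH M (Suc n) \<and> x \<in> ?Z" using cocycle by simp
    show "\<exists>\<psi>. \<psi> \<in> ?Z \<and> z = \<rho> \<psi>" if "z \<in> cocycles GH M (Suc n)" for z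
    proof -
      have z: "z \<in> cochains GH M (Suc n)" "std_differential GH z = 0" using that unfolding cocycles_def by auto
      from eval_surj[OF average_cochain(1)[OF z(1)]]
      obtain \<psi> where \<psi>: "\<psi> \<in> cochains G TM (Suc n)" "E \<psi> = av z" by (elim bexE)
      have "E (std_differential G \<psi>) = av (std_differential GH z)"
        using eval_diff[OF \<psi>(1)] \<psi>(2) average_cochain(3)[OF z(1)] by simp
      also have "\<dots> = 0" unfolding z(2) using average_zero[OF MR(1)] by (simp add: fun_eq_iff zero_fun_def)
      finally have "std_differential G \<psi> = 0" by (rule eval_inj[OF diff_cochain[OF TR \<psi>(1)]])
      hence "\<psi> \<in> ?Z" using \<psi>(1) unfolding cocycles_def by blast
      moreover have "z = \<rho> \<psi>" unfolding \<psi>(2) by (rule average_cochain(2)[OF z(1), symmetric])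
      ultimately show ?thesis by (intro exI conjI)
    qed
    fix z \<psi> assume \<psi>: "\<psi> \<in> ?Z \<and> z = \<rho> \<psi>" and "\<psi> \<in> coboundaries G TM n"
    then obtain \<eta> where \<eta>: "\<eta> \<in> cochains G TM n" "\<psi> = std_differential G \<eta>" unfolding coboundaries_def by blast
    have "z = std_differential GH (\<rho> \<eta>)" unfolding restrict_diff eval_diff[OF \<eta>(1)] using \<psi> \<eta>(2) by simp
    thus "z \<in> coboundaries GH M n" using restrict_cochain[OF eval_cochain[OF \<eta>(1)]] unfolding coboundaries_def by blast
  qed (rule add scale, assumption+)+
qed

end

end

section \<open>Filtrations\<close>

context coord_group
begin

lemma regular_maps_mono: "vector_space s \<Longrightarrow> V \<subseteq> W \<Longrightarrow> regular_maps G s V \<subseteq> regular_maps G s W"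
proof -
  assume s: "vector_space s" and VW: "V \<subseteq> W"
  interpret vector_space "fscale s" by (rule vector_space_fscale[OF s])
  show ?thesis unfolding regular_maps_def using VW by (intro span_mono) blast
qed

text \<open>An element of \<open>k[G] \<otimes> V\<close> involves finitely many vectors, and an
  ascending union absorbs finitely many vectors at one stage.\<close>

lemma regular_maps_union:
  assumes s: "vector_space s" and V: "\<And>n. V n \<subseteq> V (Suc n)" and f: "f \<in> regular_maps G s (\<Union>n::nat. V n)"
  shows "\<exists>n. f \<in> regular_maps G s (V n)"
  using f s
proof (induction rule: reg_induct)
  case zero show ?case using reg_closed(6)[OF s] by blast
next
  case (step a v f)
  from step(2,4) obtain i j where ij: "v \<in> V i" "f \<in> regular_maps G s (V j)" by blast
  have "V i \<subseteq> V (max i j)" "V j \<subseteq> V (max i j)" using V by (simp_all add: lift_Suc_mono_le)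
  hence "v \<in> V (max i j)" "f \<in> regular_maps G s (V (max i j))" using ij regular_maps_mono[OF s] by blast+
  from reg_closed(2)[OF s reg_pure[OF s step(1) this(1)] this(2)]
  have "(\<lambda>x. s (a x) v + f x) \<in> regular_maps G s (V (max i j))" by (simp add: plus_fun_def)
  thus ?case ..
qed

lemma pow_mono: "vector_space s \<Longrightarrow> V \<subseteq> W \<Longrightarrow> regular_maps_pow G s V n \<subseteq> regular_maps_pow G s W n"
proof (induction n)
  case 0 thus ?case by auto
next
  case (Suc n)
  have "regular_maps G (fscale s) (regular_maps_pow G s V n) \<subseteq> regular_maps G (fscale s) (regular_maps_pow G s W n)"
    by (rule regular_maps_mono[OF vector_space_fscale[OF Suc.prems(1)] Suc.IH[OF Suc.prems]])
  thus ?case by auto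
qed

lemma pow_union:
  assumes s: "vector_space s" and V: "\<And>n. V n \<subseteq> V (Suc n)"
  shows "f \<in> regular_maps_pow G s (\<Union>n::nat. V n) k \<Longrightarrow> \<exists>n. f \<in> regular_maps_pow G s (V n) k"
proof (induction k arbitrary: f)
  case 0 thus ?case unfolding pow_0_iff by auto
next
  case (Suc k)
  have F: "f [] = 0" "(\<lambda>x ys. f (x # ys)) \<in> regular_maps G (fscale s) (regular_maps_pow G s (\<Union>n. V n) k)"
    using Suc.prems unfolding pow_Suc_iff by auto
  have "regular_maps_pow G s (\<Union>n. V n) k \<subseteq> (\<Union>n. regular_maps_pow G s (V n) k)" using Suc.IH by blast
  from subsetD[OF regular_maps_mono[OF vector_space_fscale[OF s] this] F(2)]
  obtain n where "(\<lambda>x ys. f (x # ys)) \<in> regular_maps G (fscale s) (regular_maps_pow G s (V n) k)"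
    using regular_maps_union[OF vector_space_fscale[OF s], of "\<lambda>n. regular_maps_pow G s (V n) k"]
      pow_mono[OF s V] by blast
  thus ?case using F(1) unfolding pow_Suc_iff by blast
qed

context
  fixes N :: "('g, 'k, 'w::ab_group_add) gmodule" and Q :: "('g, 'k, 'v::ab_group_add) gmodule"
    and F :: "nat \<Rightarrow> 'v set"
  assumes N: "rational_module G N" and Q: "rational_module G Q"
    and F: "\<And>n. gsubmodule G Q (F n)" "\<And>n. F n \<subseteq> F (Suc n)" "(\<Union>n. F n) = space Q"
begin

private abbreviation "QF n \<equiv> Q\<lparr>space := F n\<rparr>"
text \<open>Tensor products of different stages consist of functionals guarded by different sets of
  bilinear forms, so a stage is not literally contained in the next one after tensoring;
  \<open>\<iota>\<close> is the comparison map into the tensor product with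
  \<open>Q\<close>.\<close>

private abbreviation "\<iota> \<equiv> tensor_map Q N (\<lambda>v. v)"

private lemma QF: "rational_module G (QF n)" by (rule submodule_rational[OF Q F(1)])
private lemma TQ: "rational_module G (Q \<otimes>\<^sub>k N)" by (rule tensor_rational[OF N Q])
private lemma TF: "rational_module G (QF n \<otimes>\<^sub>k N)" by (rule tensor_rational[OF N QF])
private lemma Fsub: "F n \<subseteq> space Q" using F(1) unfolding gsubmodule_def by blast
private lemma Fmono: "m \<le> n \<Longrightarrow> F m \<subseteq> F n" using F(2) by (rule lift_Suc_mono_le)

private lemma incl_ghom: "ghom G (QF n) Q (\<lambda>v. v)"
  using Fsub unfolding ghom_def space_update_sel by blast

private lemma incl_lin: "m \<le> n \<Longrightarrow> lin_on (scale (QF m)) (scale (QF n)) (space (QF m)) (space (QF n)) (\<lambda>v. v)"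
  using Fmono unfolding lin_on_def space_update_sel by blast

private lemma incl_linQ: "lin_on (scale (QF n)) (scale Q) (space (QF n)) (space Q) (\<lambda>v. v)"
  by (rule ghom_lin_on[OF incl_ghom])

private lemma closed: "\<forall>c. \<forall>v\<in>space (QF n). scale (QF n) c v \<in> space (QF n)"
  using subspaceD(3)[OF rationalD(1,2)[OF QF]] by blast

private lemma \<iota>: "ghom G (QF n \<otimes>\<^sub>k N) (Q \<otimes>\<^sub>k N) \<iota>"
  by (rule tensor_map_ghom[OF N QF Q incl_ghom])

private lemma \<iota>_comp:
  "m \<le> n \<Longrightarrow> \<Theta> \<in> space (QF m \<otimes>\<^sub>k N) \<Longrightarrow> \<iota> (tensor_map (QF n) N (\<lambda>v. v) \<Theta>) = \<iota> \<Theta>"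
  by (rule tensor_map_comp[OF incl_lin closed incl_linQ incl_linQ refl])

text \<open>A linear retraction of \<open>Q\<close> onto the stage remains a retraction after
  tensoring.\<close>

private lemma \<iota>_inj: "inj_on \<iota> (space (QF n \<otimes>\<^sub>k N))"
proof -
  note R = rationalD[OF QF[of n]] and RQ = rationalD[OF Q]
  obtain h where h: "lin_on (scale Q) (scale (QF n)) (space Q) (space (QF n)) h" "\<And>v. v \<in> space (QF n) \<Longrightarrow> h v = v"
    by (rule lin_on_left_inverse[OF incl_linQ R(1) RQ(1) R(2) RQ(2)]) (simp, rule that)
  have id: "lin_on (scale (QF n)) (scale (QF n)) (space (QF n)) (space (QF n)) (\<lambda>v. v)" by (rule incl_lin) simp
  show ?thesis
  proof (rule inj_on_inverseI[where g = "tensor_map (QF n) N h"])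
    fix \<Theta> assume t: "\<Theta> \<in> space (QF n \<otimes>\<^sub>k N)"
    show "tensor_map (QF n) N h (\<iota> \<Theta>) = \<Theta>"
      using tensor_map_comp[OF incl_linQ closed h(1) id h(2) t] tensor_map_ident[OF closed refl id t] by simp
  qed
qed

private lemma \<iota>_union: "(\<Union>n. \<iota> ` space (QF n \<otimes>\<^sub>k N)) = space (Q \<otimes>\<^sub>k N)"
proof (intro equalityI subsetI)
  fix \<Theta> assume "\<Theta> \<in> (\<Union>n. \<iota> ` space (QF n \<otimes>\<^sub>k N))"
  then obtain n \<Theta>' where "\<Theta>' \<in> space (QF n \<otimes>\<^sub>k N)" "\<Theta> = \<iota> \<Theta>'" by blast
  thus "\<Theta> \<in> space (Q \<otimes>\<^sub>k N)" using ghomD(1)[OF \<iota>[of n], of \<Theta>'] by simp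
next
  have cl: "\<forall>c. \<forall>v\<in>space Q. scale Q c v \<in> space Q" using subspaceD(3)[OF rationalD(1,2)[OF Q]] by blast
  fix \<Theta> assume "\<Theta> \<in> space (Q \<otimes>\<^sub>k N)"
  thus "\<Theta> \<in> (\<Union>n. \<iota> ` space (QF n \<otimes>\<^sub>k N))" using cl
  proof (induction rule: tensor_induct)
    case zero
    have "\<iota> 0 \<in> \<iota> ` space (QF 0 \<otimes>\<^sub>k N)" by (rule imageI) (rule tensor_closed(1))
    thus ?case unfolding tensor_map_linear(3) by blast
  next
    case (step v w \<Theta>)
    from step(4) obtain i \<Theta>' where i: "\<Theta>' \<in> space (QF i \<otimes>\<^sub>k N)" "\<Theta> = \<iota> \<Theta>'" by blast
    from step(1) obtain j where j: "v \<in> F j" using F(3) by blast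
    define n where "n = max i j"
    have v: "v \<in> space (QF n)" using Fmono[of j n] j by (auto simp: n_def)
    let ?t = "tensor_map (QF n) N (\<lambda>v. v) \<Theta>'"
    have il: "i \<le> n" by (simp add: n_def)
    have t: "?t \<in> space (QF n \<otimes>\<^sub>k N)"
      by (rule lin_onD(1)[OF tensor_map_lin_on[OF incl_lin[OF il] closed] i(1)])
    have "\<iota> (pure_tensor (QF n) N v w + ?t) = pure_tensor Q N v w + \<Theta>"
      unfolding tensor_map_linear(1) tensor_map_pure[OF incl_linQ] \<iota>_comp[OF il i(1)] i(2) ..
    moreover have "\<iota> (pure_tensor (QF n) N v w + ?t) \<in> \<iota> ` space (QF n \<otimes>\<^sub>k N)"
      by (rule imageI) (rule tensor_closed(2)[OF pure_tensor_in[OF v step(2)] t])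
    ultimately have "pure_tensor Q N v w + \<Theta> \<in> \<iota> ` space (QF n \<otimes>\<^sub>k N)" by (simp only:)
    thus ?case by (rule UN_I[OF UNIV_I])
  qed
qed

private lemma \<iota>_mono: "\<iota> ` space (QF n \<otimes>\<^sub>k N) \<subseteq> \<iota> ` space (QF (Suc n) \<otimes>\<^sub>k N)"
proof
  fix \<Theta> assume "\<Theta> \<in> \<iota> ` space (QF n \<otimes>\<^sub>k N)"
  then obtain \<Theta>' where t: "\<Theta>' \<in> space (QF n \<otimes>\<^sub>k N)" "\<Theta> = \<iota> \<Theta>'" by blast
  have "\<iota> (tensor_map (QF (Suc n)) N (\<lambda>v. v) \<Theta>') \<in> \<iota> ` space (QF (Suc n) \<otimes>\<^sub>k N)"
    by (rule imageI) (rule lin_onD(1)[OF tensor_map_lin_on[OF incl_lin closed] t(1)], simp)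
  thus "\<Theta> \<in> \<iota> ` space (QF (Suc n) \<otimes>\<^sub>k N)" using \<iota>_comp[of n "Suc n", OF _ t(1)] t(2) by simp
qed

text \<open>A cocycle is a regular map and so takes its values in the image of one stage. Since
  \<open>\<iota>\<close> is injective and equivariant, the map obtained at that stage inherits
  invariance and the cocycle condition.\<close>

lemma cocycle_in_stage:
  assumes z: "z \<in> cocycles G (Q \<otimes>\<^sub>k N) d"
  shows "\<exists>n. \<exists>z'\<in>cocycles G (QF n \<otimes>\<^sub>k N) d. z = \<iota> \<circ> z'"
proof -
  note RQ = rationalD[OF TQ]
  have zc: "z \<in> cochains G (Q \<otimes>\<^sub>k N) d" "std_differential G z = 0" using z unfolding cocycles_def by auto
  hence "z \<in> regular_maps_pow G (scale (Q \<otimes>\<^sub>k N)) (\<Union>n. \<iota> ` space (QF n \<otimes>\<^sub>k N)) (Suc d)"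
    unfolding \<iota>_union cochains_iff by blast
  from pow_union[OF RQ(1) \<iota>_mono this]
  obtain n where n: "z \<in> regular_maps_pow G (scale (Q \<otimes>\<^sub>k N)) (\<iota> ` space (QF n \<otimes>\<^sub>k N)) (Suc d)" by (elim exE)
  note R = rationalD[OF TF[of n]]
  let ?V = "\<iota> ` space (QF n \<otimes>\<^sub>k N)"
  note L = ghom_lin_on[OF \<iota>[of n]]
  obtain h where h: "lin_on (scale (Q \<otimes>\<^sub>k N)) (scale (QF n \<otimes>\<^sub>k N)) (space (Q \<otimes>\<^sub>k N)) (space (QF n \<otimes>\<^sub>k N)) h"
    "\<And>v. v \<in> space (QF n \<otimes>\<^sub>k N) \<Longrightarrow> h (\<iota> v) = v"
    by (rule lin_on_left_inverse[OF L R(1) RQ(1) R(2) RQ(2) \<iota>_inj]) (rule that)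
  interpret S: vector_space "scale (Q \<otimes>\<^sub>k N)" by (rule RQ(1))
  have zpow: "z \<in> regular_maps_pow G (scale (Q \<otimes>\<^sub>k N)) (space (Q \<otimes>\<^sub>k N)) (Suc d)" using zc(1) unfolding cochains_iff by blast
  define z' where "z' = h \<circ> z"
  have pw: "z' \<in> regular_maps_pow G (scale (QF n \<otimes>\<^sub>k N)) (space (QF n \<otimes>\<^sub>k N)) (Suc d)"
    unfolding z'_def by (rule pow_linear[OF h(1) RQ(1) R(1) RQ(2) R(2) zpow])
  have Vsub: "S.subspace ?V"
    unfolding S.subspace_def
  proof (intro conjI ballI allI)
    show "0 \<in> ?V" using imageI[OF tensor_closed(1), of \<iota>] unfolding tensor_map_linear(3) .
    fix x y c assume "x \<in> ?V"
    then obtain a where a: "a \<in> space (QF n \<otimes>\<^sub>k N)" "x = \<iota> a" by blast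
    show "scale (Q \<otimes>\<^sub>k N) c x \<in> ?V"
      unfolding a(2) tensor_sel(2) tensor_map_linear(2)[symmetric] by (rule imageI) (rule tensor_closed(3)[OF a(1)])
    assume "y \<in> ?V"
    then obtain b where b: "b \<in> space (QF n \<otimes>\<^sub>k N)" "y = \<iota> b" by blast
    show "x + y \<in> ?V"
      unfolding a(2) b(2) tensor_map_linear(1)[symmetric] by (rule imageI) (rule tensor_closed(2)[OF a(1) b(1)])
  qed
  have eq: "z = \<iota> \<circ> z'"
  proof
    fix xs
    have "z xs \<in> ?V" by (rule pow_in[OF n RQ(1) Vsub])
    then obtain a where a: "a \<in> space (QF n \<otimes>\<^sub>k N)" "z xs = \<iota> a" by blast
    show "z xs = (\<iota> \<circ> z') xs" unfolding z'_def o_apply a(2) h(2)[OF a(1)] ..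
  qed
  have inj: "a = b" if "\<And>xs. a xs \<in> space (QF n \<otimes>\<^sub>k N)" "\<And>xs. b xs \<in> space (QF n \<otimes>\<^sub>k N)" "\<iota> \<circ> a = \<iota> \<circ> b" for a b :: "'g list \<Rightarrow> _"
  proof
    fix xs
    have "\<iota> (a xs) = \<iota> (b xs)" using fun_cong[OF that(3), of xs] by simp
    thus "a xs = b xs" by (rule inj_onD[OF \<iota>_inj _ that(1,2)])
  qed
  note pin = pow_in[OF pw R(1,2)]
  have \<iota>0: "\<iota> 0 = 0" by (rule tensor_map_linear(3))
  have "tact (QF n \<otimes>\<^sub>k N) y z' = z'" if y: "y \<in> carrier G" for y
  proof (rule inj)
    show "tact (QF n \<otimes>\<^sub>k N) y z' xs \<in> space (QF n \<otimes>\<^sub>k N)" for xs by (rule pow_in[OF tact_in[OF TF pw y] R(1,2)])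
    show "z' xs \<in> space (QF n \<otimes>\<^sub>k N)" for xs by (rule pin)
    have "\<iota> \<circ> tact (QF n \<otimes>\<^sub>k N) y z' = tact (Q \<otimes>\<^sub>k N) y (\<iota> \<circ> z')"
      by (rule tact_comp[OF \<iota> \<iota>0 y pin])
    also have "\<dots> = \<iota> \<circ> z'" using zc(1) y unfolding eq[symmetric] cochains_iff by blast
    finally show "\<iota> \<circ> tact (QF n \<otimes>\<^sub>k N) y z' = \<iota> \<circ> z'" .
  qed
  hence z'c: "z' \<in> cochains G (QF n \<otimes>\<^sub>k N) d" using pw unfolding cochains_iff by blast
  have "std_differential G z' = 0"
  proof (rule inj)
    show "std_differential G z' xs \<in> space (QF n \<otimes>\<^sub>k N)" for xs by (rule cochains_in[OF TF diff_cochain[OF TF z'c]])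
    show "0 xs \<in> space (QF n \<otimes>\<^sub>k N)" for xs :: "'g list" using tensor_closed(1)[of "QF n" N] by (simp only: zero_fun_apply)
    have "\<iota> \<circ> std_differential G z' = 0" using comp_cochain(2)[OF TF TQ \<iota> z'c] zc(2) unfolding eq[symmetric] by simp
    also have "0 = \<iota> \<circ> 0" by (rule ext) (unfold o_apply zero_fun_apply \<iota>0, rule refl)
    finally show "\<iota> \<circ> std_differential G z' = \<iota> \<circ> 0" .
  qed
  hence "z' \<in> cocycles G (QF n \<otimes>\<^sub>k N) d" using z'c unfolding cocycles_def by blast
  thus ?thesis using eq by (intro exI bexI)
qed

text \<open>Above stage \<open>m\<close> only sections without cohomology in degree
  \<open>d + 1\<close> are added, so each cocycle of \<open>Q\<close> is cohomologous to one from
  stage \<open>m\<close>. The relation pairs a cocycle of \<open>Q\<close> with such a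
  representative, and boundaries at stage \<open>m\<close> map to boundaries in
  \<open>Q\<close>.\<close>

lemma filtration_Ext:
  fixes X :: "nat \<Rightarrow> ('g, 'k, 'x::ab_group_add) gmodule"
  assumes X: "\<And>n. n \<ge> m \<Longrightarrow> F (Suc n) \<noteq> F n \<Longrightarrow> rational_module G (X n) \<and>
      (\<exists>\<pi>. short_exact G (QF n) (\<lambda>v. v) (QF (Suc n)) \<pi> (X n)) \<and>
      cocycles G (X n \<otimes>\<^sub>k N) (Suc d) \<subseteq> coboundaries G (X n \<otimes>\<^sub>k N) d"
  shows "subquotient (fscale (scale (Q \<otimes>\<^sub>k N))) (cocycles G (Q \<otimes>\<^sub>k N) (Suc d)) (coboundaries G (Q \<otimes>\<^sub>k N) d)
    (fscale (scale (QF m \<otimes>\<^sub>k N))) (cocycles G (QF m \<otimes>\<^sub>k N) (Suc d)) (coboundaries G (QF m \<otimes>\<^sub>k N) d)"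
proof -
  note RQ = rationalD[OF TQ] and RM = rationalD[OF TF[of m]]
  let ?Z = "\<lambda>n. cocycles G (QF n \<otimes>\<^sub>k N) (Suc d)" and ?ZQ = "cocycles G (Q \<otimes>\<^sub>k N) (Suc d)"
  let ?B = "coboundaries G (Q \<otimes>\<^sub>k N) d"
  note B = subspaceD[OF vector_space_fscale[OF RQ(1)] coboundaries_subspace[OF TQ, where n = d]]
  note ZQ = subspaceD[OF vector_space_fscale[OF RQ(1)] cocycles_subspace[OF TQ, where n = "Suc d"]]
  note ZM = subspaceD[OF vector_space_fscale[OF RM(1)] cocycles_subspace[OF TF, where n = "Suc d"]]
  have C: "z \<in> cochains G (QF n \<otimes>\<^sub>k N) (Suc d)" if "z \<in> ?Z n" for z n using that unfolding cocycles_def by blast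
  have in_n: "z xs \<in> space (QF n \<otimes>\<^sub>k N)" if "z \<in> ?Z n" for z n xs by (rule cochains_in[OF TF C[OF that]])
  have diff_split: "(a - b) + (b - c) = a - c" for a b c :: "'g list \<Rightarrow> ('v \<Rightarrow> 'w \<Rightarrow> 'k) \<Rightarrow> 'k" by simp
  \<comment> \<open>Descent by one step of the filtration at a time: modulo a boundary the cocycle
    comes from the previous stage. Steps at which the filtration does not grow are skipped, as there
    is no section to use.\<close>
  have stage: "\<exists>z'\<in>?Z m. (\<iota> \<circ> z) - (\<iota> \<circ> z') \<in> ?B" if "z \<in> ?Z (m + i)" for z i
    using that
  proof (induction i arbitrary: z)
    case 0
    have "(\<iota> \<circ> z) - (\<iota> \<circ> z) = 0" by simp
    with B(1) have "(\<iota> \<circ> z) - (\<iota> \<circ> z) \<in> ?B" by (simp only:)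
    moreover have "z \<in> ?Z m" using 0 by simp
    ultimately show ?case by (rule bexI[where x = z])
  next
    case (Suc i)
    let ?n = "m + i"
    show ?case
    proof (cases "F (Suc ?n) = F ?n")
      case True
      have "z \<in> ?Z ?n" using Suc.prems True by (simp only: add_Suc_right)
      thus ?thesis by (rule Suc.IH)
    next
      case False
      from X[OF le_add1 False] obtain \<pi> where x: "rational_module G (X ?n)"
        "short_exact G (QF ?n) (\<lambda>v. v) (QF (Suc ?n)) \<pi> (X ?n)"
        "cocycles G (X ?n \<otimes>\<^sub>k N) (Suc d) \<subseteq> coboundaries G (X ?n \<otimes>\<^sub>k N) d" by (elim conjE exE)
      let ?j = "tensor_map (QF (Suc ?n)) N (\<lambda>v. v)"
      have z: "z \<in> ?Z (Suc ?n)" using Suc.prems by simp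
      have seT: "short_exact G (QF ?n \<otimes>\<^sub>k N) ?j (QF (Suc ?n) \<otimes>\<^sub>k N) (tensor_map (X ?n) N \<pi>) (X ?n \<otimes>\<^sub>k N)"
        by (rule tensor_short_exact[OF N QF QF x(1,2)])
      from cocycle_from_sub[OF TF TF tensor_rational[OF N x(1)] seT x(3) z]
      obtain z1 where z1: "z1 \<in> ?Z ?n" "z - (?j \<circ> z1) \<in> coboundaries G (QF (Suc ?n) \<otimes>\<^sub>k N) d" by (elim bexE)
      then obtain e where e: "e \<in> cochains G (QF (Suc ?n) \<otimes>\<^sub>k N) d" "z - (?j \<circ> z1) = std_differential G e"
        unfolding coboundaries_def by blast
      from Suc.IH[OF z1(1)] obtain z' where z': "z' \<in> ?Z m" "(\<iota> \<circ> z1) - (\<iota> \<circ> z') \<in> ?B" by (elim bexE)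
      have "(\<iota> \<circ> z) - (\<iota> \<circ> z1) = \<iota> \<circ> (z - (?j \<circ> z1))"
      proof
        fix xs
        have j: "?j (z1 xs) \<in> space (QF (Suc ?n) \<otimes>\<^sub>k N)"
          by (rule lin_onD(1)[OF tensor_map_lin_on[OF incl_lin closed] in_n[OF z1(1)]]) simp
        have "\<iota> (z xs - ?j (z1 xs)) = \<iota> (z xs) - \<iota> (?j (z1 xs))"
          by (rule lin_on_diff(2)[OF ghom_lin_on[OF \<iota>] rationalD(1)[OF TF] RQ(1) rationalD(2)[OF TF] in_n[OF z] j])
        also have "\<iota> (?j (z1 xs)) = \<iota> (z1 xs)" by (rule \<iota>_comp[OF _ in_n[OF z1(1)]]) simp
        finally show "((\<iota> \<circ> z) - (\<iota> \<circ> z1)) xs = (\<iota> \<circ> (z - (?j \<circ> z1))) xs"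
          unfolding minus_apply[of "\<iota> \<circ> z" "\<iota> \<circ> z1" xs] o_apply minus_apply[of z "?j \<circ> z1" xs] by (rule sym)
      qed
      also have "\<dots> = std_differential G (\<iota> \<circ> e)"
        unfolding e(2) by (rule comp_cochain(2)[OF TF TQ \<iota> e(1), symmetric])
      finally have "(\<iota> \<circ> z) - (\<iota> \<circ> z1) = std_differential G (\<iota> \<circ> e)" .
      hence "(\<iota> \<circ> z) - (\<iota> \<circ> z1) \<in> ?B"
        unfolding coboundaries_def using imageI[OF comp_cochain(1)[OF TF TQ \<iota> e(1)], of "std_differential G"]
        by (simp only:)
      from B(2)[OF this z'(2)] have "(\<iota> \<circ> z) - (\<iota> \<circ> z') \<in> ?B" unfolding diff_split .
      thus ?thesis using z'(1) by (intro bexI[of _ z'])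
    qed
  qed
  \<comment> \<open>The stage found for a cocycle may lie below \<open>m\<close>; moving up to
    \<open>m + n\<close> puts it into the range where the descent applies.\<close>
  have push: "\<exists>z'\<in>?Z (m + n). \<iota> \<circ> z = \<iota> \<circ> z'" if z: "z \<in> ?Z n" for z n
  proof -
    let ?j = "tensor_map (QF (m + n)) N (\<lambda>v. v)"
    have jl: "ghom G (QF n) (QF (m + n)) (\<lambda>v. v)"
      using Fmono[of n "m + n"] unfolding ghom_def space_update_sel by auto
    note j = tensor_map_ghom[OF N QF QF jl]
    have zc: "z \<in> cochains G (QF n \<otimes>\<^sub>k N) (Suc d)" "std_differential G z = 0" using z unfolding cocycles_def by auto
    have "std_differential G (?j \<circ> z) = ?j \<circ> 0" using comp_cochain(2)[OF TF TF j zc(1)] zc(2) by simp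
    also have "?j \<circ> 0 = 0" by (rule ext) (unfold o_apply zero_fun_apply tensor_map_linear(3), rule refl)
    finally have "?j \<circ> z \<in> ?Z (m + n)" using comp_cochain(1)[OF TF TF j zc(1)] unfolding cocycles_def by blast
    moreover have "\<iota> \<circ> z = \<iota> \<circ> (?j \<circ> z)"
      by (rule ext) (unfold o_apply, rule \<iota>_comp[OF _ in_n[OF z], symmetric], simp)
    ultimately show ?thesis by (intro bexI[of _ "?j \<circ> z"])
  qed
  let ?r = "\<lambda>z z'. z \<in> ?ZQ \<and> z' \<in> ?Z m \<and> z - (\<iota> \<circ> z') \<in> ?B"
  have \<iota>_lin: "\<iota> \<circ> (a + b) = (\<iota> \<circ> a) + (\<iota> \<circ> b)" "\<iota> \<circ> fscale (fscale (*)) c a = fscale (fscale (*)) c (\<iota> \<circ> a)"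
    for a b :: "'g list \<Rightarrow> ('v \<Rightarrow> 'w \<Rightarrow> 'k) \<Rightarrow> 'k" and c
    by (rule ext, unfold o_apply plus_fun_apply[of a] plus_fun_apply[of "\<iota> \<circ> a"] tensor_map_linear(1), rule refl)
      (rule ext, unfold o_apply fscale_apply[of "fscale (*)"] tensor_map_linear(2), rule refl)
  show ?thesis
  proof (rule subquotientI[where r = ?r])
    show "\<And>x y. ?r x y \<Longrightarrow> x \<in> ?ZQ \<and> y \<in> ?Z m" by simp
    show "?r (x + x') (y + y')" if h: "?r x y" "?r x' y'" for x y x' y'
    proof -
      have p: "x \<in> ?ZQ" "x' \<in> ?ZQ" "y \<in> ?Z m" "y' \<in> ?Z m" "x - (\<iota> \<circ> y) \<in> ?B" "x' - (\<iota> \<circ> y') \<in> ?B"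
        using h by blast+
      have "x + x' - (\<iota> \<circ> (y + y')) = (x - (\<iota> \<circ> y)) + (x' - (\<iota> \<circ> y'))" unfolding \<iota>_lin by (rule add_diff_add)
      with B(2)[OF p(5,6)] have "x + x' - (\<iota> \<circ> (y + y')) \<in> ?B" by (simp only:)
      thus ?thesis using ZQ(2)[OF p(1,2)] ZM(2)[OF p(3,4)] by blast
    qed
    show "?r (fscale (scale (Q \<otimes>\<^sub>k N)) c x) (fscale (scale (QF m \<otimes>\<^sub>k N)) c y)" if h: "?r x y" for c x y
    proof -
      interpret S: vector_space "fscale (scale (Q \<otimes>\<^sub>k N))" by (rule vector_space_fscale[OF RQ(1)])
      have "fscale (scale (Q \<otimes>\<^sub>k N)) c x - (\<iota> \<circ> fscale (scale (QF m \<otimes>\<^sub>k N)) c y) = fscale (scale (Q \<otimes>\<^sub>k N)) c (x - (\<iota> \<circ> y))"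
        unfolding S.scale_right_diff_distrib unfolding tensor_sel(2) \<iota>_lin ..
      moreover have p: "x \<in> ?ZQ" "y \<in> ?Z m" "x - (\<iota> \<circ> y) \<in> ?B" using h by blast+
      ultimately have "fscale (scale (Q \<otimes>\<^sub>k N)) c x - (\<iota> \<circ> fscale (scale (QF m \<otimes>\<^sub>k N)) c y) \<in> ?B"
        using B(3)[OF p(3), of c] by (simp only:)
      thus ?thesis using ZQ(3)[OF p(1), of c] ZM(3)[OF p(2), of c] by blast
    qed
    show "\<exists>y. ?r x y" if x: "x \<in> ?ZQ" for x
    proof -
      from cocycle_in_stage[OF x] obtain n z where z: "z \<in> ?Z n" "x = \<iota> \<circ> z" by (elim exE bexE)
      from push[OF z(1)] obtain w where w: "w \<in> ?Z (m + n)" "\<iota> \<circ> z = \<iota> \<circ> w" by (elim bexE)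
      from stage[OF w(1)] obtain y where "y \<in> ?Z m" "(\<iota> \<circ> w) - (\<iota> \<circ> y) \<in> ?B" by (elim bexE)
      thus ?thesis using x unfolding z(2) w(2) by (intro exI conjI)
    qed
    show "x \<in> ?B" if h: "?r x y" and y: "y \<in> coboundaries G (QF m \<otimes>\<^sub>k N) d" for x y
    proof -
      obtain e where e: "e \<in> cochains G (QF m \<otimes>\<^sub>k N) d" "y = std_differential G e" using y unfolding coboundaries_def by blast
      have "\<iota> \<circ> y \<in> ?B" unfolding e(2) comp_cochain(2)[OF TF TQ \<iota> e(1), symmetric] coboundaries_def
        by (rule imageI) (rule comp_cochain(1)[OF TF TQ \<iota> e(1)])
      from B(2)[OF conjunct2[OF conjunct2[OF h]] this] show ?thesis unfolding diff_add_cancel .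
    qed
  qed
qed

end

end

section \<open>The main theorem\<close>

context coord_group
begin

lemma tensor_zero_space:
  assumes "rational_module G M" "rational_module G N" "space M = {0}"
  shows "space (M \<otimes>\<^sub>k N) = {0}"
proof -
  have cl: "\<forall>c. \<forall>v\<in>space M. scale M c v \<in> space M" using subspaceD(3)[OF rationalD(1,2)[OF assms(1)]] by blast
  have "\<Theta> = 0" if "\<Theta> \<in> space (M \<otimes>\<^sub>k N)" for \<Theta>
    using that cl
  proof (induction rule: tensor_induct)
    case (step v w \<Theta>)
    have "v = 0" using step(1) assms(3) by simp
    moreover have "pure_tensor M N 0 w = 0" by (rule pure_tensor_zero(1)[OF _ step(2)]) (simp add: assms(3))
    ultimately show ?case using step(4) by (simp only: add_0_left)
  qed simp
  thus ?thesis using tensor_closed(1)[of M N] by blast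
qed

lemma zero_cocycles:
  assumes "rational_module G M" "space M = {0}"
  shows "cocycles G M (Suc d) \<subseteq> coboundaries G M d"
proof
  fix z assume z: "z \<in> cocycles G M (Suc d)"
  have "z xs = 0" for xs using cochains_in[OF assms(1), of z "Suc d" xs] z assms(2) unfolding cocycles_def by blast
  hence "z = 0" by (simp add: fun_eq_iff)
  thus "z \<in> coboundaries G M d"
    using subspaceD(1)[OF vector_space_fscale[OF rationalD(1)[OF assms(1)]] coboundaries_subspace[OF assms(1)]] by (simp only:)
qed

context
  fixes N :: "('g, 'k, 'w::ab_group_add) gmodule" and Q :: "('g, 'k, 'v::ab_group_add) gmodule"
    and HH :: "'i \<Rightarrow> ('g, 'k, 'x::ab_group_add) gmodule" and I :: "'i set"
  assumes N: "rational_module G N" and Q: "rational_module G Q"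
    and filt: "filtered_by G Q I HH"
    and HH: "\<And>i. i \<in> I \<Longrightarrow> vector_space (scale (HH i)) \<and> module.subspace (scale (HH i)) (space (HH i))"
begin

text \<open>Unpacks the filtration and adds rationality of the sections: each is a quotient of a
  stage, and the stages are submodules of a rational module.\<close>

private lemma filtration:
  obtains F J \<theta> where "\<And>n. gsubmodule G Q (F n)" "\<And>n. F n \<subseteq> F (Suc n)" "F 0 = {0}" "(\<Union>n. F n) = space Q"
    "bij_betw \<theta> J I" "\<And>n. n \<notin> J \<Longrightarrow> F (Suc n) = F n"
    "\<And>n. n \<in> J \<Longrightarrow> rational_module G (HH (\<theta> n)) \<and>
       (\<exists>\<pi>. short_exact G (Q\<lparr>space := F n\<rparr>) (\<lambda>v. v) (Q\<lparr>space := F (Suc n)\<rparr>) \<pi> (HH (\<theta> n)))"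
proof -
  from filt obtain F J \<theta> where f: "\<forall>n. gsubmodule G Q (F n) \<and> F n \<subseteq> F (Suc n)" "F 0 = {0}"
    "(\<Union>n. F n) = space Q" "bij_betw \<theta> J I" "\<forall>n. n \<notin> J \<longrightarrow> F (Suc n) = F n"
    "\<forall>n\<in>J. \<exists>\<pi>. short_exact G (Q\<lparr>space := F n\<rparr>) (\<lambda>v. v) (Q\<lparr>space := F (Suc n)\<rparr>) \<pi> (HH (\<theta> n))"
    unfolding filtered_by_def by (elim exE conjE)
  have sub: "gsubmodule G Q (F n)" "F n \<subseteq> F (Suc n)" for n using f(1) by simp_all
  have st: "rational_module G (HH (\<theta> n)) \<and>
      (\<exists>\<pi>. short_exact G (Q\<lparr>space := F n\<rparr>) (\<lambda>v. v) (Q\<lparr>space := F (Suc n)\<rparr>) \<pi> (HH (\<theta> n)))" if n: "n \<in> J" for n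
  proof -
    from bspec[OF f(6) n] obtain \<pi>
      where p: "short_exact G (Q\<lparr>space := F n\<rparr>) (\<lambda>v. v) (Q\<lparr>space := F (Suc n)\<rparr>) \<pi> (HH (\<theta> n))" by (elim exE)
    have "\<theta> n \<in> I" using n f(4) by (auto simp: bij_betw_def)
    note H = HH[OF this]
    have g: "ghom G (Q\<lparr>space := F (Suc n)\<rparr>) (HH (\<theta> n)) \<pi>" "\<pi> ` space (Q\<lparr>space := F (Suc n)\<rparr>) = space (HH (\<theta> n))"
      using p unfolding short_exact_def by simp_all
    have "rational_module G (HH (\<theta> n))"
      by (rule quotient_rational[OF submodule_rational[OF Q sub(1)] conjunct1[OF H] conjunct2[OF H] g])
    with p show ?thesis by (intro conjI exI)
  qed
  show thesis by (rule that[OF sub f(2-4) _ st]) (simp_all add: f(5))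
qed

text \<open>The filtration starts at the zero module, so with every section acyclic in this degree
  all cocycles descend to stage \<open>0\<close>.\<close>

lemma filtered_Ext_vanish:
  assumes van: "\<And>i. i \<in> I \<Longrightarrow> rational_module G (HH i) \<Longrightarrow>
      cocycles G (HH i \<otimes>\<^sub>k N) (Suc d) \<subseteq> coboundaries G (HH i \<otimes>\<^sub>k N) d"
  shows "cocycles G (Q \<otimes>\<^sub>k N) (Suc d) \<subseteq> coboundaries G (Q \<otimes>\<^sub>k N) d"
proof -
  obtain F J \<theta> where F: "\<And>n. gsubmodule G Q (F n)" "\<And>n. F n \<subseteq> F (Suc n)" "F 0 = {0}" "(\<Union>n. F n) = space Q"
    and J: "bij_betw \<theta> J I" "\<And>n. n \<notin> J \<Longrightarrow> F (Suc n) = F n"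
    and step: "\<And>n. n \<in> J \<Longrightarrow> rational_module G (HH (\<theta> n)) \<and>
       (\<exists>\<pi>. short_exact G (Q\<lparr>space := F n\<rparr>) (\<lambda>v. v) (Q\<lparr>space := F (Suc n)\<rparr>) \<pi> (HH (\<theta> n)))"
    by (rule filtration) (rule that)
  let ?Q0 = "Q\<lparr>space := F 0\<rparr>"
  have Q0: "rational_module G ?Q0" by (rule submodule_rational[OF Q F(1)])
  have z: "space (?Q0 \<otimes>\<^sub>k N) = {0}" by (rule tensor_zero_space[OF Q0 N]) (simp add: F(3))
  have st: "rational_module G (HH (\<theta> n)) \<and>
      (\<exists>\<pi>. short_exact G (Q\<lparr>space := F n\<rparr>) (\<lambda>v. v) (Q\<lparr>space := F (Suc n)\<rparr>) \<pi> (HH (\<theta> n))) \<and>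
      cocycles G (HH (\<theta> n) \<otimes>\<^sub>k N) (Suc d) \<subseteq> coboundaries G (HH (\<theta> n) \<otimes>\<^sub>k N) d" if "F (Suc n) \<noteq> F n" for n
  proof -
    have n: "n \<in> J" using that J(2) by blast
    hence "\<theta> n \<in> I" using J(1) by (auto simp: bij_betw_def)
    from van[OF this conjunct1[OF step[OF n]]] step[OF n] show ?thesis by (intro conjI) simp_all
  qed
  have "subquotient (fscale (scale (Q \<otimes>\<^sub>k N))) (cocycles G (Q \<otimes>\<^sub>k N) (Suc d)) (coboundaries G (Q \<otimes>\<^sub>k N) d)
    (fscale (scale (?Q0 \<otimes>\<^sub>k N))) (cocycles G (?Q0 \<otimes>\<^sub>k N) (Suc d)) (coboundaries G (?Q0 \<otimes>\<^sub>k N) d)"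
    by (rule filtration_Ext[where F = F and m = 0 and X = "\<lambda>n. HH (\<theta> n)", OF N Q F(1,2,4) st])
  from subquotient_vanish[OF this zero_cocycles[OF tensor_rational[OF N Q0] z]] show ?thesis .
qed

text \<open>Let \<open>n0\<close> be the step at which \<open>HH i0\<close> is added. Stages up to
  \<open>n0\<close> have no cohomology in this degree, so that of stage \<open>n0 + 1\<close> embeds
  into that of \<open>HH i0\<close>; the later stages add nothing new.\<close>

lemma filtered_Ext_single:
  assumes i0: "i0 \<in> I"
    and van: "\<And>i. i \<in> I \<Longrightarrow> i \<noteq> i0 \<Longrightarrow> rational_module G (HH i) \<Longrightarrow>
      cocycles G (HH i \<otimes>\<^sub>k N) (Suc d) \<subseteq> coboundaries G (HH i \<otimes>\<^sub>k N) d"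
  shows "rational_module G (HH i0)"
    and "subquotient (fscale (scale (Q \<otimes>\<^sub>k N))) (cocycles G (Q \<otimes>\<^sub>k N) (Suc d)) (coboundaries G (Q \<otimes>\<^sub>k N) d)
      (fscale (scale (HH i0 \<otimes>\<^sub>k N))) (cocycles G (HH i0 \<otimes>\<^sub>k N) (Suc d)) (coboundaries G (HH i0 \<otimes>\<^sub>k N) d)"
proof -
  obtain F J \<theta> where F: "\<And>n. gsubmodule G Q (F n)" "\<And>n. F n \<subseteq> F (Suc n)" "F 0 = {0}" "(\<Union>n. F n) = space Q"
    and J: "bij_betw \<theta> J I" "\<And>n. n \<notin> J \<Longrightarrow> F (Suc n) = F n"
    and step: "\<And>n. n \<in> J \<Longrightarrow> rational_module G (HH (\<theta> n)) \<and>
       (\<exists>\<pi>. short_exact G (Q\<lparr>space := F n\<rparr>) (\<lambda>v. v) (Q\<lparr>space := F (Suc n)\<rparr>) \<pi> (HH (\<theta> n)))"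
    by (rule filtration) (rule that)
  let ?Q = "\<lambda>n. Q\<lparr>space := F n\<rparr>"
  let ?v = "\<lambda>n. cocycles G (?Q n \<otimes>\<^sub>k N) (Suc d) \<subseteq> coboundaries G (?Q n \<otimes>\<^sub>k N) d"
  obtain n0 where n0: "n0 \<in> J" "\<theta> n0 = i0" using J(1) i0 by (auto simp: bij_betw_def)
  have other: "cocycles G (HH (\<theta> n) \<otimes>\<^sub>k N) (Suc d) \<subseteq> coboundaries G (HH (\<theta> n) \<otimes>\<^sub>k N) d"
    if n: "n \<in> J" "n \<noteq> n0" for n
  proof (rule van)
    show "\<theta> n \<in> I" using n(1) J(1) by (auto simp: bij_betw_def)
    show "\<theta> n \<noteq> i0" using n n0 J(1) by (auto simp: bij_betw_def inj_on_def)
    show "rational_module G (HH (\<theta> n))" using step[OF n(1)] by blast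
  qed
  have Qn: "rational_module G (?Q n)" for n by (rule submodule_rational[OF Q F(1)])
  have middle: "subquotient (fscale (scale (?Q (Suc n) \<otimes>\<^sub>k N))) (cocycles G (?Q (Suc n) \<otimes>\<^sub>k N) (Suc d))
      (coboundaries G (?Q (Suc n) \<otimes>\<^sub>k N) d) (fscale (scale (HH (\<theta> n) \<otimes>\<^sub>k N)))
      (cocycles G (HH (\<theta> n) \<otimes>\<^sub>k N) (Suc d)) (coboundaries G (HH (\<theta> n) \<otimes>\<^sub>k N) d)"
    if n: "n \<in> J" and v: "?v n" for n
  proof -
    from step[OF n] obtain \<pi> where p: "rational_module G (HH (\<theta> n))"
      "short_exact G (?Q n) (\<lambda>v. v) (?Q (Suc n)) \<pi> (HH (\<theta> n))" by (elim conjE exE)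
    show ?thesis
      by (rule Ext_middle_subquotient[OF tensor_rational[OF N Qn] tensor_rational[OF N Qn] tensor_rational[OF N p(1)]
        tensor_short_exact[OF N Qn Qn p] v])
  qed
  \<comment> \<open>Each section below \<open>n0\<close> is acyclic in this degree and so is the
    stage before it, hence also the extension. At \<open>n0\<close> itself the argument must stop,
    as the next section is \<open>HH i0\<close>.\<close>
  have prefix: "n \<le> n0 \<Longrightarrow> ?v n" for n
  proof (induction n)
    case 0
    have "space (?Q 0 \<otimes>\<^sub>k N) = {0}" by (rule tensor_zero_space[OF Qn N]) (simp add: F(3))
    from zero_cocycles[OF tensor_rational[OF N Qn] this] show ?case .
  next
    case (Suc n)
    hence v: "?v n" by simp
    show ?case
    proof (cases "n \<in> J")
      case True
      show ?thesis by (rule subquotient_vanish[OF middle[OF True v] other[OF True]]) (use Suc.prems in simp)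
    next
      case False
      show ?thesis unfolding J(2)[OF False] by (rule v)
    qed
  qed
  show "rational_module G (HH i0)" using step[OF n0(1)] n0(2) by blast
  have st: "rational_module G (HH (\<theta> n)) \<and>
      (\<exists>\<pi>. short_exact G (?Q n) (\<lambda>v. v) (?Q (Suc n)) \<pi> (HH (\<theta> n))) \<and>
      cocycles G (HH (\<theta> n) \<otimes>\<^sub>k N) (Suc d) \<subseteq> coboundaries G (HH (\<theta> n) \<otimes>\<^sub>k N) d"
    if "Suc n0 \<le> n" "F (Suc n) \<noteq> F n" for n
  proof -
    have n: "n \<in> J" using that(2) J(2) by blast
    from other[OF n] that(1) step[OF n] show ?thesis by (intro conjI) simp_all
  qed
  have "subquotient (fscale (scale (Q \<otimes>\<^sub>k N))) (cocycles G (Q \<otimes>\<^sub>k N) (Suc d)) (coboundaries G (Q \<otimes>\<^sub>k N) d)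
    (fscale (scale (?Q (Suc n0) \<otimes>\<^sub>k N))) (cocycles G (?Q (Suc n0) \<otimes>\<^sub>k N) (Suc d)) (coboundaries G (?Q (Suc n0) \<otimes>\<^sub>k N) d)"
    by (rule filtration_Ext[where F = F and m = "Suc n0" and X = "\<lambda>n. HH (\<theta> n)", OF N Q F(1,2,4) st])
  from subquotient_trans[OF this middle[OF n0(1) prefix[OF order_refl]]]
  show "subquotient (fscale (scale (Q \<otimes>\<^sub>k N))) (cocycles G (Q \<otimes>\<^sub>k N) (Suc d)) (coboundaries G (Q \<otimes>\<^sub>k N) d)
      (fscale (scale (HH i0 \<otimes>\<^sub>k N))) (cocycles G (HH i0 \<otimes>\<^sub>k N) (Suc d)) (coboundaries G (HH i0 \<otimes>\<^sub>k N) d)"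
    unfolding n0(2) .
qed

end

end

text \<open>Points of the group correspond uniquely to algebra homomorphisms, so two points at which
  all functions agree would define the same homomorphism and coincide.\<close>

lemma coord_separates:
  assumes "affine_alg_group G" "x \<in> carrier G" "y \<in> carrier G" "x \<noteq> y"
  shows "\<exists>f\<in>coord G. f x \<noteq> f y"
proof (rule ccontr)
  assume "\<not> (\<exists>f\<in>coord G. f x \<noteq> f y)"
  hence eq: "\<forall>f\<in>coord G. f x = f y" by blast
  have "algebra_hom G (\<lambda>f. f x)" using assms(2) by (simp add: algebra_hom_def restr_def)
  hence "\<exists>!z. z \<in> carrier G \<and> (\<forall>f\<in>coord G. f x = f z)"
    using assms(1) unfolding affine_alg_group_def by blast
  moreover have "x \<in> carrier G \<and> (\<forall>f\<in>coord G. f x = f x)" using assms(2) by simp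
  moreover have "y \<in> carrier G \<and> (\<forall>f\<in>coord G. f x = f y)" using assms(3) eq by simp
  ultimately show False using assms(4) by (elim ex1E) metis
qed

section \<open>Rational points form a finite subgroup\<close>

context
  fixes G :: "('g, 'k::alg_closed_field) alg_group" and A :: "('g \<Rightarrow> 'k) set" and p r :: nat
  assumes p: "prime p" and char: "CHAR('k) = p" and r: "r \<ge> 1"
    and G: "affine_alg_group G" and A: "Fp_structure p G A"
begin

private abbreviation "Fq \<equiv> subfield_of_order (p ^ r) :: 'k set"

private lemma Fq_closed:
  "(0 :: 'k) \<in> Fq" "x \<in> Fq \<Longrightarrow> y \<in> Fq \<Longrightarrow> x + y \<in> Fq" "x \<in> Fq \<Longrightarrow> y \<in> Fq \<Longrightarrow> x * y \<in> Fq"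
proof -
  have "p ^ r > 0" using p by (simp add: prime_gt_0_nat)
  thus "(0 :: 'k) \<in> Fq" by (simp add: subfield_of_order_def power_0_left)
  have "prime CHAR('k)" "p ^ r = CHAR('k) ^ r" using p char by simp_all
  from freshmans_dream'[OF this] show "x \<in> Fq \<Longrightarrow> y \<in> Fq \<Longrightarrow> x + y \<in> Fq"
    by (simp add: subfield_of_order_def)
  show "x \<in> Fq \<Longrightarrow> y \<in> Fq \<Longrightarrow> x * y \<in> Fq" by (simp add: subfield_of_order_def power_mult_distrib)
qed

private lemma Fq_sum: "(\<And>i. i \<in> S \<Longrightarrow> f i \<in> Fq) \<Longrightarrow> (\<Sum>i\<in>S. f i) \<in> Fq"
  by (induction S rule: infinite_finite_induct) (simp_all add: Fq_closed)

private lemma Fp_subset_Fq: "x \<in> subfield_of_order p \<Longrightarrow> x \<in> Fq" for x :: 'k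
proof -
  assume x: "x \<in> subfield_of_order p"
  have "x ^ (p ^ n) = x" for n
  proof (induction n)
    case (Suc n)
    have "x ^ (p ^ Suc n) = (x ^ (p ^ n)) ^ p" by (simp add: power_mult[symmetric] mult.commute)
    thus ?case using Suc x by (simp add: subfield_of_order_def)
  qed simp
  thus "x \<in> Fq" by (simp add: subfield_of_order_def)
qed

private lemma finite_Fq: "finite Fq"
proof -
  have "1 < p ^ r" by (rule one_less_power) (use r prime_gt_1_nat[OF p] in linarith)+
  define P :: "'k poly" where "P = monom 1 (p ^ r) - monom 1 1"
  have "coeff P (p ^ r) = 1" using \<open>1 < p ^ r\<close> by (simp add: P_def)
  hence "P \<noteq> 0" by auto
  moreover have "Fq = {x. poly P x = 0}" by (auto simp: subfield_of_order_def P_def poly_monom)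
  ultimately show ?thesis by (simp add: poly_roots_finite)
qed

private lemma group: "group G" using G unfolding affine_alg_group_def by blast

lemma rational_points_subgroup: "subgroup (rational_points (p ^ r) G A) G"
proof -
  interpret group G by (rule group)
  have A': "\<And>f. f \<in> A \<Longrightarrow> f \<one>\<^bsub>G\<^esub> \<in> subfield_of_order p"
    and hopf: "hopf_closed G A"
    using A unfolding Fp_structure_def by blast+
  show ?thesis
  proof (rule subgroup.intro)
    show "rational_points (p ^ r) G A \<subseteq> carrier G" unfolding rational_points_def by blast
    show "\<one>\<^bsub>G\<^esub> \<in> rational_points (p ^ r) G A"
      unfolding rational_points_def using A' Fp_subset_Fq by simp
    fix x assume x: "x \<in> rational_points (p ^ r) G A"
    hence xG: "x \<in> carrier G" "\<And>f. f \<in> A \<Longrightarrow> f x \<in> Fq" unfolding rational_points_def by auto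
    have "f (inv\<^bsub>G\<^esub> x) \<in> Fq" if "f \<in> A" for f
    proof -
      have "restr (carrier G) (\<lambda>x. f (inv\<^bsub>G\<^esub> x)) \<in> A" using hopf that unfolding hopf_closed_def by blast
      from xG(2)[OF this] show ?thesis using xG(1) by (simp add: restr_def)
    qed
    thus "inv\<^bsub>G\<^esub> x \<in> rational_points (p ^ r) G A" unfolding rational_points_def using xG(1) by simp
    fix y assume y: "y \<in> rational_points (p ^ r) G A"
    hence yG: "y \<in> carrier G" "\<And>f. f \<in> A \<Longrightarrow> f y \<in> Fq" unfolding rational_points_def by auto
    have "f (x \<otimes>\<^bsub>G\<^esub> y) \<in> Fq" if f: "f \<in> A" for f
    proof -
      from hopf f have "\<exists>n. \<exists>u v. (\<forall>i<n::nat. u i \<in> A \<and> v i \<in> A) \<and>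
        (\<forall>x\<in>carrier G. \<forall>y\<in>carrier G. f (x \<otimes>\<^bsub>G\<^esub> y) = (\<Sum>i<n. u i x * v i y))"
        unfolding hopf_closed_def by blast
      then obtain n u v where uv: "\<forall>i<n::nat. u i \<in> A \<and> v i \<in> A"
        "\<forall>x\<in>carrier G. \<forall>y\<in>carrier G. f (x \<otimes>\<^bsub>G\<^esub> y) = (\<Sum>i<n. u i x * v i y)" by (elim exE conjE)
      have "f (x \<otimes>\<^bsub>G\<^esub> y) = (\<Sum>i<n. u i x * v i y)" using uv(2) xG(1) yG(1) by blast
      thus ?thesis using uv(1) xG(2) yG(2) by (auto intro!: Fq_sum Fq_closed(3))
    qed
    thus "x \<otimes>\<^bsub>G\<^esub> y \<in> rational_points (p ^ r) G A" unfolding rational_points_def using xG(1) yG(1) by simp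
  qed
qed

text \<open>Finitely many elements of \<open>A\<close> span algebra generators of the coordinate
  ring, so they separate points. A rational point is thus determined by finitely many values in the
  finite field \<open>Fq\<close>.\<close>

lemma rational_points_finite: "finite (rational_points (p ^ r) G A)"
proof -
  interpret V: vector_space "fscale (*) :: 'k \<Rightarrow> ('g \<Rightarrow> 'k) \<Rightarrow> _"
    by (rule vector_space_fscale[OF vector_space_mult])
  interpret coord_group G by (rule coord_group_affine[OF G])
  have span: "coord G \<subseteq> V.span A" using A unfolding Fp_structure_def by blast
  have "\<exists>S. finite S \<and> S \<subseteq> coord G \<and> (\<forall>A. fun_algebra (carrier G) UNIV A \<and> S \<subseteq> A \<longrightarrow> coord G \<subseteq> A)"
    using G unfolding affine_alg_group_def by blast
  then obtain S where S: "finite S" "S \<subseteq> coord G"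
    "\<And>A. fun_algebra (carrier G) UNIV A \<Longrightarrow> S \<subseteq> A \<Longrightarrow> coord G \<subseteq> A" by (elim exE conjE) simp
  have "\<exists>T. finite T \<and> T \<subseteq> A \<and> f \<in> V.span T" if "f \<in> S" for f
  proof -
    have "f \<in> V.span A" using that S(2) span by blast
    then obtain T c where T: "finite T" "T \<subseteq> A" "f = (\<Sum>a\<in>T. fscale (*) (c a) a)"
      unfolding V.span_explicit by blast
    have "f \<in> V.span T" unfolding T(3) by (intro V.span_sum V.span_scale V.span_base)
    thus ?thesis using T(1,2) by blast
  qed
  then obtain T where T: "\<And>f. f \<in> S \<Longrightarrow> finite (T f)" "\<And>f. f \<in> S \<Longrightarrow> T f \<subseteq> A" "\<And>f. f \<in> S \<Longrightarrow> f \<in> V.span (T f)"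
    by metis
  define A0 where "A0 = (\<Union>f\<in>S. T f)"
  have A0: "finite A0" "A0 \<subseteq> A" unfolding A0_def using S(1) T by auto
  let ?ev = "\<lambda>x. restrict (\<lambda>f. f x) A0"
  have "inj_on ?ev (rational_points (p ^ r) G A)"
  proof (rule inj_onI, rule ccontr)
    fix x y assume xy: "x \<in> rational_points (p ^ r) G A" "y \<in> rational_points (p ^ r) G A" "?ev x = ?ev y" "x \<noteq> y"
    have A0_eq: "f x = f y" if "f \<in> A0" for f using fun_cong[OF xy(3), of f] that by simp
    have "V.subspace {f. f x = f y}" unfolding V.subspace_def by (simp add: fscale_apply)
    hence "V.span A0 \<subseteq> {f. f x = f y}" using A0_eq by (intro V.span_minimal) auto
    moreover have "f \<in> V.span A0" if "f \<in> S" for f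
      using T(3)[OF that] V.span_mono[of "T f" A0] that unfolding A0_def by blast
    ultimately have "S \<subseteq> {f \<in> coord G. f x = f y}" using S(2) by blast
    \<comment> \<open>The functions that do not distinguish \<open>x\<close> from \<open>y\<close>
      form a subalgebra. It contains the generators, hence everything, against separation of
      points.\<close>
    moreover have "fun_algebra (carrier G) UNIV {f \<in> coord G. f x = f y}"
      using alg xy(1,2) unfolding fun_algebra_def rational_points_def by (auto simp: restr_def)
    ultimately have "coord G \<subseteq> {f \<in> coord G. f x = f y}" by (intro S(3))
    moreover have "x \<in> carrier G" "y \<in> carrier G" using xy(1,2) unfolding rational_points_def by auto
    ultimately show False using coord_separates[OF G _ _ xy(4)] by blast
  qed
  moreover have "?ev ` rational_points (p ^ r) G A \<subseteq> PiE A0 (\<lambda>_. Fq)"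
    using A0(2) unfolding rational_points_def by auto
  hence "finite (?ev ` rational_points (p ^ r) G A)"
    by (rule finite_subset) (intro finite_PiE A0(1) finite_Fq)
  ultimately show ?thesis by (rule finite_imageD[rotated])
qed

end

theorem theorem2p7p1:
  fixes G :: "('g, 'k::alg_closed_field) alg_group"
    and A :: "('g \<Rightarrow> 'k) set" and T B :: "'g set" and p r :: nat
    and lam \<sigma> :: "'g \<Rightarrow> 'k"
    and S_lt S_le :: "('g \<Rightarrow> 'k) set"
    and Q_nlt :: "('g, 'k, 'c::ab_group_add) gmodule"
    and Q_nle :: "('g, 'k, 'd::ab_group_add) gmodule"
  defines "F \<equiv> frobenius p G A"
    and "Gq \<equiv> rational_points (p ^ r) G A"
  defines "Xp \<equiv> dominant_weights G T B"
    and "Gr \<equiv> induced_module G Gq trivial_module"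
    and "HH \<equiv> (\<lambda>\<mu>. H0 G T B \<mu> \<otimes>\<^sub>k frobenius_twist F r (H0 G T B (dual_weight G T B \<mu>)))"
    and "L \<equiv> simple_module G T B"
  assumes "prime p" and "CHAR('k) = p" and "r \<ge> 1"
    and "simple_alg_group G" and "Fp_structure p G A"
    and "maximal_torus G T" and "Fp_split G A T"
    and "borel_subgroup G B" and "T \<subseteq> B"
    and "simply_connected G T"
    and "lam \<in> Xp" and "\<sigma> \<in> Xp"
    and "gsubmodule G Gr S_lt" and "gsubmodule G Gr S_le"
    and "rational_module G Q_nlt" and "rational_module G Q_nle"
    and "filtered_by G (Gr\<lparr>space := S_lt\<rparr>)
           {\<nu> \<in> Xp. weight_less G T B \<nu> \<sigma> \<and> linked p G T B \<nu> \<sigma>} HH"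
    and "filtered_by G (Gr\<lparr>space := S_le\<rparr>)
           {\<nu> \<in> Xp. weight_le G T B \<nu> \<sigma> \<and> linked p G T B \<nu> \<sigma>} HH"
    and "filtered_by G Q_nlt
           {\<nu> \<in> Xp. \<not> weight_less G T B \<nu> \<sigma> \<or> \<not> linked p G T B \<nu> \<sigma>} HH"
    and "filtered_by G Q_nle
           {\<nu> \<in> Xp. \<not> weight_le G T B \<nu> \<sigma> \<or> \<not> linked p G T B \<nu> \<sigma>} HH"
    and "\<exists>f g. short_exact G (HH \<sigma>) f Q_nlt g Q_nle"
    and "\<exists>\<pi>. short_exact G (Gr\<lparr>space := S_lt\<rparr>) (\<lambda>v. v) Gr \<pi> Q_nlt"
    and "\<exists>\<pi>. short_exact G (Gr\<lparr>space := S_le\<rparr>) (\<lambda>v. v) Gr \<pi> Q_nle"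
    and a: "L lam = H0 G T B lam"
    and b: "\<And>\<mu>. \<mu> \<in> Xp \<Longrightarrow> \<mu> \<noteq> \<sigma> \<Longrightarrow> vanishes (Ext G 2 trivial_module (HH \<mu> \<otimes>\<^sub>k L lam))"
    and c: "vanishes (Ext G 3 trivial_module (Gr\<lparr>space := S_lt\<rparr> \<otimes>\<^sub>k L lam))"
    and d: "vanishes (Ext G 1 trivial_module (Q_nle \<otimes>\<^sub>k L lam))"
  shows "vs_isomorphic (group_cohomology G Gq 2 (L lam))
           (Ext G 2 trivial_module (HH \<sigma> \<otimes>\<^sub>k L lam))"
proof -
  have two: "(2::nat) = Suc (Suc 0)" and three: "(3::nat) = Suc (Suc (Suc 0))" by simp_all
  have affine: "affine_alg_group G" using assms(10) unfolding simple_alg_group_def by blast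
  interpret coord_group G by (rule coord_group_affine[OF affine])
  have Gq: "subgroup Gq G" "finite Gq"
    unfolding Gq_def
    by (rule rational_points_subgroup[OF assms(7-9) affine assms(11)]
      rational_points_finite[OF assms(7-9) affine assms(11)])+
  interpret finite_subgroup G Gq
    by (rule finite_subgroup.intro[OF coord_group_axioms finite_subgroup_axioms.intro[OF Gq]])
  have "\<exists>e\<in>coord G. (\<forall>x\<in>carrier G. (\<Sum>h\<in>Gq. e (x \<otimes>\<^bsub>G\<^esub> h)) = 1) \<and> e \<one>\<^bsub>G\<^esub> = 1 \<and>
      (\<forall>h\<in>Gq - {\<one>\<^bsub>G\<^esub>}. e h = 0)"
    by (rule exists_trace_one[OF _ Gq]) (rule coord_separates[OF affine])
  then obtain e where e: "e \<in> coord G" "\<forall>x\<in>carrier G. (\<Sum>h\<in>Gq. e (x \<otimes>\<^bsub>G\<^esub> h)) = 1" "e \<one>\<^bsub>G\<^esub> = 1"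
    "\<forall>h\<in>Gq - {\<one>\<^bsub>G\<^esub>}. e h = 0" by (elim bexE conjE)
  interpret averaging G Gq e
    by (rule averaging.intro[OF finite_subgroup_axioms averaging_axioms.intro]) (use e in simp_all)
  define N where "N = L lam"
  have "closed_subgroup G B" using assms(14) unfolding borel_subgroup_def Let_def by (elim conjE)
  hence "subgroup B G" unfolding closed_subgroup_def by (rule conjunct1)
  hence BG: "B \<subseteq> carrier G" by (rule subgroup.subset)
  \<comment> \<open>Hypothesis (a) enters here: it presents the simple module as an induced module,
    whose rationality is known.\<close>
  have N: "rational_module G N"
    unfolding N_def a H0_def by (rule induced_rational[OF BG]) (simp_all only: char_module_def gmodule.simps)
  have Gr: "Gr = invariants" unfolding Gr_def invariants_def by (rule refl)
  have GrR: "rational_module G Gr" unfolding Gr by (rule invariants_rational)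
  let ?S = "Gr\<lparr>space := S_lt\<rparr>"
  have SR: "rational_module G ?S" by (rule submodule_rational[OF GrR assms(19)])
  have HHv: "vector_space (scale (HH i)) \<and> module.subspace (scale (HH i)) (space (HH i))" for i
    unfolding HH_def by (rule conjI[OF tensor_vector_space tensor_subspace])
  have van: "cocycles G (HH i \<otimes>\<^sub>k N) (Suc (Suc 0)) \<subseteq> coboundaries G (HH i \<otimes>\<^sub>k N) (Suc 0)"
    if "i \<in> Xp" "i \<noteq> \<sigma>" "rational_module G (HH i)" for i
    using b[OF that(1,2)] unfolding N_def[symmetric] two
    by (rule vanishes_Ext_trivial[OF tensor_rational[OF N that(3)], THEN iffD1])
  let ?J = "{\<nu> \<in> Xp. weight_less G T B \<nu> \<sigma> \<and> linked p G T B \<nu> \<sigma>}"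
  let ?I = "{\<nu> \<in> Xp. \<not> weight_less G T B \<nu> \<sigma> \<or> \<not> linked p G T B \<nu> \<sigma>}"
  have vanJ: "cocycles G (HH i \<otimes>\<^sub>k N) (Suc (Suc 0)) \<subseteq> coboundaries G (HH i \<otimes>\<^sub>k N) (Suc 0)"
    if "i \<in> ?J" "rational_module G (HH i)" for i
  proof (rule van[OF _ _ that(2)])
    show "i \<in> Xp" "i \<noteq> \<sigma>" using that(1) by (simp_all add: weight_less_def)
  qed
  have vanI: "cocycles G (HH i \<otimes>\<^sub>k N) (Suc (Suc 0)) \<subseteq> coboundaries G (HH i \<otimes>\<^sub>k N) (Suc 0)"
    if "i \<in> ?I" "i \<noteq> \<sigma>" "rational_module G (HH i)" for i
    by (rule van[OF _ that(2,3)]) (use that(1) in simp)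
  \<comment> \<open>As \<open>\<sigma>\<close> is not strictly below itself,
    \<open>HH \<sigma>\<close> is one of the sections of \<open>Q_nlt\<close>; by (b) it is the only
    one that may have cohomology in degree \<open>2\<close>.\<close>
  have \<sigma>I: "\<sigma> \<in> ?I" using assms(18) by (simp add: weight_less_def)
  have S2: "cocycles G (?S \<otimes>\<^sub>k N) (Suc (Suc 0)) \<subseteq> coboundaries G (?S \<otimes>\<^sub>k N) (Suc 0)"
    by (rule filtered_Ext_vanish[OF N SR assms(23) HHv]) (rule vanJ)
  have S3: "cocycles G (?S \<otimes>\<^sub>k N) (Suc (Suc (Suc 0))) \<subseteq> coboundaries G (?S \<otimes>\<^sub>k N) (Suc (Suc 0))"
    using c unfolding N_def[symmetric] three
    by (rule vanishes_Ext_trivial[OF tensor_rational[OF N SR], THEN iffD1])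
  have D1: "cocycles G (Q_nle \<otimes>\<^sub>k N) (Suc 0) \<subseteq> coboundaries G (Q_nle \<otimes>\<^sub>k N) 0"
    using d unfolding N_def[symmetric] One_nat_def
    by (rule vanishes_Ext_trivial[OF tensor_rational[OF N assms(22)], THEN iffD1])
  have HH\<sigma>: "rational_module G (HH \<sigma>)"
    by (rule filtered_Ext_single(1)[OF N assms(21,25) HHv \<sigma>I]) (rule vanI)
  note rats = tensor_rational[OF N SR] tensor_rational[OF N GrR] tensor_rational[OF N assms(21)]
    tensor_rational[OF N HH\<sigma>] tensor_rational[OF N assms(22)]
  from assms(28) obtain \<pi> where \<pi>: "short_exact G ?S (\<lambda>v. v) Gr \<pi> Q_nlt" by (elim exE)
  note ex1 = tensor_short_exact[OF N SR GrR assms(21) \<pi>]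
  from assms(27) obtain f g where fg: "short_exact G (HH \<sigma>) f Q_nlt g Q_nle" by (elim exE)
  note ex2 = tensor_short_exact[OF N HH\<sigma> assms(21,22) fg]
  \<comment> \<open>The map from the cohomology of \<open>Gr\<close> to that of \<open>Q_nlt\<close>
    is injective by \<open>S2\<close> and, in the next step, surjective by
    \<open>S3\<close>.\<close>
  have 1: "subquotient (fscale (scale (Gr \<otimes>\<^sub>k N))) (cocycles G (Gr \<otimes>\<^sub>k N) (Suc (Suc 0))) (coboundaries G (Gr \<otimes>\<^sub>k N) (Suc 0))
    (fscale (scale (Q_nlt \<otimes>\<^sub>k N))) (cocycles G (Q_nlt \<otimes>\<^sub>k N) (Suc (Suc 0))) (coboundaries G (Q_nlt \<otimes>\<^sub>k N) (Suc 0))"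
    by (rule Ext_middle_subquotient[OF rats(1-3) ex1 S2])
  have 2: "subquotient (fscale (scale (Q_nlt \<otimes>\<^sub>k N))) (cocycles G (Q_nlt \<otimes>\<^sub>k N) (Suc (Suc 0))) (coboundaries G (Q_nlt \<otimes>\<^sub>k N) (Suc 0))
    (fscale (scale (Gr \<otimes>\<^sub>k N))) (cocycles G (Gr \<otimes>\<^sub>k N) (Suc (Suc 0))) (coboundaries G (Gr \<otimes>\<^sub>k N) (Suc 0))"
    by (rule Ext_quotient_subquotient[OF rats(1-3) ex1 S3])
  have 3: "subquotient (fscale (scale (Q_nlt \<otimes>\<^sub>k N))) (cocycles G (Q_nlt \<otimes>\<^sub>k N) (Suc (Suc 0))) (coboundaries G (Q_nlt \<otimes>\<^sub>k N) (Suc 0))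
    (fscale (scale (HH \<sigma> \<otimes>\<^sub>k N))) (cocycles G (HH \<sigma> \<otimes>\<^sub>k N) (Suc (Suc 0))) (coboundaries G (HH \<sigma> \<otimes>\<^sub>k N) (Suc 0))"
    by (rule filtered_Ext_single(2)[OF N assms(21,25) HHv \<sigma>I]) (rule vanI)
  \<comment> \<open>The connecting map starts in degree \<open>1\<close> of \<open>Q_nle\<close>,
    which is zero by (d). With the converse comparison \<open>3\<close> this yields only an abstract
    isomorphism, which is what is claimed.\<close>
  have 4: "subquotient (fscale (scale (HH \<sigma> \<otimes>\<^sub>k N))) (cocycles G (HH \<sigma> \<otimes>\<^sub>k N) (Suc (Suc 0))) (coboundaries G (HH \<sigma> \<otimes>\<^sub>k N) (Suc 0))
    (fscale (scale (Q_nlt \<otimes>\<^sub>k N))) (cocycles G (Q_nlt \<otimes>\<^sub>k N) (Suc (Suc 0))) (coboundaries G (Q_nlt \<otimes>\<^sub>k N) (Suc 0))"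
    by (rule Ext_sub_subquotient[OF rats(4,3,5) ex2, where n = "Suc 0"]) (simp_all only: D1 diff_Suc_1 zero_less_Suc One_nat_def diff_Suc_Suc diff_0_eq_0)
  note sh = shapiro[OF N, of "Suc 0", folded Gr]
  have "vs_isomorphic (Ext GH (Suc (Suc 0)) trivial_module N) (Ext G (Suc (Suc 0)) trivial_module (HH \<sigma> \<otimes>\<^sub>k N))"
    by (rule Ext_trivial_iso[OF GH.coord_group_axioms coord_group_axioms GH_rational[OF N] rats(4)
      subquotient_trans[OF sh(2) subquotient_trans[OF 1 3]]
      subquotient_trans[OF subquotient_trans[OF 4 2] sh(1)]])
  thus ?thesis unfolding group_cohomology_def N_def two .
qed

end
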